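(* Let $n\ge 1$, $\mathfrak g=\mathfrak{sp}(2n,\mathbb C)$, with Borel subalgebra $\mathfrak b$ and $\mathfrak n=[\mathfrak b,\mathfrak b]$. Let $S_n$ be the symmetric group on $\{1,\dots,n\}$ and let $\mathcal I$ be the set of all abelian ideals of $\mathfrak b$. For $(\sigma,I)\in S_n\times\mathcal I$ let $L(\sigma,I)\in\bigwedge\mathfrak n^*$ be the element (defined up to a nonzero scalar) $$L(\sigma,I)=\Big(\bigwedge_{\alpha\in\Phi_\sigma}f_\alpha\Big)\wedge \sigma\sigma_l\big(\textstyle\bigwedge^{\max}I^*\big).$$ Then every $L(\sigma,I)$ is a harmonic cocycle, and, writing $[L(\sigma,I)]$ for its cohomology class, $$H(\mathfrak n)=\bigoplus_{(\sigma,I)\in S_n\times\mathcal I}\mathbb C\,[L(\sigma,I)],$$ where each $\mathbb C[L(\sigma,I)]$ is a one-dimensional subspace; i.e. the classes $[L(\sigma,I)]$, indexed by $(\sigma,I)\in S_n\times\mathcal I$, form a basis of $H(\mathfrak n)$.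
   Context: Fix a Cartan subalgebra $\mathfrak h$ of $\mathfrak g=\mathfrak{sp}(2n,\mathbb C)$, with root system $\Phi=\{\pm2\epsilon_i,\ \pm(\epsilon_i\pm\epsilon_j)\mid 1\le i\ne j\le n\}$, positive roots $\Phi_+=\{2\epsilon_i\mid 1\le i\le n\}\cup\{\epsilon_i\pm\epsilon_j\mid 1\le i<j\le n\}$, and root spaces $\mathfrak g_\alpha$. Put $\mathfrak b=\mathfrak h\oplus\bigoplus_{\alpha\in\Phi_+}\mathfrak g_\alpha$ and $\mathfrak n=[\mathfrak b,\mathfrak b]=\bigoplus_{\alpha\in\Phi_+}\mathfrak g_\alpha$. An abelian ideal of $\mathfrak b$ is an ideal $I$ of $\mathfrak b$ with $[I,I]=0$ (the zero ideal included). For each $\alpha\in\Phi_+$ choose a nonzero $e_\alpha\in\mathfrak g_\alpha$, and let $\{f_\alpha\}_{\alpha\in\Phi_+}$ be the basis of $\mathfrak n^*$ dual to $\{e_\alpha\}$, i.e. $f_\alpha(e_\beta)=\delta_{\alpha,\beta}$. $H(\mathfrak n)=\bigoplus_i H^i(\mathfrak n)$ is the Lie algebra cohomology of $\mathfrak n$ with trivial coefficients $\mathbb C$, computed by the Chevalley–Eilenberg complex $(\bigwedge\mathfrak n^*,d)$. A cochain is harmonic if it is annihilated by the Laplacian $dd^*+d^*d$, where $d^*$ is the adjoint of $d$ for the positive definite Hermitian inner product on $\bigwedge\mathfrak n^*$ induced by the Hermitian inner product $\langle x,y\rangle=-B(x,\theta y)$ on $\mathfrak g$; here $B$ is the Killing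 form and $\theta$ is the conjugation of $\mathfrak g$ with respect to a compact real form $\mathfrak k$ such that $\mathfrak k\cap\mathfrak h$ is a real form of $\mathfrak h$ (so $\theta\mathfrak g_\alpha=\mathfrak g_{-\alpha}$). A harmonic cochain is in particular a cocycle. $S_n$ acts by $\sigma(\epsilon_i)=\epsilon_{\sigma(i)}$. For $\sigma\in S_n$, $\Phi_\sigma=\sigma(-\Phi_+)\cap\Phi_+$. The permutation $\sigma_l\in S_n$ is $\sigma_l(j)=n+1-j$; products of permutations are compositions of maps, so $\sigma\sigma_l(j)=\sigma(n+1-j)$. Let $\Phi_+^1=\{\epsilon_i+\epsilon_j\mid 1\le i\le j\le n\}$. Each $I\in\mathcal I$ is of the form $I=\bigoplus_{\alpha\in\Psi}\mathfrak g_\alpha$ for a unique subset $\Psi=\Psi_I\subset\Phi_+$, and $\Psi_I\subset\Phi_+^1$. Regard $I^*$ as the subspace of $\mathfrak n^*$ spanned by $\{f_\alpha\mid\alpha\in\Psi_I\}$; $\bigwedge^{\max}I^*$ denotes the (unique up to nonzero scalar) nonzero element of $\bigwedge^{\dim I}I^*$, namely $\bigwedge_{\alpha\in\Psi_I}f_\alpha$. A permutation $\tau\in S_n$ acts on the span of $\{f_\alpha\mid\alpha\in\Phi_+^1\}$ by $\tau(f_{\epsilon_i+\epsilon_j})=f_{\epsilon_{\tau(i)}+\epsilon_{\tau(j)}}$, and on its exterior algebra by $\tau(f_1\wedge\cdots\wedge f_k)=\tau(f_1)\wedge\cdots\wedge\tau(f_k)$. Wedge products over finite sets are taken in any order (so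 defined up to sign), and an empty wedge product is $1$. *)

theory Defs
  imports
    "HOL-Analysis.Analysis"
    "HOL-Combinatorics.Permutations"
    "HOL-Library.Function_Algebras"
    "HOL-Algebra.Module"
begin

section \<open>Complex matrices and the Lie algebra sp(2n, C)\<close>

text \<open>The rank n is \<open>CARD('n)\<close>. Matrices carry only a real vector space structure in the
  library; the complex one, like the one on complex-valued functions, is interpreted here.\<close>

type_synonym 'n cmat = "complex^('n + 'n)^('n + 'n)"

definition mscale :: "complex \<Rightarrow> 'n::finite cmat \<Rightarrow> 'n cmat" where
  "mscale c X = (\<chi> i j. c * X $ i $ j)"

interpretation mt: vector_space "mscale :: complex \<Rightarrow> 'n::finite cmat \<Rightarrow> 'n cmat"
  by unfold_locales (simp_all add: mscale_def vec_eq_iff algebra_simps)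

definition fscale :: "complex \<Rightarrow> ('a \<Rightarrow> complex) \<Rightarrow> 'a \<Rightarrow> complex" where
  "fscale c f = (\<lambda>x. c * f x)"

interpretation fn: vector_space "fscale :: complex \<Rightarrow> ('a \<Rightarrow> complex) \<Rightarrow> 'a \<Rightarrow> complex"
  by unfold_locales (simp_all add: fscale_def fun_eq_iff algebra_simps)

definition br :: "'n::finite cmat \<Rightarrow> 'n cmat \<Rightarrow> 'n cmat" where
  "br X Y = X ** Y - Y ** X"

definition symp_J :: "'n::finite cmat" where
  "symp_J = (\<chi> i j. case (i, j) of
      (Inl a, Inr b) \<Rightarrow> if a = b then 1 else 0
    | (Inr a, Inl b) \<Rightarrow> if a = b then -1 else 0
    | _ \<Rightarrow> 0)"

definition sp :: "'n::finite cmat set" where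
  "sp = {X. transpose X ** symp_J + symp_J ** X = 0}"

text \<open>Span of all brackets, i.e. [A, B] for subspaces A and B.\<close>
definition br_span :: "'n::finite cmat set \<Rightarrow> 'n cmat set \<Rightarrow> 'n cmat set" where
  "br_span A B = mt.span {br x y | x y. x \<in> A \<and> y \<in> B}"

definition lie_subalgebra :: "'n::finite cmat set \<Rightarrow> bool" where
  "lie_subalgebra V \<longleftrightarrow> V \<subseteq> sp \<and> mt.subspace V \<and> (\<forall>x\<in>V. \<forall>y\<in>V. br x y \<in> V)"

definition lie_nilpotent :: "'n::finite cmat set \<Rightarrow> bool" where
  "lie_nilpotent V \<longleftrightarrow> (\<exists>m. (br_span V ^^ m) V = {0})"

definition cartan_subalgebra :: "'n::finite cmat set \<Rightarrow> bool" where
  "cartan_subalgebra H \<longleftrightarrow> lie_subalgebra H \<and> lie_nilpotent H \<and>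
     {x \<in> sp. \<forall>y\<in>H. br x y \<in> H} = H"

section \<open>Roots, the Borel subalgebra and its abelian ideals\<close>

text \<open>Functionals on a subspace V are represented by functions that vanish outside V, so that
  equality of functionals is equality of functions.\<close>
definition dual :: "'n::finite cmat set \<Rightarrow> ('n cmat \<Rightarrow> complex) set" where
  "dual V = {f. (\<forall>x\<in>V. \<forall>y\<in>V. f (x + y) = f x + f y) \<and>
                (\<forall>c. \<forall>x\<in>V. f (mscale c x) = c * f x) \<and> (\<forall>x. x \<notin> V \<longrightarrow> f x = 0)}"

definition root_space :: "'n::finite cmat set \<Rightarrow> ('n cmat \<Rightarrow> complex) \<Rightarrow> 'n cmat set" where
  "root_space H \<alpha> = {x \<in> sp. \<forall>t\<in>H. br t x = mscale (\<alpha> t) x}"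

definition roots :: "'n::finite cmat set \<Rightarrow> ('n cmat \<Rightarrow> complex) set" where
  "roots H = {\<alpha> \<in> dual H. \<alpha> \<noteq> 0 \<and> root_space H \<alpha> \<noteq> {0}}"

text \<open>Integral combinations of the basis \<open>\<epsilon>\<^sub>1, \<dots>, \<epsilon>\<^sub>n\<close> of the dual of the Cartan subalgebra
  are given by their coordinate vectors; \<open>wt \<epsilon> \<alpha>\<close> is the functional with coordinates \<open>\<alpha>\<close>.\<close>

type_synonym weight = "nat \<Rightarrow> int"

definition wt :: "(nat \<Rightarrow> 'n::finite cmat \<Rightarrow> complex) \<Rightarrow> weight \<Rightarrow> 'n cmat \<Rightarrow> complex" where
  "wt \<epsilon> \<alpha> = (\<lambda>t. \<Sum>i = 1..CARD('n). of_int (\<alpha> i) * \<epsilon> i t)"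

definition eps :: "nat \<Rightarrow> weight" where
  "eps i = (\<lambda>k. if k = i then 1 else 0)"

definition Phi_pos :: "nat \<Rightarrow> weight set" where
  "Phi_pos n = {eps i + eps i | i. 1 \<le> i \<and> i \<le> n}
     \<union> {eps i + eps j | i j. 1 \<le> i \<and> i < j \<and> j \<le> n}
     \<union> {eps i - eps j | i j. 1 \<le> i \<and> i < j \<and> j \<le> n}"

definition Phi :: "nat \<Rightarrow> weight set" where
  "Phi n = Phi_pos n \<union> uminus ` Phi_pos n"

text \<open>The linear action with \<open>\<sigma> (eps i) = eps (\<sigma> i)\<close>, in coordinates.\<close>
definition perm_act :: "(nat \<Rightarrow> nat) \<Rightarrow> weight \<Rightarrow> weight" where
  "perm_act \<sigma> \<alpha> = (\<lambda>k. \<alpha> (inv_into UNIV \<sigma> k))"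

lemma perm_act_eps: "bij \<sigma> \<Longrightarrow> perm_act \<sigma> (eps i) = eps (\<sigma> i)"
  by (auto simp: perm_act_def eps_def fun_eq_iff bij_is_inj bij_is_surj inv_f_f surj_f_inv_f)

definition Phi_perm :: "nat \<Rightarrow> (nat \<Rightarrow> nat) \<Rightarrow> weight set" where
  "Phi_perm n \<sigma> = perm_act \<sigma> ` (uminus ` Phi_pos n) \<inter> Phi_pos n"

definition perm_rev :: "nat \<Rightarrow> nat \<Rightarrow> nat" where
  "perm_rev n j = (if j \<in> {1..n} then n + 1 - j else j)"

definition is_weight_basis :: "'n::finite cmat set \<Rightarrow> (nat \<Rightarrow> 'n cmat \<Rightarrow> complex) \<Rightarrow> bool" where
  "is_weight_basis H \<epsilon> \<longleftrightarrow> inj_on \<epsilon> {1..CARD('n)} \<and>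
     fn.independent (\<epsilon> ` {1..CARD('n)}) \<and> fn.span (\<epsilon> ` {1..CARD('n)}) = dual H"

definition borel_sub ::
  "'n::finite cmat set \<Rightarrow> (nat \<Rightarrow> 'n cmat \<Rightarrow> complex) \<Rightarrow> 'n cmat set" where
  "borel_sub H \<epsilon> = mt.span (H \<union> (\<Union>\<alpha>\<in>Phi_pos CARD('n). root_space H (wt \<epsilon> \<alpha>)))"

definition nilrad ::
  "'n::finite cmat set \<Rightarrow> (nat \<Rightarrow> 'n cmat \<Rightarrow> complex) \<Rightarrow> 'n cmat set" where
  "nilrad H \<epsilon> = br_span (borel_sub H \<epsilon>) (borel_sub H \<epsilon>)"

definition abelian_ideals :: "'n::finite cmat set \<Rightarrow> 'n cmat set set" where
  "abelian_ideals b = {I. mt.subspace I \<and> I \<subseteq> b \<and> (\<forall>x\<in>b. \<forall>y\<in>I. br x y \<in> I) \<and>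
     (\<forall>x\<in>I. \<forall>y\<in>I. br x y = 0)}"

definition ideal_roots ::
  "'n::finite cmat set \<Rightarrow> (nat \<Rightarrow> 'n cmat \<Rightarrow> complex) \<Rightarrow> 'n cmat set \<Rightarrow> weight set" where
  "ideal_roots H \<epsilon> I = {\<alpha> \<in> Phi_pos CARD('n). root_space H (wt \<epsilon> \<alpha>) \<subseteq> I}"

section \<open>The Hermitian inner product attached to a compact real form\<close>

definition trace_on :: "'n::finite cmat set \<Rightarrow> ('n cmat \<Rightarrow> 'n cmat) \<Rightarrow> complex" where
  "trace_on V T = (let b = (SOME b. mt.independent b \<and> mt.span b = V)
     in \<Sum>v\<in>b. mt.representation b (T v) v)"

definition killing :: "'n::finite cmat \<Rightarrow> 'n cmat \<Rightarrow> complex" where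
  "killing x y = trace_on sp (\<lambda>z. br x (br y z))"

definition real_form :: "'n::finite cmat set \<Rightarrow> 'n cmat set \<Rightarrow> bool" where
  "real_form K V \<longleftrightarrow> subspace K \<and> K \<subseteq> V \<and>
     (\<forall>z\<in>V. \<exists>!p. p \<in> K \<times> K \<and> z = fst p + mscale \<i> (snd p))"

text \<open>The Killing form takes real values on a real form that is closed under brackets, hence
  \<open>Re\<close> below only changes the type.\<close>
definition compact_real_form :: "'n::finite cmat set \<Rightarrow> bool" where
  "compact_real_form K \<longleftrightarrow> real_form K sp \<and> (\<forall>x\<in>K. \<forall>y\<in>K. br x y \<in> K) \<and>
     (\<forall>x\<in>K. x \<noteq> 0 \<longrightarrow> Re (killing x x) < 0)"

definition conjugation :: "'n::finite cmat set \<Rightarrow> 'n cmat \<Rightarrow> 'n cmat" where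
  "conjugation K z = (THE w. \<exists>x\<in>K. \<exists>y\<in>K. z = x + mscale \<i> y \<and> w = x - mscale \<i> y)"

definition herm :: "'n::finite cmat set \<Rightarrow> 'n cmat \<Rightarrow> 'n cmat \<Rightarrow> complex" where
  "herm K x y = - killing x (conjugation K y)"

section \<open>The exterior algebra of the dual and the Chevalley--Eilenberg complex\<close>

text \<open>An element of the exterior algebra of the dual of V is a family of alternating multilinear
  forms on V, one in each degree. It is encoded as a single function on lists, whose component of
  degree k is the restriction to lists of length k. As V is finite-dimensional, only finitely many
  components are nonzero. Lists that leave V get the value 0.\<close>

type_synonym 'n form = "'n cmat list \<Rightarrow> complex"

definition cochains :: "'n::finite cmat set \<Rightarrow> 'n form set" where
  "cochains V = {\<omega>.
     (\<forall>xs i x y. set xs \<subseteq> V \<and> i < length xs \<and> x \<in> V \<and> y \<in> V \<longrightarrow>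
        \<omega> (xs[i := x + y]) = \<omega> (xs[i := x]) + \<omega> (xs[i := y])) \<and>
     (\<forall>xs i x c. set xs \<subseteq> V \<and> i < length xs \<and> x \<in> V \<longrightarrow>
        \<omega> (xs[i := mscale c x]) = c * \<omega> (xs[i := x])) \<and>
     (\<forall>xs. set xs \<subseteq> V \<and> \<not> distinct xs \<longrightarrow> \<omega> xs = 0) \<and>
     (\<forall>xs. \<not> set xs \<subseteq> V \<longrightarrow> \<omega> xs = 0)}"

definition form_one :: "'n::finite form" where
  "form_one xs = (if xs = [] then 1 else 0)"

definition one_form :: "('n::finite cmat \<Rightarrow> complex) \<Rightarrow> 'n form" where
  "one_form f xs = (if length xs = 1 then f (hd xs) else 0)"

text \<open>Sum over shuffles, i.e. over the set S of positions fed to the first factor, with the sign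
  of the permutation that moves the positions in S to the front. In this normalisation
  \<open>(f\<^sub>1 \<and> \<dots> \<and> f\<^sub>k) (x\<^sub>1, \<dots>, x\<^sub>k) = det (f\<^sub>i (x\<^sub>j))\<close>.\<close>
definition wedge :: "'n::finite form \<Rightarrow> 'n form \<Rightarrow> 'n form" where
  "wedge \<omega> \<eta> xs = (\<Sum>S\<in>Pow {..<length xs}.
     (-1) ^ card {(i, j). i \<in> S \<and> j \<in> {..<length xs} - S \<and> j < i}
       * \<omega> (nths xs S) * \<eta> (nths xs (- S)))"

definition wedge_list :: "('n::finite cmat \<Rightarrow> complex) list \<Rightarrow> 'n form" where
  "wedge_list fs = foldr (\<lambda>f. wedge (one_form f)) fs form_one"

text \<open>\<open>(d\<omega>) (x\<^sub>0, \<dots>, x\<^sub>k)\<close> is the sum over \<open>i < j\<close> of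
  \<open>(-1)\<^bsup>i + j\<^esup> \<omega> ([x\<^sub>i, x\<^sub>j], x\<^sub>0, \<dots>)\<close> with \<open>x\<^sub>i\<close> and \<open>x\<^sub>j\<close> omitted.\<close>
definition ce_diff :: "'n::finite cmat set \<Rightarrow> 'n form \<Rightarrow> 'n form" where
  "ce_diff V \<omega> xs = (if set xs \<subseteq> V
     then \<Sum>(i, j)\<in>{(i, j). i < j \<and> j < length xs}.
       (-1) ^ (i + j) * \<omega> (br (xs ! i) (xs ! j) # nths xs (- {i, j}))
     else 0)"

section \<open>Harmonic cochains\<close>

definition orthonormal_basis ::
  "('n::finite cmat \<Rightarrow> 'n cmat \<Rightarrow> complex) \<Rightarrow> 'n cmat set \<Rightarrow> 'n cmat list \<Rightarrow> bool" where
  "orthonormal_basis ip V us \<longleftrightarrow> distinct us \<and> mt.independent (set us) \<and> mt.span (set us) = V \<and>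
     (\<forall>u\<in>set us. \<forall>v\<in>set us. ip u v = (if u = v then 1 else 0))"

text \<open>If \<open>u\<^sub>1, \<dots>, u\<^sub>N\<close> is an orthonormal basis of V, then the wedge products of the members of the
  dual basis are orthonormal for the induced inner product, and the coefficient of \<open>\<omega>\<close> at the
  product over S is the value of \<open>\<omega>\<close> at the vectors with positions in S. The result does not
  depend on the chosen basis.\<close>
definition form_inner ::
  "('n::finite cmat \<Rightarrow> 'n cmat \<Rightarrow> complex) \<Rightarrow> 'n cmat set \<Rightarrow> 'n form \<Rightarrow> 'n form \<Rightarrow> complex" where
  "form_inner ip V \<omega> \<eta> = (let us = (SOME us. orthonormal_basis ip V us)
     in \<Sum>S\<in>Pow {..<length us}. \<omega> (nths us S) * cnj (\<eta> (nths us S)))"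

definition ce_codiff ::
  "('n::finite cmat \<Rightarrow> 'n cmat \<Rightarrow> complex) \<Rightarrow> 'n cmat set \<Rightarrow> 'n form \<Rightarrow> 'n form" where
  "ce_codiff ip V \<eta> = (THE \<zeta>. \<zeta> \<in> cochains V \<and>
     (\<forall>\<omega>\<in>cochains V. form_inner ip V (ce_diff V \<omega>) \<eta> = form_inner ip V \<omega> \<zeta>))"

definition harmonic ::
  "('n::finite cmat \<Rightarrow> 'n cmat \<Rightarrow> complex) \<Rightarrow> 'n cmat set \<Rightarrow> 'n form \<Rightarrow> bool" where
  "harmonic ip V \<omega> \<longleftrightarrow> \<omega> \<in> cochains V \<and>
     ce_diff V (ce_codiff ip V \<omega>) + ce_codiff ip V (ce_diff V \<omega>) = 0"

section \<open>Cohomology\<close>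

definition cocycles :: "'n::finite cmat set \<Rightarrow> 'n form set" where
  "cocycles V = {\<omega> \<in> cochains V. ce_diff V \<omega> = 0}"

definition coboundaries :: "'n::finite cmat set \<Rightarrow> 'n form set" where
  "coboundaries V = ce_diff V ` cochains V"

definition coh_class :: "'n::finite cmat set \<Rightarrow> 'n form \<Rightarrow> 'n form set" where
  "coh_class V \<omega> = {\<omega> + \<beta> | \<beta>. \<beta> \<in> coboundaries V}"

text \<open>The direct sum over all degrees, as the quotient of cocycles by coboundaries. The ring
  multiplication required by the record type plays no role.\<close>
definition cohomology :: "'n::finite cmat set \<Rightarrow> (complex, 'n form set) module" where
  "cohomology V = \<lparr>
     carrier = coh_class V ` cocycles V,
     monoid.mult = undefined, one = undefined,
     zero = coboundaries V,
     add = (\<lambda>A B. {a + b | a b. a \<in> A \<and> b \<in> B}),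
     smult = (\<lambda>c A. {fscale c a + \<beta> | a \<beta>. a \<in> A \<and> \<beta> \<in> coboundaries V})\<rparr>"

definition basis_family ::
  "(complex, 'b) module \<Rightarrow> 'i set \<Rightarrow> ('i \<Rightarrow> 'b) \<Rightarrow> bool" where
  "basis_family M P v \<longleftrightarrow> finite P \<and> v ` P \<subseteq> carrier M \<and>
     (\<forall>x\<in>carrier M. \<exists>!c. c \<in> P \<rightarrow>\<^sub>E UNIV \<and> x = (\<Oplus>\<^bsub>M\<^esub>p\<in>P. c p \<odot>\<^bsub>M\<^esub> v p))"

section \<open>The cochains attached to permutations and abelian ideals\<close>

text \<open>\<open>dual_root_basis e \<alpha>\<close> is the \<open>\<alpha>\<close>-coordinate with respect to the root vectors
  \<open>e \<beta>\<close> for positive \<open>\<beta>\<close>. It vanishes outside their span.\<close>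
definition dual_root_basis ::
  "(weight \<Rightarrow> 'n::finite cmat) \<Rightarrow> weight \<Rightarrow> 'n cmat \<Rightarrow> complex" where
  "dual_root_basis e \<alpha> x = mt.representation (e ` Phi_pos CARD('n)) x (e \<alpha>)"

text \<open>The forms that represent \<open>L(\<sigma>, I)\<close>: any order of the factors and any nonzero scalar is
  allowed. With \<open>\<tau> = \<sigma> \<circ> perm_rev n\<close>, the second wedge product is \<open>\<tau>\<close> applied to the product
  of the \<open>f\<^sub>\<alpha>\<close>, as \<open>\<tau>\<close> acts factorwise and sends \<open>f\<^sub>\<alpha>\<close> to \<open>f\<close> with index \<open>\<tau> \<alpha>\<close>.\<close>
definition is_L ::
  "'n::finite cmat set \<Rightarrow> (nat \<Rightarrow> 'n cmat \<Rightarrow> complex) \<Rightarrow> (weight \<Rightarrow> 'n cmat) \<Rightarrow>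
     (nat \<Rightarrow> nat) \<Rightarrow> 'n cmat set \<Rightarrow> 'n form \<Rightarrow> bool" where
  "is_L H \<epsilon> e \<sigma> I \<omega> \<longleftrightarrow> (\<exists>c as bs. c \<noteq> 0 \<and>
     distinct as \<and> set as = Phi_perm CARD('n) \<sigma> \<and>
     distinct bs \<and> set bs = ideal_roots H \<epsilon> I \<and>
     \<omega> = fscale c (wedge
       (wedge_list (map (dual_root_basis e) as))
       (wedge_list (map (\<lambda>\<alpha>. dual_root_basis e (perm_act (\<sigma> \<circ> perm_rev CARD('n)) \<alpha>)) bs))))"

end

theory Submission
  imports Defs "HOL-Combinatorics.Multiset_Permutations"
begin

text \<open>The proof is Kostant's computation of the cohomology of a nilradical, carried out for the Lie
  algebra sp(2n, C), followed by a count of the surviving weights in terms of abelian ideals.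

  The Cartan subalgebra acts on cochains of n, and the component of a cochain at the root vectors
  with indices in a set S of positive roots has weight \<open>- \<Sum>S\<close>. Extend a form by zero along the
  opposite Borel subalgebra, and sum the contractions by \<open>e\<^sub>\<alpha>\<close> of its Lie derivatives along \<open>y\<^sub>\<alpha>\<close>,
  where the \<open>y\<^sub>\<alpha>\<close> are the vectors of the opposite nilradical that are dual to the \<open>e\<^sub>\<alpha>\<close> for the
  Killing form; this defines an operator s of degree -1. On weight \<open>- \<mu>\<close> the operator \<open>d s + s d\<close> is the scalar \<open>2 \<langle>\<rho>, \<mu>\<rangle> - \<langle>\<mu>, \<mu>\<rangle>\<close> up to a positive constant
  (\<open>homotopy_formula\<close>, \<open>laplacian_weight\<close>). Hence only the weights where this scalar vanishes
  contribute to the cohomology.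

  The scalar vanishes at \<open>\<Sum>S\<close> exactly if \<open>\<rho> - \<Sum>S\<close> has the norm of \<open>\<rho>\<close>. Moving \<open>\<rho> - \<Sum>S\<close>
  into the dominant chamber by a signed permutation of the coordinates shows that it is regular and
  that S consists of the positive roots on which it is negative (\<open>extremal_cut_out\<close>). Splitting
  the ordering of its coordinates into a permutation and the signs of their pairwise sums turns
  S into \<open>\<Phi>\<^sub>\<sigma> \<union> \<sigma>\<sigma>\<^sub>l \<Psi>\<close>, where \<open>\<Psi>\<close> is closed under passing to higher roots
  (\<open>extremal_is_L_roots\<close>); conversely every such union is cut out by a regular weight
  (\<open>separated_L_roots\<close>), and it determines \<open>\<sigma>\<close> and \<open>\<Psi>\<close> (\<open>L_roots_inj\<close>). The sets \<open>\<Psi>\<close> are the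
  root sets of the abelian ideals of the Borel subalgebra (\<open>ideal_roots_upper\<close>, \<open>ideal_span\<close>,
  \<open>upper_set_ideal\<close>).

  A set S cut out by a regular weight is the only set of positive roots with its sum
  (\<open>separated_unique_sum\<close>), so the weight \<open>- \<Sum>S\<close> occurs in the whole exterior algebra with
  multiplicity one. Since d preserves weights and changes the degree, the corresponding product of
  the \<open>f\<^sub>\<alpha>\<close> is closed, and no coboundary has a component at S. Root vectors are orthogonal for the
  Hermitian form of a compact real form that is compatible with the Cartan subalgebra, so the
  product is orthogonal to all coboundaries, that is, harmonic (\<open>L_harmonic\<close>), and the classes are
  linearly independent (\<open>L_independent\<close>). That they span is the statement about the scalar
  (\<open>cocycle_decompose\<close>).\<close>

section \<open>Combinatorics of the root system of type C\<close>

definition wdot :: "nat \<Rightarrow> weight \<Rightarrow> weight \<Rightarrow> int" where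
  "wdot n a b = (\<Sum>i = 1..n. a i * b i)"

lemma wdot_add_left: "wdot n (a + b) c = wdot n a c + wdot n b c"
  by (simp add: wdot_def sum.distrib algebra_simps)

lemma wdot_add_right: "wdot n c (a + b) = wdot n c a + wdot n c b"
  by (simp add: wdot_def sum.distrib algebra_simps)

lemma wdot_diff_left: "wdot n (a - b) c = wdot n a c - wdot n b c"
  by (simp add: wdot_def sum_subtractf algebra_simps)

lemma wdot_diff_right: "wdot n c (a - b) = wdot n c a - wdot n c b"
  by (simp add: wdot_def sum_subtractf algebra_simps)

lemma wdot_minus_left: "wdot n (- a) c = - wdot n a c"
  by (simp add: wdot_def sum_negf)

lemma wdot_minus_right: "wdot n c (- a) = - wdot n c a"
  by (simp add: wdot_def sum_negf)

lemma wdot_zero [simp]: "wdot n 0 a = 0" "wdot n a 0 = 0"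
  by (simp_all add: wdot_def)

lemma wdot_commute: "wdot n a b = wdot n b a"
  by (simp add: wdot_def mult.commute)

lemma wdot_eps: "k \<in> {1..n} \<Longrightarrow> wdot n a (eps k) = a k"
  by (simp add: wdot_def eps_def if_distrib cong: if_cong)

lemmas wdot_simps = wdot_add_left wdot_add_right wdot_diff_left wdot_diff_right
  wdot_minus_left wdot_minus_right

lemma eps_same [simp]: "eps i i = 1" and eps_other: "i \<noteq> j \<Longrightarrow> eps i j = 0"
  by (simp_all add: eps_def)

lemma sum_fun_apply: "(sum f S) x = (\<Sum>a\<in>S. f a x)" for f :: "'a \<Rightarrow> 'b \<Rightarrow> 'c::comm_monoid_add"
  by (induction S rule: infinite_finite_induct) simp_all

lemma wdot_sum_right: "wdot n a (sum f S) = (\<Sum>x\<in>S. wdot n a (f x))"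
  unfolding wdot_def sum_fun_apply sum_distrib_left by (rule sum.swap)

abbreviation pinv :: "('a \<Rightarrow> 'a) \<Rightarrow> 'a \<Rightarrow> 'a" where
  "pinv \<equiv> inv_into UNIV"

text \<open>Half the sum of the positive roots, in coordinates.\<close>
definition rho :: "nat \<Rightarrow> weight" where
  "rho n i = int (n + 1) - int i"

definition seps :: "int \<Rightarrow> nat \<Rightarrow> int \<Rightarrow> nat \<Rightarrow> weight" where
  "seps s i t j = (\<lambda>k. s * eps i k + t * eps j k)"

lemma Phi_posE:
  assumes "\<alpha> \<in> Phi_pos n"
  obtains (plus) i j where "1 \<le> i" "i \<le> j" "j \<le> n" "\<alpha> = eps i + eps j"
    | (diff) i j where "1 \<le> i" "i < j" "j \<le> n" "\<alpha> = eps i - eps j"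
  using assms unfolding Phi_pos_def by (blast intro: less_imp_le)

lemma plus_in_Phi_pos: "i \<in> {1..n} \<Longrightarrow> j \<in> {1..n} \<Longrightarrow> eps i + eps j \<in> Phi_pos n"
proof -
  have *: "i < j \<Longrightarrow> 1 \<le> i \<Longrightarrow> j \<le> n \<Longrightarrow> eps i + eps j \<in> Phi_pos n" for i j
    unfolding Phi_pos_def by blast
  have **: "1 \<le> i \<Longrightarrow> i \<le> n \<Longrightarrow> eps i + eps i \<in> Phi_pos n" for i
    unfolding Phi_pos_def by blast
  assume ij: "i \<in> {1..n}" "j \<in> {1..n}"
  have comm: "eps i + eps j = eps j + eps i" by (rule add.commute)
  consider "i < j" | "i = j" | "j < i" by linarith
  then show ?thesis
    by cases (metis ij * ** comm atLeastAtMost_iff)+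
qed

lemma diff_in_Phi_pos: "1 \<le> i \<Longrightarrow> i < j \<Longrightarrow> j \<le> n \<Longrightarrow> eps i - eps j \<in> Phi_pos n"
  by (auto simp: Phi_pos_def)

lemma rho_pos: assumes "\<alpha> \<in> Phi_pos n" shows "wdot n (rho n) \<alpha> > 0"
  using assms by (cases rule: Phi_posE) (auto simp: wdot_simps wdot_eps rho_def)

lemma finite_Phi_pos: "finite (Phi_pos n)"
proof -
  have "Phi_pos n \<subseteq> (\<lambda>(i, j). eps i + eps j) ` ({1..n} \<times> {1..n}) \<union> (\<lambda>(i, j). eps i - eps j) ` ({1..n} \<times> {1..n})"
    (is "_ \<subseteq> ?A")
  proof
    fix \<alpha> assume "\<alpha> \<in> Phi_pos n"
    then show "\<alpha> \<in> ?A"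
    proof (cases rule: Phi_posE)
      case (plus i j)
      then show ?thesis by (intro UnI1 rev_image_eqI[of "(i, j)"]) auto
    next
      case (diff i j)
      then show ?thesis by (intro UnI2 rev_image_eqI[of "(i, j)"]) auto
    qed
  qed
  then show ?thesis by (rule finite_subset) auto
qed

lemma finite_Phi: "finite (Phi n)"
  by (simp add: Phi_def finite_Phi_pos)

lemma Phi_uminus: "- \<alpha> \<in> Phi n \<longleftrightarrow> \<alpha> \<in> Phi n"
proof -
  have "- \<alpha> \<in> uminus ` A \<longleftrightarrow> \<alpha> \<in> A" for A :: "weight set"
    by auto
  moreover have "\<alpha> \<in> uminus ` A \<longleftrightarrow> - \<alpha> \<in> A" for A :: "weight set"
    by (metis image_iff minus_minus)
  ultimately show ?thesis
    unfolding Phi_def by blast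
qed

lemma Phi_pos_iff: "\<alpha> \<in> Phi_pos n \<longleftrightarrow> \<alpha> \<in> Phi n \<and> wdot n (rho n) \<alpha> > 0"
proof -
  have "wdot n (rho n) \<alpha> < 0" if "\<alpha> \<in> uminus ` Phi_pos n"
    using that by (auto simp: wdot_minus_right dest: rho_pos)
  then show ?thesis
    unfolding Phi_def using rho_pos by force
qed

lemma Phi_cases: "\<alpha> \<in> Phi n \<Longrightarrow> \<alpha> \<in> Phi_pos n \<or> - \<alpha> \<in> Phi_pos n"
  by (auto simp: Phi_def)

lemma Phi_pos_uminus: "\<alpha> \<in> Phi_pos n \<Longrightarrow> - \<alpha> \<notin> Phi_pos n"
  using Phi_pos_iff[of "- \<alpha>" n] rho_pos[of \<alpha> n] by (simp add: wdot_minus_right)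

lemma zero_notin_Phi: "0 \<notin> Phi n"
  using Phi_cases[of 0 n] rho_pos[of 0 n] by auto

text \<open>A description of the roots in which all signed permutations of the coordinates are visible
  symmetries.\<close>
lemma Phi_iff:
  "\<alpha> \<in> Phi n \<longleftrightarrow> \<alpha> \<noteq> 0 \<and> (\<exists>i j s t. i \<in> {1..n} \<and> j \<in> {1..n} \<and> s \<in> {-1, 1} \<and> t \<in> {-1, 1} \<and> \<alpha> = seps s i t j)"
  (is "?L = ?R")
proof
  assume L: ?L
  have "\<exists>i j s t. i \<in> {1..n} \<and> j \<in> {1..n} \<and> s \<in> {-1, 1} \<and> t \<in> {-1, 1} \<and> \<alpha> = seps s i t j"
    using Phi_cases[OF L]
  proof
    assume "\<alpha> \<in> Phi_pos n"
    then show ?thesis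
    proof (cases rule: Phi_posE)
      case (plus i j)
      then show ?thesis
        by (intro exI[of _ i] exI[of _ j] exI[of _ 1]) (auto simp: seps_def fun_eq_iff)
    next
      case (diff i j)
      then show ?thesis
        by (intro exI[of _ i] exI[of _ j] exI[of _ 1] exI[of _ "-1"]) (auto simp: seps_def fun_eq_iff)
    qed
  next
    assume "- \<alpha> \<in> Phi_pos n"
    then show ?thesis
    proof (cases rule: Phi_posE)
      case (plus i j)
      from plus(4) have "\<alpha> = - (eps i + eps j)" by (metis minus_minus)
      with plus show ?thesis
        by (intro exI[of _ i] exI[of _ j] exI[of _ "-1"]) (auto simp: seps_def fun_eq_iff)
    next
      case (diff i j)
      from diff(4) have "\<alpha> = - (eps i - eps j)" by (metis minus_minus)
      with diff show ?thesis
        by (intro exI[of _ i] exI[of _ j] exI[of _ "-1"] exI[of _ 1]) (auto simp: seps_def fun_eq_iff)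
    qed
  qed
  moreover have "\<alpha> \<noteq> 0" using L zero_notin_Phi by blast
  ultimately show ?R by blast
next
  assume ?R
  then obtain i j s t where ij: "i \<in> {1..n}" "j \<in> {1..n}" and st: "s = -1 \<or> s = 1" "t = -1 \<or> t = 1"
    and \<alpha>: "\<alpha> = seps s i t j" and "\<alpha> \<noteq> 0" by auto
  have pm: "eps i - eps j \<in> Phi n" if "i \<noteq> j" "i \<in> {1..n}" "j \<in> {1..n}" for i j
  proof (cases "i < j")
    case True
    then show ?thesis using diff_in_Phi_pos[of i j n] that by (simp add: Phi_def)
  next
    case False
    then have "eps j - eps i \<in> Phi n" using diff_in_Phi_pos[of j i n] that by (simp add: Phi_def)
    then show ?thesis using Phi_uminus[of "eps j - eps i" n] by simp
  qed
  have pp: "eps i + eps j \<in> Phi n" "- (eps i + eps j) \<in> Phi n" 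
    using plus_in_Phi_pos[OF ij] Phi_uminus[of "eps i + eps j"] by (auto simp: Phi_def)
  have "seps s i t j = eps i + eps j \<or> seps s i t j = - (eps i + eps j) \<or>
     (i \<noteq> j \<and> (seps s i t j = eps i - eps j \<or> seps s i t j = eps j - eps i))"
  proof (cases "s = t")
    case True
    then show ?thesis using st by (auto simp: seps_def fun_eq_iff)
  next
    case False
    then have "i \<noteq> j" using \<open>\<alpha> \<noteq> 0\<close> st \<alpha> by (auto simp: seps_def fun_eq_iff)
    then show ?thesis using st False by (auto simp: seps_def fun_eq_iff)
  qed
  then show ?L using pp pm ij \<alpha> by metis
qed

lemma Phi_outside: assumes "\<alpha> \<in> Phi n" "k \<notin> {1..n}" shows "\<alpha> k = 0"
  using assms unfolding Phi_iff seps_def eps_def by (auto split: if_splits)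

lemma wdot_Phi: assumes "\<alpha> \<in> Phi n" shows "wdot n \<alpha> \<alpha> \<in> {2, 4}"
proof -
  have *: "wdot n \<beta> \<beta> \<in> {2, 4}" if "\<beta> \<in> Phi_pos n" for \<beta>
    using that
  proof (cases rule: Phi_posE)
    case (plus i j)
    have "wdot n \<beta> \<beta> = eps i i + eps j i + (eps i j + eps j j)"
      using plus(1-3) unfolding plus(4) wdot_simps by (simp add: wdot_eps)
    then show ?thesis by (cases "i = j") (auto simp: eps_other)
  next
    case (diff i j)
    then show ?thesis by (auto simp: wdot_simps wdot_eps eps_other)
  qed
  from Phi_cases[OF assms] show ?thesis
    using *[of \<alpha>] *[of "- \<alpha>"] by (auto simp: wdot_simps)
qed

subsection \<open>Signed permutations\<close>

text \<open>The action of the Weyl group of type C.\<close>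
definition sact :: "(nat \<Rightarrow> int) \<Rightarrow> (nat \<Rightarrow> nat) \<Rightarrow> weight \<Rightarrow> weight" where
  "sact sg \<pi> \<alpha> = (\<lambda>k. sg k * \<alpha> (\<pi> k))"

definition signs :: "(nat \<Rightarrow> int) \<Rightarrow> bool" where
  "signs sg \<longleftrightarrow> (\<forall>k. sg k = 1 \<or> sg k = -1)"

lemma signs_sq: "signs sg \<Longrightarrow> sg k * sg k = 1"
  by (metis signs_def mult_1 minus_mult_minus)

lemma sact_uminus: "sact sg \<pi> (- a) = - sact sg \<pi> a"
  and sact_zero: "sact sg \<pi> 0 = 0"
  by (simp_all add: sact_def fun_eq_iff algebra_simps)

lemma wdot_sact:
  assumes "signs sg" "\<pi> permutes {1..n}"
  shows "wdot n (sact sg \<pi> a) (sact sg \<pi> b) = wdot n a b"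
proof -
  have "wdot n (sact sg \<pi> a) (sact sg \<pi> b) = (\<Sum>i = 1..n. (sg i * sg i) * (a (\<pi> i) * b (\<pi> i)))"
    by (simp add: wdot_def sact_def mult_ac)
  also have "\<dots> = (\<Sum>i = 1..n. a (\<pi> i) * b (\<pi> i))"
    using assms by (simp add: signs_sq)
  also have "\<dots> = wdot n a b"
    unfolding wdot_def using sum.permute[OF assms(2), of "\<lambda>i. a i * b i"] by (simp add: o_def)
  finally show ?thesis .
qed

lemma sact_inj:
  assumes "signs sg" "\<pi> permutes {1..n}" shows "inj (sact sg \<pi>)"
proof (rule injI)
  fix a b assume "sact sg \<pi> a = sact sg \<pi> b"
  then have "a (\<pi> k) = b (\<pi> k)" for k
    using assms(1) by (auto simp: sact_def fun_eq_iff signs_def) (metis mult_cancel_left zero_neq_one zero_neq_neg_one)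
  then show "a = b" using permutes_surj[OF assms(2)] by (metis ext surj_def)
qed

lemma sact_seps:
  assumes "\<pi> permutes {1..n}"
  shows "sact sg \<pi> (seps s i t j) = seps (sg (pinv \<pi> i) * s) (pinv \<pi> i) (sg (pinv \<pi> j) * t) (pinv \<pi> j)"
proof -
  have "eps i (\<pi> k) = eps (pinv \<pi> i) k" for i k
    using permutes_inverses[OF assms] by (auto simp: eps_def)
  moreover have "sg k * (s * eps i k) = sg i * s * eps i k" for k i s
    by (simp add: eps_def)
  ultimately show ?thesis
    unfolding sact_def seps_def by (simp only: distrib_left)
qed

lemma sact_Phi:
  assumes "signs sg" "\<pi> permutes {1..n}" shows "sact sg \<pi> ` Phi n = Phi n"
proof (rule endo_inj_surj[OF finite_Phi])
  show inj: "inj_on (sact sg \<pi>) (Phi n)" using sact_inj[OF assms] inj_on_subset by blast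
  show "sact sg \<pi> ` Phi n \<subseteq> Phi n"
  proof (rule image_subsetI)
    fix \<alpha> assume "\<alpha> \<in> Phi n"
    then obtain i j s t where ij: "i \<in> {1..n}" "j \<in> {1..n}" and st: "s \<in> {-1, 1}" "t \<in> {-1, 1}"
      and \<alpha>: "\<alpha> = seps s i t j" and nz: "\<alpha> \<noteq> 0" unfolding Phi_iff by blast
    have "sact sg \<pi> \<alpha> \<noteq> 0"
      using sact_inj[OF assms] nz sact_zero[of sg \<pi>] by (metis injD)
    moreover have "pinv \<pi> i \<in> {1..n}" "pinv \<pi> j \<in> {1..n}"
      using ij permutes_in_image[OF permutes_inv[OF assms(2)]] by blast+
    moreover have "sg k * s \<in> {-1,1}" "sg k * t \<in> {-1,1}" for k
      using st assms(1) unfolding signs_def by auto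
    ultimately show "sact sg \<pi> \<alpha> \<in> Phi n"
      unfolding Phi_iff \<alpha> sact_seps[OF assms(2)] by blast
  qed
qed

lemma sort_exists:
  fixes f :: "nat \<Rightarrow> 'a::linorder"
  shows "\<exists>\<pi>. \<pi> permutes {1..n} \<and> (\<forall>i j. 1 \<le> i \<and> i \<le> j \<and> j \<le> n \<longrightarrow> f (\<pi> j) \<le> f (\<pi> i))"
proof (induction n arbitrary: f)
  case 0
  show ?case by (rule exI[of _ id]) (auto simp: permutes_id)
next
  case (Suc n)
  define m where "m = arg_min_on f {1..Suc n}"
  have m: "m \<in> {1..Suc n}" "\<And>k. k \<in> {1..Suc n} \<Longrightarrow> f m \<le> f k"
    unfolding m_def using arg_min_if_finite(1)[of "{1..Suc n}" f] arg_min_least[of "{1..Suc n}" _ f] by auto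
  define \<tau> where "\<tau> = Transposition.transpose m (Suc n)"
  have \<tau>: "\<tau> permutes {1..Suc n}" unfolding \<tau>_def using m(1) by (intro permutes_swap_id) auto
  obtain \<pi> where \<pi>: "\<pi> permutes {1..n}" "\<And>i j. 1 \<le> i \<Longrightarrow> i \<le> j \<Longrightarrow> j \<le> n \<Longrightarrow> f (\<tau> (\<pi> j)) \<le> f (\<tau> (\<pi> i))"
    using Suc.IH[of "f \<circ> \<tau>"] by auto
  have \<pi>': "\<pi> permutes {1..Suc n}" using \<pi>(1) by (rule permutes_subset) auto
  have last: "\<pi> (Suc n) = Suc n" using \<pi>(1) by (simp add: permutes_def)
  show ?case
  proof (intro exI[of _ "\<tau> \<circ> \<pi>"] conjI allI impI)
    show "(\<tau> \<circ> \<pi>) permutes {1..Suc n}" using permutes_compose[OF \<pi>' \<tau>] .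
    fix i j assume ij: "1 \<le> i \<and> i \<le> j \<and> j \<le> Suc n"
    show "f ((\<tau> \<circ> \<pi>) j) \<le> f ((\<tau> \<circ> \<pi>) i)"
    proof (cases "j = Suc n")
      case True
      have "(\<tau> \<circ> \<pi>) j = m" using True last by (simp add: \<tau>_def)
      moreover have "(\<tau> \<circ> \<pi>) i \<in> {1..Suc n}"
        using ij permutes_in_image[OF permutes_compose[OF \<pi>' \<tau>], of i] by simp
      ultimately show ?thesis using m(2) by simp
    next
      case False
      then show ?thesis using ij \<pi>(2)[of i j] by simp
    qed
  qed
qed

subsection \<open>Sets of positive roots cut out by a regular weight\<close>

definition separated :: "nat \<Rightarrow> weight set \<Rightarrow> bool" where
  "separated n S \<longleftrightarrow> S \<subseteq> Phi_pos n \<and>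
     (\<exists>v. \<forall>\<alpha>\<in>Phi_pos n. wdot n v \<alpha> \<noteq> 0 \<and> (\<alpha> \<in> S \<longleftrightarrow> wdot n v \<alpha> < 0))"

text \<open>The set S minimises the value of the separating weight at the sum of a set of positive roots, and
  regularity makes the minimum unique.\<close>
lemma separated_unique_sum:
  assumes S: "separated n S" and S': "S' \<subseteq> Phi_pos n" and eq: "\<Sum>S' = \<Sum>S"
  shows "S' = S"
proof -
  obtain v where v: "\<And>\<alpha>. \<alpha> \<in> Phi_pos n \<Longrightarrow> wdot n v \<alpha> \<noteq> 0 \<and> (\<alpha> \<in> S \<longleftrightarrow> wdot n v \<alpha> < 0)"
    and SP: "S \<subseteq> Phi_pos n"
    using S unfolding separated_def by blast
  have fin: "finite S" "finite S'"
    using finite_subset[OF SP finite_Phi_pos] finite_subset[OF S' finite_Phi_pos] by auto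
  have "(\<Sum>\<alpha>\<in>S'. wdot n v \<alpha>) = (\<Sum>\<alpha>\<in>S. wdot n v \<alpha>)"
    using arg_cong[OF eq, of "wdot n v"] by (simp add: wdot_sum_right)
  moreover have "(\<Sum>\<alpha>\<in>S'. wdot n v \<alpha>) = (\<Sum>\<alpha>\<in>S' \<inter> S. wdot n v \<alpha>) + (\<Sum>\<alpha>\<in>S' - S. wdot n v \<alpha>)"
    using sum.Int_Diff[OF fin(2)] .
  moreover have "(\<Sum>\<alpha>\<in>S. wdot n v \<alpha>) = (\<Sum>\<alpha>\<in>S' \<inter> S. wdot n v \<alpha>) + (\<Sum>\<alpha>\<in>S - S'. wdot n v \<alpha>)"
    using sum.Int_Diff[OF fin(1), of _ S'] by (simp add: Int_commute)
  ultimately have *: "(\<Sum>\<alpha>\<in>S' - S. wdot n v \<alpha>) = (\<Sum>\<alpha>\<in>S - S'. wdot n v \<alpha>)" by simp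
  have nn: "(\<Sum>\<alpha>\<in>S' - S. wdot n v \<alpha>) \<ge> 0"
  proof (rule sum_nonneg)
    fix \<alpha> assume "\<alpha> \<in> S' - S"
    then show "0 \<le> wdot n v \<alpha>" using v[of \<alpha>] S' by auto
  qed
  have np: "(\<Sum>\<alpha>\<in>S - S'. wdot n v \<alpha>) \<le> 0"
  proof (rule sum_nonpos)
    fix \<alpha> assume "\<alpha> \<in> S - S'"
    then show "wdot n v \<alpha> \<le> 0" using v[of \<alpha>] SP by auto
  qed
  have "S' - S = {}"
  proof (rule ccontr)
    assume ne: "S' - S \<noteq> {}"
    have "(\<Sum>\<alpha>\<in>S' - S. wdot n v \<alpha>) > 0"
    proof (rule sum_pos)
      fix \<alpha> assume "\<alpha> \<in> S' - S"
      then show "0 < wdot n v \<alpha>" using v[of \<alpha>] S' by auto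
    qed (use fin ne in auto)
    with * np show False by simp
  qed
  moreover have "S - S' = {}"
  proof (rule ccontr)
    assume ne: "S - S' \<noteq> {}"
    have "(\<Sum>\<alpha>\<in>S - S'. - wdot n v \<alpha>) > 0"
    proof (rule sum_pos)
      fix \<alpha> assume "\<alpha> \<in> S - S'"
      then show "0 < - wdot n v \<alpha>" using v[of \<alpha>] SP by auto
    qed (use fin ne in auto)
    with * nn show False by (simp add: sum_negf)
  qed
  ultimately show ?thesis by blast
qed

text \<open>The roots \<open>eps i + eps j\<close> and \<open>eps i - eps j\<close> with \<open>i < j\<close> contribute only at the smaller
  index, since the contributions at the larger one cancel.\<close>
lemma sum_Phi_pos: assumes k: "k \<in> {1..n}" shows "(\<Sum>\<alpha>\<in>Phi_pos n. \<alpha> k) = 2 * rho n k"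
proof -
  define I where "I = {(i, j). 1 \<le> i \<and> i < j \<and> j \<le> n}"
  define A where "A = (\<lambda>i. eps i + eps i) ` {1..n}"
  define B where "B = (\<lambda>(i, j). eps i + eps j) ` I"
  define C where "C = (\<lambda>(i, j). eps i - eps j) ` I"
  have fI: "finite I" by (rule finite_subset[of _ "{1..n} \<times> {1..n}"]) (auto simp: I_def)
  have fin: "finite A" "finite B" "finite C" by (simp_all add: A_def B_def C_def fI)
  have A_eq: "A = {eps i + eps i |i. 1 \<le> i \<and> i \<le> n}"
    unfolding A_def image_def Bex_def atLeastAtMost_iff by (intro Collect_cong) blast
  have B_eq: "B = {eps i + eps j |i j. 1 \<le> i \<and> i < j \<and> j \<le> n}"
    unfolding B_def I_def image_def Bex_def split_paired_Ex mem_Collect_eq case_prod_conv by (intro Collect_cong) blast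
  have C_eq: "C = {eps i - eps j |i j. 1 \<le> i \<and> i < j \<and> j \<le> n}"
    unfolding C_def I_def image_def Bex_def split_paired_Ex mem_Collect_eq case_prod_conv by (intro Collect_cong) blast
  have PP: "Phi_pos n = A \<union> B \<union> C"
    unfolding Phi_pos_def A_eq B_eq C_eq by (rule refl)
  have AB: "A \<inter> B = {}"
  proof -
    have "eps i + eps i \<noteq> eps a + eps b" if "a < b" for i a b
    proof
      assume "eps i + eps i = eps a + eps b"
      from fun_cong[OF this, of a] that show False by (auto simp: eps_def split: if_splits)
    qed
    then show ?thesis unfolding A_eq B_eq by blast
  qed
  have ABC: "(A \<union> B) \<inter> C = {}"
  proof -
    have "eps i + eps j \<noteq> eps a - eps b" if "a < b" for i j a b
    proof
      assume "eps i + eps j = eps a - eps b"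
      from fun_cong[OF this, of b] that show False by (auto simp: eps_def split: if_splits)
    qed
    then show ?thesis unfolding A_eq B_eq C_eq by blast
  qed
  have injA: "inj_on (\<lambda>i. eps i + eps i) {1..n}"
  proof (rule inj_onI)
    fix i j assume "eps i + eps i = eps j + eps j"
    from fun_cong[OF this, of i] show "i = j" by (auto simp: eps_def split: if_splits)
  qed
  have injB: "inj_on (\<lambda>(i, j). eps i + eps j) I"
  proof (rule inj_onI, clarify)
    fix i j a b assume ij: "(i, j) \<in> I" "(a, b) \<in> I" and eq: "eps i + eps j = eps a + eps b"
    show "i = a \<and> j = b"
      using ij fun_cong[OF eq, of i] fun_cong[OF eq, of j] fun_cong[OF eq, of a]
      by (auto simp: eps_def I_def split: if_splits)
  qed
  have injC: "inj_on (\<lambda>(i, j). eps i - eps j) I"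
  proof (rule inj_onI, clarify)
    fix i j a b assume ij: "(i, j) \<in> I" "(a, b) \<in> I" and eq: "eps i - eps j = eps a - eps b"
    show "i = a \<and> j = b"
      using ij fun_cong[OF eq, of i] fun_cong[OF eq, of j]
      by (auto simp: eps_def I_def split: if_splits)
  qed
  have sA: "(\<Sum>\<alpha>\<in>A. \<alpha> k) = 2"
  proof -
    have "(\<Sum>\<alpha>\<in>A. \<alpha> k) = (\<Sum>i = 1..n. 2 * eps i k)"
      unfolding A_def by (subst sum.reindex[OF injA]) simp
    also have "\<dots> = 2" using k by (simp add: eps_def if_distrib cong: if_cong)
    finally show ?thesis .
  qed
  have "(\<Sum>\<alpha>\<in>B. \<alpha> k) + (\<Sum>\<alpha>\<in>C. \<alpha> k) = (\<Sum>p\<in>I. 2 * eps (fst p) k)"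
    unfolding B_def C_def by (subst sum.reindex[OF injB], subst sum.reindex[OF injC])
      (simp add: sum.distrib[symmetric] case_prod_unfold)
  also have "\<dots> = (\<Sum>p\<in>Pair k ` {k<..n}. 2)"
    by (rule sum.mono_neutral_cong_right[OF fI]) (use k in \<open>auto simp: I_def eps_def split: if_splits\<close>)
  also have "\<dots> = 2 * int (n - k)" by (simp add: card_image inj_on_def)
  finally have sBC: "(\<Sum>\<alpha>\<in>B. \<alpha> k) + (\<Sum>\<alpha>\<in>C. \<alpha> k) = 2 * int (n - k)" .
  have "(\<Sum>\<alpha>\<in>Phi_pos n. \<alpha> k) = (\<Sum>\<alpha>\<in>A. \<alpha> k) + (\<Sum>\<alpha>\<in>B. \<alpha> k) + (\<Sum>\<alpha>\<in>C. \<alpha> k)"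
    unfolding PP using fin AB ABC by (simp add: sum.union_disjoint)
  then show ?thesis using sA sBC k by (auto simp: rho_def of_nat_diff)
qed

lemma wdot_sum_Phi_pos: "(\<Sum>\<alpha>\<in>Phi_pos n. wdot n s \<alpha>) = 2 * wdot n (rho n) s"
proof -
  have "(\<Sum>\<alpha>\<in>Phi_pos n. wdot n s \<alpha>) = (\<Sum>i=1..n. s i * (\<Sum>\<alpha>\<in>Phi_pos n. \<alpha> i))"
    unfolding wdot_def sum_distrib_left by (rule sum.swap)
  also have "\<dots> = (\<Sum>i=1..n. 2 * (rho n i * s i))"
    by (rule sum.cong) (simp_all add: sum_Phi_pos)
  finally show ?thesis by (simp add: wdot_def sum_distrib_left)
qed

text \<open>The weight \<open>\<rho> - \<Sum>S\<close> is half the sum of the system obtained from the positive roots by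
  changing the sign of those in S. A signed permutation makes it dominant without changing its norm
  and turns S into another set \<open>S'\<close>. With \<open>v' = \<rho> - \<Sum>S'\<close> dominant,
  \<open>\<bar>\<rho>\<bar>\<^sup>2 - \<bar>v'\<bar>\<^sup>2 = \<langle>\<rho> + v', \<Sum>S'\<rangle>\<close> is positive unless \<open>S'\<close> is empty; this is why only the sets cut
  out by a regular weight reach the norm of \<open>\<rho>\<close>.\<close>
lemma extremal_cut_out:
  assumes S: "S \<subseteq> Phi_pos n" and ext: "wdot n (\<Sum>S) (\<Sum>S) = 2 * wdot n (rho n) (\<Sum>S)"
  shows "\<forall>\<alpha>\<in>Phi_pos n. wdot n (rho n - \<Sum>S) \<alpha> \<noteq> 0 \<and> (\<alpha> \<in> S \<longleftrightarrow> wdot n (rho n - \<Sum>S) \<alpha> < 0)"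
proof -
  define v where "v = rho n - \<Sum>S"
  obtain \<pi> where \<pi>: "\<pi> permutes {1..n}"
    and dec: "\<And>i j. 1 \<le> i \<Longrightarrow> i \<le> j \<Longrightarrow> j \<le> n \<Longrightarrow> \<bar>v (\<pi> j)\<bar> \<le> \<bar>v (\<pi> i)\<bar>"
    using sort_exists[of n "\<lambda>k. \<bar>v k\<bar>"] by blast
  define sg where "sg k = (if v (\<pi> k) < 0 then -1 else 1 :: int)" for k
  have sg: "signs sg" by (simp add: signs_def sg_def)
  define w where "w = sact sg \<pi>"
  have w_val: "w v k = \<bar>v (\<pi> k)\<bar>" for k by (simp add: w_def sact_def sg_def)
  have dom: "wdot n (w v) \<alpha> \<ge> 0" if "\<alpha> \<in> Phi_pos n" for \<alpha>
    using that
  proof (cases rule: Phi_posE)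
    case (plus i j)
    then show ?thesis by (simp add: wdot_simps wdot_eps w_val)
  next
    case (diff i j)
    then show ?thesis using dec[of i j] by (simp add: wdot_simps wdot_eps w_val)
  qed
  have w_inj: "inj w" unfolding w_def by (rule sact_inj[OF sg \<pi>])
  have w_Phi: "w ` Phi n = Phi n" unfolding w_def by (rule sact_Phi[OF sg \<pi>])
  have w_minus: "w (- a) = - w a" for a by (simp add: w_def sact_uminus)
  have w_wdot: "wdot n (w a) (w b) = wdot n a b" for a b unfolding w_def by (rule wdot_sact[OF sg \<pi>])
  define T where "T = (Phi_pos n - S) \<union> uminus ` S"
  have fS: "finite S" using finite_subset[OF S finite_Phi_pos] .
  have T_Phi: "T \<subseteq> Phi n" using S by (auto simp: T_def Phi_def)
  have fT: "finite T" using T_Phi finite_Phi finite_subset by blast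
  have T_half: "(\<alpha> \<in> T) \<noteq> (- \<alpha> \<in> T)" if "\<alpha> \<in> Phi n" for \<alpha>
  proof -
    have *: "(\<alpha> \<in> T) \<noteq> (- \<alpha> \<in> T)" if "\<alpha> \<in> Phi_pos n" for \<alpha>
      using that Phi_pos_uminus[OF that] S unfolding T_def by auto
    show ?thesis using Phi_cases[OF that] *[of \<alpha>] *[of "- \<alpha>"] by auto
  qed
  have sumT: "(\<Sum>\<alpha>\<in>T. \<alpha> k) = 2 * v k" if k: "k \<in> {1..n}" for k
  proof -
    have disj: "(Phi_pos n - S) \<inter> uminus ` S = {}"
    proof -
      have "- \<beta> \<notin> Phi_pos n" if "\<beta> \<in> S" for \<beta> using that S Phi_pos_uminus by blast
      then show ?thesis by blast
    qed
    have "(\<Sum>\<alpha>\<in>T. \<alpha> k) = (\<Sum>\<alpha>\<in>Phi_pos n - S. \<alpha> k) + (\<Sum>\<alpha>\<in>uminus ` S. \<alpha> k)"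
      unfolding T_def using disj fS finite_Phi_pos by (simp add: sum.union_disjoint)
    also have "(\<Sum>\<alpha>\<in>uminus ` S. \<alpha> k) = - (\<Sum>\<alpha>\<in>S. \<alpha> k)"
      by (subst sum.reindex) (simp_all add: sum_negf)
    also have "(\<Sum>\<alpha>\<in>Phi_pos n - S. \<alpha> k) = (\<Sum>\<alpha>\<in>Phi_pos n. \<alpha> k) - (\<Sum>\<alpha>\<in>S. \<alpha> k)"
      by (rule sum_diff[OF finite_Phi_pos S])
    finally show ?thesis
      using sum_Phi_pos[OF k] by (simp add: v_def sum_fun_apply)
  qed
  define S' where "S' = Phi_pos n - w ` T"
  have fS': "finite S'" using finite_Phi_pos by (simp add: S'_def)
  have wT_half: "(\<alpha> \<in> w ` T) \<noteq> (- \<alpha> \<in> w ` T)" if "\<alpha> \<in> Phi n" for \<alpha>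
  proof -
    have "\<alpha> \<in> w ` Phi n" unfolding w_Phi by (rule that)
    then obtain \<beta> where \<beta>: "\<beta> \<in> Phi n" "\<alpha> = w \<beta>" by blast
    have "\<alpha> \<in> w ` T \<longleftrightarrow> \<beta> \<in> T" "- \<alpha> \<in> w ` T \<longleftrightarrow> - \<beta> \<in> T"
      unfolding \<beta>(2) w_minus[symmetric] by (rule inj_image_mem_iff[OF w_inj])+
    then show ?thesis using T_half[OF \<beta>(1)] by simp
  qed
  have wT_Phi: "w ` T \<subseteq> Phi n" using image_mono[OF T_Phi, of w] unfolding w_Phi .
  have wT: "w ` T = (Phi_pos n - S') \<union> uminus ` S'"
  proof
    show "w ` T \<subseteq> (Phi_pos n - S') \<union> uminus ` S'"
    proof
      fix \<alpha> assume \<alpha>: "\<alpha> \<in> w ` T"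
      then have "\<alpha> \<in> Phi n" using wT_Phi by blast
      then consider "\<alpha> \<in> Phi_pos n" | "- \<alpha> \<in> Phi_pos n" using Phi_cases by blast
      then show "\<alpha> \<in> (Phi_pos n - S') \<union> uminus ` S'"
      proof cases
        case 2
        then have "- \<alpha> \<in> S'" using wT_half[OF \<open>\<alpha> \<in> Phi n\<close>] \<alpha> by (simp add: S'_def)
        then show ?thesis by (metis UnI2 image_eqI minus_minus)
      qed (use \<alpha> in \<open>auto simp: S'_def\<close>)
    qed
    show "(Phi_pos n - S') \<union> uminus ` S' \<subseteq> w ` T"
    proof
      fix \<alpha> assume "\<alpha> \<in> (Phi_pos n - S') \<union> uminus ` S'"
      then consider "\<alpha> \<in> Phi_pos n - S'" | \<beta> where "\<beta> \<in> S'" "\<alpha> = - \<beta>" by blast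
      then show "\<alpha> \<in> w ` T"
      proof cases
        case 2
        then have "\<beta> \<in> Phi n" "\<beta> \<notin> w ` T" by (simp_all add: S'_def Phi_def)
        then show ?thesis using wT_half[of \<beta>] 2 by simp
      qed (simp add: S'_def)
    qed
  qed
  define s' where "s' = \<Sum>S'"
  have wv: "w v k = rho n k - s' k" if k: "k \<in> {1..n}" for k
  proof -
    have disj: "(Phi_pos n - S') \<inter> uminus ` S' = {}"
    proof -
      have "- \<beta> \<notin> Phi_pos n" if "\<beta> \<in> S'" for \<beta> using that Phi_pos_uminus S'_def by blast
      then show ?thesis by blast
    qed
    have "(\<Sum>\<alpha>\<in>w ` T. \<alpha> k) = (\<Sum>\<alpha>\<in>Phi_pos n - S'. \<alpha> k) + (\<Sum>\<alpha>\<in>uminus ` S'. \<alpha> k)"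
      unfolding wT using disj fS' finite_Phi_pos by (simp add: sum.union_disjoint)
    also have "(\<Sum>\<alpha>\<in>uminus ` S'. \<alpha> k) = - (\<Sum>\<alpha>\<in>S'. \<alpha> k)"
      by (subst sum.reindex) (simp_all add: sum_negf)
    also have "(\<Sum>\<alpha>\<in>Phi_pos n - S'. \<alpha> k) = (\<Sum>\<alpha>\<in>Phi_pos n. \<alpha> k) - (\<Sum>\<alpha>\<in>S'. \<alpha> k)"
      by (rule sum_diff[OF finite_Phi_pos]) (simp add: S'_def)
    finally have "(\<Sum>\<alpha>\<in>w ` T. \<alpha> k) = 2 * (rho n k - s' k)"
      using sum_Phi_pos[OF k] by (simp add: s'_def sum_fun_apply)
    moreover have "(\<Sum>\<alpha>\<in>w ` T. \<alpha> k) = (\<Sum>\<alpha>\<in>T. w \<alpha> k)"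
      using inj_on_subset[OF w_inj, of T] by (subst sum.reindex) auto
    moreover have "\<dots> = sg k * (\<Sum>\<alpha>\<in>T. \<alpha> (\<pi> k))"
      by (simp add: w_def sact_def sum_distrib_left)
    moreover have "\<dots> = 2 * w v k"
      using sumT[of "\<pi> k"] permutes_in_image[OF \<pi>, of k] k by (simp add: w_def sact_def)
    ultimately show ?thesis by simp
  qed
  have wdot_wv: "wdot n (w v) a = wdot n (rho n) a - wdot n s' a" for a
    unfolding wdot_diff_left[symmetric] using wv by (auto simp: wdot_def intro!: sum.cong)
  have "wdot n (w v) (w v) = wdot n (rho n) (rho n)"
    using ext by (simp add: w_wdot v_def wdot_simps wdot_commute[of n "\<Sum>S" "rho n"])
  moreover have "wdot n (w v) (w v) = wdot n (rho n) (rho n) - wdot n (rho n) s' - wdot n (w v) s'"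
  proof -
    have "wdot n (w v) (w v) = wdot n (rho n) (w v) - wdot n s' (w v)" by (rule wdot_wv)
    also have "\<dots> = wdot n (w v) (rho n) - wdot n (w v) s'" by (simp add: wdot_commute)
    also have "wdot n (w v) (rho n) = wdot n (rho n) (rho n) - wdot n s' (rho n)" by (rule wdot_wv)
    finally show ?thesis by (simp add: wdot_commute)
  qed
  ultimately have zero: "(\<Sum>\<alpha>\<in>S'. wdot n (rho n) \<alpha> + wdot n (w v) \<alpha>) = 0"
    by (simp add: s'_def wdot_sum_right sum.distrib)
  have "S' = {}"
  proof (rule ccontr)
    assume "S' \<noteq> {}"
    then have "(\<Sum>\<alpha>\<in>S'. wdot n (rho n) \<alpha> + wdot n (w v) \<alpha>) > 0"
      using fS' dom rho_pos by (intro sum_pos) (auto simp: S'_def intro!: add_pos_nonneg)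
    with zero show False by simp
  qed
  then have wT': "w ` T = Phi_pos n" and "s' = 0" using wT by (simp_all add: s'_def)
  then have wv': "wdot n (w v) a = wdot n (rho n) a" for a using wdot_wv[of a] by simp
  have T_char: "\<alpha> \<in> T \<longleftrightarrow> wdot n v \<alpha> > 0" if "\<alpha> \<in> Phi n" for \<alpha>
  proof -
    have "\<alpha> \<in> T \<longleftrightarrow> w \<alpha> \<in> w ` T" using inj_image_mem_iff[OF w_inj] by simp
    also have "\<dots> \<longleftrightarrow> wdot n (rho n) (w \<alpha>) > 0"
      unfolding wT' Phi_pos_iff using imageI[OF that, of w] unfolding w_Phi by blast
    also have "\<dots> \<longleftrightarrow> wdot n v \<alpha> > 0" unfolding wv'[symmetric] w_wdot ..
    finally show ?thesis .
  qed
  show ?thesis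
  proof
    fix \<alpha> assume \<alpha>: "\<alpha> \<in> Phi_pos n"
    then have P: "\<alpha> \<in> Phi n" "- \<alpha> \<in> Phi n" using Phi_uminus by (auto simp: Phi_def)
    have "\<alpha> \<in> S \<longleftrightarrow> - \<alpha> \<in> T" using \<alpha> Phi_pos_uminus[OF \<alpha>] S by (auto simp: T_def)
    then show "wdot n (rho n - \<Sum>S) \<alpha> \<noteq> 0 \<and> (\<alpha> \<in> S \<longleftrightarrow> wdot n (rho n - \<Sum>S) \<alpha> < 0)"
      using T_char[OF P(1)] T_char[OF P(2)] T_half[OF P(1)] by (auto simp: v_def wdot_minus_right)
  qed
qed

subsection \<open>The root sets attached to a permutation and an upper set\<close>

text \<open>The root sets of abelian ideals, in coordinates: adding a positive root of the form
  \<open>eps k - eps i\<close> with \<open>k < i\<close> lowers an index.\<close>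
definition upper_set :: "nat \<Rightarrow> weight set \<Rightarrow> bool" where
  "upper_set n \<Psi> \<longleftrightarrow> \<Psi> \<subseteq> {eps i + eps j | i j. i \<in> {1..n} \<and> j \<in> {1..n}} \<and>
     (\<forall>i\<in>{1..n}. \<forall>j\<in>{1..n}. \<forall>k\<in>{1..i}. eps i + eps j \<in> \<Psi> \<longrightarrow> eps k + eps j \<in> \<Psi>)"

definition L_roots :: "nat \<Rightarrow> (nat \<Rightarrow> nat) \<Rightarrow> weight set \<Rightarrow> weight set" where
  "L_roots n \<sigma> \<Psi> = Phi_perm n \<sigma> \<union> perm_act (\<sigma> \<circ> perm_rev n) ` \<Psi>"

lemma perm_act_add: "perm_act \<tau> (a + b) = perm_act \<tau> a + perm_act \<tau> b"
  and perm_act_diff: "perm_act \<tau> (a - b) = perm_act \<tau> a - perm_act \<tau> b"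
  and perm_act_uminus: "perm_act \<tau> (- a) = - perm_act \<tau> a"
  by (simp_all add: perm_act_def fun_eq_iff)

lemma eps_sum_eq_iff: "eps i + eps j = eps a + eps b \<longleftrightarrow> (i = a \<and> j = b) \<or> (i = b \<and> j = a)"
proof
  assume eq: "eps i + eps j = eps a + eps b"
  show "(i = a \<and> j = b) \<or> (i = b \<and> j = a)"
    using fun_cong[OF eq, of i] fun_cong[OF eq, of j] fun_cong[OF eq, of a] fun_cong[OF eq, of b]
    by (auto simp: eps_def split: if_splits)
qed (auto simp: add.commute)

lemma eps_eq_iff: "eps i = eps j \<longleftrightarrow> i = j"
  by (auto dest!: fun_cong[of _ _ i] simp: eps_def split: if_splits)

lemma wdot_one_plus: "i \<in> {1..n} \<Longrightarrow> j \<in> {1..n} \<Longrightarrow> wdot n (\<lambda>_. 1) (eps i + eps j) = 2"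
  and wdot_one_diff: "i \<in> {1..n} \<Longrightarrow> j \<in> {1..n} \<Longrightarrow> wdot n (\<lambda>_. 1) (eps i - eps j) = 0"
  unfolding wdot_simps by (simp_all add: wdot_eps)

lemma perm_rev_permutes: "perm_rev n permutes {1..n}"
proof -
  have "perm_rev n (perm_rev n j) = j" for j by (auto simp: perm_rev_def)
  then have "bij (perm_rev n)" by (intro o_bij[of "perm_rev n"]) (simp_all add: fun_eq_iff)
  then show ?thesis unfolding permutes_def bij_iff by (auto simp: perm_rev_def)
qed

lemma pinv_perm_rev: "j \<in> {1..n} \<Longrightarrow> pinv (perm_rev n) j = n + 1 - j"
  using permutes_inv_eq[OF perm_rev_permutes, of n j "n + 1 - j"] by (auto simp: perm_rev_def)

context
  fixes n :: nat and \<sigma> \<tau> :: "nat \<Rightarrow> nat"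
  assumes \<sigma>: "\<sigma> permutes {1..n}"
  defines "\<tau> \<equiv> \<sigma> \<circ> perm_rev n"
begin

lemma tau_permutes: "\<tau> permutes {1..n}"
  unfolding \<tau>_def by (rule permutes_compose[OF perm_rev_permutes \<sigma>])

lemma pinv_sigma_in: "a \<in> {1..n} \<Longrightarrow> pinv \<sigma> a \<in> {1..n}"
  using permutes_in_image[OF permutes_inv[OF \<sigma>]] by blast

lemma pinv_tau: assumes "a \<in> {1..n}" shows "pinv \<tau> a = n + 1 - pinv \<sigma> a"
  using pinv_perm_rev[OF pinv_sigma_in[OF assms]] unfolding \<tau>_def
  by (simp add: o_inv_distrib permutes_bij[OF \<sigma>] permutes_bij[OF perm_rev_permutes])

lemma pinv_tau_in: "a \<in> {1..n} \<Longrightarrow> pinv \<tau> a \<in> {1..n}"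
  using permutes_in_image[OF permutes_inv[OF tau_permutes]] by blast

lemma perm_act_sigma_eps: "perm_act \<sigma> (eps i) = eps (\<sigma> i)"
  by (rule perm_act_eps[OF permutes_bij[OF \<sigma>]])

lemma perm_act_tau_eps: "perm_act \<tau> (eps i) = eps (\<tau> i)"
  by (rule perm_act_eps[OF permutes_bij[OF tau_permutes]])

lemma Phi_permE:
  assumes "\<alpha> \<in> Phi_perm n \<sigma>"
  obtains a b where "1 \<le> a" "a < b" "b \<le> n" "\<alpha> = eps a - eps b" "pinv \<sigma> b < pinv \<sigma> a"
proof -
  obtain \<beta> where \<beta>: "\<beta> \<in> Phi_pos n" "\<alpha> = perm_act \<sigma> (- \<beta>)" and \<alpha>: "\<alpha> \<in> Phi_pos n"
    using assms unfolding Phi_perm_def by blast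
  show thesis
    using \<beta>(1)
  proof (cases rule: Phi_posE)
    case (plus i j)
    then have "\<sigma> i \<in> {1..n}" "\<sigma> j \<in> {1..n}" using permutes_in_image[OF \<sigma>] by auto
    then have "eps (\<sigma> i) + eps (\<sigma> j) \<in> Phi_pos n" by (rule plus_in_Phi_pos)
    then have "- (eps (\<sigma> i) + eps (\<sigma> j)) \<notin> Phi_pos n" by (rule Phi_pos_uminus)
    moreover have "\<alpha> = - (eps (\<sigma> i) + eps (\<sigma> j))"
      unfolding \<beta>(2) plus(4) perm_act_uminus perm_act_add perm_act_sigma_eps ..
    ultimately show ?thesis using \<alpha> by simp
  next
    case (diff i j)
    then have in_n: "\<sigma> i \<in> {1..n}" "\<sigma> j \<in> {1..n}" using permutes_in_image[OF \<sigma>] by auto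
    have eq: "\<alpha> = eps (\<sigma> j) - eps (\<sigma> i)"
      unfolding \<beta>(2) diff(4) perm_act_uminus perm_act_diff perm_act_sigma_eps by simp
    have "wdot n (rho n) \<alpha> > 0" using \<alpha> by (rule rho_pos)
    then have "\<sigma> j < \<sigma> i" using in_n unfolding eq wdot_simps by (simp add: wdot_eps rho_def)
    then show ?thesis
      using that[of "\<sigma> j" "\<sigma> i"] in_n eq diff by (simp add: permutes_inverses[OF \<sigma>])
  qed
qed

lemma Phi_perm_diff_iff:
  assumes "1 \<le> a" "a < b" "b \<le> n"
  shows "eps a - eps b \<in> Phi_perm n \<sigma> \<longleftrightarrow> pinv \<sigma> b < pinv \<sigma> a"
proof
  assume "eps a - eps b \<in> Phi_perm n \<sigma>"
  then show "pinv \<sigma> b < pinv \<sigma> a"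
  proof (cases rule: Phi_permE)
    case (1 a' b')
    have "a' = a" using fun_cong[OF 1(4), of a] 1(2) assms(2) by (auto simp: eps_def split: if_splits)
    moreover have "b' = b" using fun_cong[OF 1(4), of b] 1(2) assms(2) by (auto simp: eps_def split: if_splits)
    ultimately show ?thesis using 1 by simp
  qed
next
  assume lt: "pinv \<sigma> b < pinv \<sigma> a"
  have "pinv \<sigma> a \<in> {1..n}" "pinv \<sigma> b \<in> {1..n}" using assms pinv_sigma_in by auto
  then have "eps (pinv \<sigma> b) - eps (pinv \<sigma> a) \<in> Phi_pos n" using lt by (intro diff_in_Phi_pos) auto
  moreover have "eps a - eps b = perm_act \<sigma> (- (eps (pinv \<sigma> b) - eps (pinv \<sigma> a)))"
    unfolding perm_act_uminus perm_act_diff perm_act_sigma_eps by (simp add: permutes_inverses[OF \<sigma>])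
  ultimately show "eps a - eps b \<in> Phi_perm n \<sigma>"
    unfolding Phi_perm_def using diff_in_Phi_pos[OF assms] by blast
qed

lemma perm_act_tau_in:
  assumes \<Psi>: "upper_set n \<Psi>" and \<alpha>: "\<alpha> \<in> perm_act \<tau> ` \<Psi>"
  obtains a b where "a \<in> {1..n}" "b \<in> {1..n}" "\<alpha> = eps a + eps b"
proof -
  obtain \<beta> where \<beta>: "\<beta> \<in> \<Psi>" "\<alpha> = perm_act \<tau> \<beta>" using \<alpha> by blast
  obtain i j where ij: "i \<in> {1..n}" "j \<in> {1..n}" "\<beta> = eps i + eps j"
    using \<Psi> \<beta>(1) unfolding upper_set_def by blast
  have "\<alpha> = eps (\<tau> i) + eps (\<tau> j)"
    unfolding \<beta>(2) ij(3) perm_act_add perm_act_tau_eps ..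
  then show thesis using that ij permutes_in_image[OF tau_permutes] by blast
qed

lemma perm_act_tau_iff:
  assumes \<Psi>: "upper_set n \<Psi>"
  shows "eps a + eps b \<in> perm_act \<tau> ` \<Psi> \<longleftrightarrow> eps (pinv \<tau> a) + eps (pinv \<tau> b) \<in> \<Psi>"
proof
  assume "eps a + eps b \<in> perm_act \<tau> ` \<Psi>"
  then obtain \<beta> where \<beta>: "\<beta> \<in> \<Psi>" "eps a + eps b = perm_act \<tau> \<beta>" by blast
  obtain i j where ij: "\<beta> = eps i + eps j"
    using \<Psi> \<beta>(1) unfolding upper_set_def by blast
  have "eps a + eps b = eps (\<tau> i) + eps (\<tau> j)"
    unfolding \<beta>(2) ij perm_act_add perm_act_tau_eps ..
  then have "(a = \<tau> i \<and> b = \<tau> j) \<or> (a = \<tau> j \<and> b = \<tau> i)" unfolding eps_sum_eq_iff .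
  then have "eps (pinv \<tau> a) + eps (pinv \<tau> b) = \<beta>"
    unfolding ij by (auto simp: permutes_inverses[OF tau_permutes] add.commute)
  then show "eps (pinv \<tau> a) + eps (pinv \<tau> b) \<in> \<Psi>" using \<beta>(1) by simp
next
  assume *: "eps (pinv \<tau> a) + eps (pinv \<tau> b) \<in> \<Psi>"
  have "eps a + eps b = perm_act \<tau> (eps (pinv \<tau> a) + eps (pinv \<tau> b))"
    unfolding perm_act_add perm_act_tau_eps by (simp add: permutes_inverses[OF tau_permutes])
  then show "eps a + eps b \<in> perm_act \<tau> ` \<Psi>" using * by blast
qed

lemma L_parts_disjoint:
  assumes \<Psi>: "upper_set n \<Psi>" shows "Phi_perm n \<sigma> \<inter> perm_act \<tau> ` \<Psi> = {}"
proof -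
  have False if "\<alpha> \<in> Phi_perm n \<sigma>" "\<alpha> \<in> perm_act \<tau> ` \<Psi>" for \<alpha>
  proof -
    from that(1) have "wdot n (\<lambda>_. 1) \<alpha> = 0" by (rule Phi_permE) (simp add: wdot_one_diff)
    moreover from \<Psi> that(2) have "wdot n (\<lambda>_. 1) \<alpha> = 2" by (rule perm_act_tau_in) (simp add: wdot_one_plus)
    ultimately show False by simp
  qed
  then show ?thesis by blast
qed

lemma L_roots_diff_iff:
  assumes \<Psi>: "upper_set n \<Psi>" and ab: "1 \<le> a" "a < b" "b \<le> n"
  shows "eps a - eps b \<in> L_roots n \<sigma> \<Psi> \<longleftrightarrow> pinv \<sigma> b < pinv \<sigma> a"
proof -
  have "eps a - eps b \<notin> perm_act \<tau> ` \<Psi>"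
  proof
    assume "eps a - eps b \<in> perm_act \<tau> ` \<Psi>"
    with \<Psi> have "wdot n (\<lambda>_. 1) (eps a - eps b) = 2" by (rule perm_act_tau_in) (simp add: wdot_one_plus)
    then show False using wdot_one_diff[of a n b] ab by simp
  qed
  then show ?thesis using Phi_perm_diff_iff[OF ab] unfolding L_roots_def \<tau>_def by blast
qed

lemma L_roots_plus_iff:
  assumes \<Psi>: "upper_set n \<Psi>" and ab: "a \<in> {1..n}" "b \<in> {1..n}"
  shows "eps a + eps b \<in> L_roots n \<sigma> \<Psi> \<longleftrightarrow> eps (pinv \<tau> a) + eps (pinv \<tau> b) \<in> \<Psi>"
proof -
  have "eps a + eps b \<notin> Phi_perm n \<sigma>"
  proof
    assume "eps a + eps b \<in> Phi_perm n \<sigma>"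
    then have "wdot n (\<lambda>_. 1) (eps a + eps b) = 0" by (rule Phi_permE) (simp add: wdot_one_diff)
    then show False using wdot_one_plus[OF ab] by simp
  qed
  then show ?thesis using perm_act_tau_iff[OF \<Psi>] unfolding L_roots_def \<tau>_def by blast
qed

lemma L_roots_pos: assumes \<Psi>: "upper_set n \<Psi>" shows "L_roots n \<sigma> \<Psi> \<subseteq> Phi_pos n"
proof -
  have "perm_act \<tau> ` \<Psi> \<subseteq> Phi_pos n"
    using perm_act_tau_in[OF \<Psi>] plus_in_Phi_pos by (metis subsetI)
  then show ?thesis by (auto simp: L_roots_def Phi_perm_def \<tau>_def)
qed

end

context
  fixes n :: nat and \<Psi> :: "weight set"
  assumes \<Psi>: "upper_set n \<Psi>"
begin

lemma upper_left: "eps i + eps j \<in> \<Psi> \<Longrightarrow> i \<in> {1..n} \<Longrightarrow> j \<in> {1..n} \<Longrightarrow> 1 \<le> k \<Longrightarrow> k \<le> i \<Longrightarrow> eps k + eps j \<in> \<Psi>"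
  using \<Psi>[unfolded upper_set_def, THEN conjunct2, rule_format, of i j k] by simp

lemma upper_right: "eps i + eps j \<in> \<Psi> \<Longrightarrow> i \<in> {1..n} \<Longrightarrow> j \<in> {1..n} \<Longrightarrow> 1 \<le> k \<Longrightarrow> k \<le> j \<Longrightarrow> eps i + eps k \<in> \<Psi>"
  using upper_left[of j i k] by (metis add.commute)

text \<open>The set as a symmetric 0-1 matrix whose rows are left-justified. Its row lengths give the
  coordinates of its sum, up to one for a diagonal entry.\<close>
definition row :: "nat \<Rightarrow> nat set" where
  "row i = {j \<in> {1..n}. eps i + eps j \<in> \<Psi>}"

lemma finite_row: "finite (row i)"
  by (simp add: row_def)

lemma sum_upper:
  assumes i: "i \<in> {1..n}"
  shows "(\<Sum>\<Psi>) i = int (card (row i)) + (if eps i + eps i \<in> \<Psi> then 1 else 0)"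
proof -
  have sub: "\<Psi> \<subseteq> Phi_pos n"
    using \<Psi> plus_in_Phi_pos unfolding upper_set_def by blast
  have fin: "finite \<Psi>" using finite_subset[OF sub finite_Phi_pos] .
  have inj: "inj_on (\<lambda>j. eps i + eps j) (row i)"
    by (rule inj_onI) (simp add: eps_eq_iff)
  have "(\<Sum>\<Psi>) i = (\<Sum>\<alpha>\<in>\<Psi>. \<alpha> i)" by (simp add: sum_fun_apply)
  also have "\<dots> = (\<Sum>\<alpha>\<in>(\<lambda>j. eps i + eps j) ` row i. \<alpha> i)"
  proof (rule sum.mono_neutral_right[OF fin])
    show "(\<lambda>j. eps i + eps j) ` row i \<subseteq> \<Psi>" by (auto simp: row_def)
    show "\<forall>\<alpha>\<in>\<Psi> - (\<lambda>j. eps i + eps j) ` row i. \<alpha> i = 0"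
    proof
      fix \<alpha> assume \<alpha>: "\<alpha> \<in> \<Psi> - (\<lambda>j. eps i + eps j) ` row i"
      then obtain a b where ab: "a \<in> {1..n}" "b \<in> {1..n}" "\<alpha> = eps a + eps b"
        using \<Psi> unfolding upper_set_def by blast
      have "a \<noteq> i" using \<alpha> ab by (auto simp: row_def)
      moreover have "b \<noteq> i"
      proof
        assume "b = i"
        then have "\<alpha> = eps i + eps a" using ab(3) by (simp add: add.commute)
        then show False using \<alpha> ab(1) by (auto simp: row_def)
      qed
      ultimately show "\<alpha> i = 0" using ab by (simp add: eps_def)
    qed
  qed
  also have "\<dots> = (\<Sum>j\<in>row i. 1 + eps j i)" by (subst sum.reindex[OF inj]) simp
  also have "\<dots> = int (card (row i)) + (\<Sum>j\<in>row i. if j = i then 1 else 0)"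
    by (simp add: sum.distrib eps_def eq_commute)
  also have "(\<Sum>j\<in>row i. if j = i then 1 else 0) = (if eps i + eps i \<in> \<Psi> then 1 else 0 :: int)"
    using i finite_row by (auto simp: row_def)
  finally show ?thesis .
qed

lemma upper_strict: assumes "1 \<le> i" "i < k" "k \<le> n" shows "int i - (\<Sum>\<Psi>) i < int k - (\<Sum>\<Psi>) k"
proof -
  have "row k \<subseteq> row i" using upper_left[of k _ i] assms by (auto simp: row_def)
  then have "card (row k) \<le> card (row i)" by (rule card_mono[OF finite_row])
  moreover have "eps k + eps k \<in> \<Psi> \<Longrightarrow> eps i + eps i \<in> \<Psi>"
    using upper_left[of k k i] upper_right[of i k i] assms by simp
  ultimately show ?thesis using assms by (simp add: sum_upper)
qed

text \<open>For \<open>i \<le> j\<close> and \<open>eps i + eps j\<close> in the set, row i has at least j and row j at least i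
  entries; otherwise at most \<open>j - 1\<close> and \<open>i - 1\<close>. The diagonal entry breaks the tie.\<close>
lemma upper_sign_aux:
  assumes ij: "1 \<le> i" "i \<le> j" "j \<le> n"
  shows "if eps i + eps j \<in> \<Psi> then (int i - (\<Sum>\<Psi>) i) + (int j - (\<Sum>\<Psi>) j) < 0
         else (int i - (\<Sum>\<Psi>) i) + (int j - (\<Sum>\<Psi>) j) > 0"
proof (cases "eps i + eps j \<in> \<Psi>")
  case True
  have "{1..j} \<subseteq> row i" using upper_right[OF True] ij by (auto simp: row_def)
  then have "j \<le> card (row i)" using card_mono[OF finite_row, of "{1..j}" i] by simp
  moreover have "eps j + eps l \<in> \<Psi>" if "l \<in> {1..i}" for l
    using upper_left[OF True, of l] ij that by (simp add: add.commute)
  then have "{1..i} \<subseteq> row j" using ij by (auto simp: row_def)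
  then have "i \<le> card (row j)" using card_mono[OF finite_row, of "{1..i}" j] by simp
  moreover have "eps i + eps i \<in> \<Psi>" using upper_right[OF True, of i] ij by simp
  ultimately show ?thesis using True ij by (simp add: sum_upper)
next
  case False
  have r: "eps i + eps l \<notin> \<Psi>" if "j \<le> l" "l \<le> n" for l
    using upper_right[of i l j] that ij False by auto
  have c: "eps j + eps l \<notin> \<Psi>" if "i \<le> l" "l \<le> n" for l
    using upper_right[of j l i] that ij False by (auto simp: add.commute)
  have "row i \<subseteq> {1..j - 1}"
  proof
    fix l assume l: "l \<in> row i"
    then have "\<not> j \<le> l" using r[of l] by (auto simp: row_def)
    then show "l \<in> {1..j - 1}" using l by (auto simp: row_def)
  qed
  then have "card (row i) \<le> j - 1" using card_mono[of "{1..j - 1}" "row i"] by simp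
  moreover have "row j \<subseteq> {1..i - 1}"
  proof
    fix l assume l: "l \<in> row j"
    then have "\<not> i \<le> l" using c[of l] by (auto simp: row_def)
    then show "l \<in> {1..i - 1}" using l by (auto simp: row_def)
  qed
  then have "card (row j) \<le> i - 1" using card_mono[of "{1..i - 1}" "row j"] by simp
  moreover have "eps j + eps j \<notin> \<Psi>" using c[of j] ij by simp
  ultimately show ?thesis using False ij by (cases "i = j") (auto simp: sum_upper)
qed

lemma upper_sign:
  assumes "i \<in> {1..n}" "j \<in> {1..n}"
  shows "if eps i + eps j \<in> \<Psi> then (int i - (\<Sum>\<Psi>) i) + (int j - (\<Sum>\<Psi>) j) < 0
         else (int i - (\<Sum>\<Psi>) i) + (int j - (\<Sum>\<Psi>) j) > 0"
proof (cases "i \<le> j")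
  case True
  then show ?thesis using upper_sign_aux[of i j] assms by simp
next
  case False
  have "eps i + eps j = eps j + eps i" by (rule add.commute)
  then show ?thesis using upper_sign_aux[of j i] assms False by (simp only: add.commute atLeastAtMost_iff) simp
qed

end

text \<open>The separating weight is the permuted version of \<open>i - (\<Sum>\<Psi>) i\<close>. These numbers increase strictly
  with i, which accounts for the roots \<open>eps a - eps b\<close>, and the signs of their pairwise sums
  recognise \<open>\<Psi>\<close>.\<close>
lemma separated_L_roots:
  assumes \<sigma>: "\<sigma> permutes {1..n}" and \<Psi>: "upper_set n \<Psi>"
  shows "separated n (L_roots n \<sigma> \<Psi>)"
  unfolding separated_def
proof (intro conjI exI ballI)
  define \<tau> where "\<tau> = \<sigma> \<circ> perm_rev n"
  note tau = pinv_tau[OF \<sigma>, folded \<tau>_def] pinv_tau_in[OF \<sigma>, folded \<tau>_def]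
  show "L_roots n \<sigma> \<Psi> \<subseteq> Phi_pos n" by (rule L_roots_pos[OF \<sigma> \<Psi>])
  define u where "u i = int i - (\<Sum>\<Psi>) i" for i
  define v where "v a = u (pinv \<tau> a)" for a
  fix \<alpha> assume "\<alpha> \<in> Phi_pos n"
  then have "wdot n v \<alpha> \<noteq> 0 \<and> (\<alpha> \<in> L_roots n \<sigma> \<Psi>) = (wdot n v \<alpha> < 0)"
  proof (cases rule: Phi_posE)
    case (plus a b)
    then have ab: "a \<in> {1..n}" "b \<in> {1..n}" by auto
    have "wdot n v \<alpha> = v a + v b" unfolding plus(4) wdot_simps using ab by (simp add: wdot_eps)
    then show ?thesis
      using upper_sign[OF \<Psi> tau(2)[OF ab(1)] tau(2)[OF ab(2)]] L_roots_plus_iff[OF \<sigma> \<Psi> ab]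
      unfolding plus(4) v_def u_def \<tau>_def by (auto split: if_splits)
  next
    case (diff a b)
    then have ab: "a \<in> {1..n}" "b \<in> {1..n}" by auto
    have w: "wdot n v \<alpha> = v a - v b" unfolding diff(4) wdot_simps using ab by (simp add: wdot_eps)
    have iff: "\<alpha> \<in> L_roots n \<sigma> \<Psi> \<longleftrightarrow> pinv \<tau> a < pinv \<tau> b"
      using L_roots_diff_iff[OF \<sigma> \<Psi> diff(1-3)] tau(1)[OF ab(1)] tau(1)[OF ab(2)]
        pinv_sigma_in[OF \<sigma> ab(1)] pinv_sigma_in[OF \<sigma> ab(2)] unfolding diff(4) by auto
    have mono: "pinv \<tau> x < pinv \<tau> y \<Longrightarrow> v x < v y" if "x \<in> {1..n}" "y \<in> {1..n}" for x y
      unfolding v_def u_def using upper_strict[OF \<Psi>] tau(2)[OF that(1)] tau(2)[OF that(2)] by simp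
    have "pinv \<tau> a \<noteq> pinv \<tau> b"
      using diff(2) permutes_inverses(1)[OF tau_permutes[OF \<sigma>]] unfolding \<tau>_def by (metis less_irrefl)
    then consider "pinv \<tau> a < pinv \<tau> b" | "pinv \<tau> b < pinv \<tau> a" by linarith
    then show ?thesis
    proof cases
      case 1
      then show ?thesis using mono[OF ab] iff w by simp
    next
      case 2
      then show ?thesis using mono[OF ab(2,1)] iff w by simp
    qed
  qed
  then show "wdot n v \<alpha> \<noteq> 0" "(\<alpha> \<in> L_roots n \<sigma> \<Psi>) = (wdot n v \<alpha> < 0)" by auto
qed

lemma permutes_determined_by_order:
  fixes f g :: "nat \<Rightarrow> nat"
  assumes f: "f permutes {1..n}" and g: "g permutes {1..n}"
    and ord: "\<And>a b. a \<in> {1..n} \<Longrightarrow> b \<in> {1..n} \<Longrightarrow> f b < f a \<longleftrightarrow> g b < g a"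
  shows "f = g"
proof
  have count: "card {b \<in> {1..n}. h b < h a} = h a - 1" if h: "h permutes {1..n}" and a: "a \<in> {1..n}" for h :: "nat \<Rightarrow> nat" and a
  proof -
    have ha: "h a \<in> {1..n}" using permutes_in_image[OF h] a by blast
    have "h ` {b \<in> {1..n}. h b < h a} = {1..<h a}"
    proof
      show "h ` {b \<in> {1..n}. h b < h a} \<subseteq> {1..<h a}"
      proof (rule image_subsetI)
        fix b assume b: "b \<in> {b \<in> {1..n}. h b < h a}"
        then have "h b \<in> {1..n}" using permutes_in_image[OF h, of b] by blast
        then show "h b \<in> {1..<h a}" using b by simp
      qed
      show "{1..<h a} \<subseteq> h ` {b \<in> {1..n}. h b < h a}"
      proof
        fix c assume c: "c \<in> {1..<h a}"
        then have "c \<in> {1..n}" using ha by simp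
        then have "pinv h c \<in> {1..n}" using permutes_in_image[OF permutes_inv[OF h], of c] by blast
        then show "c \<in> h ` {b \<in> {1..n}. h b < h a}"
          using c permutes_inverses(1)[OF h, of c] by (intro rev_image_eqI[of "pinv h c"]) simp_all
      qed
    qed
    moreover have "inj_on h {b \<in> {1..n}. h b < h a}" using permutes_inj_on[OF h] .
    ultimately show ?thesis using card_image[of h "{b \<in> {1..n}. h b < h a}"] by simp
  qed
  fix a show "f a = g a"
  proof (cases "a \<in> {1..n}")
    case True
    have "{b \<in> {1..n}. f b < f a} = {b \<in> {1..n}. g b < g a}" using ord True by blast
    then have "f a - 1 = g a - 1" using count[OF f True] count[OF g True] by simp
    moreover have "f a \<ge> 1" "g a \<ge> 1"
      using permutes_in_image[OF f, of a] permutes_in_image[OF g, of a] True by auto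
    ultimately show ?thesis by simp
  qed (use f g in \<open>auto simp: permutes_def\<close>)
qed

text \<open>The differences \<open>eps a - eps b\<close> in the set are the inversions of \<open>\<sigma>\<close>, which determine it.\<close>
lemma L_roots_inj:
  assumes \<sigma>: "\<sigma> permutes {1..n}" and \<Psi>: "upper_set n \<Psi>"
    and \<sigma>': "\<sigma>' permutes {1..n}" and \<Psi>': "upper_set n \<Psi>'"
    and eq: "L_roots n \<sigma> \<Psi> = L_roots n \<sigma>' \<Psi>'"
  shows "\<sigma> = \<sigma>'" "\<Psi> = \<Psi>'"
proof -
  have lt: "pinv \<sigma> b < pinv \<sigma> a \<longleftrightarrow> pinv \<sigma>' b < pinv \<sigma>' a" if "1 \<le> a" "a < b" "b \<le> n" for a b
    using L_roots_diff_iff[OF \<sigma> \<Psi> that] L_roots_diff_iff[OF \<sigma>' \<Psi>' that] eq by simp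
  have "pinv \<sigma> = pinv \<sigma>'"
  proof (rule permutes_determined_by_order[OF permutes_inv[OF \<sigma>] permutes_inv[OF \<sigma>']])
    fix a b assume ab: "a \<in> {1..n}" "b \<in> {1..n}"
    have inj: "a \<noteq> b \<Longrightarrow> pinv \<sigma> a \<noteq> pinv \<sigma> b \<and> pinv \<sigma>' a \<noteq> pinv \<sigma>' b"
      using permutes_inverses(1)[OF \<sigma>] permutes_inverses(1)[OF \<sigma>'] by metis
    consider "a < b" | "a = b" | "b < a" by linarith
    then show "pinv \<sigma> b < pinv \<sigma> a \<longleftrightarrow> pinv \<sigma>' b < pinv \<sigma>' a"
    proof cases
      case 1
      then show ?thesis using lt ab by simp
    next
      case 3
      then have "pinv \<sigma> a \<noteq> pinv \<sigma> b" "pinv \<sigma>' a \<noteq> pinv \<sigma>' b"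
        "pinv \<sigma> a < pinv \<sigma> b \<longleftrightarrow> pinv \<sigma>' a < pinv \<sigma>' b"
        using lt[of b a] ab inj by simp_all
      then show ?thesis by linarith
    qed simp
  qed
  from arg_cong[OF this, of pinv] show *: "\<sigma> = \<sigma>'"
    by (simp only: permutes_inv_inv[OF \<sigma>] permutes_inv_inv[OF \<sigma>'])
  define \<tau> where "\<tau> = \<sigma> \<circ> perm_rev n"
  note tau = tau_permutes[OF \<sigma>, folded \<tau>_def]
  have iff: "eps i + eps j \<in> \<Psi> \<longleftrightarrow> eps i + eps j \<in> \<Psi>'" if ij: "i \<in> {1..n}" "j \<in> {1..n}" for i j
  proof -
    have in_n: "\<tau> i \<in> {1..n}" "\<tau> j \<in> {1..n}" using ij permutes_in_image[OF tau] by auto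
    show ?thesis
      using L_roots_plus_iff[OF \<sigma> \<Psi> in_n, folded \<tau>_def] L_roots_plus_iff[OF \<sigma>' \<Psi>' in_n, folded *, folded \<tau>_def]
        eq by (simp add: * permutes_inverses(2)[OF tau])
  qed
  have sub: "A \<subseteq> B" if "upper_set n A" "\<And>i j. i \<in> {1..n} \<Longrightarrow> j \<in> {1..n} \<Longrightarrow> eps i + eps j \<in> A \<Longrightarrow> eps i + eps j \<in> B" for A B
    using that unfolding upper_set_def by blast
  show "\<Psi> = \<Psi>'" using sub[OF \<Psi>, of \<Psi>'] sub[OF \<Psi>', of \<Psi>] iff by blast
qed

text \<open>The permutation sorts the coordinates of \<open>\<rho> - \<Sum>S\<close>; then \<open>\<Psi>\<close> records which pairwise sums of the
  sorted coordinates are negative.\<close>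
lemma extremal_is_L_roots:
  assumes S: "S \<subseteq> Phi_pos n" and ext: "wdot n (\<Sum>S) (\<Sum>S) = 2 * wdot n (rho n) (\<Sum>S)"
  shows "\<exists>\<sigma> \<Psi>. \<sigma> permutes {1..n} \<and> upper_set n \<Psi> \<and> S = L_roots n \<sigma> \<Psi>"
proof -
  define v where "v = rho n - \<Sum>S"
  have v: "wdot n v \<alpha> \<noteq> 0" "\<alpha> \<in> S \<longleftrightarrow> wdot n v \<alpha> < 0" if "\<alpha> \<in> Phi_pos n" for \<alpha>
    using extremal_cut_out[OF S ext] that unfolding v_def by auto
  obtain \<sigma> where \<sigma>: "\<sigma> permutes {1..n}"
    and dec: "\<And>i j. 1 \<le> i \<Longrightarrow> i \<le> j \<Longrightarrow> j \<le> n \<Longrightarrow> v (\<sigma> j) \<le> v (\<sigma> i)"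
    using sort_exists[of n v] by blast
  define \<tau> where "\<tau> = \<sigma> \<circ> perm_rev n"
  note tau = tau_permutes[OF \<sigma>, folded \<tau>_def]
  have inc: "v (\<tau> i) \<le> v (\<tau> j)" if "1 \<le> i" "i \<le> j" "j \<le> n" for i j
    using dec[of "n + 1 - j" "n + 1 - i"] that by (simp add: \<tau>_def perm_rev_def)
  define \<Psi> where "\<Psi> = {eps i + eps j | i j. i \<in> {1..n} \<and> j \<in> {1..n} \<and> v (\<tau> i) + v (\<tau> j) < 0}"
  have \<Psi>_iff: "eps i + eps j \<in> \<Psi> \<longleftrightarrow> v (\<tau> i) + v (\<tau> j) < 0" if "i \<in> {1..n}" "j \<in> {1..n}" for i j
  proof -
    have "eps i + eps j \<in> \<Psi> \<longleftrightarrow> (\<exists>a b. eps i + eps j = eps a + eps b \<and> a \<in> {1..n} \<and> b \<in> {1..n} \<and> v (\<tau> a) + v (\<tau> b) < 0)"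
      unfolding \<Psi>_def by blast
    then show ?thesis unfolding eps_sum_eq_iff using that by (auto simp: add.commute)
  qed
  have \<Psi>: "upper_set n \<Psi>"
    unfolding upper_set_def
  proof (intro conjI ballI impI)
    show "\<Psi> \<subseteq> {eps i + eps j |i j. i \<in> {1..n} \<and> j \<in> {1..n}}" unfolding \<Psi>_def by blast
    fix i j k assume ij: "i \<in> {1..n}" "j \<in> {1..n}" and k: "k \<in> {1..i}" and "eps i + eps j \<in> \<Psi>"
    then have "v (\<tau> i) + v (\<tau> j) < 0" using \<Psi>_iff by blast
    moreover have "v (\<tau> k) \<le> v (\<tau> i)" using inc k ij by simp
    moreover have "k \<in> {1..n}" using k ij by auto
    ultimately show "eps k + eps j \<in> \<Psi>" using \<Psi>_iff[of k j] ij by simp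
  qed
  have "\<alpha> \<in> S \<longleftrightarrow> \<alpha> \<in> L_roots n \<sigma> \<Psi>" if \<alpha>: "\<alpha> \<in> Phi_pos n" for \<alpha>
    using \<alpha>
  proof (cases rule: Phi_posE)
    case (plus a b)
    then have ab: "a \<in> {1..n}" "b \<in> {1..n}" by auto
    have "wdot n v \<alpha> = v a + v b" unfolding plus(4) wdot_simps using ab by (simp add: wdot_eps)
    then show ?thesis
      using v(2)[OF \<alpha>] L_roots_plus_iff[OF \<sigma> \<Psi> ab, folded \<tau>_def]
        \<Psi>_iff[OF pinv_tau_in[OF \<sigma> ab(1), folded \<tau>_def] pinv_tau_in[OF \<sigma> ab(2), folded \<tau>_def]]
      unfolding plus(4) by (simp add: permutes_inverses[OF tau])
  next
    case (diff a b)
    then have ab: "a \<in> {1..n}" "b \<in> {1..n}" by auto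
    have w: "wdot n v \<alpha> = v a - v b" unfolding diff(4) wdot_simps using ab by (simp add: wdot_eps)
    have dec': "pinv \<sigma> x \<le> pinv \<sigma> y \<Longrightarrow> v y \<le> v x" if "x \<in> {1..n}" "y \<in> {1..n}" for x y
      using dec[of "pinv \<sigma> x" "pinv \<sigma> y"] pinv_sigma_in[OF \<sigma> that(1)] pinv_sigma_in[OF \<sigma> that(2)]
      by (simp add: permutes_inverses[OF \<sigma>])
    have "v a - v b < 0 \<longleftrightarrow> pinv \<sigma> b < pinv \<sigma> a"
      using dec'[OF ab] dec'[OF ab(2,1)] v(1)[OF \<alpha>] w by fastforce
    then show ?thesis
      using v(2)[OF \<alpha>] L_roots_diff_iff[OF \<sigma> \<Psi> diff(1-3)] w unfolding diff(4) by simp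
  qed
  moreover have "L_roots n \<sigma> \<Psi> \<subseteq> Phi_pos n" by (rule L_roots_pos[OF \<sigma> \<Psi>])
  ultimately have "S = L_roots n \<sigma> \<Psi>" using S by blast
  then show ?thesis using \<sigma> \<Psi> by blast
qed

section \<open>Lie derivative and differential on alternating forms\<close>

lemma mscale_mult_left: "mscale c A ** B = mscale c (A ** B)"
  and mscale_mult_right: "A ** mscale c B = mscale c (A ** B)"
  by (simp_all add: mscale_def matrix_matrix_mult_def vec_eq_iff sum_distrib_left mult_ac)

lemma br_add_left: "br (x + y) z = br x z + br y z"
  and br_add_right: "br z (x + y) = br z x + br z y"
  by (simp_all add: br_def matrix_matrix_mult_def vec_eq_iff sum.distrib algebra_simps)

lemma br_scale_left: "br (mscale c x) z = mscale c (br x z)"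
  and br_scale_right: "br z (mscale c x) = mscale c (br z x)"
  by (simp_all add: br_def mscale_mult_left mscale_mult_right mt.scale_right_diff_distrib)

lemma br_anti: "br y x = - br x y"
  by (simp add: br_def)

lemma br_zero [simp]: "br 0 x = 0" "br x 0 = 0"
  by (simp_all add: br_def)

lemma br_minus_right: "br x (- y) = - br x y"
  using br_add_right[of x y "- y"] by (simp add: minus_unique)

lemma br_diff_right: "br x (y - z) = br x y - br x z"
  using br_add_right[of x y "- z"] by (simp add: br_minus_right)

lemma br_jacobi: "br (br x y) z = br x (br y z) - br y (br x z)"
proof -
  have r: "(a - b) ** c = a ** c - b ** c" "c ** (a - b) = c ** a - c ** b" for a b c :: "'n::finite cmat"
    by (simp_all add: matrix_matrix_mult_def vec_eq_iff sum_subtractf algebra_simps)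
  show ?thesis unfolding br_def by (simp add: r matrix_mul_assoc algebra_simps)
qed

lemma br_sum_right: "br x (\<Sum>i\<in>A. f i) = (\<Sum>i\<in>A. br x (f i))"
  by (induction A rule: infinite_finite_induct) (simp_all add: br_add_right)

text \<open>Forms are functions on lists; both operators recurse on the first vector, the differential
  through Cartan's formula \<open>\<iota>\<^sub>x d + d \<iota>\<^sub>x = \<theta>\<^sub>x\<close>. On alternating forms this is the
  Chevalley--Eilenberg differential, and the recursion replaces all reasoning about signs by
  inductions on the list.\<close>
primrec lie_der :: "'n::finite cmat \<Rightarrow> 'n form \<Rightarrow> 'n cmat list \<Rightarrow> complex" where
  "lie_der x \<omega> [] = 0"
| "lie_der x \<omega> (y # ys) = lie_der x (\<lambda>zs. \<omega> (y # zs)) ys - \<omega> (br x y # ys)"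

primrec cartan_d :: "'n::finite form \<Rightarrow> 'n cmat list \<Rightarrow> complex" where
  "cartan_d \<omega> [] = 0"
| "cartan_d \<omega> (x # xs) = lie_der x \<omega> xs - cartan_d (\<lambda>zs. \<omega> (x # zs)) xs"

lemma lie_der_lin:
  "lie_der x (\<lambda>zs. a * f zs + b * g zs) ys = a * lie_der x f ys + b * lie_der x g ys"
  by (induction ys arbitrary: f g) (simp_all add: algebra_simps)

lemma cartan_d_lin:
  "cartan_d (\<lambda>zs. a * f zs + b * g zs) ys = a * cartan_d f ys + b * cartan_d g ys"
  by (induction ys arbitrary: f g) (simp_all add: algebra_simps lie_der_lin)

lemma lie_der_add: "lie_der x (\<lambda>zs. f zs + g zs) ys = lie_der x f ys + lie_der x g ys"
  and lie_der_diff: "lie_der x (\<lambda>zs. f zs - g zs) ys = lie_der x f ys - lie_der x g ys"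
  and lie_der_minus: "lie_der x (\<lambda>zs. - f zs) ys = - lie_der x f ys"
  and lie_der_scale: "lie_der x (\<lambda>zs. c * f zs) ys = c * lie_der x f ys"
  and lie_der_zero: "lie_der x (\<lambda>zs. 0) ys = 0"
  using lie_der_lin[of x 1 f 1 g] lie_der_lin[of x 1 f "-1" g] lie_der_lin[of x "-1" f 0 g]
    lie_der_lin[of x c f 0 g] lie_der_lin[of x 0 f 0 g]
  by simp_all

lemma cartan_d_add: "cartan_d (\<lambda>zs. f zs + g zs) ys = cartan_d f ys + cartan_d g ys"
  and cartan_d_diff: "cartan_d (\<lambda>zs. f zs - g zs) ys = cartan_d f ys - cartan_d g ys"
  and cartan_d_minus: "cartan_d (\<lambda>zs. - f zs) ys = - cartan_d f ys"
  and cartan_d_scale: "cartan_d (\<lambda>zs. c * f zs) ys = c * cartan_d f ys"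
  and cartan_d_zero: "cartan_d (\<lambda>zs. 0) ys = 0"
  using cartan_d_lin[of 1 f 1 g] cartan_d_lin[of 1 f "-1" g] cartan_d_lin[of "-1" f 0 g]
    cartan_d_lin[of c f 0 g] cartan_d_lin[of 0 f 0 g]
  by simp_all

lemma cartan_d_sum: "cartan_d (\<lambda>zs. \<Sum>i\<in>A. f i zs) ys = (\<Sum>i\<in>A. cartan_d (f i) ys)"
  by (induction A rule: infinite_finite_induct) (simp_all add: cartan_d_zero cartan_d_add)

lemma lie_der_conv_sum:
  "lie_der x \<omega> ys = - (\<Sum>j<length ys. \<omega> (ys[j := br x (ys ! j)]))"
  by (induction ys arbitrary: \<omega>) (simp_all add: sum.lessThan_Suc_shift del: sum.lessThan_Suc)

text \<open>Alternation is expressed by adjacent transpositions, a form that survives the contraction with a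
  first vector; the values at lists outside V are left free.\<close>
definition alt_multilinear :: "'n::finite cmat set \<Rightarrow> 'n form \<Rightarrow> bool" where
  "alt_multilinear V \<omega> \<longleftrightarrow>
     (\<forall>us x y vs. set us \<subseteq> V \<and> x \<in> V \<and> y \<in> V \<and> set vs \<subseteq> V \<longrightarrow>
        \<omega> (us @ (x + y) # vs) = \<omega> (us @ x # vs) + \<omega> (us @ y # vs)) \<and>
     (\<forall>us c x vs. set us \<subseteq> V \<and> x \<in> V \<and> set vs \<subseteq> V \<longrightarrow>
        \<omega> (us @ mscale c x # vs) = c * \<omega> (us @ x # vs)) \<and>
     (\<forall>us x y vs. set us \<subseteq> V \<and> x \<in> V \<and> y \<in> V \<and> set vs \<subseteq> V \<longrightarrow>
        \<omega> (us @ x # y # vs) = - \<omega> (us @ y # x # vs))"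

lemma alt_multilinearI:
  assumes "\<And>us x y vs. set us \<subseteq> V \<Longrightarrow> x \<in> V \<Longrightarrow> y \<in> V \<Longrightarrow> set vs \<subseteq> V \<Longrightarrow>
      \<omega> (us @ (x + y) # vs) = \<omega> (us @ x # vs) + \<omega> (us @ y # vs)"
    and "\<And>us c x vs. set us \<subseteq> V \<Longrightarrow> x \<in> V \<Longrightarrow> set vs \<subseteq> V \<Longrightarrow>
      \<omega> (us @ mscale c x # vs) = c * \<omega> (us @ x # vs)"
    and "\<And>us x y vs. set us \<subseteq> V \<Longrightarrow> x \<in> V \<Longrightarrow> y \<in> V \<Longrightarrow> set vs \<subseteq> V \<Longrightarrow>
      \<omega> (us @ x # y # vs) = - \<omega> (us @ y # x # vs)"
  shows "alt_multilinear V \<omega>"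
  using assms unfolding alt_multilinear_def by blast

lemma
  assumes "alt_multilinear V \<omega>" "set us \<subseteq> V" "x \<in> V" "set vs \<subseteq> V"
  shows alt_add: "y \<in> V \<Longrightarrow> \<omega> (us @ (x + y) # vs) = \<omega> (us @ x # vs) + \<omega> (us @ y # vs)"
    and alt_scale: "\<omega> (us @ mscale c x # vs) = c * \<omega> (us @ x # vs)"
    and alt_swap: "y \<in> V \<Longrightarrow> \<omega> (us @ x # y # vs) = - \<omega> (us @ y # x # vs)"
  using assms unfolding alt_multilinear_def by blast+

lemmas alt_add0 = alt_add[of _ _ "[]", simplified]
lemmas alt_scale0 = alt_scale[of _ _ "[]", simplified]
lemmas alt_swap0 = alt_swap[of _ _ "[]", simplified]

lemma alt_prefix:
  assumes "alt_multilinear V \<omega>" "set ps \<subseteq> V"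
  shows "alt_multilinear V (\<lambda>zs. \<omega> (ps @ zs))"
proof (rule alt_multilinearI)
  fix us x y vs assume "set us \<subseteq> V" "x \<in> V" "y \<in> V" "set vs \<subseteq> V"
  then show "\<omega> (ps @ us @ (x + y) # vs) = \<omega> (ps @ us @ x # vs) + \<omega> (ps @ us @ y # vs)"
    and "\<omega> (ps @ us @ x # y # vs) = - \<omega> (ps @ us @ y # x # vs)"
    using alt_add[OF assms(1), of "ps @ us" x vs y] alt_swap[OF assms(1), of "ps @ us" x vs y] assms(2)
    by simp_all
next
  fix us c x vs assume "set us \<subseteq> V" "x \<in> V" "set vs \<subseteq> V"
  then show "\<omega> (ps @ us @ mscale c x # vs) = c * \<omega> (ps @ us @ x # vs)"
    using alt_scale[OF assms(1), of "ps @ us" x vs c] assms(2) by simp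
qed

lemma alt_contract:
  assumes "alt_multilinear V \<omega>" "y \<in> V" shows "alt_multilinear V (\<lambda>zs. \<omega> (y # zs))"
  using alt_prefix[OF assms(1), of "[y]"] assms(2) by simp

lemma alt_cong:
  assumes "alt_multilinear V \<omega>" "mt.subspace V" "\<And>xs. set xs \<subseteq> V \<Longrightarrow> \<eta> xs = \<omega> xs"
  shows "alt_multilinear V \<eta>"
proof (rule alt_multilinearI)
  fix us x y vs assume us: "set us \<subseteq> V" "x \<in> V" "y \<in> V" "set vs \<subseteq> V"
  then have "x + y \<in> V" using assms(2) by (simp add: mt.subspace_add)
  then show "\<eta> (us @ (x + y) # vs) = \<eta> (us @ x # vs) + \<eta> (us @ y # vs)"
    using us alt_add[OF assms(1), of us x vs y] by (simp add: assms(3))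
  show "\<eta> (us @ x # y # vs) = - \<eta> (us @ y # x # vs)"
    using us alt_swap[OF assms(1), of us x vs y] by (simp add: assms(3))
next
  fix us c x vs assume us: "set us \<subseteq> V" "x \<in> V" "set vs \<subseteq> V"
  then have "mscale c x \<in> V" using assms(2) by (simp add: mt.subspace_scale)
  then show "\<eta> (us @ mscale c x # vs) = c * \<eta> (us @ x # vs)"
    using us alt_scale[OF assms(1), of us x vs c] by (simp add: assms(3))
qed

lemma alt_front:
  assumes "alt_multilinear V \<omega>" "set us \<subseteq> V" "y \<in> V" "set vs \<subseteq> V"
  shows "\<omega> (us @ y # vs) = (- 1) ^ length us * \<omega> (y # us @ vs)"
  using assms
proof (induction us arbitrary: \<omega>)
  case (Cons u us)
  have "\<omega> ((u # us) @ y # vs) = (- 1) ^ length us * \<omega> (u # y # us @ vs)"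
    using Cons.IH[OF alt_contract[OF Cons.prems(1), of u]] Cons.prems by simp
  also have "\<omega> (u # y # us @ vs) = - \<omega> (y # u # us @ vs)"
    using alt_swap0[OF Cons.prems(1), of u "us @ vs" y] Cons.prems by simp
  finally show ?case by simp
qed simp

lemma alt_eq_neg_imp_zero: "(a::complex) = - a \<Longrightarrow> a = 0"
  by (simp add: eq_neg_iff_add_eq_0)

lemma alt_not_distinct:
  assumes "alt_multilinear V \<omega>" "set xs \<subseteq> V" "\<not> distinct xs"
  shows "\<omega> xs = 0"
proof -
  obtain as y bs cs where xs: "xs = as @ [y] @ bs @ [y] @ cs"
    using not_distinct_decomp[OF assms(3)] by blast
  have V: "set as \<subseteq> V" "y \<in> V" "set bs \<subseteq> V" "set cs \<subseteq> V" using assms(2) xs by auto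
  have "\<omega> xs = (- 1) ^ length bs * \<omega> (as @ y # y # bs @ cs)"
    using alt_front[OF alt_prefix[OF assms(1), of "as @ [y]"], of bs y cs] V xs by simp
  moreover have "\<omega> (as @ y # y # bs @ cs) = 0"
    using alt_swap[OF assms(1), of as y "bs @ cs" y] V by (intro alt_eq_neg_imp_zero) simp
  ultimately show ?thesis by simp
qed

lemma cochains_iff:
  assumes V: "mt.subspace V"
  shows "\<omega> \<in> cochains V \<longleftrightarrow> alt_multilinear V \<omega> \<and> (\<forall>xs. \<not> set xs \<subseteq> V \<longrightarrow> \<omega> xs = 0)"
proof
  assume \<omega>: "\<omega> \<in> cochains V"
  have add': "\<And>xs i x y. set xs \<subseteq> V \<Longrightarrow> i < length xs \<Longrightarrow> x \<in> V \<Longrightarrow> y \<in> V \<Longrightarrow>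
      \<omega> (xs[i := x + y]) = \<omega> (xs[i := x]) + \<omega> (xs[i := y])"
    and sc': "\<And>xs i x c. set xs \<subseteq> V \<Longrightarrow> i < length xs \<Longrightarrow> x \<in> V \<Longrightarrow>
      \<omega> (xs[i := mscale c x]) = c * \<omega> (xs[i := x])"
    using \<omega> unfolding cochains_def by blast+
  have add: "\<omega> (us @ (x + y) # vs) = \<omega> (us @ x # vs) + \<omega> (us @ y # vs)"
    if "set us \<subseteq> V" "x \<in> V" "y \<in> V" "set vs \<subseteq> V" for us x y vs
  proof -
    have "\<omega> ((us @ x # vs)[length us := x + y]) =
        \<omega> ((us @ x # vs)[length us := x]) + \<omega> ((us @ x # vs)[length us := y])"
      using that by (intro add') auto
    then show ?thesis by simp
  qed
  have sc: "\<omega> (us @ mscale c x # vs) = c * \<omega> (us @ x # vs)"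
    if "set us \<subseteq> V" "x \<in> V" "set vs \<subseteq> V" for us x vs c
  proof -
    have "\<omega> ((us @ x # vs)[length us := mscale c x]) = c * \<omega> ((us @ x # vs)[length us := x])"
      using that by (intro sc') auto
    then show ?thesis by simp
  qed
  have nd: "\<omega> xs = 0" if "set xs \<subseteq> V" "\<not> distinct xs" for xs
    using \<omega> that unfolding cochains_def by blast
  have sw: "\<omega> (us @ x # y # vs) = - \<omega> (us @ y # x # vs)"
    if u: "set us \<subseteq> V" "x \<in> V" "y \<in> V" "set vs \<subseteq> V" for us x y vs
  proof -
    have xy: "x + y \<in> V" using V u by (simp add: mt.subspace_add)
    have "0 = \<omega> (us @ (x + y) # (x + y) # vs)" using u xy by (intro nd[symmetric]) auto
    also have "\<dots> = \<omega> (us @ x # (x + y) # vs) + \<omega> (us @ y # (x + y) # vs)"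
      using add[of us x y "(x + y) # vs"] u xy by simp
    also have "\<omega> (us @ x # (x + y) # vs) = \<omega> (us @ x # x # vs) + \<omega> (us @ x # y # vs)"
      using add[of "us @ [x]" x y vs] u by simp
    also have "\<omega> (us @ y # (x + y) # vs) = \<omega> (us @ y # x # vs) + \<omega> (us @ y # y # vs)"
      using add[of "us @ [y]" x y vs] u by simp
    also have "\<omega> (us @ x # x # vs) = 0" using u by (intro nd) auto
    also have "\<omega> (us @ y # y # vs) = 0" using u by (intro nd) auto
    finally show ?thesis by (simp add: eq_neg_iff_add_eq_0)
  qed
  show "alt_multilinear V \<omega> \<and> (\<forall>xs. \<not> set xs \<subseteq> V \<longrightarrow> \<omega> xs = 0)"
    using alt_multilinearI[OF add sc sw] \<omega> unfolding cochains_def by blast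
next
  assume R: "alt_multilinear V \<omega> \<and> (\<forall>xs. \<not> set xs \<subseteq> V \<longrightarrow> \<omega> xs = 0)"
  then have a: "alt_multilinear V \<omega>" by blast
  have td: "set (take i xs) \<subseteq> V \<and> set (drop (Suc i) xs) \<subseteq> V" if "set xs \<subseteq> V" for i and xs :: "'a cmat list"
    using that set_take_subset set_drop_subset by fastforce
  have "\<omega> (xs[i := x + y]) = \<omega> (xs[i := x]) + \<omega> (xs[i := y])"
    if "set xs \<subseteq> V" "i < length xs" "x \<in> V" "y \<in> V" for xs i x y
    using alt_add[OF a, of "take i xs" x "drop (Suc i) xs" y] that td[of xs i]
    by (simp add: upd_conv_take_nth_drop)
  moreover have "\<omega> (xs[i := mscale c x]) = c * \<omega> (xs[i := x])"
    if "set xs \<subseteq> V" "i < length xs" "x \<in> V" for xs i x c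
    using alt_scale[OF a, of "take i xs" x "drop (Suc i) xs" c] that td[of xs i]
    by (simp add: upd_conv_take_nth_drop)
  ultimately show "\<omega> \<in> cochains V"
    using R alt_not_distinct[OF a] unfolding cochains_def by simp
qed

locale matrix_lie_algebra =
  fixes V :: "'n::finite cmat set"
  assumes subspace: "mt.subspace V"
    and br_closed: "x \<in> V \<Longrightarrow> y \<in> V \<Longrightarrow> br x y \<in> V"
begin

lemma add_closed: "x \<in> V \<Longrightarrow> y \<in> V \<Longrightarrow> x + y \<in> V"
  and scale_closed: "x \<in> V \<Longrightarrow> mscale c x \<in> V"
  and zero_closed: "0 \<in> V"
  and diff_closed: "x \<in> V \<Longrightarrow> y \<in> V \<Longrightarrow> x - y \<in> V"
  and minus_closed: "x \<in> V \<Longrightarrow> - x \<in> V"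
  using subspace by (auto intro: mt.subspace_add mt.subspace_scale mt.subspace_0 mt.subspace_diff mt.subspace_neg)

lemma alt_minus0:
  assumes "alt_multilinear V \<omega>" "x \<in> V" "set vs \<subseteq> V"
  shows "\<omega> (- x # vs) = - \<omega> (x # vs)"
  using alt_scale0[OF assms, of "-1"] by simp

lemma alt_diff0:
  assumes "alt_multilinear V \<omega>" "x \<in> V" "y \<in> V" "set vs \<subseteq> V"
  shows "\<omega> ((x - y) # vs) = \<omega> (x # vs) - \<omega> (y # vs)"
  using alt_add0[OF assms(1,2,4), of "- y"] alt_minus0[OF assms(1,3,4)] minus_closed[OF assms(3)] by simp

lemma lie_der_cong:
  assumes "\<And>zs. set zs \<subseteq> V \<Longrightarrow> f zs = g zs" "x \<in> V" "set ys \<subseteq> V"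
  shows "lie_der x f ys = lie_der x g ys"
  using assms
proof (induction ys arbitrary: f g)
  case (Cons y ys)
  have "lie_der x (\<lambda>zs. f (y # zs)) ys = lie_der x (\<lambda>zs. g (y # zs)) ys"
    using Cons.prems by (intro Cons.IH) auto
  then show ?case using Cons.prems by (simp add: br_closed)
qed simp

lemma cartan_d_cong:
  assumes "\<And>zs. set zs \<subseteq> V \<Longrightarrow> f zs = g zs" "set ys \<subseteq> V"
  shows "cartan_d f ys = cartan_d g ys"
  using assms
proof (induction ys arbitrary: f g)
  case (Cons y ys)
  have "cartan_d (\<lambda>zs. f (y # zs)) ys = cartan_d (\<lambda>zs. g (y # zs)) ys"
    using Cons.prems by (intro Cons.IH) auto
  moreover have "lie_der y f ys = lie_der y g ys"
    using Cons.prems by (intro lie_der_cong) auto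
  ultimately show ?case by simp
qed simp

lemma lie_der_add_vec:
  assumes "alt_multilinear V \<omega>" "x \<in> V" "y \<in> V" "set zs \<subseteq> V"
  shows "lie_der (x + y) \<omega> zs = lie_der x \<omega> zs + lie_der y \<omega> zs"
  using assms
proof (induction zs arbitrary: \<omega>)
  case (Cons z zs)
  have "lie_der (x + y) (\<lambda>zs. \<omega> (z # zs)) zs = lie_der x (\<lambda>zs. \<omega> (z # zs)) zs + lie_der y (\<lambda>zs. \<omega> (z # zs)) zs"
    using Cons.prems by (intro Cons.IH alt_contract) auto
  then show ?case using Cons.prems by (simp add: br_add_left br_closed alt_add0)
qed simp

lemma lie_der_scale_vec:
  assumes "alt_multilinear V \<omega>" "x \<in> V" "set zs \<subseteq> V"
  shows "lie_der (mscale c x) \<omega> zs = c * lie_der x \<omega> zs"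
  using assms
proof (induction zs arbitrary: \<omega>)
  case (Cons z zs)
  have "lie_der (mscale c x) (\<lambda>zs. \<omega> (z # zs)) zs = c * lie_der x (\<lambda>zs. \<omega> (z # zs)) zs"
    using Cons.prems by (intro Cons.IH alt_contract) auto
  then show ?case using Cons.prems by (simp add: br_scale_left br_closed alt_scale0 algebra_simps)
qed simp

lemma alt_lie_der:
  assumes "alt_multilinear V \<omega>" "x \<in> V" shows "alt_multilinear V (lie_der x \<omega>)"
proof (rule alt_multilinearI)
  fix us a b vs assume "set us \<subseteq> V" and v: "a \<in> V" "b \<in> V" "set vs \<subseteq> V"
  then show "lie_der x \<omega> (us @ (a + b) # vs) = lie_der x \<omega> (us @ a # vs) + lie_der x \<omega> (us @ b # vs)"
    using assms
  proof (induction us arbitrary: \<omega>)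
    case Nil
    have "lie_der x (\<lambda>zs. \<omega> ((a + b) # zs)) vs = lie_der x (\<lambda>zs. \<omega> (a # zs) + \<omega> (b # zs)) vs"
      using Nil by (intro lie_der_cong) (simp_all add: alt_add0)
    then show ?case using Nil by (simp add: lie_der_add br_add_right alt_add0 br_closed)
  next
    case (Cons u us)
    then have "lie_der x (\<lambda>zs. \<omega> (u # zs)) (us @ (a + b) # vs) =
        lie_der x (\<lambda>zs. \<omega> (u # zs)) (us @ a # vs) + lie_der x (\<lambda>zs. \<omega> (u # zs)) (us @ b # vs)"
      by (intro Cons.IH alt_contract) auto
    moreover have "\<omega> (br x u # us @ (a + b) # vs) = \<omega> (br x u # us @ a # vs) + \<omega> (br x u # us @ b # vs)"
      using alt_add[OF Cons.prems(5), of "br x u # us" a vs b] Cons.prems by (simp add: br_closed)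
    ultimately show ?case by simp
  qed
next
  fix us c a vs assume "set us \<subseteq> V" and v: "a \<in> V" "set vs \<subseteq> V"
  then show "lie_der x \<omega> (us @ mscale c a # vs) = c * lie_der x \<omega> (us @ a # vs)"
    using assms
  proof (induction us arbitrary: \<omega>)
    case Nil
    have "lie_der x (\<lambda>zs. \<omega> (mscale c a # zs)) vs = lie_der x (\<lambda>zs. c * \<omega> (a # zs)) vs"
      using Nil by (intro lie_der_cong) (simp_all add: alt_scale0)
    then show ?case using Nil by (simp add: lie_der_scale br_scale_right alt_scale0 br_closed algebra_simps)
  next
    case (Cons u us)
    then have "lie_der x (\<lambda>zs. \<omega> (u # zs)) (us @ mscale c a # vs) =
        c * lie_der x (\<lambda>zs. \<omega> (u # zs)) (us @ a # vs)"
      by (intro Cons.IH alt_contract) auto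
    moreover have "\<omega> (br x u # us @ mscale c a # vs) = c * \<omega> (br x u # us @ a # vs)"
      using alt_scale[OF Cons.prems(4), of "br x u # us" a vs c] Cons.prems by (simp add: br_closed)
    ultimately show ?case by (simp add: algebra_simps)
  qed
next
  fix us a b vs assume "set us \<subseteq> V" and v: "a \<in> V" "b \<in> V" "set vs \<subseteq> V"
  then show "lie_der x \<omega> (us @ a # b # vs) = - lie_der x \<omega> (us @ b # a # vs)"
    using assms
  proof (induction us arbitrary: \<omega>)
    case Nil
    have "lie_der x (\<lambda>zs. \<omega> (a # b # zs)) vs = lie_der x (\<lambda>zs. - \<omega> (b # a # zs)) vs"
      using Nil alt_swap0 by (intro lie_der_cong) simp_all
    moreover have "\<omega> (br x a # b # vs) = - \<omega> (b # br x a # vs)" "\<omega> (a # br x b # vs) = - \<omega> (br x b # a # vs)"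
      using alt_swap0[OF Nil(5), of "br x a" vs b] alt_swap0[OF Nil(5), of a vs "br x b"] Nil
      by (simp_all add: br_closed)
    ultimately show ?case by (simp add: lie_der_minus)
  next
    case (Cons u us)
    then have "lie_der x (\<lambda>zs. \<omega> (u # zs)) (us @ a # b # vs) =
        - lie_der x (\<lambda>zs. \<omega> (u # zs)) (us @ b # a # vs)"
      by (intro Cons.IH alt_contract) auto
    moreover have "\<omega> (br x u # us @ a # b # vs) = - \<omega> (br x u # us @ b # a # vs)"
      using alt_swap[OF Cons.prems(5), of "br x u # us" a vs b] Cons.prems by (simp add: br_closed)
    ultimately show ?case by simp
  qed
qed

lemma lie_der_commutator:
  assumes "alt_multilinear V \<omega>" "x \<in> V" "y \<in> V" "set zs \<subseteq> V"
  shows "lie_der x (lie_der y \<omega>) zs - lie_der y (lie_der x \<omega>) zs = lie_der (br x y) \<omega> zs"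
  using assms
proof (induction zs arbitrary: \<omega>)
  case (Cons z zs)
  have IH: "lie_der x (lie_der y (\<lambda>zs. \<omega> (z # zs))) zs - lie_der y (lie_der x (\<lambda>zs. \<omega> (z # zs))) zs
      = lie_der (br x y) (\<lambda>zs. \<omega> (z # zs)) zs"
    using Cons.prems by (intro Cons.IH alt_contract) auto
  have "\<omega> (br (br x y) z # zs) = \<omega> (br x (br y z) # zs) - \<omega> (br y (br x z) # zs)"
    unfolding br_jacobi using Cons.prems by (intro alt_diff0) (auto intro: br_closed)
  with IH show ?case by (simp add: lie_der_diff algebra_simps)
qed simp

lemma cartan_d_lie_der:
  assumes "alt_multilinear V \<omega>" "x \<in> V" "set zs \<subseteq> V"
  shows "cartan_d (lie_der x \<omega>) zs = lie_der x (cartan_d \<omega>) zs"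
  using assms
proof (induction zs arbitrary: \<omega>)
  case (Cons z zs)
  have IH: "cartan_d (lie_der x (\<lambda>zs. \<omega> (z # zs))) zs = lie_der x (cartan_d (\<lambda>zs. \<omega> (z # zs))) zs"
    using Cons.prems by (intro Cons.IH alt_contract) auto
  have "lie_der x (lie_der z \<omega>) zs - lie_der z (lie_der x \<omega>) zs = lie_der (br x z) \<omega> zs"
    using Cons.prems by (intro lie_der_commutator) auto
  with IH show ?case by (simp add: lie_der_diff cartan_d_diff algebra_simps)
qed simp

lemma alt_cartan_d:
  assumes "alt_multilinear V \<omega>" shows "alt_multilinear V (cartan_d \<omega>)"
proof (rule alt_multilinearI)
  fix us a b vs assume "set us \<subseteq> V" and v: "a \<in> V" "b \<in> V" "set vs \<subseteq> V"
  then show "cartan_d \<omega> (us @ (a + b) # vs) = cartan_d \<omega> (us @ a # vs) + cartan_d \<omega> (us @ b # vs)"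
    using assms
  proof (induction us arbitrary: \<omega>)
    case Nil
    have "cartan_d (\<lambda>zs. \<omega> ((a + b) # zs)) vs = cartan_d (\<lambda>zs. \<omega> (a # zs) + \<omega> (b # zs)) vs"
      using Nil by (intro cartan_d_cong) (simp_all add: alt_add0)
    then show ?case using Nil by (simp add: cartan_d_add lie_der_add_vec)
  next
    case (Cons u us)
    then have "cartan_d (\<lambda>zs. \<omega> (u # zs)) (us @ (a + b) # vs) =
        cartan_d (\<lambda>zs. \<omega> (u # zs)) (us @ a # vs) + cartan_d (\<lambda>zs. \<omega> (u # zs)) (us @ b # vs)"
      by (intro Cons.IH alt_contract) auto
    moreover have "lie_der u \<omega> (us @ (a + b) # vs) = lie_der u \<omega> (us @ a # vs) + lie_der u \<omega> (us @ b # vs)"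
      using Cons.prems by (intro alt_add[OF alt_lie_der]) auto
    ultimately show ?case by simp
  qed
next
  fix us c a vs assume "set us \<subseteq> V" and v: "a \<in> V" "set vs \<subseteq> V"
  then show "cartan_d \<omega> (us @ mscale c a # vs) = c * cartan_d \<omega> (us @ a # vs)"
    using assms
  proof (induction us arbitrary: \<omega>)
    case Nil
    have "cartan_d (\<lambda>zs. \<omega> (mscale c a # zs)) vs = cartan_d (\<lambda>zs. c * \<omega> (a # zs)) vs"
      using Nil by (intro cartan_d_cong) (simp_all add: alt_scale0)
    then show ?case using Nil by (simp add: cartan_d_scale lie_der_scale_vec algebra_simps)
  next
    case (Cons u us)
    then have "cartan_d (\<lambda>zs. \<omega> (u # zs)) (us @ mscale c a # vs) =
        c * cartan_d (\<lambda>zs. \<omega> (u # zs)) (us @ a # vs)"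
      by (intro Cons.IH alt_contract) auto
    moreover have "lie_der u \<omega> (us @ mscale c a # vs) = c * lie_der u \<omega> (us @ a # vs)"
      using Cons.prems by (intro alt_scale[OF alt_lie_der]) auto
    ultimately show ?case by (simp add: algebra_simps)
  qed
next
  fix us a b vs assume "set us \<subseteq> V" and v: "a \<in> V" "b \<in> V" "set vs \<subseteq> V"
  then show "cartan_d \<omega> (us @ a # b # vs) = - cartan_d \<omega> (us @ b # a # vs)"
    using assms
  proof (induction us arbitrary: \<omega>)
    case Nil
    have "cartan_d (\<lambda>zs. \<omega> (a # b # zs)) vs = cartan_d (\<lambda>zs. - \<omega> (b # a # zs)) vs"
      using Nil alt_swap0 by (intro cartan_d_cong) simp_all
    moreover have "\<omega> (br a b # vs) = - \<omega> (br b a # vs)"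
      using alt_minus0[OF Nil(5), of "br b a" vs] Nil by (simp add: br_closed br_anti[of a b])
    ultimately show ?case by (simp add: cartan_d_minus)
  next
    case (Cons u us)
    then have "cartan_d (\<lambda>zs. \<omega> (u # zs)) (us @ a # b # vs) =
        - cartan_d (\<lambda>zs. \<omega> (u # zs)) (us @ b # a # vs)"
      by (intro Cons.IH alt_contract) auto
    moreover have "lie_der u \<omega> (us @ a # b # vs) = - lie_der u \<omega> (us @ b # a # vs)"
      using Cons.prems by (intro alt_swap[OF alt_lie_der]) auto
    ultimately show ?case by simp
  qed
qed

lemma alt_update:
  assumes "alt_multilinear V \<omega>" "y \<in> V" "set xs \<subseteq> V" "j < length xs"
  shows "\<omega> (xs[j := y]) = (- 1) ^ j * \<omega> (y # nths xs (- {j}))"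
  using assms
proof (induction xs arbitrary: j \<omega>)
  case (Cons x xs)
  show ?case
  proof (cases j)
    case 0
    have "{k. Suc k \<in> - {0::nat}} = UNIV" by auto
    then show ?thesis using 0 by (simp add: nths_Cons nths_all)
  next
    case (Suc i)
    have sub: "set (nths xs (- {i})) \<subseteq> V" using set_nths_subset Cons.prems by fastforce
    have "\<omega> (x # xs[i := y]) = (- 1) ^ i * \<omega> (x # y # nths xs (- {i}))"
      using Cons.IH[OF alt_contract[OF Cons.prems(1), of x], of i] Cons.prems Suc by simp
    also have "\<omega> (x # y # nths xs (- {i})) = - \<omega> (y # x # nths xs (- {i}))"
      using alt_swap0[OF Cons.prems(1), of x "nths xs (- {i})" y] Cons.prems sub by simp
    moreover have "{k. Suc k \<in> - {Suc i}} = - {i}" by auto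
    ultimately show ?thesis using Suc by (simp add: nths_Cons)
  qed
qed simp

text \<open>Both sides satisfy Cartan's recursion: in the double sum over pairs of positions, the pairs that
  involve the first position form the Lie derivative.\<close>
lemma ce_diff_eq_cartan_d:
  assumes "alt_multilinear V \<omega>" "set xs \<subseteq> V" shows "ce_diff V \<omega> xs = cartan_d \<omega> xs"
  using assms
proof (induction xs arbitrary: \<omega>)
  case Nil
  then show ?case by (simp add: ce_diff_def)
next
  case (Cons x xs)
  define I where "I m = {(i, j). i < j \<and> j < (m::nat)}" for m
  have fI: "finite (I m)" for m by (rule finite_subset[of _ "{..<m} \<times> {..<m}"]) (auto simp: I_def)
  define t where "t = (\<lambda>(i, j). (- 1) ^ (i + j) * \<omega> (br ((x # xs) ! i) ((x # xs) ! j) # nths (x # xs) (- {i, j})))"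
  have split: "I (Suc m) = (\<lambda>j. (0, Suc j)) ` {..<m} \<union> (\<lambda>(i, j). (Suc i, Suc j)) ` I m" for m
  proof
    show "I (Suc m) \<subseteq> (\<lambda>j. (0, Suc j)) ` {..<m} \<union> (\<lambda>(i, j). (Suc i, Suc j)) ` I m"
    proof
      fix p assume "p \<in> I (Suc m)"
      then obtain i j where p: "p = (i, j)" "i < j" "j < Suc m" by (auto simp: I_def)
      then obtain j' where j': "j = Suc j'" by (cases j) auto
      show "p \<in> (\<lambda>j. (0, Suc j)) ` {..<m} \<union> (\<lambda>(i, j). (Suc i, Suc j)) ` I m"
      proof (cases i)
        case 0
        then show ?thesis using p j' by (intro UnI1 rev_image_eqI[of j']) auto
      next
        case (Suc i')
        then show ?thesis using p j' by (intro UnI2 rev_image_eqI[of "(i', j')"]) (auto simp: I_def)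
      qed
    qed
  qed (auto simp: I_def)
  have "ce_diff V \<omega> (x # xs) = sum t (I (Suc (length xs)))"
    using Cons.prems by (simp add: ce_diff_def t_def I_def)
  also have "\<dots> = sum t ((\<lambda>j. (0, Suc j)) ` {..<length xs}) + sum t ((\<lambda>(i, j). (Suc i, Suc j)) ` I (length xs))"
    unfolding split by (intro sum.union_disjoint finite_imageI fI) auto
  also have "sum t ((\<lambda>j. (0, Suc j)) ` {..<length xs}) = (\<Sum>j<length xs. t (0, Suc j))"
    by (subst sum.reindex) (auto simp: inj_on_def)
  also have "\<dots> = lie_der x \<omega> xs"
    unfolding lie_der_conv_sum sum_negf[symmetric]
  proof (rule sum.cong[OF refl])
    fix j assume j: "j \<in> {..<length xs}"
    have "{k. Suc k \<in> - {0, Suc j}} = - {j}" by auto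
    then have "t (0, Suc j) = - ((- 1) ^ j * \<omega> (br x (xs ! j) # nths xs (- {j})))"
      by (simp add: t_def nths_Cons)
    also have "\<dots> = - \<omega> (xs[j := br x (xs ! j)])"
      using alt_update[OF Cons.prems(1), of "br x (xs ! j)" xs j] Cons.prems j
      by (simp add: br_closed subset_code(1))
    finally show "t (0, Suc j) = - \<omega> (xs[j := br x (xs ! j)])" .
  qed
  also have "sum t ((\<lambda>(i, j). (Suc i, Suc j)) ` I (length xs)) = (\<Sum>(i, j)\<in>I (length xs). t (Suc i, Suc j))"
    by (subst sum.reindex) (auto simp: inj_on_def case_prod_unfold)
  also have "\<dots> = - ce_diff V (\<lambda>zs. \<omega> (x # zs)) xs"
    using Cons.prems unfolding ce_diff_def I_def[symmetric]
    apply (simp add: sum_negf[symmetric])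
  proof (rule sum.cong[OF refl], clarify)
    fix i j assume ij: "(i, j) \<in> I (length xs)"
    have "{k. Suc k \<in> - {Suc i, Suc j}} = - {i, j}" by auto
    then have "t (Suc i, Suc j) = (- 1) ^ (i + j) * \<omega> (br (xs ! i) (xs ! j) # x # nths xs (- {i, j}))"
      by (simp add: t_def nths_Cons)
    also have "\<omega> (br (xs ! i) (xs ! j) # x # nths xs (- {i, j})) = - \<omega> (x # br (xs ! i) (xs ! j) # nths xs (- {i, j}))"
    proof (rule alt_swap0[OF Cons.prems(1)])
      show "br (xs ! i) (xs ! j) \<in> V" using Cons.prems ij by (intro br_closed) (auto simp: I_def subset_code(1))
      show "set (nths xs (- {i, j})) \<subseteq> V" using set_nths_subset Cons.prems by fastforce
    qed (use Cons.prems in auto)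
    finally show "t (Suc i, Suc j) = - ((- 1) ^ (i + j) * \<omega> (x # br (xs ! i) (xs ! j) # nths xs (- {i, j})))"
      by simp
  qed
  also have "ce_diff V (\<lambda>zs. \<omega> (x # zs)) xs = cartan_d (\<lambda>zs. \<omega> (x # zs)) xs"
    using Cons.prems by (intro Cons.IH alt_contract) auto
  finally show ?case by simp
qed

lemma ce_diff_cochains:
  assumes "\<omega> \<in> cochains V" shows "ce_diff V \<omega> \<in> cochains V"
proof -
  have a: "alt_multilinear V \<omega>" using assms cochains_iff[OF subspace] by blast
  have "alt_multilinear V (ce_diff V \<omega>)"
    by (rule alt_cong[OF alt_cartan_d[OF a] subspace ce_diff_eq_cartan_d[OF a]])
  then show ?thesis unfolding cochains_iff[OF subspace] by (auto simp: ce_diff_def)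
qed

end

section \<open>Wedge products\<close>

lemma set_nths_split: "set xs = set (nths xs S) \<union> set (nths xs (- S))"
  unfolding set_nths[of xs] set_conv_nth[of xs] by blast

text \<open>The contraction by a vector is an antiderivation of the wedge product; the sets of positions are
  sorted by whether they contain the first one.\<close>
lemma wedge_Cons:
  "wedge \<omega> \<eta> (x # xs) = wedge (\<lambda>zs. \<omega> (x # zs)) \<eta> xs
     + wedge (\<lambda>zs. (- 1) ^ length zs * \<omega> zs) (\<lambda>zs. \<eta> (x # zs)) xs"
proof -
  define m where "m = length xs"
  define invs where "invs S k = {(i, j). i \<in> S \<and> j \<in> {..<k} - S \<and> j < i}" for S :: "nat set" and k
  define t where "t S = (- 1) ^ card (invs S (Suc m)) * \<omega> (nths (x # xs) S) * \<eta> (nths (x # xs) (- S))" for S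
  have Suc_pre: "{j. Suc j \<in> Suc ` S} = S" "{j. Suc j \<in> - (Suc ` S)} = - S"
    "{j. Suc j \<in> insert 0 (Suc ` S)} = S" "{j. Suc j \<in> - insert 0 (Suc ` S)} = - S" for S
    by auto
  have nths_Suc: "nths (x # xs) (Suc ` S) = nths xs S" "nths (x # xs) (- (Suc ` S)) = x # nths xs (- S)"
    "nths (x # xs) (insert 0 (Suc ` S)) = x # nths xs S" "nths (x # xs) (- insert 0 (Suc ` S)) = nths xs (- S)" for S
    unfolding nths_Cons Suc_pre by auto
  have PS: "Pow (Suc ` {..<m}) = image Suc ` Pow {..<m}"
    by (rule image_Pow_surj[OF refl, symmetric])
  have Pow: "Pow {..<Suc m} = image Suc ` Pow {..<m} \<union> (\<lambda>S. insert 0 (Suc ` S)) ` Pow {..<m}"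
    unfolding lessThan_Suc_eq_insert_0 Pow_insert PS image_image ..
  have inj: "inj_on (image Suc) (Pow {..<m})" "inj_on (\<lambda>S. insert 0 (Suc ` S)) (Pow {..<m})"
  proof -
    show "inj_on (image Suc) (Pow {..<m})" using Suc_pre(1) by (intro inj_on_inverseI[where g = "\<lambda>T. {j. Suc j \<in> T}"])
    show "inj_on (\<lambda>S. insert 0 (Suc ` S)) (Pow {..<m})" using Suc_pre(3) by (intro inj_on_inverseI[where g = "\<lambda>T. {j. Suc j \<in> T}"])
  qed
  have disj: "image Suc ` Pow {..<m} \<inter> (\<lambda>S. insert 0 (Suc ` S)) ` Pow {..<m} = {}"
    by auto
  have "wedge \<omega> \<eta> (x # xs) = (\<Sum>S\<in>Pow {..<Suc m}. t S)"
    unfolding wedge_def t_def invs_def m_def length_Cons ..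
  also have "\<dots> = (\<Sum>S\<in>Pow {..<m}. t (Suc ` S)) + (\<Sum>S\<in>Pow {..<m}. t (insert 0 (Suc ` S)))"
    unfolding Pow using disj by (simp add: sum.union_disjoint sum.reindex[OF inj(1)] sum.reindex[OF inj(2)] o_def)
  also have "(\<Sum>S\<in>Pow {..<m}. t (Suc ` S)) = wedge (\<lambda>zs. (- 1) ^ length zs * \<omega> zs) (\<lambda>zs. \<eta> (x # zs)) xs"
    unfolding wedge_def m_def[symmetric]
  proof (rule sum.cong[OF refl])
    fix S assume S: "S \<in> Pow {..<m}"
    then have fS: "finite S" using finite_subset by auto
    have "invs (Suc ` S) (Suc m) = (\<lambda>i. (Suc i, 0)) ` S \<union> map_prod Suc Suc ` invs S m"
    proof
      show "invs (Suc ` S) (Suc m) \<subseteq> (\<lambda>i. (Suc i, 0)) ` S \<union> map_prod Suc Suc ` invs S m"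
      proof
        fix p assume "p \<in> invs (Suc ` S) (Suc m)"
        then obtain i j where p: "p = (Suc i, j)" "i \<in> S" "j < Suc m" "j \<notin> Suc ` S" "j < Suc i"
          by (auto simp: invs_def)
        show "p \<in> (\<lambda>i. (Suc i, 0)) ` S \<union> map_prod Suc Suc ` invs S m"
        proof (cases j)
          case (Suc j')
          then show ?thesis using p by (intro UnI2 rev_image_eqI[of "(i, j')"]) (auto simp: invs_def)
        qed (use p in auto)
      qed
    qed (auto simp: invs_def)
    moreover have "(\<lambda>i. (Suc i, 0)) ` S \<inter> map_prod Suc Suc ` invs S m = {}" by auto
    moreover have "finite (invs S m)"
      by (rule finite_subset[of _ "S \<times> {..<m}"]) (use fS in \<open>auto simp: invs_def\<close>)
    moreover have "card ((\<lambda>i. (Suc i, 0::nat)) ` S) = card S" by (intro card_image) (simp add: inj_on_def)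
    moreover have "card (map_prod Suc Suc ` invs S m) = card (invs S m)"
      by (intro card_image) (auto simp: inj_on_def)
    ultimately have "card (invs (Suc ` S) (Suc m)) = card S + card (invs S m)"
      using fS by (simp add: card_Un_disjoint)
    moreover have "length (nths xs S) = card S"
    proof -
      have "{i. i < length xs \<and> i \<in> S} = S" using S by (auto simp: m_def)
      then show ?thesis by (simp add: length_nths)
    qed
    ultimately show "t (Suc ` S) = (- 1) ^ card {(i, j). i \<in> S \<and> j \<in> {..<m} - S \<and> j < i}
        * ((- 1) ^ length (nths xs S) * \<omega> (nths xs S)) * \<eta> (x # nths xs (- S))"
      unfolding t_def invs_def[symmetric] nths_Suc by (simp add: power_add)
  qed
  also have "(\<Sum>S\<in>Pow {..<m}. t (insert 0 (Suc ` S))) = wedge (\<lambda>zs. \<omega> (x # zs)) \<eta> xs"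
    unfolding wedge_def m_def[symmetric]
  proof (rule sum.cong[OF refl])
    fix S assume S: "S \<in> Pow {..<m}"
    have "invs (insert 0 (Suc ` S)) (Suc m) = map_prod Suc Suc ` invs S m"
    proof
      show "invs (insert 0 (Suc ` S)) (Suc m) \<subseteq> map_prod Suc Suc ` invs S m"
      proof
        fix p assume "p \<in> invs (insert 0 (Suc ` S)) (Suc m)"
        then obtain i j where p: "p = (Suc i, Suc j)" "i \<in> S" "j < m" "j \<notin> S" "j < i"
          by (auto simp: invs_def less_Suc_eq_0_disj)
        then show "p \<in> map_prod Suc Suc ` invs S m"
          by (intro rev_image_eqI[of "(i, j)"]) (auto simp: invs_def)
      qed
    qed (auto simp: invs_def)
    moreover have "card (map_prod Suc Suc ` invs S m) = card (invs S m)"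
      by (intro card_image) (auto simp: inj_on_def)
    ultimately show "t (insert 0 (Suc ` S)) = (- 1) ^ card {(i, j). i \<in> S \<and> j \<in> {..<m} - S \<and> j < i}
        * \<omega> (x # nths xs S) * \<eta> (nths xs (- S))"
      unfolding t_def invs_def[symmetric] nths_Suc by simp
  qed
  finally show ?thesis by simp
qed

lemma wedge_lin_left: "wedge (\<lambda>zs. a * f zs + b * g zs) \<eta> xs = a * wedge f \<eta> xs + b * wedge g \<eta> xs"
  and wedge_lin_right: "wedge \<eta> (\<lambda>zs. a * f zs + b * g zs) xs = a * wedge \<eta> f xs + b * wedge \<eta> g xs"
  unfolding wedge_def sum_distrib_left sum.distrib[symmetric]
  by (rule sum.cong; simp add: algebra_simps)+

lemma wedge_cong:
  assumes "\<And>zs. set zs \<subseteq> V \<Longrightarrow> f zs = f' zs" "\<And>zs. set zs \<subseteq> V \<Longrightarrow> g zs = g' zs" "set xs \<subseteq> V"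
  shows "wedge f g xs = wedge f' g' xs"
proof -
  have "set (nths xs S) \<subseteq> V" for S using assms(3) set_nths_subset by fastforce
  then show ?thesis unfolding wedge_def using assms(1,2) by (intro sum.cong refl) simp
qed

lemma wedge_outside:
  assumes "\<And>zs. \<not> set zs \<subseteq> V \<Longrightarrow> f zs = 0" "\<And>zs. \<not> set zs \<subseteq> V \<Longrightarrow> g zs = 0" "\<not> set xs \<subseteq> V"
  shows "wedge f g xs = 0"
  unfolding wedge_def
proof (rule sum.neutral, rule ballI)
  fix S
  have "set xs \<subseteq> set (nths xs S) \<union> set (nths xs (- S))"
    using set_nths_split[of xs S] by simp
  then have "\<not> set (nths xs S) \<subseteq> V \<or> \<not> set (nths xs (- S)) \<subseteq> V" using assms(3) by blast
  then show "(- 1) ^ card {(i, j). i \<in> S \<and> j \<in> {..<length xs} - S \<and> j < i} * f (nths xs S) * g (nths xs (- S)) = 0"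
    using assms(1,2) by auto
qed

lemma alt_sign_twist:
  assumes "alt_multilinear V \<omega>" shows "alt_multilinear V (\<lambda>zs. (- 1) ^ length zs * \<omega> zs)"
proof (rule alt_multilinearI)
  fix us x y vs assume "set us \<subseteq> V" "x \<in> V" "y \<in> V" "set vs \<subseteq> V"
  then show "(- 1) ^ length (us @ (x + y) # vs) * \<omega> (us @ (x + y) # vs) =
      (- 1) ^ length (us @ x # vs) * \<omega> (us @ x # vs) + (- 1) ^ length (us @ y # vs) * \<omega> (us @ y # vs)"
    and "(- 1) ^ length (us @ x # y # vs) * \<omega> (us @ x # y # vs) =
      - ((- 1) ^ length (us @ y # x # vs) * \<omega> (us @ y # x # vs))"
    using alt_add[OF assms, of us x vs y] alt_swap[OF assms, of us x vs y]
    by (simp_all add: algebra_simps)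
next
  fix us c x vs assume "set us \<subseteq> V" "x \<in> V" "set vs \<subseteq> V"
  then show "(- 1) ^ length (us @ mscale c x # vs) * \<omega> (us @ mscale c x # vs) =
      c * ((- 1) ^ length (us @ x # vs) * \<omega> (us @ x # vs))"
    using alt_scale[OF assms, of us x vs c] by (simp add: algebra_simps)
qed

lemma alt_wedge:
  assumes "alt_multilinear V \<omega>" "alt_multilinear V \<eta>" shows "alt_multilinear V (wedge \<omega> \<eta>)"
proof (rule alt_multilinearI)
  fix us a b vs assume "set us \<subseteq> V" and v: "a \<in> V" "b \<in> V" "set vs \<subseteq> V"
  then show "wedge \<omega> \<eta> (us @ (a + b) # vs) = wedge \<omega> \<eta> (us @ a # vs) + wedge \<omega> \<eta> (us @ b # vs)"
    using assms
  proof (induction us arbitrary: \<omega> \<eta>)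
    case Nil
    have "wedge (\<lambda>zs. \<omega> ((a + b) # zs)) \<eta> vs = wedge (\<lambda>zs. 1 * \<omega> (a # zs) + 1 * \<omega> (b # zs)) \<eta> vs"
      by (rule wedge_cong[of V]) (use Nil in \<open>auto simp: alt_add0\<close>)
    moreover have "wedge \<zeta> (\<lambda>zs. \<eta> ((a + b) # zs)) vs = wedge \<zeta> (\<lambda>zs. 1 * \<eta> (a # zs) + 1 * \<eta> (b # zs)) vs" for \<zeta>
      by (rule wedge_cong[of V]) (use Nil in \<open>auto simp: alt_add0\<close>)
    ultimately show ?case by (simp only: wedge_Cons append_Nil wedge_lin_left wedge_lin_right) simp
  next
    case (Cons u us)
    have "wedge (\<lambda>zs. \<omega> (u # zs)) \<eta> (us @ (a + b) # vs) =
        wedge (\<lambda>zs. \<omega> (u # zs)) \<eta> (us @ a # vs) + wedge (\<lambda>zs. \<omega> (u # zs)) \<eta> (us @ b # vs)"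
      using Cons.prems by (intro Cons.IH alt_contract) auto
    moreover have "wedge (\<lambda>zs. (- 1) ^ length zs * \<omega> zs) (\<lambda>zs. \<eta> (u # zs)) (us @ (a + b) # vs) =
        wedge (\<lambda>zs. (- 1) ^ length zs * \<omega> zs) (\<lambda>zs. \<eta> (u # zs)) (us @ a # vs) +
        wedge (\<lambda>zs. (- 1) ^ length zs * \<omega> zs) (\<lambda>zs. \<eta> (u # zs)) (us @ b # vs)"
      using Cons.prems by (intro Cons.IH alt_contract alt_sign_twist) auto
    ultimately show ?case by (simp add: wedge_Cons)
  qed
next
  fix us c a vs assume "set us \<subseteq> V" and v: "a \<in> V" "set vs \<subseteq> V"
  then show "wedge \<omega> \<eta> (us @ mscale c a # vs) = c * wedge \<omega> \<eta> (us @ a # vs)"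
    using assms
  proof (induction us arbitrary: \<omega> \<eta>)
    case Nil
    have "wedge (\<lambda>zs. \<omega> (mscale c a # zs)) \<eta> vs = wedge (\<lambda>zs. c * \<omega> (a # zs) + 0 * \<omega> zs) \<eta> vs"
      by (rule wedge_cong[of V]) (use Nil in \<open>auto simp: alt_scale0\<close>)
    moreover have "wedge \<zeta> (\<lambda>zs. \<eta> (mscale c a # zs)) vs = wedge \<zeta> (\<lambda>zs. c * \<eta> (a # zs) + 0 * \<eta> zs) vs" for \<zeta>
      by (rule wedge_cong[of V]) (use Nil in \<open>auto simp: alt_scale0\<close>)
    ultimately show ?case
      by (simp only: wedge_Cons append_Nil wedge_lin_left wedge_lin_right) (simp add: algebra_simps)
  next
    case (Cons u us)
    have "wedge (\<lambda>zs. \<omega> (u # zs)) \<eta> (us @ mscale c a # vs) = c * wedge (\<lambda>zs. \<omega> (u # zs)) \<eta> (us @ a # vs)"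
      using Cons.prems by (intro Cons.IH alt_contract) auto
    moreover have "wedge (\<lambda>zs. (- 1) ^ length zs * \<omega> zs) (\<lambda>zs. \<eta> (u # zs)) (us @ mscale c a # vs) =
        c * wedge (\<lambda>zs. (- 1) ^ length zs * \<omega> zs) (\<lambda>zs. \<eta> (u # zs)) (us @ a # vs)"
      using Cons.prems by (intro Cons.IH alt_contract alt_sign_twist) auto
    ultimately show ?case by (simp add: wedge_Cons algebra_simps)
  qed
next
  fix us a b vs assume "set us \<subseteq> V" and v: "a \<in> V" "b \<in> V" "set vs \<subseteq> V"
  then show "wedge \<omega> \<eta> (us @ a # b # vs) = - wedge \<omega> \<eta> (us @ b # a # vs)"
    using assms
  proof (induction us arbitrary: \<omega> \<eta>)
    case Nil
    have 1: "wedge (\<lambda>zs. \<omega> (a # b # zs)) \<eta> vs = wedge (\<lambda>zs. (- 1) * \<omega> (b # a # zs) + 0 * \<omega> zs) \<eta> vs"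
      by (rule wedge_cong[of V]) (use Nil alt_swap0[OF Nil(5), of a _ b] in auto)
    have 2: "wedge \<zeta> (\<lambda>zs. \<eta> (a # b # zs)) vs = wedge \<zeta> (\<lambda>zs. (- 1) * \<eta> (b # a # zs) + 0 * \<eta> zs) vs" for \<zeta>
      by (rule wedge_cong[of V]) (use Nil alt_swap0[OF Nil(6), of a _ b] in auto)
    have tw: "wedge (\<lambda>zs. (- 1) ^ length (c # zs) * \<omega> (c # zs)) \<zeta> vs =
        wedge (\<lambda>zs. (- 1) * ((- 1) ^ length zs * \<omega> (c # zs)) + 0 * \<omega> zs) \<zeta> vs" for c \<zeta>
      by (rule wedge_cong[of V]) (use Nil in auto)
    show ?case
      unfolding append_Nil wedge_Cons 1 2 tw wedge_lin_left wedge_lin_right by simp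
  next
    case (Cons u us)
    have "wedge (\<lambda>zs. \<omega> (u # zs)) \<eta> (us @ a # b # vs) = - wedge (\<lambda>zs. \<omega> (u # zs)) \<eta> (us @ b # a # vs)"
      using Cons.prems by (intro Cons.IH alt_contract) auto
    moreover have "wedge (\<lambda>zs. (- 1) ^ length zs * \<omega> zs) (\<lambda>zs. \<eta> (u # zs)) (us @ a # b # vs) =
        - wedge (\<lambda>zs. (- 1) ^ length zs * \<omega> zs) (\<lambda>zs. \<eta> (u # zs)) (us @ b # a # vs)"
      using Cons.prems by (intro Cons.IH alt_contract alt_sign_twist) auto
    ultimately show ?case by (simp add: wedge_Cons)
  qed
qed

lemma wedge_cochains:
  assumes V: "mt.subspace V" and "\<omega> \<in> cochains V" "\<eta> \<in> cochains V"
  shows "wedge \<omega> \<eta> \<in> cochains V"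
  using assms alt_wedge[of V \<omega> \<eta>] wedge_outside[of V \<omega> \<eta>] unfolding cochains_iff[OF V] by blast

lemma form_one_cochains: "form_one \<in> cochains V"
  unfolding cochains_def form_one_def by auto

lemma one_form_cochains:
  assumes V: "mt.subspace V" and f: "f \<in> dual V" shows "one_form f \<in> cochains V"
proof -
  have f: "\<And>x y. x \<in> V \<Longrightarrow> y \<in> V \<Longrightarrow> f (x + y) = f x + f y"
    "\<And>x c. x \<in> V \<Longrightarrow> f (mscale c x) = c * f x" "\<And>x. x \<notin> V \<Longrightarrow> f x = 0"
    using f unfolding dual_def by blast+
  have "alt_multilinear V (one_form f)"
    by (rule alt_multilinearI) (auto simp: one_form_def f hd_append)
  moreover have "one_form f xs = 0" if "\<not> set xs \<subseteq> V" for xs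
    using that f(3) by (cases xs) (auto simp: one_form_def)
  ultimately show ?thesis unfolding cochains_iff[OF V] by blast
qed

lemma wedge_list_cochains:
  assumes "mt.subspace V" "set fs \<subseteq> dual V" shows "wedge_list fs \<in> cochains V"
  using assms(2)
proof (induction fs)
  case Nil
  show ?case by (simp add: wedge_list_def form_one_cochains)
next
  case (Cons f fs)
  have "wedge_list (f # fs) = wedge (one_form f) (wedge_list fs)" by (simp add: wedge_list_def)
  with Cons show ?case by (simp add: wedge_cochains[OF assms(1)] one_form_cochains[OF assms(1)])
qed

text \<open>Up to a scalar, a form with this property is the product of the members of the basis dual
  to \<open>e\<close> with indices in A; the property avoids any choice of their order.\<close>
definition supported_at :: "('a \<Rightarrow> 'n::finite cmat) \<Rightarrow> 'a set \<Rightarrow> 'a set \<Rightarrow> 'n form \<Rightarrow> bool" where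
  "supported_at e P A \<omega> \<longleftrightarrow> (\<forall>l. set l \<subseteq> P \<longrightarrow> \<omega> (map e l) \<noteq> 0 \<longleftrightarrow> distinct l \<and> set l = A)"

lemma supported_wedge:
  assumes \<omega>: "supported_at e P A \<omega>" and \<eta>: "supported_at e P B \<eta>" and disj: "A \<inter> B = {}"
  shows "supported_at e P (A \<union> B) (wedge \<omega> \<eta>)"
  unfolding supported_at_def
proof (intro allI impI)
  fix l :: "'a list" assume l: "set l \<subseteq> P"
  have sub: "set (nths l S) \<subseteq> P" for S using l set_nths_subset by fastforce
  define t where "t S = (- 1) ^ card {(i, j). i \<in> S \<and> j \<in> {..<length l} - S \<and> j < i}
     * \<omega> (nths (map e l) S) * \<eta> (nths (map e l) (- S))" for S
  have t: "t S \<noteq> 0 \<longleftrightarrow> distinct (nths l S) \<and> set (nths l S) = A \<and> distinct (nths l (- S)) \<and> set (nths l (- S)) = B" for S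
    using \<omega> \<eta> sub[of S] sub[of "- S"] unfolding t_def supported_at_def by (simp add: nths_map)
  have sum: "wedge \<omega> \<eta> (map e l) = (\<Sum>S\<in>Pow {..<length l}. t S)"
    by (simp add: wedge_def t_def)
  have set_l: "set l = set (nths l S) \<union> set (nths l (- S))" for S
    by (rule set_nths_split)
  show "wedge \<omega> \<eta> (map e l) \<noteq> 0 \<longleftrightarrow> distinct l \<and> set l = A \<union> B"
  proof
    assume "wedge \<omega> \<eta> (map e l) \<noteq> 0"
    then obtain S where S: "t S \<noteq> 0" using sum sum.neutral by metis
    then have s: "set l = A \<union> B" using t[of S] set_l[of S] by simp
    have fin: "finite A" "finite B" using S t[of S] finite_set[of "nths l S"] finite_set[of "nths l (- S)"] by simp_all
    have "length l = length (nths l S) + length (nths l (- S))"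
    proof -
      have "card {i. i < length l} = card ({i. i < length l \<and> i \<in> S} \<union> {i. i < length l \<and> i \<in> - S})"
        by (rule arg_cong[of _ _ card]) auto
      also have "\<dots> = card {i. i < length l \<and> i \<in> S} + card {i. i < length l \<and> i \<in> - S}"
        by (rule card_Un_disjoint) auto
      finally show ?thesis by (simp add: length_nths)
    qed
    also have "\<dots> = card A + card B" using S t[of S] distinct_card by metis
    also have "\<dots> = card (set l)" using fin disj s by (simp add: card_Un_disjoint)
    finally show "distinct l \<and> set l = A \<union> B" using s card_distinct by metis
  next
    assume dl: "distinct l \<and> set l = A \<union> B"
    define S0 where "S0 = {i. i < length l \<and> l ! i \<in> A}"
    have "set (nths l S0) = A" using dl by (auto simp: set_nths S0_def) (metis UnCI in_set_conv_nth)
    moreover have "set (nths l (- S0)) = B"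
    proof
      show "set (nths l (- S0)) \<subseteq> B" using dl by (auto simp: set_nths S0_def)
      show "B \<subseteq> set (nths l (- S0))"
      proof
        fix b assume b: "b \<in> B"
        then obtain i where i: "i < length l" "l ! i = b" using dl by (metis UnCI in_set_conv_nth)
        moreover have "b \<notin> A" using b disj by blast
        ultimately show "b \<in> set (nths l (- S0))" by (auto simp: set_nths S0_def)
      qed
    qed
    ultimately have S0: "t S0 \<noteq> 0" using t[of S0] dl by (simp add: distinct_nthsI)
    have other: "t S = 0" if S: "S \<in> Pow {..<length l}" "S \<noteq> S0" for S
    proof (rule ccontr)
      assume "t S \<noteq> 0"
      then have SA: "set (nths l S) = A" and SB: "set (nths l (- S)) = B" using t[of S] by auto
      have "S = S0"
      proof
        show "S \<subseteq> S0" using SA S(1) by (auto simp: S0_def set_nths)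
        show "S0 \<subseteq> S"
        proof
          fix i assume i: "i \<in> S0"
          show "i \<in> S"
          proof (rule ccontr)
            assume "i \<notin> S"
            then have "l ! i \<in> B" using SB i by (auto simp: set_nths S0_def)
            then show False using disj i by (auto simp: S0_def)
          qed
        qed
      qed
      then show False using S(2) by simp
    qed
    have "S0 \<in> Pow {..<length l}" by (auto simp: S0_def)
    then have "wedge \<omega> \<eta> (map e l) = t S0 + (\<Sum>S\<in>Pow {..<length l} - {S0}. t S)"
      unfolding sum by (intro sum.remove) auto
    also have "(\<Sum>S\<in>Pow {..<length l} - {S0}. t S) = 0" using other by (intro sum.neutral) auto
    finally show "wedge \<omega> \<eta> (map e l) \<noteq> 0" using S0 by simp
  qed
qed

lemma supported_wedge_list:
  assumes "\<And>\<alpha>. \<alpha> \<in> set as \<Longrightarrow> supported_at e P {\<alpha>} (one_form (f \<alpha>))" and "distinct as"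
  shows "supported_at e P (set as) (wedge_list (map f as))"
  using assms
proof (induction as)
  case Nil
  then show ?case by (auto simp: wedge_list_def supported_at_def form_one_def)
next
  case (Cons \<alpha> as)
  have "wedge_list (map f (\<alpha> # as)) = wedge (one_form (f \<alpha>)) (wedge_list (map f as))"
    by (simp add: wedge_list_def)
  moreover have "supported_at e P ({\<alpha>} \<union> set as) (wedge (one_form (f \<alpha>)) (wedge_list (map f as)))"
    using Cons by (intro supported_wedge) auto
  ultimately show ?case by simp
qed

section \<open>The homotopy formula\<close>

lemma alt_mono:
  assumes "alt_multilinear V \<omega>" "U \<subseteq> V" shows "alt_multilinear U \<omega>"
proof (rule alt_multilinearI)
  fix us x y vs assume "set us \<subseteq> U" "x \<in> U" "y \<in> U" "set vs \<subseteq> U"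
  then show "\<omega> (us @ (x + y) # vs) = \<omega> (us @ x # vs) + \<omega> (us @ y # vs)"
    and "\<omega> (us @ x # y # vs) = - \<omega> (us @ y # x # vs)"
    using assms by (auto intro!: alt_add[OF assms(1)] alt_swap[OF assms(1)])
next
  fix us c x vs assume "set us \<subseteq> U" "x \<in> U" "set vs \<subseteq> U"
  then show "\<omega> (us @ mscale c x # vs) = c * \<omega> (us @ x # vs)"
    using assms by (auto intro!: alt_scale[OF assms(1)])
qed

lemma alt_sum:
  assumes "\<And>a. a \<in> A \<Longrightarrow> alt_multilinear V (f a)"
  shows "alt_multilinear V (\<lambda>xs. \<Sum>a\<in>A. f a xs)"
proof (rule alt_multilinearI)
  fix us x y vs assume "set us \<subseteq> V" "x \<in> V" "y \<in> V" "set vs \<subseteq> V"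
  then show "(\<Sum>a\<in>A. f a (us @ (x + y) # vs)) = (\<Sum>a\<in>A. f a (us @ x # vs)) + (\<Sum>a\<in>A. f a (us @ y # vs))"
    and "(\<Sum>a\<in>A. f a (us @ x # y # vs)) = - (\<Sum>a\<in>A. f a (us @ y # x # vs))"
    unfolding sum.distrib[symmetric] sum_negf[symmetric]
    by (auto intro!: sum.cong alt_add[OF assms] alt_swap[OF assms])
next
  fix us c x vs assume "set us \<subseteq> V" "x \<in> V" "set vs \<subseteq> V"
  then show "(\<Sum>a\<in>A. f a (us @ mscale c x # vs)) = c * (\<Sum>a\<in>A. f a (us @ x # vs))"
    unfolding sum_distrib_left by (auto intro!: sum.cong alt_scale[OF assms])
qed

lemma alt_diff:
  assumes "alt_multilinear V f" "alt_multilinear V g"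
  shows "alt_multilinear V (\<lambda>xs. f xs - g xs)"
proof (rule alt_multilinearI)
  fix us x y vs assume "set us \<subseteq> V" "x \<in> V" "y \<in> V" "set vs \<subseteq> V"
  then show "f (us @ (x + y) # vs) - g (us @ (x + y) # vs) =
      (f (us @ x # vs) - g (us @ x # vs)) + (f (us @ y # vs) - g (us @ y # vs))"
    and "f (us @ x # y # vs) - g (us @ x # y # vs) = - (f (us @ y # x # vs) - g (us @ y # x # vs))"
    using alt_add[OF assms(1), of us x vs y] alt_add[OF assms(2), of us x vs y]
      alt_swap[OF assms(1), of us x vs y] alt_swap[OF assms(2), of us x vs y] by simp_all
next
  fix us c x vs assume "set us \<subseteq> V" "x \<in> V" "set vs \<subseteq> V"
  then show "f (us @ mscale c x # vs) - g (us @ mscale c x # vs) = c * (f (us @ x # vs) - g (us @ x # vs))"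
    using alt_scale[OF assms(1), of us x vs c] alt_scale[OF assms(2), of us x vs c]
    by (simp add: right_diff_distrib)
qed

lemma alt_exchange:
  assumes "alt_multilinear V \<omega>" "x \<in> V" "y \<in> V" "set xs \<subseteq> V" "j < length xs"
  shows "\<omega> (x # xs[j := y]) = - \<omega> (y # xs[j := x])"
  using assms
proof (induction xs arbitrary: j \<omega>)
  case (Cons z zs)
  show ?case
  proof (cases j)
    case 0
    then show ?thesis using alt_swap0[OF Cons.prems(1), of x zs y] Cons.prems by simp
  next
    case (Suc i)
    have u: "set (zs[i := w]) \<subseteq> V" if "w \<in> V" for w
      using set_update_subset_insert[of zs i w] that Cons.prems by auto
    have "\<omega> (x # z # zs[i := y]) = - \<omega> (z # x # zs[i := y])"
      using alt_swap0[OF Cons.prems(1), of x "zs[i := y]" z] u Cons.prems by simp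
    also have "\<omega> (z # x # zs[i := y]) = - \<omega> (z # y # zs[i := x])"
      using Cons.IH[OF alt_contract[OF Cons.prems(1), of z], of i] Cons.prems Suc by simp
    also have "\<omega> (z # y # zs[i := x]) = - \<omega> (y # z # zs[i := x])"
      using alt_swap0[OF Cons.prems(1), of z "zs[i := x]" y] u Cons.prems by simp
    finally show ?thesis using Suc by simp
  qed
qed simp

context matrix_lie_algebra
begin

lemma sum_closed: "(\<And>a. a \<in> A \<Longrightarrow> g a \<in> V) \<Longrightarrow> (\<Sum>a\<in>A. g a) \<in> V"
  by (rule mt.subspace_sum[OF subspace])

lemma alt_zero:
  assumes "alt_multilinear V \<omega>" "set us \<subseteq> V" "set vs \<subseteq> V"
  shows "\<omega> (us @ 0 # vs) = 0"
  using alt_scale[OF assms(1,2) zero_closed assms(3), of 0] by simp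

lemma alt_update_add:
  assumes "alt_multilinear V \<omega>" "set xs \<subseteq> V" "j < length xs" "x \<in> V" "y \<in> V"
  shows "\<omega> (xs[j := x + y]) = \<omega> (xs[j := x]) + \<omega> (xs[j := y])"
proof -
  have "set (take j xs) \<subseteq> V" "set (drop (Suc j) xs) \<subseteq> V"
    using assms(2) set_take_subset set_drop_subset by fastforce+
  then show ?thesis
    using alt_add[OF assms(1), of "take j xs" x "drop (Suc j) xs" y] assms by (simp add: upd_conv_take_nth_drop)
qed

lemma alt_update_scale:
  assumes "alt_multilinear V \<omega>" "set xs \<subseteq> V" "j < length xs" "x \<in> V"
  shows "\<omega> (xs[j := mscale c x]) = c * \<omega> (xs[j := x])"
proof -
  have "set (take j xs) \<subseteq> V" "set (drop (Suc j) xs) \<subseteq> V"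
    using assms(2) set_take_subset set_drop_subset by fastforce+
  then show ?thesis
    using alt_scale[OF assms(1), of "take j xs" x "drop (Suc j) xs" c] assms by (simp add: upd_conv_take_nth_drop)
qed

lemma alt_update_sum:
  assumes "alt_multilinear V \<omega>" "set xs \<subseteq> V" "j < length xs" "\<And>a. a \<in> A \<Longrightarrow> g a \<in> V"
  shows "\<omega> (xs[j := (\<Sum>a\<in>A. mscale (c a) (g a))]) = (\<Sum>a\<in>A. c a * \<omega> (xs[j := g a]))"
  using assms(4)
proof (induction A rule: infinite_finite_induct)
  case (insert a A)
  then show ?case
    using alt_update_add[OF assms(1-3), of "mscale (c a) (g a)" "\<Sum>a\<in>A. mscale (c a) (g a)"]
      alt_update_scale[OF assms(1-3), of "g a" "c a"]
    by (simp add: scale_closed sum_closed)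
next
  case empty
  then show ?case using alt_update_scale[OF assms(1-3) zero_closed, of 0] by simp
next
  case (infinite A)
  then show ?case using alt_update_scale[OF assms(1-3) zero_closed, of 0] by simp
qed

lemma lie_der_zero_vec:
  assumes "alt_multilinear V \<omega>" "set zs \<subseteq> V" shows "lie_der 0 \<omega> zs = 0"
  using lie_der_scale_vec[OF assms(1) zero_closed assms(2), of 0] by simp

lemma lie_der_sum_vec:
  assumes "alt_multilinear V \<omega>" "set zs \<subseteq> V" "\<And>a. a \<in> A \<Longrightarrow> g a \<in> V"
  shows "lie_der (\<Sum>a\<in>A. mscale (c a) (g a)) \<omega> zs = (\<Sum>a\<in>A. c a * lie_der (g a) \<omega> zs)"
  using assms(3)
proof (induction A rule: infinite_finite_induct)
  case (insert a A)
  then show ?case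
    using lie_der_add_vec[OF assms(1), of "mscale (c a) (g a)" "\<Sum>a\<in>A. mscale (c a) (g a)" zs]
      lie_der_scale_vec[OF assms(1), of "g a" zs "c a"] assms(2)
    by (simp add: scale_closed sum_closed)
qed (simp_all add: lie_der_zero_vec[OF assms(1,2)])

end

text \<open>The situation of a nilradical N in a Lie algebra G with invariant form B: the vectors
  \<open>e a\<close>, \<open>f a\<close>, \<open>h i\<close> form a basis of G with B-dual basis \<open>f a\<close>, \<open>e a\<close>, \<open>h' i\<close>, and
  \<open>n_proj\<close> is the projection onto N along the span of the \<open>f a\<close> and \<open>h i\<close>. Forms on N are
  extended to G along this projection, which identifies the dual of N with the opposite
  nilradical.\<close>
locale dual_bases = G: matrix_lie_algebra G + N: matrix_lie_algebra N
  for G N :: "'n::finite cmat set" +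
  fixes B :: "'n cmat \<Rightarrow> 'n cmat \<Rightarrow> complex"
    and A :: "'a set" and e f :: "'a \<Rightarrow> 'n cmat"
    and I :: "'b set" and h h' :: "'b \<Rightarrow> 'n cmat"
  assumes N_sub: "N \<subseteq> G"
    and B_add: "x \<in> G \<Longrightarrow> y \<in> G \<Longrightarrow> z \<in> G \<Longrightarrow> B (x + y) z = B x z + B y z"
    and B_scale: "x \<in> G \<Longrightarrow> z \<in> G \<Longrightarrow> B (mscale c x) z = c * B x z"
    and B_sym: "x \<in> G \<Longrightarrow> y \<in> G \<Longrightarrow> B x y = B y x"
    and B_inv: "x \<in> G \<Longrightarrow> y \<in> G \<Longrightarrow> z \<in> G \<Longrightarrow> B (br x y) z = B x (br y z)"
    and e_in: "a \<in> A \<Longrightarrow> e a \<in> N" and f_in: "a \<in> A \<Longrightarrow> f a \<in> G"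
    and h_in: "i \<in> I \<Longrightarrow> h i \<in> G" and h'_in: "i \<in> I \<Longrightarrow> h' i \<in> G"
    and expand: "z \<in> G \<Longrightarrow> z = (\<Sum>a\<in>A. mscale (B z (f a)) (e a)) +
        ((\<Sum>a\<in>A. mscale (B z (e a)) (f a)) + (\<Sum>i\<in>I. mscale (B z (h' i)) (h i)))"
    and N_perp: "z \<in> N \<Longrightarrow> a \<in> A \<Longrightarrow> B z (e a) = 0" "z \<in> N \<Longrightarrow> i \<in> I \<Longrightarrow> B z (h' i) = 0"
    and opp_perp: "a \<in> A \<Longrightarrow> b \<in> A \<Longrightarrow> B (f a) (f b) = 0" "i \<in> I \<Longrightarrow> b \<in> A \<Longrightarrow> B (h i) (f b) = 0"
    and coroot_perp: "a \<in> A \<Longrightarrow> b \<in> A \<Longrightarrow> B (br (f a) (e a)) (f b) = 0"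
    and h'_N: "i \<in> I \<Longrightarrow> z \<in> N \<Longrightarrow> br (h' i) z \<in> N"
begin

text \<open>The projection to N along the opposite subspace spanned by the \<open>f a\<close> and \<open>h i\<close>; \<open>opp_proj\<close> is
  the complementary one.\<close>
definition n_proj :: "'n cmat \<Rightarrow> 'n cmat" where
  "n_proj z = (\<Sum>a\<in>A. mscale (B z (f a)) (e a))"

definition opp_proj :: "'n cmat \<Rightarrow> 'n cmat" where
  "opp_proj z = (\<Sum>a\<in>A. mscale (B z (e a)) (f a)) + (\<Sum>i\<in>I. mscale (B z (h' i)) (h i))"

definition extend :: "'n form \<Rightarrow> 'n form" where
  "extend \<omega> xs = \<omega> (map n_proj xs)"

text \<open>When N is a nilradical and the \<open>f a\<close> span the opposite one, the pairing B identifies forms on N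
  with multivectors of the opposite nilradical; up to a scalar this is its Koszul boundary operator.\<close>
definition homotopy :: "'n form \<Rightarrow> 'n form" where
  "homotopy \<omega> xs = (\<Sum>a\<in>A. lie_der (f a) (extend \<omega>) (e a # xs))"

lemma eG: "a \<in> A \<Longrightarrow> e a \<in> G" using e_in N_sub by blast

lemma N_G: "set xs \<subseteq> N \<Longrightarrow> set xs \<subseteq> G" using N_sub by blast

lemma n_proj_in: "n_proj z \<in> N"
  unfolding n_proj_def by (intro N.sum_closed N.scale_closed e_in)

lemma opp_proj_in: "opp_proj z \<in> G"
  unfolding opp_proj_def by (intro G.add_closed G.sum_closed G.scale_closed f_in h_in)

lemma proj_split: "z \<in> G \<Longrightarrow> z = n_proj z + opp_proj z"
  unfolding n_proj_def opp_proj_def by (rule expand)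

lemma n_proj_add: "x \<in> G \<Longrightarrow> y \<in> G \<Longrightarrow> n_proj (x + y) = n_proj x + n_proj y"
  by (simp add: n_proj_def B_add f_in mt.scale_left_distrib sum.distrib)

lemma n_proj_scale: "x \<in> G \<Longrightarrow> n_proj (mscale c x) = mscale c (n_proj x)"
  by (simp add: n_proj_def B_scale f_in mt.scale_sum_right)

lemma n_proj_id: "z \<in> N \<Longrightarrow> n_proj z = z"
  using proj_split[of z] N_sub N_perp by (auto simp: opp_proj_def)

lemma map_n_proj_id: "set xs \<subseteq> N \<Longrightarrow> map n_proj xs = xs"
  by (rule map_idI) (auto intro: n_proj_id)

lemma n_proj_zeroI: "(\<And>a. a \<in> A \<Longrightarrow> B y (f a) = 0) \<Longrightarrow> n_proj y = 0"
  by (simp add: n_proj_def)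

lemma n_proj_f: "a \<in> A \<Longrightarrow> n_proj (f a) = 0"
  and n_proj_h: "i \<in> I \<Longrightarrow> n_proj (h i) = 0"
  and n_proj_coroot: "a \<in> A \<Longrightarrow> n_proj (br (f a) (e a)) = 0"
  by (intro n_proj_zeroI; simp add: opp_perp coroot_perp)+

lemma n_proj_sum_zero:
  assumes "\<And>a. a \<in> S \<Longrightarrow> g a \<in> G \<and> n_proj (g a) = 0"
  shows "n_proj (\<Sum>a\<in>S. mscale (c a) (g a)) = 0"
  using assms
proof (induction S rule: infinite_finite_induct)
  case (insert a S)
  then show ?case
    using n_proj_add[of "mscale (c a) (g a)" "\<Sum>a\<in>S. mscale (c a) (g a)"]
    by (simp add: G.scale_closed G.sum_closed n_proj_scale)
qed (use n_proj_scale[OF G.zero_closed, of 0] in simp_all)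

lemma n_proj_opp_proj: "n_proj (opp_proj z) = 0"
proof -
  have "n_proj (\<Sum>a\<in>A. mscale (B z (e a)) (f a)) = 0"
    by (rule n_proj_sum_zero) (simp add: f_in n_proj_f)
  moreover have "n_proj (\<Sum>i\<in>I. mscale (B z (h' i)) (h i)) = 0"
    by (rule n_proj_sum_zero) (simp add: h_in n_proj_h)
  ultimately show ?thesis
    unfolding opp_proj_def
    by (subst n_proj_add) (auto intro!: G.sum_closed G.scale_closed f_in h_in)
qed

lemma alt_extend:
  assumes "alt_multilinear N \<omega>" shows "alt_multilinear G (extend \<omega>)"
proof (rule alt_multilinearI)
  have in_N: "set (map n_proj xs) \<subseteq> N" for xs using n_proj_in by auto
  fix us x y vs assume "set us \<subseteq> G" "x \<in> G" "y \<in> G" "set vs \<subseteq> G"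
  then show "extend \<omega> (us @ (x + y) # vs) = extend \<omega> (us @ x # vs) + extend \<omega> (us @ y # vs)"
    and "extend \<omega> (us @ x # y # vs) = - extend \<omega> (us @ y # x # vs)"
    using alt_add[OF assms in_N[of us] n_proj_in in_N[of vs] n_proj_in, of x y]
      alt_swap[OF assms in_N[of us] n_proj_in in_N[of vs] n_proj_in, of x y]
    by (simp_all add: extend_def n_proj_add)
next
  have in_N: "set (map n_proj xs) \<subseteq> N" for xs using n_proj_in by auto
  fix us c x vs assume "set us \<subseteq> G" "x \<in> G" "set vs \<subseteq> G"
  then show "extend \<omega> (us @ mscale c x # vs) = c * extend \<omega> (us @ x # vs)"
    using alt_scale[OF assms in_N[of us] n_proj_in in_N[of vs], of c x]
    by (simp add: extend_def n_proj_scale)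
qed

lemma alt_homotopy:
  assumes "alt_multilinear N \<omega>" shows "alt_multilinear N (homotopy \<omega>)"
  unfolding homotopy_def
  by (intro alt_mono[OF _ N_sub] alt_sum alt_contract[OF G.alt_lie_der[OF alt_extend[OF assms] f_in] eG])

text \<open>The failure of extension to commute with the differential.\<close>
definition defect :: "'n form \<Rightarrow> 'n form" where
  "defect \<omega> xs = cartan_d (extend \<omega>) xs - extend (cartan_d \<omega>) xs"

lemma alt_defect:
  assumes "alt_multilinear N \<omega>" shows "alt_multilinear G (defect \<omega>)"
  unfolding defect_def[abs_def]
  by (rule alt_diff[OF G.alt_cartan_d[OF alt_extend[OF assms]] alt_extend[OF N.alt_cartan_d[OF assms]]])

lemma extend_N: "set xs \<subseteq> N \<Longrightarrow> extend \<omega> xs = \<omega> xs"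
  by (simp add: extend_def map_n_proj_id)

lemma defect_N: assumes "set xs \<subseteq> N" shows "defect \<omega> xs = 0"
  using assms N.cartan_d_cong[of "extend \<omega>" \<omega> xs] by (simp add: defect_def extend_N)

text \<open>Forms extended by zero are killed by the contraction with y, so Cartan's formula leaves only the
  Lie derivative.\<close>
lemma defect_opp:
  assumes \<omega>: "alt_multilinear N \<omega>" and y: "y \<in> G" "n_proj y = 0" and zs: "set zs \<subseteq> N"
  shows "defect \<omega> (y # zs) = lie_der y (extend \<omega>) zs"
proof -
  have "extend \<omega> (y # xs) = 0" for xs
    using N.alt_zero[OF \<omega>, of "[]" "map n_proj xs"] y n_proj_in by (auto simp: extend_def)
  then have "cartan_d (\<lambda>xs. extend \<omega> (y # xs)) zs = 0" by (simp add: cartan_d_zero)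
  moreover have "extend (cartan_d \<omega>) (y # zs) = 0"
    using N.alt_zero[OF N.alt_cartan_d[OF \<omega>], of "[]" "map n_proj zs"] y n_proj_in
    by (auto simp: extend_def simp del: cartan_d.simps)
  ultimately show ?thesis by (simp add: defect_def)
qed

lemma defect_swap:
  assumes \<omega>: "alt_multilinear N \<omega>" and a: "a \<in> A" and w: "w \<in> G" and xs: "set xs \<subseteq> N" "j < length xs"
  shows "defect \<omega> (e a # xs[j := w]) = - lie_der (opp_proj w) (extend \<omega>) (xs[j := e a])"
proof -
  note D = alt_defect[OF \<omega>]
  have xs_upd: "set (xs[j := u]) \<subseteq> N" if "u \<in> N" for u
    using set_update_subset_insert[of xs j u] that xs by auto
  have "defect \<omega> (e a # xs[j := w]) = defect \<omega> ((e a # xs)[Suc j := n_proj w + opp_proj w])"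
    using proj_split[OF w] by simp
  also have "\<dots> = defect \<omega> (e a # xs[j := n_proj w]) + defect \<omega> (e a # xs[j := opp_proj w])"
    using xs eG[OF a] N_sub n_proj_in
    by (subst G.alt_update_add[OF D]) (auto simp: opp_proj_in)
  also have "defect \<omega> (e a # xs[j := n_proj w]) = 0"
    using e_in[OF a] xs_upd[OF n_proj_in[of w]] by (intro defect_N) auto
  also have "defect \<omega> (e a # xs[j := opp_proj w]) = - defect \<omega> (opp_proj w # xs[j := e a])"
    using xs N_G by (intro alt_exchange[OF D] eG[OF a] opp_proj_in) auto
  also have "defect \<omega> (opp_proj w # xs[j := e a]) = lie_der (opp_proj w) (extend \<omega>) (xs[j := e a])"
    using xs_upd[OF e_in[OF a]] by (intro defect_opp[OF \<omega> opp_proj_in n_proj_opp_proj])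
  finally show ?thesis by simp
qed

text \<open>Invariance of B says that \<open>\<Sum>\<^sub>a q[f\<^sub>a, z] \<otimes> e\<^sub>a = \<Sum>\<^sub>i y\<^sub>i \<otimes> [z, y\<^sup>i]\<close>, where q is the projection
  along N and \<open>y\<^sub>i\<close> runs through the \<open>f a\<close> and \<open>h i\<close> with dual vectors \<open>y\<^sup>i\<close>.\<close>
lemma casimir_exchange:
  assumes \<omega>: "alt_multilinear N \<omega>" and xs: "set xs \<subseteq> N" "j < length xs"
  shows "(\<Sum>a\<in>A. lie_der (opp_proj (br (f a) (xs ! j))) (extend \<omega>) (xs[j := e a])) =
    - (\<Sum>b\<in>A. lie_der (f b) (extend \<omega>) (xs[j := br (e b) (xs ! j)]))
    - (\<Sum>i\<in>I. lie_der (h i) (extend \<omega>) (xs[j := br (h' i) (xs ! j)]))"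
proof -
  define z where "z = xs ! j"
  have z: "z \<in> N" unfolding z_def by (rule subsetD[OF xs(1) nth_mem[OF xs(2)]])
  then have zG: "z \<in> G" using N_sub by blast
  note E = alt_extend[OF \<omega>]
  have upd: "set (xs[j := e a]) \<subseteq> G" if "a \<in> A" for a
    using set_update_subset_insert[of xs j "e a"] eG[OF that] N_G[OF xs(1)] by auto
  have coef: "B (br (f a) z) y = B (br z y) (f a)" if "a \<in> A" "y \<in> G" for a y
    using B_inv[OF f_in[OF that(1)] zG that(2)] B_sym[OF f_in[OF that(1)] G.br_closed[OF zG that(2)]] by simp
  have reassemble: "(\<Sum>a\<in>A. B (br (f a) z) y' * lie_der y (extend \<omega>) (xs[j := e a])) =
      - lie_der y (extend \<omega>) (xs[j := br y' z])"
    if y: "y \<in> G" "y' \<in> G" "br y' z \<in> N" for y y'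
  proof -
    have zN: "br z y' \<in> N" using y(3) N.minus_closed by (metis br_anti)
    have "(\<Sum>a\<in>A. B (br (f a) z) y' * lie_der y (extend \<omega>) (xs[j := e a])) =
        (\<Sum>a\<in>A. B (br z y') (f a) * lie_der y (extend \<omega>) (xs[j := e a]))"
      by (rule sum.cong) (simp_all add: coef y)
    also have "\<dots> = lie_der y (extend \<omega>) (xs[j := n_proj (br z y')])"
      unfolding n_proj_def
      using G.alt_update_sum[OF G.alt_lie_der[OF E y(1)] N_G[OF xs(1)] xs(2), of A e "\<lambda>a. B (br z y') (f a)"] eG
      by simp
    also have "n_proj (br z y') = mscale (-1) (br y' z)"
      by (simp add: n_proj_id[OF zN] br_anti[of y' z])
    also have "lie_der y (extend \<omega>) (xs[j := mscale (-1) (br y' z)]) = - lie_der y (extend \<omega>) (xs[j := br y' z])"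
      using G.alt_update_scale[OF G.alt_lie_der[OF E y(1)] N_G[OF xs(1)] xs(2), of "br y' z" "-1"] y(3) N_sub
      by auto
    finally show ?thesis .
  qed
  have "(\<Sum>a\<in>A. lie_der (opp_proj (br (f a) z)) (extend \<omega>) (xs[j := e a])) =
     (\<Sum>a\<in>A. (\<Sum>b\<in>A. B (br (f a) z) (e b) * lie_der (f b) (extend \<omega>) (xs[j := e a])) +
            (\<Sum>i\<in>I. B (br (f a) z) (h' i) * lie_der (h i) (extend \<omega>) (xs[j := e a])))"
    unfolding opp_proj_def
    by (intro sum.cong refl)
      (simp add: G.lie_der_add_vec[OF E] G.lie_der_sum_vec[OF E] upd f_in h_in G.sum_closed G.scale_closed)
  also have "\<dots> = (\<Sum>b\<in>A. \<Sum>a\<in>A. B (br (f a) z) (e b) * lie_der (f b) (extend \<omega>) (xs[j := e a])) +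
      (\<Sum>i\<in>I. \<Sum>a\<in>A. B (br (f a) z) (h' i) * lie_der (h i) (extend \<omega>) (xs[j := e a]))"
    unfolding sum.distrib by (intro arg_cong2[of _ _ _ _ "(+)"] sum.swap)
  also have "\<dots> = (\<Sum>b\<in>A. - lie_der (f b) (extend \<omega>) (xs[j := br (e b) z])) +
      (\<Sum>i\<in>I. - lie_der (h i) (extend \<omega>) (xs[j := br (h' i) z]))"
    by (intro arg_cong2[of _ _ _ _ "(+)"] sum.cong refl reassemble f_in eG h_in h'_in N.br_closed e_in z h'_N)
  finally show ?thesis by (simp add: z_def sum_negf)
qed

text \<open>In \<open>d s + s d\<close> the terms in which a Lie derivative acts on the extended form commute up to
  brackets \<open>[f\<^sub>a, e\<^sub>a]\<close>, by Cartan's formula on G. The remaining terms come from the defect of the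
  extension; invariance of B turns them into Casimir-like second order terms, whose part in the
  \<open>e a\<close> and \<open>f a\<close> cancels and leaves only the part in the \<open>h i\<close>.\<close>
theorem homotopy_formula:
  assumes \<omega>: "alt_multilinear N \<omega>" and xs: "set xs \<subseteq> N"
  shows "cartan_d (homotopy \<omega>) xs + homotopy (cartan_d \<omega>) xs =
    (\<Sum>a\<in>A. lie_der (br (f a) (e a)) (extend \<omega>) xs)
    - (\<Sum>i\<in>I. lie_der (h' i) (lie_der (h i) (extend \<omega>)) xs)"
proof -
  note E = alt_extend[OF \<omega>]
  note xsG = N_G[OF xs]
  have d1: "cartan_d (homotopy \<omega>) xs =
     (\<Sum>a\<in>A. lie_der (e a) (lie_der (f a) (extend \<omega>)) xs - lie_der (f a) (cartan_d (extend \<omega>)) (e a # xs))"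
  proof -
    have "cartan_d (homotopy \<omega>) xs = (\<Sum>a\<in>A. cartan_d (\<lambda>xs. lie_der (f a) (extend \<omega>) (e a # xs)) xs)"
      unfolding homotopy_def[abs_def] by (rule cartan_d_sum)
    also have "\<dots> = (\<Sum>a\<in>A. lie_der (e a) (lie_der (f a) (extend \<omega>)) xs - cartan_d (lie_der (f a) (extend \<omega>)) (e a # xs))"
      by (simp only: cartan_d.simps diff_diff_eq2 add_diff_cancel_left' diff_add_cancel)
    also have "\<dots> = (\<Sum>a\<in>A. lie_der (e a) (lie_der (f a) (extend \<omega>)) xs - lie_der (f a) (cartan_d (extend \<omega>)) (e a # xs))"
      using xsG eG by (intro sum.cong refl arg_cong2[of _ _ _ _ "(-)"] G.cartan_d_lie_der[OF E f_in]) auto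
    finally show ?thesis .
  qed
  have def: "lie_der (f a) (cartan_d (extend \<omega>)) (e a # xs) - lie_der (f a) (extend (cartan_d \<omega>)) (e a # xs)
     = lie_der (f a) (defect \<omega>) (e a # xs)" for a
    unfolding defect_def[abs_def] by (simp only: lie_der_diff)
  have dsum: "lie_der (f a) (defect \<omega>) (e a # xs) = - lie_der (br (f a) (e a)) (extend \<omega>) xs +
      (\<Sum>j<length xs. lie_der (opp_proj (br (f a) (xs ! j))) (extend \<omega>) (xs[j := e a]))" if a: "a \<in> A" for a
  proof -
    have "lie_der (f a) (defect \<omega>) (e a # xs) = - defect \<omega> (br (f a) (e a) # xs) -
       (\<Sum>j<length xs. defect \<omega> (e a # xs[j := br (f a) (xs ! j)]))"
      by (simp add: lie_der_conv_sum[of "f a" "defect \<omega>"] sum.lessThan_Suc_shift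
          del: sum.lessThan_Suc lie_der.simps)
    also have "defect \<omega> (br (f a) (e a) # xs) = lie_der (br (f a) (e a)) (extend \<omega>) xs"
      by (rule defect_opp[OF \<omega> G.br_closed[OF f_in[OF a] eG[OF a]] n_proj_coroot[OF a] xs])
    also have "(\<Sum>j<length xs. defect \<omega> (e a # xs[j := br (f a) (xs ! j)])) =
        (\<Sum>j<length xs. - lie_der (opp_proj (br (f a) (xs ! j))) (extend \<omega>) (xs[j := e a]))"
      using xsG by (intro sum.cong refl defect_swap[OF \<omega> a _ xs] G.br_closed f_in[OF a]) auto
    finally show ?thesis by (simp add: sum_negf)
  qed
  have "cartan_d (homotopy \<omega>) xs + homotopy (cartan_d \<omega>) xs =
     (\<Sum>a\<in>A. lie_der (e a) (lie_der (f a) (extend \<omega>)) xs - lie_der (f a) (defect \<omega>) (e a # xs))"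
    unfolding d1 homotopy_def sum.distrib[symmetric] def[symmetric] by (simp add: algebra_simps del: lie_der.simps cartan_d.simps)
  also have "\<dots> = (\<Sum>a\<in>A. lie_der (e a) (lie_der (f a) (extend \<omega>)) xs) +
      (\<Sum>a\<in>A. lie_der (br (f a) (e a)) (extend \<omega>) xs) -
      (\<Sum>a\<in>A. \<Sum>j<length xs. lie_der (opp_proj (br (f a) (xs ! j))) (extend \<omega>) (xs[j := e a]))"
    by (simp add: dsum sum.distrib sum_subtractf del: lie_der.simps)
  also have "(\<Sum>a\<in>A. \<Sum>j<length xs. lie_der (opp_proj (br (f a) (xs ! j))) (extend \<omega>) (xs[j := e a])) =
      (\<Sum>j<length xs. - (\<Sum>b\<in>A. lie_der (f b) (extend \<omega>) (xs[j := br (e b) (xs ! j)]))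
        - (\<Sum>i\<in>I. lie_der (h i) (extend \<omega>) (xs[j := br (h' i) (xs ! j)])))"
    by (subst sum.swap) (intro sum.cong refl casimir_exchange[OF \<omega> xs], simp)
  also have "\<dots> = - (\<Sum>b\<in>A. \<Sum>j<length xs. lie_der (f b) (extend \<omega>) (xs[j := br (e b) (xs ! j)]))
        - (\<Sum>i\<in>I. \<Sum>j<length xs. lie_der (h i) (extend \<omega>) (xs[j := br (h' i) (xs ! j)]))"
    unfolding sum_subtractf sum_negf by (simp add: sum.swap[of _ A] sum.swap[of _ I])
  also have "\<dots> = (\<Sum>b\<in>A. lie_der (e b) (lie_der (f b) (extend \<omega>)) xs) +
      (\<Sum>i\<in>I. lie_der (h' i) (lie_der (h i) (extend \<omega>)) xs)"
    by (simp add: lie_der_conv_sum[of "e _" "lie_der _ _"] lie_der_conv_sum[of "h' _" "lie_der _ _"] sum_negf)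
  finally show ?thesis by simp
qed

end

section \<open>The symplectic Lie algebra\<close>

lemma transpose_add: "transpose (A + B) = transpose A + transpose B"
  and transpose_mscale: "transpose (mscale c A) = mscale c (transpose A)"
  and transpose_diff: "transpose (A - B) = transpose A - transpose B"
  by (simp_all add: transpose_def mscale_def vec_eq_iff)

lemma mat_mult_add: "(A + B) ** C = A ** C + B ** C" "C ** (A + B) = C ** A + C ** B"
  and mat_mult_diff: "(A - B) ** C = A ** C - B ** C" "C ** (A - B) = C ** A - C ** B"
  and mat_mult_minus: "(- A) ** C = - (A ** C)" "C ** (- A) = - (C ** A)"
  for A B C :: "'n::finite cmat"
  by (simp_all add: matrix_matrix_mult_def vec_eq_iff sum.distrib sum_subtractf sum_negf algebra_simps)

lemma mat_mult_sum: "C ** (\<Sum>i\<in>A. f i) = (\<Sum>i\<in>A. C ** f i)" for C :: "'n::finite cmat" and f :: "'a \<Rightarrow> 'n cmat"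
  by (induction A rule: infinite_finite_induct) (simp_all add: mat_mult_add)

lemma sp_iff: "X \<in> sp \<longleftrightarrow> transpose X ** symp_J = - (symp_J ** X)"
  by (simp add: sp_def add_eq_0_iff2)

lemma subspace_sp: "mt.subspace sp"
  by (rule mt.subspaceI)
    (simp_all add: sp_iff transpose_add transpose_mscale mat_mult_add mscale_mult_left mscale_mult_right,
      simp add: transpose_def zero_vec_def matrix_matrix_mult_def vec_eq_iff)

lemma br_sp:
  assumes X: "X \<in> sp" and Y: "Y \<in> sp" shows "br X Y \<in> sp"
proof -
  have X': "transpose X ** symp_J = - (symp_J ** X)" and Y': "transpose Y ** symp_J = - (symp_J ** Y)"
    using X Y by (simp_all add: sp_iff)
  have a: "transpose Y ** transpose X ** symp_J = symp_J ** Y ** X"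
  proof -
    have "transpose Y ** transpose X ** symp_J = transpose Y ** (transpose X ** symp_J)"
      by (simp add: matrix_mul_assoc)
    also have "\<dots> = - (transpose Y ** symp_J ** X)"
      unfolding X' by (simp add: mat_mult_minus matrix_mul_assoc)
    also have "\<dots> = symp_J ** Y ** X" unfolding Y' by (simp add: mat_mult_minus)
    finally show ?thesis .
  qed
  have b: "transpose X ** transpose Y ** symp_J = symp_J ** X ** Y"
  proof -
    have "transpose X ** transpose Y ** symp_J = transpose X ** (transpose Y ** symp_J)"
      by (simp add: matrix_mul_assoc)
    also have "\<dots> = - (transpose X ** symp_J ** Y)"
      unfolding Y' by (simp add: mat_mult_minus matrix_mul_assoc)
    also have "\<dots> = symp_J ** X ** Y" unfolding X' by (simp add: mat_mult_minus)
    finally show ?thesis .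
  qed
  have "transpose (br X Y) ** symp_J =
      transpose Y ** transpose X ** symp_J - transpose X ** transpose Y ** symp_J"
    by (simp add: br_def transpose_diff matrix_transpose_mul mat_mult_diff)
  also have "\<dots> = - (symp_J ** br X Y)"
    unfolding a b br_def by (simp add: mat_mult_diff matrix_mul_assoc)
  finally show ?thesis by (simp add: sp_iff)
qed

interpretation sp: matrix_lie_algebra "sp :: 'n::finite cmat set"
  by unfold_locales (simp_all add: subspace_sp br_sp)

lemma symp_J_square: "symp_J ** symp_J = (mscale (-1) (mat 1) :: 'n::finite cmat)"
proof -
  have *: "(UNIV :: ('n + 'n) set) = range Inl \<union> range Inr" using UNIV_sum by auto
  have s: "(\<Sum>k\<in>UNIV. g k) = (\<Sum>a\<in>UNIV. g (Inl a)) + (\<Sum>a\<in>UNIV. g (Inr a))" for g :: "'n + 'n \<Rightarrow> complex"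
    unfolding * by (subst sum.union_disjoint) (auto simp: sum.reindex inj_on_def)
  have "(symp_J ** symp_J) $ i $ j = (mscale (-1) (mat 1) :: 'n cmat) $ i $ j" for i j
    by (cases i; cases j)
      (simp_all add: matrix_matrix_mult_def s symp_J_def mscale_def mat_def if_distrib if_distribR cong: if_cong)
  then show ?thesis by (simp add: vec_eq_iff)
qed

lemma transpose_symp_J: "transpose symp_J = (- symp_J :: 'n::finite cmat)"
proof -
  have "transpose symp_J $ i $ j = (- symp_J :: 'n cmat) $ i $ j" for i j
    by (cases i; cases j) (simp_all add: transpose_def symp_J_def)
  then show ?thesis by (simp add: vec_eq_iff)
qed

text \<open>Multiplication by the matrix of the symplectic form turns elements of sp into symmetric
  matrices of size \<open>2n\<close>, which have \<open>n (2n + 1)\<close> free entries.\<close>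
lemma sp_spanned:
  "\<exists>S :: 'n::finite cmat set. finite S \<and> card S \<le> 2 * CARD('n)\<^sup>2 + CARD('n) \<and> sp \<subseteq> mt.span S"
proof -
  obtain \<iota> :: "'n + 'n \<Rightarrow> nat" where \<iota>: "inj \<iota>"
    using finite_imp_inj_to_nat_seg[of "UNIV :: ('n + 'n) set"] by auto
  define P where "P = {(i, j). \<iota> i \<le> \<iota> j}"
  define E :: "('n + 'n) \<times> ('n + 'n) \<Rightarrow> 'n cmat" where
    "E p = (\<chi> k l. if (k, l) = p \<or> (l, k) = p then 1 else 0)" for p
  define S where "S = (\<lambda>p. - (symp_J ** E p)) ` P"
  have "card P + card P = card (P \<union> prod.swap ` P) + card (P \<inter> prod.swap ` P)"
    using card_Un_Int[of P "prod.swap ` P"] by (simp add: card_image)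
  also have "P \<union> prod.swap ` P = UNIV"
  proof -
    have "p \<in> P \<union> prod.swap ` P" for p
      by (cases p, cases "\<iota> (fst p) \<le> \<iota> (snd p)") (auto simp: P_def image_iff)
    then show ?thesis by blast
  qed
  also have "P \<inter> prod.swap ` P = range (\<lambda>i. (i, i))"
    using injD[OF \<iota>] by (auto simp: P_def)
  also have "card (range (\<lambda>i::'n + 'n. (i, i))) = CARD('n + 'n)"
    by (intro card_image) (simp add: inj_on_def)
  finally have "2 * card P = 2 * (2 * CARD('n)\<^sup>2 + CARD('n))"
    by (simp add: card_UNIV_sum power2_eq_square algebra_simps)
  then have cP: "card P = 2 * CARD('n)\<^sup>2 + CARD('n)" by simp
  then have "card S \<le> 2 * CARD('n)\<^sup>2 + CARD('n)" unfolding S_def using card_image_le[of P] by simp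
  moreover have "sp \<subseteq> mt.span S"
  proof
    fix X :: "'n cmat" assume X: "X \<in> sp"
    define Z where "Z = symp_J ** X"
    have "transpose Z = Z"
      using X by (simp add: Z_def sp_iff matrix_transpose_mul transpose_symp_J mat_mult_minus)
    then have "transpose Z $ l $ k = Z $ l $ k" for k l by (simp only:)
    then have sym: "Z $ k $ l = Z $ l $ k" for k l by (simp only: transpose_def vec_lambda_beta)
    have "(\<Sum>p\<in>P. mscale (Z $ fst p $ snd p) (E p)) $ k $ l = Z $ k $ l" for k l
    proof -
      define q where "q = (if \<iota> k \<le> \<iota> l then (k, l) else (l, k))"
      have q: "q \<in> P" "Z $ fst q $ snd q = Z $ k $ l" using sym by (auto simp: q_def P_def)
      have eq: "E p $ k $ l = (if p = q then 1 else 0)" if "p \<in> P" for p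
        using that injD[OF \<iota>, of k l] unfolding E_def q_def P_def by auto
      have "(\<Sum>p\<in>P. mscale (Z $ fst p $ snd p) (E p)) $ k $ l = (\<Sum>p\<in>P. Z $ fst p $ snd p * E p $ k $ l)"
        by (simp add: mscale_def)
      also have "\<dots> = (\<Sum>p\<in>P. if p = q then Z $ fst p $ snd p else 0)"
        by (rule sum.cong) (simp_all add: eq)
      also have "\<dots> = Z $ k $ l" using q by simp
      finally show ?thesis .
    qed
    then have Z: "Z = (\<Sum>p\<in>P. mscale (Z $ fst p $ snd p) (E p))" by (simp add: vec_eq_iff)
    have "symp_J ** Z = mscale (-1) X"
      by (simp add: Z_def matrix_mul_assoc symp_J_square mat_mult_minus)
    then have "X = - (symp_J ** Z)" by simp
    also have "\<dots> = (\<Sum>p\<in>P. mscale (Z $ fst p $ snd p) (- (symp_J ** E p)))"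
      by (subst Z) (simp add: mat_mult_sum mscale_mult_right sum_negf)
    also have "\<dots> \<in> mt.span S"
      by (intro mt.span_sum mt.span_scale mt.span_base) (auto simp: S_def)
    finally show "X \<in> mt.span S" .
  qed
  moreover have "finite S" by (simp add: S_def)
  ultimately show ?thesis by blast
qed

lemma independent_finite_in_sp:
  assumes "mt.independent B" "B \<subseteq> (sp :: 'n::finite cmat set)" shows "finite B"
  using mt.independent_span_bound assms sp_spanned order_trans by blast

lemma independent_spans_sp:
  assumes "mt.independent B" "B \<subseteq> (sp :: 'n::finite cmat set)" "card B \<ge> 2 * CARD('n)\<^sup>2 + CARD('n)"
  shows "mt.span B = sp"
proof
  show "mt.span B \<subseteq> sp" by (rule mt.span_minimal[OF assms(2) subspace_sp])
  show "sp \<subseteq> mt.span B"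
  proof
    fix x :: "'n cmat" assume x: "x \<in> sp"
    show "x \<in> mt.span B"
    proof (rule ccontr)
      assume nx: "x \<notin> mt.span B"
      then have "mt.independent (insert x B)" using assms(1) by (simp add: mt.independent_insert mt.span_base)
      moreover obtain S :: "'n cmat set" where S: "finite S" "card S \<le> 2 * CARD('n)\<^sup>2 + CARD('n)" "sp \<subseteq> mt.span S"
        using sp_spanned by blast
      ultimately have "card (insert x B) \<le> card S"
        using mt.independent_span_bound[of S "insert x B"] x assms(2) by blast
      moreover have "card (insert x B) = Suc (card B)"
        using independent_finite_in_sp[OF assms(1,2)] nx mt.span_base by (intro card_insert_disjoint) auto
      ultimately show False using S(2) assms(3) by simp
    qed
  qed
qed

section \<open>The Killing form and compact real forms\<close>

text \<open>Traces are taken over the elements of a basis inside V, since the dimension of a subspace is not a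
  type. Independence of the basis allows root vectors and real forms to be used alternately.\<close>
definition endo_on :: "'n::finite cmat set \<Rightarrow> ('n cmat \<Rightarrow> 'n cmat) \<Rightarrow> bool" where
  "endo_on V T \<longleftrightarrow> (\<forall>x\<in>V. T x \<in> V) \<and> (\<forall>x\<in>V. \<forall>y\<in>V. T (x + y) = T x + T y) \<and>
     (\<forall>c. \<forall>x\<in>V. T (mscale c x) = mscale c (T x))"

definition basis_of :: "'n::finite cmat set \<Rightarrow> 'n cmat set \<Rightarrow> bool" where
  "basis_of V B \<longleftrightarrow> finite B \<and> mt.independent B \<and> mt.span B = V"

definition trace_wrt :: "'n::finite cmat set \<Rightarrow> ('n cmat \<Rightarrow> 'n cmat) \<Rightarrow> complex" where
  "trace_wrt B T = (\<Sum>v\<in>B. mt.representation B (T v) v)"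

lemma basis_expand: "basis_of V B \<Longrightarrow> v \<in> V \<Longrightarrow> (\<Sum>u\<in>B. mscale (mt.representation B v u) u) = v"
  using mt.sum_representation_eq[of B v B] by (simp add: basis_of_def)

lemma basis_in: "basis_of V B \<Longrightarrow> u \<in> B \<Longrightarrow> u \<in> V"
  unfolding basis_of_def using mt.span_base by blast

lemma basis_subspace: "basis_of V B \<Longrightarrow> mt.subspace V"
  unfolding basis_of_def using mt.subspace_span by blast

lemma linear_basis_expand:
  assumes B: "basis_of V B" and v: "v \<in> V"
    and add: "\<And>x y. x \<in> V \<Longrightarrow> y \<in> V \<Longrightarrow> \<phi> (x + y) = \<phi> x + \<phi> y"
    and sc: "\<And>c x. x \<in> V \<Longrightarrow> \<phi> (mscale c x) = (c :: complex) * \<phi> x"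
  shows "\<phi> v = (\<Sum>u\<in>B. mt.representation B v u * \<phi> u)"
proof -
  have V: "mt.subspace V" by (rule basis_subspace[OF B])
  have zero: "\<phi> 0 = 0" using sc[of 0 0] mt.subspace_0[OF V] by simp
  have "\<phi> (\<Sum>u\<in>S. mscale (c u) u) = (\<Sum>u\<in>S. c u * \<phi> u)" if "S \<subseteq> B" for S c
  proof -
    have "finite S" using that B finite_subset unfolding basis_of_def by blast
    then show ?thesis
      using that
    proof (induction S)
      case (insert u S)
      then have "u \<in> V" using B basis_in by blast
      moreover have "(\<Sum>u\<in>S. mscale (c u) u) \<in> V"
        using insert.prems basis_in[OF B] by (intro mt.subspace_sum[OF V] mt.subspace_scale[OF V]) auto
      ultimately show ?case using insert by (simp add: add sc mt.subspace_scale[OF V])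
    qed (simp add: zero)
  qed
  from this[of B "mt.representation B v"] show ?thesis using basis_expand[OF B v] by simp
qed

lemma representation_linear:
  assumes B: "basis_of V B"
  shows "x \<in> V \<Longrightarrow> y \<in> V \<Longrightarrow> mt.representation B (x + y) w = mt.representation B x w + mt.representation B y w"
    and "x \<in> V \<Longrightarrow> mt.representation B (mscale c x) w = c * mt.representation B x w"
  using B by (auto simp: basis_of_def mt.representation_add mt.representation_scale)

lemma representation_endo:
  assumes B: "basis_of V B" and T: "endo_on V T" and B': "basis_of V B'" and v: "v \<in> V"
  shows "mt.representation B (T v) w = (\<Sum>u\<in>B'. mt.representation B' v u * mt.representation B (T u) w)"
  by (rule linear_basis_expand[OF B' v, where \<phi> = "\<lambda>v. mt.representation B (T v) w"])
    (use T in \<open>auto simp: endo_on_def representation_linear[OF B]\<close>)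

lemma trace_basis_independent:
  assumes B: "basis_of V B" and B': "basis_of V B'" and T: "endo_on V T"
  shows "trace_wrt B T = trace_wrt B' T"
proof -
  have "trace_wrt B T = (\<Sum>v\<in>B. \<Sum>w\<in>B'. mt.representation B' v w * mt.representation B (T w) v)"
    unfolding trace_wrt_def by (intro sum.cong refl representation_endo[OF B T B'] basis_in[OF B])
  also have "\<dots> = (\<Sum>w\<in>B'. \<Sum>v\<in>B. mt.representation B (T w) v * mt.representation B' v w)"
    by (subst sum.swap) (simp add: mult.commute)
  also have "\<dots> = trace_wrt B' T"
    unfolding trace_wrt_def
  proof (intro sum.cong refl)
    fix w assume "w \<in> B'"
    then have Tw: "T w \<in> V" using T basis_in[OF B'] by (simp add: endo_on_def)
    show "(\<Sum>v\<in>B. mt.representation B (T w) v * mt.representation B' v w) = mt.representation B' (T w) w"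
      by (rule linear_basis_expand[OF B Tw, symmetric]) (auto simp: representation_linear[OF B'])
  qed
  finally show ?thesis .
qed

lemma trace_commute:
  assumes B: "basis_of V B" and S: "endo_on V S" and T: "endo_on V T"
  shows "trace_wrt B (\<lambda>z. S (T z)) = trace_wrt B (\<lambda>z. T (S z))"
proof -
  have *: "trace_wrt B (\<lambda>z. S (T z)) = (\<Sum>v\<in>B. \<Sum>u\<in>B. mt.representation B (T v) u * mt.representation B (S u) v)"
    if S: "endo_on V S" and T: "endo_on V T" for S T
    unfolding trace_wrt_def
    by (intro sum.cong refl representation_endo[OF B S B]) (use T basis_in[OF B] in \<open>auto simp: endo_on_def\<close>)
  show ?thesis unfolding *[OF S T] *[OF T S] by (subst sum.swap) (simp add: mult.commute)
qed

lemma trace_add: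
  assumes "basis_of V B" "endo_on V S" "endo_on V T"
  shows "trace_wrt B (\<lambda>z. S z + T z) = trace_wrt B S + trace_wrt B T"
  unfolding trace_wrt_def sum.distrib[symmetric]
  by (intro sum.cong refl representation_linear(1)[OF assms(1)])
    (use assms basis_in[OF assms(1)] in \<open>auto simp: endo_on_def\<close>)

lemma trace_scale:
  assumes "basis_of V B" "endo_on V S"
  shows "trace_wrt B (\<lambda>z. mscale c (S z)) = c * trace_wrt B S"
  unfolding trace_wrt_def sum_distrib_left
  by (intro sum.cong refl representation_linear(2)[OF assms(1)])
    (use assms basis_in[OF assms(1)] in \<open>auto simp: endo_on_def\<close>)

lemma endo_ad: "x \<in> sp \<Longrightarrow> endo_on sp (br x)"
  by (simp add: endo_on_def br_sp br_add_right br_scale_right)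

lemma endo_compose: "endo_on V S \<Longrightarrow> endo_on V T \<Longrightarrow> endo_on V (\<lambda>z. S (T z))"
  by (simp add: endo_on_def)

lemma basis_sp_exists: "\<exists>B :: 'n::finite cmat set. basis_of sp B"
proof -
  obtain B :: "'n cmat set" where B: "B \<subseteq> sp" "mt.independent B" "sp \<subseteq> mt.span B"
    using mt.maximal_independent_subset by blast
  then have "mt.span B = sp" using mt.span_minimal[OF B(1) subspace_sp] by blast
  then show ?thesis using B independent_finite_in_sp unfolding basis_of_def by blast
qed

lemma killing_trace:
  fixes x y :: "'n::finite cmat"
  assumes B: "basis_of sp B" and xy: "x \<in> sp" "y \<in> sp"
  shows "killing x y = trace_wrt B (\<lambda>z. br x (br y z))"
proof -
  define b where "b = (SOME b. mt.independent b \<and> mt.span b = (sp :: 'n::finite cmat set))"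
  have "mt.independent b \<and> mt.span b = sp"
    unfolding b_def by (rule someI_ex) (use basis_sp_exists in \<open>auto simp: basis_of_def\<close>)
  then have b: "basis_of sp b"
    using independent_finite_in_sp mt.span_superset unfolding basis_of_def by blast
  have "killing x y = trace_wrt b (\<lambda>z. br x (br y z))"
    unfolding killing_def trace_on_def b_def[symmetric] trace_wrt_def Let_def ..
  also have "\<dots> = trace_wrt B (\<lambda>z. br x (br y z))"
    by (rule trace_basis_independent[OF b B endo_compose[OF endo_ad endo_ad]]) (use xy in auto)
  finally show ?thesis .
qed

lemma killing_sym: fixes x y :: "'n::finite cmat" assumes "x \<in> sp" "y \<in> sp" shows "killing x y = killing y x"
proof -
  obtain B :: "'n cmat set" where B: "basis_of sp B" using basis_sp_exists by blast
  show ?thesis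
    unfolding killing_trace[OF B assms] killing_trace[OF B assms(2,1)]
    by (rule trace_commute[OF B endo_ad endo_ad]) (use assms in auto)
qed

lemma killing_add: fixes x y z :: "'n::finite cmat" assumes "x \<in> sp" "y \<in> sp" "z \<in> sp" shows "killing (x + y) z = killing x z + killing y z"
proof -
  obtain B :: "'n cmat set" where B: "basis_of sp B" using basis_sp_exists by blast
  show ?thesis
    using trace_add[OF B endo_compose[OF endo_ad endo_ad] endo_compose[OF endo_ad endo_ad], of x z y z] assms
    by (simp add: killing_trace[OF B] sp.add_closed br_add_left)
qed

lemma killing_scale: fixes x z :: "'n::finite cmat" assumes "x \<in> sp" "z \<in> sp" shows "killing (mscale c x) z = c * killing x z"
proof -
  obtain B :: "'n cmat set" where B: "basis_of sp B" using basis_sp_exists by blast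
  show ?thesis
    using trace_scale[OF B endo_compose[OF endo_ad endo_ad], of x z c] assms
    by (simp add: killing_trace[OF B] sp.scale_closed br_scale_left)
qed

lemma killing_add_right: "x \<in> sp \<Longrightarrow> y \<in> sp \<Longrightarrow> z \<in> sp \<Longrightarrow> killing z (x + y) = killing z x + killing z y"
  using killing_add[of x y z] killing_sym sp.add_closed by metis

lemma killing_scale_right: "x \<in> sp \<Longrightarrow> z \<in> sp \<Longrightarrow> killing z (mscale c x) = c * killing z x"
  using killing_scale[of x z c] killing_sym sp.scale_closed by metis

lemma killing_minus: "x \<in> sp \<Longrightarrow> z \<in> sp \<Longrightarrow> killing (- x) z = - killing x z"
  using killing_scale[of x z "-1"] by simp

lemma killing_minus_right: "x \<in> sp \<Longrightarrow> z \<in> sp \<Longrightarrow> killing z (- x) = - killing z x"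
  using killing_scale_right[of x z "-1"] by simp

lemma killing_diff_right:
  "x \<in> sp \<Longrightarrow> y \<in> sp \<Longrightarrow> z \<in> sp \<Longrightarrow> killing z (x - y) = killing z x - killing z y"
  using killing_add_right[of x "- y" z] killing_minus_right[of y z] by (simp add: sp.minus_closed)

lemma killing_sum: "(\<And>a. a \<in> A \<Longrightarrow> g a \<in> sp) \<Longrightarrow> z \<in> sp \<Longrightarrow>
    killing (\<Sum>a\<in>A. mscale (c a) (g a)) z = (\<Sum>a\<in>A. c a * killing (g a) z)"
proof (induction A rule: infinite_finite_induct)
  case (insert a A)
  then show ?case
    by (simp add: killing_add killing_scale sp.scale_closed sp.sum_closed)
qed (use killing_scale[OF sp.zero_closed, of z 0] in simp_all)

lemma killing_invariant:
  fixes x y z :: "'n::finite cmat"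
  assumes "x \<in> sp" "y \<in> sp" "z \<in> sp" shows "killing (br x y) z = killing x (br y z)"
proof -
  obtain B :: "'n cmat set" where B: "basis_of sp B" using basis_sp_exists by blast
  have e: "endo_on sp (\<lambda>w. br a (br b (br c w)))" if "a \<in> sp" "b \<in> sp" "c \<in> sp" for a b c :: "'n cmat"
    using that by (intro endo_compose[OF endo_ad endo_compose[OF endo_ad endo_ad]])
  have e': "endo_on sp (\<lambda>w. mscale (-1) (br a (br b (br c w))))" if "a \<in> sp" "b \<in> sp" "c \<in> sp" for a b c :: "'n cmat"
    using e[OF that] by (simp add: endo_on_def sp.minus_closed)
  have t: "trace_wrt B (\<lambda>w. br a (br b (br c w)) + mscale (-1) (br a' (br b' (br c' w)))) =
      trace_wrt B (\<lambda>w. br a (br b (br c w))) - trace_wrt B (\<lambda>w. br a' (br b' (br c' w)))"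
    if "a \<in> sp" "b \<in> sp" "c \<in> sp" "a' \<in> sp" "b' \<in> sp" "c' \<in> sp" for a b c a' b' c'
    using trace_add[OF B e[OF that(1-3)] e'[OF that(4-6)]] trace_scale[OF B e[OF that(4-6)], of "-1"] by simp
  have "killing (br x y) z = trace_wrt B (\<lambda>w. br x (br y (br z w)) + mscale (-1) (br y (br x (br z w))))"
    using assms by (simp add: killing_trace[OF B] br_sp br_jacobi)
  also have "\<dots> = trace_wrt B (\<lambda>w. br x (br y (br z w))) - trace_wrt B (\<lambda>w. br y (br x (br z w)))"
    by (rule t) (use assms in auto)
  also have "trace_wrt B (\<lambda>w. br y (br x (br z w))) = trace_wrt B (\<lambda>w. br x (br z (br y w)))"
    by (rule trace_commute[OF B endo_ad endo_compose[OF endo_ad endo_ad]]) (use assms in auto)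
  also have "trace_wrt B (\<lambda>w. br x (br y (br z w))) - trace_wrt B (\<lambda>w. br x (br z (br y w))) =
     trace_wrt B (\<lambda>w. br x (br y (br z w)) + mscale (-1) (br x (br z (br y w))))"
    by (rule t[symmetric]) (use assms in auto)
  also have "\<dots> = killing x (br y z)"
    using assms by (simp add: killing_trace[OF B] br_sp br_jacobi br_diff_right)
  finally show ?thesis .
qed

subsection \<open>The Hermitian form of a compact real form\<close>

lemma mscale_of_real: "mscale (of_real r) x = r *\<^sub>R x"
  unfolding mscale_def vec_eq_iff vector_scaleR_component by (simp add: scaleR_conv_of_real)

locale compact_form =
  fixes K :: "'n::finite cmat set"
  assumes compact: "compact_real_form K"
begin

lemma K_sub: "x \<in> K \<Longrightarrow> x \<in> sp"
  and K_br: "x \<in> K \<Longrightarrow> y \<in> K \<Longrightarrow> br x y \<in> K"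
  and K_neg: "x \<in> K \<Longrightarrow> x \<noteq> 0 \<Longrightarrow> Re (killing x x) < 0"
  and K_subspace: "subspace K"
  using compact unfolding compact_real_form_def real_form_def by blast+

lemma K_zero: "0 \<in> K" and K_add: "x \<in> K \<Longrightarrow> y \<in> K \<Longrightarrow> x + y \<in> K"
  and K_scale: "x \<in> K \<Longrightarrow> mscale (of_real r) x \<in> K"
  using K_subspace by (auto simp: mscale_of_real subspace_0 subspace_add subspace_scale)

lemma K_split: assumes "z \<in> sp" obtains x y where "x \<in> K" "y \<in> K" "z = x + mscale \<i> y"
proof -
  have "\<exists>p. p \<in> K \<times> K \<and> z = fst p + mscale \<i> (snd p)"
    using compact assms unfolding compact_real_form_def real_form_def by blast
  then show thesis using that by auto
qed

lemma K_unique: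
  assumes "x \<in> K" "y \<in> K" "x' \<in> K" "y' \<in> K" "x + mscale \<i> y = x' + mscale \<i> y'"
  shows "x = x'" "y = y'"
proof -
  have "x + mscale \<i> y \<in> sp" using assms K_sub by (simp add: sp.add_closed sp.scale_closed)
  then have "\<exists>!p. p \<in> K \<times> K \<and> x + mscale \<i> y = fst p + mscale \<i> (snd p)"
    using compact unfolding compact_real_form_def real_form_def by blast
  then have "(x, y) = (x', y')" using assms by (elim ex1E) (metis (no_types) SigmaI fst_conv snd_conv)
  then show "x = x'" "y = y'" by auto
qed

lemma conjugation_eq:
  assumes "x \<in> K" "y \<in> K" shows "conjugation K (x + mscale \<i> y) = x - mscale \<i> y"
  unfolding conjugation_def
proof (rule the_equality)
  show "\<exists>x'\<in>K. \<exists>y'\<in>K. x + mscale \<i> y = x' + mscale \<i> y' \<and> x - mscale \<i> y = x' - mscale \<i> y'"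
    using assms by blast
  fix w assume "\<exists>x'\<in>K. \<exists>y'\<in>K. x + mscale \<i> y = x' + mscale \<i> y' \<and> w = x' - mscale \<i> y'"
  then obtain x' y' where "x' \<in> K" "y' \<in> K" "x + mscale \<i> y = x' + mscale \<i> y'" "w = x' - mscale \<i> y'" by blast
  then show "w = x - mscale \<i> y" using K_unique[OF assms] by metis
qed

text \<open>A maximal independent subset of a real form is a complex basis, with respect to which the
  elements of the real form have real coordinates.\<close>
lemma K_basis: "\<exists>B. basis_of sp B \<and> B \<subseteq> K"
proof -
  obtain B where B: "B \<subseteq> K" "mt.independent B" "K \<subseteq> mt.span B"
    using mt.maximal_independent_subset by blast
  have BS: "B \<subseteq> sp" using B(1) K_sub by blast
  have "sp \<subseteq> mt.span B"
  proof
    fix z :: "'n cmat" assume "z \<in> sp"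
    then obtain x y where "x \<in> K" "y \<in> K" "z = x + mscale \<i> y" by (rule K_split)
    then show "z \<in> mt.span B" using B(3) by (auto intro: mt.span_add mt.span_scale)
  qed
  then have "mt.span B = sp" using mt.span_minimal[OF BS subspace_sp] by blast
  then show ?thesis using B independent_finite_in_sp[OF B(2) BS] unfolding basis_of_def by blast
qed

lemma K_representation_real:
  assumes B: "basis_of sp B" "B \<subseteq> K" and x: "x \<in> K" and v: "v \<in> B"
  shows "mt.representation B x v \<in> \<real>"
proof -
  define c where "c = mt.representation B x"
  have fin: "finite B" using B by (simp add: basis_of_def)
  have sumK: "(\<Sum>u\<in>S. mscale (of_real (r u)) u) \<in> K" if "S \<subseteq> B" for S and r :: "_ \<Rightarrow> real"
    using finite_subset[OF that fin] that by (induction S) (use B(2) in \<open>auto simp: K_zero intro!: K_add K_scale\<close>)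
  have "x = (\<Sum>u\<in>B. mscale (c u) u)" using basis_expand[OF B(1) K_sub[OF x]] by (simp add: c_def)
  also have "\<dots> = (\<Sum>u\<in>B. mscale (of_real (Re (c u))) u) + mscale \<i> (\<Sum>u\<in>B. mscale (of_real (Im (c u))) u)"
    unfolding mt.scale_sum_right sum.distrib[symmetric]
    by (intro sum.cong refl) (metis complex_eq mt.scale_left_distrib mt.scale_scale)
  finally have "x + mscale \<i> 0 = (\<Sum>u\<in>B. mscale (of_real (Re (c u))) u) + mscale \<i> (\<Sum>u\<in>B. mscale (of_real (Im (c u))) u)"
    by simp
  from K_unique(2)[OF x K_zero sumK sumK this] have "(\<Sum>u\<in>B. mscale (of_real (Im (c u))) u) = 0" by simp
  then have "complex_of_real (Im (c v)) = 0"
    using mt.independentD[of B B "\<lambda>u. of_real (Im (c u))" v] B(1) fin v by (simp add: basis_of_def)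
  then show ?thesis by (simp add: c_def complex_is_Real_iff)
qed

lemma killing_real: assumes "x \<in> K" "y \<in> K" shows "killing x y \<in> \<real>"
proof -
  obtain B where B: "basis_of sp B" "B \<subseteq> K" using K_basis by blast
  show ?thesis
    unfolding killing_trace[OF B(1) K_sub[OF assms(1)] K_sub[OF assms(2)]] trace_wrt_def
    by (intro sum_in_Reals K_representation_real[OF B] K_br assms) (use B(2) in auto)
qed

lemma sp_i: "x \<in> K \<Longrightarrow> mscale \<i> x \<in> sp"
  by (simp add: K_sub sp.scale_closed)

lemma herm_formula:
  assumes "x \<in> K" "y \<in> K" "a \<in> K" "b \<in> K"
  shows "herm K (x + mscale \<i> y) (a + mscale \<i> b) =
    - (killing x a + killing y b) - \<i> * (killing y a - killing x b)"
proof -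
  have "herm K (x + mscale \<i> y) (a + mscale \<i> b) = - killing (x + mscale \<i> y) (a - mscale \<i> b)"
    by (simp add: herm_def conjugation_eq[OF assms(3,4)])
  also have "\<dots> = - (killing x a + killing y b) - \<i> * (killing y a - killing x b)"
    using assms K_sub
    by (simp add: killing_add killing_add_right killing_scale killing_scale_right sp.scale_closed sp.add_closed
        killing_diff_right sp.diff_closed algebra_simps)
  finally show ?thesis .
qed

lemma conjugation_sp: assumes "z \<in> sp" shows "conjugation K z \<in> sp"
proof -
  obtain x y where "x \<in> K" "y \<in> K" "z = x + mscale \<i> y" using assms by (rule K_split)
  then show ?thesis by (simp add: conjugation_eq K_sub sp.diff_closed sp_i)
qed

lemma herm_positive:
  assumes "z \<in> sp" "z \<noteq> 0" shows "\<exists>r>0. herm K z z = of_real r"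
proof -
  obtain x y where xy: "x \<in> K" "y \<in> K" and z: "z = x + mscale \<i> y" using assms(1) by (rule K_split)
  have "herm K z z = - (killing x x + killing y y)"
    unfolding z herm_formula[OF xy xy] using xy by (simp add: killing_sym K_sub)
  moreover have "killing x x \<in> \<real>" "killing y y \<in> \<real>" using xy killing_real by auto
  ultimately have eq: "herm K z z = of_real (- (Re (killing x x) + Re (killing y y)))"
    by (simp add: of_real_Re)
  have le: "Re (killing w w) \<le> 0" if "w \<in> K" for w
  proof (cases "w = 0")
    case True
    have "killing 0 (0 :: 'n cmat) = 0" using killing_scale[OF sp.zero_closed sp.zero_closed, of 0] by simp
    then show ?thesis using True by simp
  qed (use K_neg[OF that] in simp)
  have "x \<noteq> 0 \<or> y \<noteq> 0" using assms(2) z by auto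
  then have "- (Re (killing x x) + Re (killing y y)) > 0"
    using K_neg le[OF xy(1)] le[OF xy(2)] xy by fastforce
  then show ?thesis using eq by blast
qed

text \<open>The conjugate of z witnesses nondegeneracy, by definiteness of the Hermitian form.\<close>
lemma killing_nondegenerate:
  fixes z :: "'n cmat"
  assumes "z \<in> sp" "\<And>w. w \<in> sp \<Longrightarrow> killing z w = 0" shows "z = 0"
proof (rule ccontr)
  assume "z \<noteq> 0"
  then obtain r where "r > 0" "herm K z z = of_real r" using herm_positive assms(1) by blast
  then show False using assms(2)[OF conjugation_sp[OF assms(1)]] by (simp add: herm_def)
qed

lemma herm_cnj: assumes "z \<in> sp" "w \<in> sp" shows "herm K w z = cnj (herm K z w)"
proof -
  obtain x y where xy: "x \<in> K" "y \<in> K" and z: "z = x + mscale \<i> y" using assms(1) by (rule K_split)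
  obtain a b where ab: "a \<in> K" "b \<in> K" and w: "w = a + mscale \<i> b" using assms(2) by (rule K_split)
  have r: "cnj (killing u v) = killing u v" if "u \<in> K" "v \<in> K" for u v
    using killing_real[OF that] by (simp add: Reals_cnj_iff)
  show ?thesis
    unfolding z w herm_formula[OF xy ab] herm_formula[OF ab xy]
    using xy ab by (simp add: r killing_sym[of a] killing_sym[of b] K_sub algebra_simps)
qed

lemma herm_add: "x \<in> sp \<Longrightarrow> y \<in> sp \<Longrightarrow> z \<in> sp \<Longrightarrow> herm K (x + y) z = herm K x z + herm K y z"
  by (simp add: herm_def killing_add conjugation_sp)

lemma herm_scale: "x \<in> sp \<Longrightarrow> z \<in> sp \<Longrightarrow> herm K (mscale c x) z = c * herm K x z"
  by (simp add: herm_def killing_scale conjugation_sp)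

lemma herm_scale_right: "x \<in> sp \<Longrightarrow> z \<in> sp \<Longrightarrow> herm K z (mscale c x) = cnj c * herm K z x"
  using herm_cnj[of "mscale c x" z] herm_cnj[of x z] herm_scale[of x z c] by (simp add: sp.scale_closed)

lemma herm_sum: "(\<And>a. a \<in> A \<Longrightarrow> g a \<in> sp) \<Longrightarrow> z \<in> sp \<Longrightarrow>
    herm K (\<Sum>a\<in>A. mscale (c a) (g a)) z = (\<Sum>a\<in>A. c a * herm K (g a) z)"
  by (simp add: herm_def killing_sum conjugation_sp sum_negf)

text \<open>Elements of K commute with the conjugation, so invariance of the Killing form makes them skew.\<close>
lemma herm_skew:
  assumes "t \<in> K" "x \<in> sp" "y \<in> sp" shows "herm K (br t x) y = - herm K x (br t y)"
proof -
  obtain a b where ab: "a \<in> K" "b \<in> K" and y: "y = a + mscale \<i> b" using assms(3) by (rule K_split)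
  have "br t y = br t a + mscale \<i> (br t b)" by (simp add: y br_add_right br_scale_right)
  then have "conjugation K (br t y) = br t (conjugation K y)"
    using ab assms(1) by (simp add: y conjugation_eq K_br br_diff_right br_scale_right)
  moreover have "killing (br t x) (conjugation K y) = - killing x (br t (conjugation K y))"
    using assms K_sub conjugation_sp
    by (simp add: br_anti[of t x] killing_minus br_sp killing_invariant)
  ultimately show ?thesis by (simp add: herm_def)
qed

end

section \<open>Root decomposition\<close>

lemma card_Phi: "card (Phi n) \<ge> 2 * n\<^sup>2"
proof -
  define g where "g = (\<lambda>(i, j). if i \<le> j then eps i + eps j else eps j - eps i)"
  have "inj_on g ({1..n} \<times> {1..n})"
  proof (rule inj_onI, clarify)
    fix i j a b assume ij: "i \<in> {1..n}" "j \<in> {1..n}" and ab: "a \<in> {1..n}" "b \<in> {1..n}" and eq: "g (i, j) = g (a, b)"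
    have ht: "wdot n (\<lambda>_. 1) (g (x, y)) = (if x \<le> y then 2 else 0)" if "x \<in> {1..n}" "y \<in> {1..n}" for x y
      using that wdot_one_plus[of x n y] wdot_one_diff[of y n x] by (simp add: g_def)
    have le: "i \<le> j \<longleftrightarrow> a \<le> b" using ht[OF ij] ht[OF ab] eq by (auto split: if_splits)
    show "i = a \<and> j = b"
    proof (cases "i \<le> j")
      case True
      then have "eps i + eps j = eps a + eps b" using eq le by (simp add: g_def)
      then show ?thesis using True le unfolding eps_sum_eq_iff by auto
    next
      case False
      then have "eps j - eps i = eps b - eps a" using eq le by (simp add: g_def)
      then have e: "(eps j - eps i) k = (eps b - eps a) k" for k by simp
      show ?thesis using e[of i] e[of j] False le by (auto simp: eps_def split: if_splits)
    qed
  qed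
  moreover have "g ` ({1..n} \<times> {1..n}) \<subseteq> Phi_pos n"
    using plus_in_Phi_pos diff_in_Phi_pos by (auto simp: g_def)
  ultimately have "card ({1..n} \<times> {1..n}) \<le> card (Phi_pos n)"
    using card_inj_on_le finite_Phi_pos by blast
  then have "n\<^sup>2 \<le> card (Phi_pos n)" by (simp add: power2_eq_square)
  moreover have "card (Phi n) = card (Phi_pos n) + card (uminus ` Phi_pos n)"
    unfolding Phi_def using finite_Phi_pos Phi_pos_uminus by (intro card_Un_disjoint) auto
  moreover have "card (uminus ` Phi_pos n) = card (Phi_pos n)" by (intro card_image) simp
  ultimately show ?thesis by simp
qed

text \<open>Signed permutations preserve the roots: a transposition identifies the diagonal sums, and the
  change of a single sign makes the others vanish.\<close>
lemma Phi_sum_squares: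
  assumes "i \<in> {1..n}" "j \<in> {1..n}"
  shows "(\<Sum>\<alpha>\<in>Phi n. \<alpha> i * \<alpha> j) = (if i = j then \<Sum>\<alpha>\<in>Phi n. \<alpha> 1 * \<alpha> 1 else 0)"
proof (cases "i = j")
  case True
  define \<pi> where "\<pi> = Transposition.transpose 1 i"
  have \<pi>: "\<pi> permutes {1..n}" unfolding \<pi>_def using assms by (intro permutes_swap_id) auto
  have sg: "signs (\<lambda>_. 1)" by (simp add: signs_def)
  have inj: "inj_on (sact (\<lambda>_. 1) \<pi>) (Phi n)" using sact_inj[OF sg \<pi>] inj_on_subset by blast
  have "(\<Sum>\<alpha>\<in>Phi n. \<alpha> 1 * \<alpha> 1) = (\<Sum>\<alpha>\<in>sact (\<lambda>_. 1) \<pi> ` Phi n. \<alpha> 1 * \<alpha> 1)"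
    unfolding sact_Phi[OF sg \<pi>] ..
  also have "\<dots> = (\<Sum>\<alpha>\<in>Phi n. \<alpha> i * \<alpha> i)"
    by (subst sum.reindex[OF inj]) (simp add: sact_def \<pi>_def)
  finally show ?thesis using True by simp
next
  case False
  define sg where "sg k = (if k = i then -1 else 1 :: int)" for k
  have sg: "signs sg" by (simp add: signs_def sg_def)
  have id: "id permutes {1..n}" by (rule permutes_id)
  have inj: "inj_on (sact sg id) (Phi n)" using sact_inj[OF sg id] inj_on_subset by blast
  have "(\<Sum>\<alpha>\<in>Phi n. \<alpha> i * \<alpha> j) = (\<Sum>\<alpha>\<in>sact sg id ` Phi n. \<alpha> i * \<alpha> j)"
    unfolding sact_Phi[OF sg id] ..
  also have "\<dots> = - (\<Sum>\<alpha>\<in>Phi n. \<alpha> i * \<alpha> j)"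
    using False by (subst sum.reindex[OF inj]) (simp add: sact_def sg_def sum_negf)
  finally show ?thesis using False by simp
qed

locale sp_roots = compact_form K for K :: "'n::finite cmat set" +
  fixes H :: "'n cmat set" and \<epsilon> :: "nat \<Rightarrow> 'n cmat \<Rightarrow> complex" and e :: "weight \<Rightarrow> 'n cmat"
    and n :: nat
  assumes n: "n = CARD('n)"
    and cartan: "cartan_subalgebra H"
    and weights: "is_weight_basis H \<epsilon>"
    and root_system: "roots H = wt \<epsilon> ` Phi n"
    and root_vectors: "\<forall>\<alpha>\<in>Phi_pos n. e \<alpha> \<in> root_space H (wt \<epsilon> \<alpha>) \<and> e \<alpha> \<noteq> 0"
    and compact_cartan: "real_form (K \<inter> H) H"
begin

abbreviation rspace :: "weight \<Rightarrow> 'n cmat set" where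
  "rspace \<alpha> \<equiv> root_space H (wt \<epsilon> \<alpha>)"

lemma H_sub: "t \<in> H \<Longrightarrow> t \<in> sp"
  and H_subspace: "mt.subspace H"
  and H_br: "t \<in> H \<Longrightarrow> u \<in> H \<Longrightarrow> br t u \<in> H"
  using cartan unfolding cartan_subalgebra_def lie_subalgebra_def by blast+

lemma H_add: "t \<in> H \<Longrightarrow> u \<in> H \<Longrightarrow> t + u \<in> H" and H_scale: "t \<in> H \<Longrightarrow> mscale c t \<in> H"
  using H_subspace mt.subspace_add mt.subspace_scale by blast+

lemma eps_inj: "inj_on \<epsilon> {1..n}"
  and eps_independent: "fn.independent (\<epsilon> ` {1..n})"
  and eps_span: "fn.span (\<epsilon> ` {1..n}) = dual H"
  using weights unfolding is_weight_basis_def n by auto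

lemma wt_eq: "wt \<epsilon> \<alpha> t = (\<Sum>i = 1..n. of_int (\<alpha> i) * \<epsilon> i t)"
  unfolding wt_def n ..

lemma eps_dual: "i \<in> {1..n} \<Longrightarrow> \<epsilon> i \<in> dual H"
  unfolding eps_span[symmetric] by (rule fn.span_base) simp

lemma eps_linear:
  assumes "i \<in> {1..n}"
  shows "t \<in> H \<Longrightarrow> u \<in> H \<Longrightarrow> \<epsilon> i (t + u) = \<epsilon> i t + \<epsilon> i u"
    and "t \<in> H \<Longrightarrow> \<epsilon> i (mscale c t) = c * \<epsilon> i t"
    and "t \<notin> H \<Longrightarrow> \<epsilon> i t = 0"
  using eps_dual[OF assms] unfolding dual_def by blast+

lemma wt_linear:
  shows "t \<in> H \<Longrightarrow> u \<in> H \<Longrightarrow> wt \<epsilon> \<alpha> (t + u) = wt \<epsilon> \<alpha> t + wt \<epsilon> \<alpha> u"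
    and "t \<in> H \<Longrightarrow> wt \<epsilon> \<alpha> (mscale c t) = c * wt \<epsilon> \<alpha> t"
    and "t \<notin> H \<Longrightarrow> wt \<epsilon> \<alpha> t = 0"
  by (simp_all add: wt_eq eps_linear sum.distrib sum_distrib_left algebra_simps)

lemma wt_add: "wt \<epsilon> (\<alpha> + \<beta>) t = wt \<epsilon> \<alpha> t + wt \<epsilon> \<beta> t"
  and wt_zero: "wt \<epsilon> 0 t = 0"
  by (simp_all add: wt_eq sum.distrib algebra_simps)

lemma wt_dual: "wt \<epsilon> \<alpha> \<in> dual H"
  unfolding dual_def using wt_linear by blast

lemma eps_combination_zero:
  assumes "\<And>x. (\<Sum>i = 1..n. c i * \<epsilon> i x) = 0" "i \<in> {1..n}" shows "c i = 0"
proof -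
  note inj = eps_inj and ind = eps_independent
  have "(\<Sum>v\<in>\<epsilon> ` {1..n}. fscale (c (the_inv_into {1..n} \<epsilon> v)) v) = (\<Sum>i = 1..n. fscale (c i) (\<epsilon> i))"
    unfolding sum.reindex[OF inj] o_def by (intro sum.cong refl) (simp only: the_inv_into_f_f[OF inj])
  also have "\<dots> = 0" using assms(1) by (simp add: fun_eq_iff sum_fun_apply fscale_def)
  finally have "c (the_inv_into {1..n} \<epsilon> (\<epsilon> i)) = 0"
    using fn.independentD[OF ind, of "\<epsilon> ` {1..n}" "\<lambda>v. c (the_inv_into {1..n} \<epsilon> v)" "\<epsilon> i"] assms(2) by auto
  then show ?thesis by (simp only: the_inv_into_f_f[OF inj assms(2)])
qed

lemma H_basis_exists:
  "\<exists>t. (\<forall>i\<in>{1..n}. t i \<in> H) \<and> (\<forall>i\<in>{1..n}. \<forall>j\<in>{1..n}. \<epsilon> j (t i) = (if i = j then 1 else 0)) \<and>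
     (\<forall>h\<in>H. h = (\<Sum>i = 1..n. mscale (\<epsilon> i h) (t i)))"
proof -
  obtain B where B: "B \<subseteq> H" "mt.independent B" "H \<subseteq> mt.span B"
    using mt.maximal_independent_subset by blast
  have "B \<subseteq> sp" using B(1) H_sub by blast
  then have HB: "basis_of H B"
    using B independent_finite_in_sp[OF B(2)] mt.span_minimal[OF B(1) H_subspace] unfolding basis_of_def by blast
  define \<phi> where "\<phi> b x = (if x \<in> H then mt.representation B x b else 0)" for b x
  have "\<phi> b \<in> dual H" for b
    by (auto simp: dual_def \<phi>_def H_add H_scale representation_linear[OF HB])
  then have "\<phi> b \<in> fn.span (\<epsilon> ` {1..n})" for b
    using eps_span by simp
  then have "\<exists>u. \<phi> b = (\<Sum>v\<in>\<epsilon> ` {1..n}. fscale (u v) v)" for b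
    unfolding fn.span_finite[OF finite_imageI[OF finite_atLeastAtMost]] by blast
  then have "\<exists>u. \<forall>b. \<phi> b = (\<Sum>v\<in>\<epsilon> ` {1..n}. fscale (u b v) v)" by (intro choice allI)
  then obtain u where u: "\<And>b. \<phi> b = (\<Sum>v\<in>\<epsilon> ` {1..n}. fscale (u b v) v)" by (elim exE) (simp only:)
  note inj = eps_inj
  define a where "a b i = u b (\<epsilon> i)" for b i
  have phi: "\<phi> b x = (\<Sum>i = 1..n. a b i * \<epsilon> i x)" for b x
    unfolding u sum_fun_apply sum.reindex[OF inj] o_def fscale_def a_def ..
  define t where "t i = (\<Sum>b\<in>B. mscale (a b i) b)" for i
  have tH: "t i \<in> H" for i
    unfolding t_def using B(1) by (intro mt.subspace_sum[OF H_subspace] H_scale) auto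
  have eps_expand: "\<epsilon> j x = (\<Sum>b\<in>B. mt.representation B x b * \<epsilon> j b)" if "j \<in> {1..n}" "x \<in> H" for j x
    by (rule linear_basis_expand[OF HB that(2), where \<phi> = "\<epsilon> j"]) (use eps_linear[OF that(1)] in auto)
  have eps_sum: "\<epsilon> j (\<Sum>b\<in>S. mscale (c b) b) = (\<Sum>b\<in>S. c b * \<epsilon> j b)" if j: "j \<in> {1..n}" and S: "S \<subseteq> B" for j S c
  proof -
    have "finite S" using S HB finite_subset unfolding basis_of_def by blast
    then show ?thesis using S
    proof (induction S)
      case empty
      show ?case using eps_linear(2)[OF j, of 0 0] mt.subspace_0[OF H_subspace] by simp
    next
      case (insert b S)
      then have "b \<in> H" "(\<Sum>b\<in>S. mscale (c b) b) \<in> H"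
        using B(1) by (auto intro!: mt.subspace_sum[OF H_subspace] H_scale)
      then show ?case using insert by (simp add: eps_linear[OF j] H_scale)
    qed
  qed
  have delta: "\<epsilon> j (t i) = (if i = j then 1 else 0)" if ij: "i \<in> {1..n}" "j \<in> {1..n}" for i j
  proof -
    have et: "\<epsilon> j (t i) = (\<Sum>b\<in>B. a b i * \<epsilon> j b)" for i unfolding t_def by (rule eps_sum[OF ij(2)]) simp
    have "(\<Sum>i = 1..n. (\<epsilon> j (t i) - (if i = j then 1 else 0)) * \<epsilon> i x) = 0" for x
    proof (cases "x \<in> H")
      case True
      have "(\<Sum>i = 1..n. \<epsilon> j (t i) * \<epsilon> i x) = (\<Sum>b\<in>B. \<Sum>i = 1..n. a b i * \<epsilon> j b * \<epsilon> i x)"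
        unfolding et sum_distrib_right by (rule sum.swap)
      also have "\<dots> = (\<Sum>b\<in>B. \<phi> b x * \<epsilon> j b)"
        unfolding phi sum_distrib_right by (simp add: mult_ac)
      also have "\<dots> = \<epsilon> j x" using True eps_expand[OF ij(2) True] by (simp add: \<phi>_def)
      finally have "(\<Sum>i = 1..n. \<epsilon> j (t i) * \<epsilon> i x) = \<epsilon> j x" .
      moreover have "(\<Sum>i = 1..n. (if i = j then 1 else 0) * \<epsilon> i x) = (\<Sum>i = 1..n. if i = j then \<epsilon> i x else 0)"
        by (rule sum.cong) auto
      ultimately show ?thesis using ij(2) by (simp add: left_diff_distrib sum_subtractf)
    next
      case False
      then show ?thesis by (simp add: eps_linear(3))
    qed
    from eps_combination_zero[OF this ij(1)] show ?thesis by simp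
  qed
  have "h = (\<Sum>i = 1..n. mscale (\<epsilon> i h) (t i))" if "h \<in> H" for h
  proof -
    have "h = (\<Sum>b\<in>B. mscale (\<phi> b h) b)" using basis_expand[OF HB that] that by (simp add: \<phi>_def)
    also have "\<dots> = (\<Sum>b\<in>B. \<Sum>i = 1..n. mscale (a b i * \<epsilon> i h) b)"
      unfolding phi mt.scale_sum_left ..
    also have "\<dots> = (\<Sum>i = 1..n. mscale (\<epsilon> i h) (t i))"
      unfolding t_def mt.scale_sum_right by (subst sum.swap) (simp add: mult.commute)
    finally show ?thesis .
  qed
  then show ?thesis using tH delta by blast
qed

text \<open>The basis of H dual to the \<open>\<epsilon> i\<close>; a weight takes its coordinates as values there.\<close>
definition tv :: "nat \<Rightarrow> 'n cmat" where
  "tv = (SOME t. (\<forall>i\<in>{1..n}. t i \<in> H) \<and> (\<forall>i\<in>{1..n}. \<forall>j\<in>{1..n}. \<epsilon> j (t i) = (if i = j then 1 else 0)) \<and>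
     (\<forall>h\<in>H. h = (\<Sum>i = 1..n. mscale (\<epsilon> i h) (t i))))"

lemma tv_H: "i \<in> {1..n} \<Longrightarrow> tv i \<in> H"
  and eps_tv: "i \<in> {1..n} \<Longrightarrow> j \<in> {1..n} \<Longrightarrow> \<epsilon> j (tv i) = (if i = j then 1 else 0)"
  and H_expand: "h \<in> H \<Longrightarrow> h = (\<Sum>i = 1..n. mscale (\<epsilon> i h) (tv i))"
  using someI_ex[OF H_basis_exists] unfolding tv_def[symmetric] by blast+

lemma tv_sp: "i \<in> {1..n} \<Longrightarrow> tv i \<in> sp"
  using tv_H H_sub by blast

lemma wt_tv: "i \<in> {1..n} \<Longrightarrow> wt \<epsilon> \<alpha> (tv i) = of_int (\<alpha> i)"
  by (simp add: wt_eq eps_tv if_distrib cong: if_cong)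

lemma wt_tv_combination: "wt \<epsilon> \<alpha> (\<Sum>i = 1..n. mscale (c i) (tv i)) = (\<Sum>i = 1..n. c i * of_int (\<alpha> i))"
proof -
  have "wt \<epsilon> \<alpha> (\<Sum>i\<in>S. mscale (c i) (tv i)) = (\<Sum>i\<in>S. c i * of_int (\<alpha> i))" if "S \<subseteq> {1..n}" for S
    using finite_subset[OF that finite_atLeastAtMost] that
  proof (induction S)
    case empty
    show ?case using wt_linear(2)[of 0 \<alpha> 0] mt.subspace_0[OF H_subspace] by simp
  next
    case (insert i S)
    then have "tv i \<in> H" "(\<Sum>i\<in>S. mscale (c i) (tv i)) \<in> H"
      by (auto intro!: mt.subspace_sum[OF H_subspace] H_scale tv_H)
    then show ?case using insert by (simp add: wt_linear H_scale wt_tv)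
  qed
  then show ?thesis by blast
qed

lemma root_space_nontrivial: assumes "\<alpha> \<in> Phi n" shows "\<exists>x\<in>rspace \<alpha>. x \<noteq> 0"
proof -
  have "wt \<epsilon> \<alpha> \<in> roots H" using root_system assms by blast
  then have "rspace \<alpha> \<noteq> {0}" by (simp add: roots_def)
  moreover have "0 \<in> rspace \<alpha>" by (simp add: root_space_def sp.zero_closed)
  ultimately show ?thesis by blast
qed

lemma rspace_sp: "x \<in> rspace \<alpha> \<Longrightarrow> x \<in> sp"
  and rspace_br: "x \<in> rspace \<alpha> \<Longrightarrow> t \<in> H \<Longrightarrow> br t x = mscale (wt \<epsilon> \<alpha> t) x"
  by (simp_all add: root_space_def)

lemma br_rspace: assumes "x \<in> rspace \<alpha>" "y \<in> rspace \<beta>" shows "br x y \<in> rspace (\<alpha> + \<beta>)"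
proof -
  have "br t (br x y) = mscale (wt \<epsilon> (\<alpha> + \<beta>) t) (br x y)" if t: "t \<in> H" for t
  proof -
    have "br t (br x y) = br (br t x) y + br x (br t y)"
      using br_jacobi[of t x y] by simp
    then show ?thesis
      using rspace_br[OF assms(1) t] rspace_br[OF assms(2) t]
      by (simp add: br_scale_left br_scale_right wt_add mt.scale_left_distrib)
  qed
  then show ?thesis using rspace_sp[OF assms(1)] rspace_sp[OF assms(2)] by (simp add: root_space_def br_sp)
qed

text \<open>A commutator of elements of H acts on each root space both as a commutator of scalars and
  through the root, so all roots vanish on it.\<close>
lemma H_abelian: assumes t: "t \<in> H" and u: "u \<in> H" shows "br t u = 0"
proof -
  have "wt \<epsilon> \<alpha> (br t u) = 0" if \<alpha>: "\<alpha> \<in> Phi n" for \<alpha>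
  proof -
    obtain x where x: "x \<in> rspace \<alpha>" "x \<noteq> 0" using root_space_nontrivial[OF \<alpha>] by blast
    have "br (br t u) x = br t (br u x) - br u (br t x)" by (rule br_jacobi)
    also have "\<dots> = 0"
      using rspace_br[OF x(1) t] rspace_br[OF x(1) u] by (simp add: br_scale_right mult.commute)
    finally have "mscale (wt \<epsilon> \<alpha> (br t u)) x = 0"
      using rspace_br[OF x(1) H_br[OF t u]] by simp
    then show ?thesis using x(2) by simp
  qed
  then have "wt \<epsilon> (eps i + eps i) (br t u) = 0" if "i \<in> {1..n}" for i
    using plus_in_Phi_pos[OF that that] by (simp add: Phi_def)
  moreover have "wt \<epsilon> (eps i + eps i) (br t u) = 2 * \<epsilon> i (br t u)" if "i \<in> {1..n}" for i
    unfolding wt_add using that by (simp add: wt_eq eps_def if_distrib if_distribR cong: if_cong)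
  ultimately have "\<epsilon> i (br t u) = 0" if "i \<in> {1..n}" for i
    using that by simp
  then show ?thesis using H_expand[OF H_br[OF t u]] by simp
qed

lemma H_rspace_zero: "H \<subseteq> rspace 0"
  using H_abelian H_sub by (auto simp: root_space_def wt_zero)

lemma rspace_subspace: "mt.subspace (rspace \<alpha>)"
  by (rule mt.subspaceI)
    (auto simp: root_space_def sp.zero_closed sp.add_closed sp.scale_closed br_add_right br_scale_right
      mt.scale_right_distrib mult.commute)

text \<open>Coordinates outside \<open>{1..n}\<close> do not influence the functional \<open>wt \<epsilon> \<alpha>\<close>; requiring them to be zero
  makes coordinate vectors and functionals correspond one to one.\<close>
definition weight_vec :: "weight \<Rightarrow> bool" where
  "weight_vec \<alpha> \<longleftrightarrow> (\<forall>k. k \<notin> {1..n} \<longrightarrow> \<alpha> k = 0)"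

lemma weight_vec_zero: "weight_vec 0"
  and weight_vec_add: "weight_vec \<alpha> \<Longrightarrow> weight_vec \<beta> \<Longrightarrow> weight_vec (\<alpha> + \<beta>)"
  and weight_vec_minus: "weight_vec \<alpha> \<Longrightarrow> weight_vec (- \<alpha>)"
  and weight_vec_Phi: "\<alpha> \<in> Phi n \<Longrightarrow> weight_vec \<alpha>"
  by (auto simp: weight_vec_def Phi_outside)

lemma weight_separate:
  assumes "weight_vec \<alpha>" "weight_vec \<beta>" "\<alpha> \<noteq> \<beta>"
  obtains k where "k \<in> {1..n}" "\<alpha> k \<noteq> \<beta> k"
  using assms unfolding weight_vec_def by (metis ext)

lemma rspace_trivial:
  assumes \<alpha>: "weight_vec \<alpha>" "\<alpha> \<noteq> 0" "\<alpha> \<notin> Phi n" and x: "x \<in> rspace \<alpha>"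
  shows "x = 0"
proof (rule ccontr)
  assume "x \<noteq> 0"
  obtain k where k: "k \<in> {1..n}" "\<alpha> k \<noteq> 0 k" using weight_separate[OF \<alpha>(1) weight_vec_zero \<alpha>(2)] by blast
  then have "wt \<epsilon> \<alpha> (tv k) \<noteq> 0" by (simp add: wt_tv)
  then have "wt \<epsilon> \<alpha> \<noteq> 0" by (metis zero_fun_apply)
  moreover have "rspace \<alpha> \<noteq> {0}" using x \<open>x \<noteq> 0\<close> by blast
  ultimately have "wt \<epsilon> \<alpha> \<in> roots H" using wt_dual by (simp add: roots_def)
  then obtain \<beta> where \<beta>: "\<beta> \<in> Phi n" "wt \<epsilon> \<alpha> = wt \<epsilon> \<beta>" using root_system by auto
  have "\<alpha> i = \<beta> i" if "i \<in> {1..n}" for i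
    using fun_cong[OF \<beta>(2), of "tv i"] wt_tv[OF that] by simp
  then have "\<alpha> = \<beta>" using \<alpha>(1) weight_vec_Phi[OF \<beta>(1)] unfolding weight_vec_def by (metis ext)
  then show False using \<beta>(1) \<alpha>(3) by simp
qed

text \<open>A subspace stable under H contains the weight components of its elements. With the zero
  subspace this says that the sum of the weight spaces is direct.\<close>
lemma weight_components:
  assumes "finite A" and I: "mt.subspace I" "\<And>t y. t \<in> H \<Longrightarrow> y \<in> I \<Longrightarrow> br t y \<in> I"
    and "\<And>\<alpha>. \<alpha> \<in> A \<Longrightarrow> weight_vec \<alpha>" "\<And>\<alpha>. \<alpha> \<in> A \<Longrightarrow> x \<alpha> \<in> rspace \<alpha>" "(\<Sum>\<alpha>\<in>A. x \<alpha>) \<in> I" "\<alpha> \<in> A"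
  shows "x \<alpha> \<in> I"
  using assms(1,4-7)
proof (induction A arbitrary: x \<alpha> rule: finite_induct)
  case empty
  then show ?case by simp
next
  case (insert \<beta> A)
  have others: "x \<gamma> \<in> I" if \<gamma>: "\<gamma> \<in> A" for \<gamma>
  proof -
    have "\<gamma> \<noteq> \<beta>" using insert.hyps \<gamma> by auto
    then obtain k where k: "k \<in> {1..n}" "\<gamma> k \<noteq> \<beta> k"
      using weight_separate[of \<gamma> \<beta>] insert.prems(1) \<gamma> by blast
    define t where "t = tv k"
    have t: "t \<in> H" using k tv_H by (simp add: t_def)
    define d where "d \<delta> = wt \<epsilon> \<delta> t - wt \<epsilon> \<beta> t" for \<delta>
    have "br t (\<Sum>\<alpha>\<in>insert \<beta> A. x \<alpha>) - mscale (wt \<epsilon> \<beta> t) (\<Sum>\<alpha>\<in>insert \<beta> A. x \<alpha>) \<in> I"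
      using I(2)[OF t insert.prems(3)] insert.prems(3)
      by (intro mt.subspace_diff[OF I(1)] mt.subspace_scale[OF I(1)])
    also have "br t (\<Sum>\<alpha>\<in>insert \<beta> A. x \<alpha>) - mscale (wt \<epsilon> \<beta> t) (\<Sum>\<alpha>\<in>insert \<beta> A. x \<alpha>) =
        (\<Sum>\<delta>\<in>insert \<beta> A. mscale (d \<delta>) (x \<delta>))"
      unfolding br_sum_right mt.scale_sum_right sum_subtractf[symmetric]
      using insert.prems(2) rspace_br[OF _ t] by (intro sum.cong refl) (simp add: d_def mt.scale_left_diff_distrib)
    also have "\<dots> = (\<Sum>\<delta>\<in>A. mscale (d \<delta>) (x \<delta>))"
      using insert.hyps by (simp add: d_def)
    finally have "mscale (d \<gamma>) (x \<gamma>) \<in> I"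
      using insert.IH[of "\<lambda>\<delta>. mscale (d \<delta>) (x \<delta>)" \<gamma>] insert.prems(1,2) \<gamma>
      by (simp add: mt.subspace_scale[OF rspace_subspace])
    then have "mscale (inverse (d \<gamma>)) (mscale (d \<gamma>) (x \<gamma>)) \<in> I" by (rule mt.subspace_scale[OF I(1)])
    moreover have "d \<gamma> \<noteq> 0" using k by (simp add: d_def t_def wt_tv)
    ultimately show ?thesis by simp
  qed
  show ?case
  proof (cases "\<alpha> = \<beta>")
    case True
    have "(\<Sum>\<alpha>\<in>A. x \<alpha>) \<in> I" using others by (rule mt.subspace_sum[OF I(1)])
    then have "(\<Sum>\<alpha>\<in>insert \<beta> A. x \<alpha>) - (\<Sum>\<alpha>\<in>A. x \<alpha>) \<in> I"
      by (rule mt.subspace_diff[OF I(1) insert.prems(3)])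
    then show ?thesis using insert.hyps True by simp
  next
    case False
    then show ?thesis using others insert.prems(4) by blast
  qed
qed

text \<open>Negative root vectors are chosen arbitrarily. They are only used up to scalars, which \<open>fv\<close> later
  fixes by duality.\<close>
definition rv :: "weight \<Rightarrow> 'n cmat" where
  "rv \<alpha> = (if \<alpha> \<in> Phi_pos n then e \<alpha> else SOME x. x \<in> rspace \<alpha> \<and> x \<noteq> 0)"

lemma rv: assumes "\<alpha> \<in> Phi n" shows "rv \<alpha> \<in> rspace \<alpha>" "rv \<alpha> \<noteq> 0"
proof -
  have "rv \<alpha> \<in> rspace \<alpha> \<and> rv \<alpha> \<noteq> 0"
  proof (cases "\<alpha> \<in> Phi_pos n")
    case True
    then show ?thesis using root_vectors by (simp add: rv_def)
  next
    case False
    have "\<exists>x. x \<in> rspace \<alpha> \<and> x \<noteq> 0" using root_space_nontrivial[OF assms] by blast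
    from someI_ex[OF this] show ?thesis using False by (simp add: rv_def)
  qed
  then show "rv \<alpha> \<in> rspace \<alpha>" "rv \<alpha> \<noteq> 0" by auto
qed

lemma rspace_unique:
  assumes "x \<in> rspace \<alpha>" "x \<in> rspace \<beta>" "x \<noteq> 0" "weight_vec \<alpha>" "weight_vec \<beta>" shows "\<alpha> = \<beta>"
proof (rule ccontr)
  assume "\<alpha> \<noteq> \<beta>"
  then obtain k where k: "k \<in> {1..n}" "\<alpha> k \<noteq> \<beta> k" using weight_separate assms(4,5) by blast
  have "mscale (wt \<epsilon> \<alpha> (tv k)) x = mscale (wt \<epsilon> \<beta> (tv k)) x"
    unfolding rspace_br[OF assms(1) tv_H[OF k(1)], symmetric] rspace_br[OF assms(2) tv_H[OF k(1)], symmetric] ..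
  then show False using k assms(3) by (simp add: wt_tv)
qed

lemma rv_inj: "inj_on rv (Phi n)"
  by (rule inj_onI) (metis rv rspace_unique weight_vec_Phi)

lemma tv_inj: "inj_on tv {1..n}"
proof (rule inj_onI)
  fix i j assume "i \<in> {1..n}" "j \<in> {1..n}" "tv i = tv j"
  then show "i = j" using eps_tv[of i j] eps_tv[of j j] by (simp split: if_splits)
qed

definition root_basis :: "'n cmat set" where
  "root_basis = tv ` {1..n} \<union> rv ` Phi n"

lemma root_basis_disjoint: "tv ` {1..n} \<inter> rv ` Phi n = {}"
proof -
  have False if "i \<in> {1..n}" "\<alpha> \<in> Phi n" "tv i = rv \<alpha>" for i \<alpha>
  proof -
    have "rv \<alpha> \<in> rspace 0" using H_rspace_zero tv_H[OF that(1)] that(3) by auto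
    then have "\<alpha> = 0"
      using rv[OF that(2)] rspace_unique weight_vec_Phi[OF that(2)] weight_vec_zero by blast
    then show False using that(2) zero_notin_Phi by simp
  qed
  then show ?thesis by blast
qed

lemma root_basis_independent: "mt.independent root_basis"
proof -
  have fin: "finite root_basis" using finite_Phi by (simp add: root_basis_def)
  have "u v = 0" if u: "(\<Sum>v\<in>root_basis. mscale (u v) v) = 0" and v: "v \<in> root_basis" for u v
  proof -
    define x where "x \<alpha> = (if \<alpha> = 0 then \<Sum>i = 1..n. mscale (u (tv i)) (tv i) else mscale (u (rv \<alpha>)) (rv \<alpha>))" for \<alpha>
    have x0: "x 0 \<in> H" unfolding x_def by (auto intro!: mt.subspace_sum[OF H_subspace] H_scale tv_H)
    have "(\<Sum>v\<in>root_basis. mscale (u v) v) = (\<Sum>i = 1..n. mscale (u (tv i)) (tv i)) + (\<Sum>\<alpha>\<in>Phi n. mscale (u (rv \<alpha>)) (rv \<alpha>))"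
      unfolding root_basis_def
        sum.union_disjoint[OF finite_imageI[OF finite_atLeastAtMost] finite_imageI[OF finite_Phi] root_basis_disjoint]
        sum.reindex[OF tv_inj] sum.reindex[OF rv_inj] o_def ..
    also have "(\<Sum>\<alpha>\<in>Phi n. mscale (u (rv \<alpha>)) (rv \<alpha>)) = (\<Sum>\<alpha>\<in>Phi n. x \<alpha>)"
      using zero_notin_Phi by (intro sum.cong refl) (auto simp: x_def)
    also have "(\<Sum>i = 1..n. mscale (u (tv i)) (tv i)) + \<dots> = (\<Sum>\<alpha>\<in>insert 0 (Phi n). x \<alpha>)"
      using finite_Phi zero_notin_Phi by (simp add: x_def)
    finally have s: "(\<Sum>\<alpha>\<in>insert 0 (Phi n). x \<alpha>) \<in> {0}" using u by simp
    have z: "x \<alpha> = 0" if "\<alpha> \<in> insert 0 (Phi n)" for \<alpha>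
    proof -
      have "x \<alpha> \<in> {0}"
      proof (rule weight_components[of "insert 0 (Phi n)" "{0}" x \<alpha>])
        show "x \<alpha> \<in> rspace \<alpha>" if "\<alpha> \<in> insert 0 (Phi n)" for \<alpha>
          using that H_rspace_zero x0 rv(1) mt.subspace_scale[OF rspace_subspace]
          by (cases "\<alpha> = 0") (auto simp: x_def)
        show "weight_vec \<alpha>" if "\<alpha> \<in> insert 0 (Phi n)" for \<alpha>
          using that weight_vec_zero weight_vec_Phi by auto
      qed (use s that finite_Phi in \<open>auto simp: mt.subspace_single_0\<close>)
      then show ?thesis by simp
    qed
    from v consider i where "i \<in> {1..n}" "v = tv i" | \<alpha> where "\<alpha> \<in> Phi n" "v = rv \<alpha>"
      unfolding root_basis_def by blast
    then show "u v = 0"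
    proof cases
      case 1
      have "(\<Sum>i = 1..n. mscale (u (tv i)) (tv i)) = 0" using z[of 0] by (simp add: x_def)
      then have "wt \<epsilon> (eps i) (\<Sum>i = 1..n. mscale (u (tv i)) (tv i)) = 0"
        using wt_linear(2)[of 0 _ 0] mt.subspace_0[OF H_subspace] by simp
      then show ?thesis unfolding wt_tv_combination using 1
        by (simp add: eps_def if_distrib cong: if_cong)
    next
      case 2
      then have "\<alpha> \<noteq> 0" using zero_notin_Phi by auto
      then show ?thesis using z[of \<alpha>] 2 rv(2) by (auto simp: x_def)
    qed
  qed
  then show ?thesis unfolding mt.dependent_finite[OF fin] by blast
qed

lemma root_basis_sp: "root_basis \<subseteq> sp"
  using tv_sp rv(1) rspace_sp by (auto simp: root_basis_def)

text \<open>Roots and coordinates together supply \<open>2n\<^sup>2 + n\<close> independent vectors, which bounds the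
  dimension of sp from above, so that these vectors span.\<close>
lemma root_basis: "basis_of sp root_basis"
proof -
  have "card root_basis = n + card (Phi n)"
    unfolding root_basis_def
      card_Un_disjoint[OF finite_imageI[OF finite_atLeastAtMost] finite_imageI[OF finite_Phi] root_basis_disjoint]
      card_image[OF tv_inj] card_image[OF rv_inj] by simp
  then have "card root_basis \<ge> 2 * n\<^sup>2 + n" using card_Phi[of n] by simp
  then have "mt.span root_basis = sp"
    using independent_spans_sp[OF root_basis_independent root_basis_sp, folded n] by blast
  moreover have "finite root_basis" using finite_Phi by (simp add: root_basis_def)
  ultimately show ?thesis using root_basis_independent unfolding basis_of_def by blast
qed

end

subsection \<open>The Killing form on root vectors\<close>

context sp_roots
begin

lemma killing_orth:
  assumes "x \<in> rspace \<alpha>" "y \<in> rspace \<beta>" "weight_vec \<alpha>" "weight_vec \<beta>" "\<alpha> + \<beta> \<noteq> 0"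
  shows "killing x y = 0"
proof -
  obtain k where k: "k \<in> {1..n}" "(\<alpha> + \<beta>) k \<noteq> 0 k"
    using weight_separate[OF weight_vec_add[OF assms(3,4)] weight_vec_zero assms(5)] by blast
  note sp = rspace_sp[OF assms(1)] rspace_sp[OF assms(2)] tv_sp[OF k(1)]
  have "killing (br x (tv k)) y = killing x (br (tv k) y)" by (rule killing_invariant[OF sp(1,3,2)])
  moreover have "br x (tv k) = mscale (- of_int (\<alpha> k)) x"
    using rspace_br[OF assms(1) tv_H[OF k(1)]] by (simp add: br_anti[of x "tv k"] wt_tv[OF k(1)])
  moreover have "br (tv k) y = mscale (of_int (\<beta> k)) y"
    using rspace_br[OF assms(2) tv_H[OF k(1)]] by (simp add: wt_tv[OF k(1)])
  ultimately have "- of_int (\<alpha> k) * killing x y = of_int (\<beta> k) * killing x y"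
    using sp killing_scale[OF sp(1,2), of "- of_int (\<alpha> k)"] killing_scale_right[OF sp(2,1), of "of_int (\<beta> k)"] by simp
  then have "of_int (\<alpha> k + \<beta> k) * killing x y = 0"
    by (simp add: distrib_right neg_eq_iff_add_eq_0)
  then show ?thesis using k(2) by (simp flip: of_int_add)
qed

lemma killing_H:
  assumes t: "t \<in> H" and u: "u \<in> H"
  shows "killing t u = (\<Sum>\<alpha>\<in>Phi n. wt \<epsilon> \<alpha> t * wt \<epsilon> \<alpha> u)"
proof -
  let ?g = "\<lambda>v. mt.representation root_basis (br t (br u v)) v"
  have z: "?g (tv i) = 0" if "i \<in> {1..n}" for i
    using H_abelian[OF u tv_H[OF that]] by (simp add: mt.representation_zero)
  have r: "?g (rv \<alpha>) = wt \<epsilon> \<alpha> t * wt \<epsilon> \<alpha> u" if \<alpha>: "\<alpha> \<in> Phi n" for \<alpha>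
  proof -
    have "br t (br u (rv \<alpha>)) = mscale (wt \<epsilon> \<alpha> u * wt \<epsilon> \<alpha> t) (rv \<alpha>)"
      using rspace_br[OF rv(1)[OF \<alpha>] t] rspace_br[OF rv(1)[OF \<alpha>] u] by (simp add: br_scale_right)
    moreover have "mt.representation root_basis (rv \<alpha>) (rv \<alpha>) = 1"
      using mt.representation_basis[OF root_basis_independent] \<alpha> by (simp add: root_basis_def)
    ultimately show ?thesis
      using representation_linear(2)[OF root_basis rspace_sp[OF rv(1)[OF \<alpha>]]] by simp
  qed
  have "killing t u = (\<Sum>v\<in>tv ` {1..n}. ?g v) + (\<Sum>v\<in>rv ` Phi n. ?g v)"
    unfolding killing_trace[OF root_basis H_sub[OF t] H_sub[OF u]] trace_wrt_def
    by (subst root_basis_def, rule sum.union_disjoint[OF _ _ root_basis_disjoint]) (auto simp: finite_Phi)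
  also have "(\<Sum>v\<in>tv ` {1..n}. ?g v) = 0" using z by (intro sum.neutral) auto
  also have "(\<Sum>v\<in>rv ` Phi n. ?g v) = (\<Sum>\<alpha>\<in>Phi n. wt \<epsilon> \<alpha> t * wt \<epsilon> \<alpha> u)"
    unfolding sum.reindex[OF rv_inj] o_def using r by (intro sum.cong refl) auto
  finally show ?thesis by simp
qed

text \<open>The factor between the Killing form and the standard inner product: the form
  \<open>\<langle>\<mu>, \<nu>\<rangle>\<close> induced on weights is \<open>wdot n \<mu> \<nu> / cc\<close>.\<close>
definition cc :: int where "cc = (\<Sum>\<alpha>\<in>Phi n. \<alpha> 1 * \<alpha> 1)"

lemma n_pos: "n \<ge> 1"
  unfolding n by (simp add: Suc_leI)

lemma cc_pos: "cc > 0"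
  unfolding cc_def
proof (rule sum_pos2[OF finite_Phi, of "eps 1 + eps 1"])
  show "eps 1 + eps 1 \<in> Phi n" using plus_in_Phi_pos[of 1 n 1] n_pos by (simp add: Phi_def)
qed (auto simp: eps_def)

lemma killing_tv:
  assumes "i \<in> {1..n}" "j \<in> {1..n}" shows "killing (tv i) (tv j) = (if i = j then of_int cc else 0)"
proof -
  have "killing (tv i) (tv j) = of_int (\<Sum>\<alpha>\<in>Phi n. \<alpha> i * \<alpha> j)"
    unfolding killing_H[OF tv_H[OF assms(1)] tv_H[OF assms(2)]] wt_tv[OF assms(1)] wt_tv[OF assms(2)] by simp
  then show ?thesis unfolding Phi_sum_squares[OF assms] cc_def by simp
qed

lemma killing_zero_on_basis:
  assumes "z \<in> sp" "\<And>i. i \<in> {1..n} \<Longrightarrow> killing z (tv i) = 0" "\<And>\<alpha>. \<alpha> \<in> Phi n \<Longrightarrow> killing z (rv \<alpha>) = 0"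
  shows "z = 0"
proof (rule killing_nondegenerate[OF assms(1)])
  fix w :: "'n cmat" assume w: "w \<in> sp"
  have "killing z w = (\<Sum>v\<in>root_basis. mt.representation root_basis w v * killing z v)"
    by (rule linear_basis_expand[OF root_basis w, where \<phi> = "killing z"])
      (simp_all add: killing_add_right killing_scale_right assms(1))
  also have "\<dots> = 0"
    using assms(2,3) by (intro sum.neutral) (auto simp: root_basis_def)
  finally show "killing z w = 0" .
qed

lemma Phi_minus: "\<alpha> \<in> Phi n \<Longrightarrow> - \<alpha> \<in> Phi n"
  by (simp add: Phi_uminus)

lemma Phi_posD: "\<alpha> \<in> Phi_pos n \<Longrightarrow> \<alpha> \<in> Phi n"
  by (simp add: Phi_def)

text \<open>Otherwise x would be orthogonal to a basis.\<close>
lemma killing_opposite: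
  assumes \<alpha>: "\<alpha> \<in> Phi n" and x: "x \<in> rspace \<alpha>" "x \<noteq> 0" shows "killing x (rv (- \<alpha>)) \<noteq> 0"
proof
  assume zero: "killing x (rv (- \<alpha>)) = 0"
  have "x = 0"
  proof (rule killing_zero_on_basis[OF rspace_sp[OF x(1)]])
    fix i assume "i \<in> {1..n}"
    then have "tv i \<in> rspace 0" using tv_H H_rspace_zero by blast
    then show "killing x (tv i) = 0"
      using \<alpha> zero_notin_Phi by (intro killing_orth[OF x(1) _ weight_vec_Phi[OF \<alpha>] weight_vec_zero]) auto
  next
    fix \<beta> assume \<beta>: "\<beta> \<in> Phi n"
    show "killing x (rv \<beta>) = 0"
    proof (cases "\<alpha> + \<beta> = 0")
      case True
      then have "\<beta> = - \<alpha>" by (simp add: eq_neg_iff_add_eq_0 add.commute)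
      then show ?thesis using zero by simp
    qed (rule killing_orth[OF x(1) rv(1)[OF \<beta>] weight_vec_Phi[OF \<alpha>] weight_vec_Phi[OF \<beta>]])
  qed
  then show False using x(2) by simp
qed

lemma killing_pair: "\<alpha> \<in> Phi n \<Longrightarrow> killing (rv \<alpha>) (rv (- \<alpha>)) \<noteq> 0"
  by (rule killing_opposite[OF _ rv])

text \<open>Normalised so that \<open>fv\<close> and \<open>e\<close> are dual bases for the Killing form.\<close>
definition fv :: "weight \<Rightarrow> 'n cmat" where
  "fv \<alpha> = mscale (1 / killing (e \<alpha>) (rv (- \<alpha>))) (rv (- \<alpha>))"

definition tv' :: "nat \<Rightarrow> 'n cmat" where
  "tv' i = mscale (1 / of_int cc) (tv i)"

lemma rv_pos: "\<alpha> \<in> Phi_pos n \<Longrightarrow> rv \<alpha> = e \<alpha>"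
  by (simp add: rv_def)

lemma e_rspace: "\<alpha> \<in> Phi_pos n \<Longrightarrow> e \<alpha> \<in> rspace \<alpha>" and e_nonzero: "\<alpha> \<in> Phi_pos n \<Longrightarrow> e \<alpha> \<noteq> 0"
  using root_vectors by auto

lemma e_sp: "\<alpha> \<in> Phi_pos n \<Longrightarrow> e \<alpha> \<in> sp"
  using e_rspace rspace_sp by blast

lemma fv_rspace: assumes "\<alpha> \<in> Phi_pos n" shows "fv \<alpha> \<in> rspace (- \<alpha>)"
  unfolding fv_def by (intro mt.subspace_scale[OF rspace_subspace] rv(1) Phi_minus Phi_posD assms)

lemma fv_sp: "\<alpha> \<in> Phi_pos n \<Longrightarrow> fv \<alpha> \<in> sp"
  using fv_rspace rspace_sp by blast

lemma tv'_H: "i \<in> {1..n} \<Longrightarrow> tv' i \<in> H"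
  unfolding tv'_def by (intro H_scale tv_H)

lemma tv'_sp: "i \<in> {1..n} \<Longrightarrow> tv' i \<in> sp"
  using tv'_H H_sub by blast

lemma rv_neg: assumes "\<alpha> \<in> Phi_pos n" shows "rv (- \<alpha>) = mscale (killing (e \<alpha>) (rv (- \<alpha>))) (fv \<alpha>)"
  using killing_pair[OF Phi_posD[OF assms]] rv_pos[OF assms] by (simp add: fv_def)

lemma weight_vec_pos: "\<alpha> \<in> Phi_pos n \<Longrightarrow> weight_vec \<alpha>"
  using weight_vec_Phi Phi_posD by blast

lemma killing_e_f:
  assumes "\<alpha> \<in> Phi_pos n" "\<beta> \<in> Phi_pos n"
  shows "killing (e \<alpha>) (fv \<beta>) = (if \<alpha> = \<beta> then 1 else 0)" "killing (fv \<beta>) (e \<alpha>) = (if \<alpha> = \<beta> then 1 else 0)"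
proof -
  show 1: "killing (e \<alpha>) (fv \<beta>) = (if \<alpha> = \<beta> then 1 else 0)"
  proof (cases "\<alpha> = \<beta>")
    case True
    have "killing (e \<alpha>) (fv \<alpha>) = 1"
      using killing_pair[OF Phi_posD[OF assms(1)]] rv_pos[OF assms(1)] e_sp[OF assms(1)]
        rspace_sp[OF rv(1)[OF Phi_minus[OF Phi_posD[OF assms(1)]]]]
      by (simp add: fv_def killing_scale_right)
    then show ?thesis using True by simp
  next
    case False
    then have "\<alpha> + - \<beta> \<noteq> 0" by (simp add: algebra_simps)
    then have "killing (e \<alpha>) (fv \<beta>) = 0"
      using assms by (intro killing_orth[OF e_rspace fv_rspace] weight_vec_pos weight_vec_minus)
    then show ?thesis using False by simp
  qed
  then show "killing (fv \<beta>) (e \<alpha>) = (if \<alpha> = \<beta> then 1 else 0)"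
    using killing_sym[OF e_sp[OF assms(1)] fv_sp[OF assms(2)]] by simp
qed

lemma pos_sum_nonzero: assumes "\<alpha> \<in> Phi_pos n" "\<beta> \<in> Phi_pos n" shows "\<alpha> + \<beta> \<noteq> 0" "- \<alpha> + - \<beta> \<noteq> 0" "\<alpha> \<noteq> 0"
proof -
  have "wdot n (rho n) (\<alpha> + \<beta>) > 0" "wdot n (rho n) (- \<alpha> + - \<beta>) < 0" "wdot n (rho n) \<alpha> > 0"
    using rho_pos[OF assms(1)] rho_pos[OF assms(2)] unfolding wdot_simps by auto
  then show "\<alpha> + \<beta> \<noteq> 0" "- \<alpha> + - \<beta> \<noteq> 0" "\<alpha> \<noteq> 0" by (metis less_irrefl wdot_zero(2))+
qed

lemma killing_e_e: "\<alpha> \<in> Phi_pos n \<Longrightarrow> \<beta> \<in> Phi_pos n \<Longrightarrow> killing (e \<alpha>) (e \<beta>) = 0"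
  and killing_f_f: "\<alpha> \<in> Phi_pos n \<Longrightarrow> \<beta> \<in> Phi_pos n \<Longrightarrow> killing (fv \<alpha>) (fv \<beta>) = 0"
  by (intro killing_orth[OF e_rspace e_rspace] killing_orth[OF fv_rspace fv_rspace]
      weight_vec_pos weight_vec_minus pos_sum_nonzero; assumption)+

lemma killing_H_root:
  assumes "t \<in> H" "\<alpha> \<in> Phi_pos n"
  shows "killing t (e \<alpha>) = 0" "killing t (fv \<alpha>) = 0" "killing (e \<alpha>) t = 0" "killing (fv \<alpha>) t = 0"
proof -
  have t: "t \<in> rspace 0" using H_rspace_zero assms(1) by blast
  show 1: "killing t (e \<alpha>) = 0"
    using pos_sum_nonzero(3)[OF assms(2,2)]
    by (intro killing_orth[OF t e_rspace[OF assms(2)] weight_vec_zero weight_vec_pos[OF assms(2)]]) simp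
  show 2: "killing t (fv \<alpha>) = 0"
    using pos_sum_nonzero(3)[OF assms(2,2)]
    by (intro killing_orth[OF t fv_rspace[OF assms(2)] weight_vec_zero weight_vec_minus[OF weight_vec_pos[OF assms(2)]]]) simp
  show "killing (e \<alpha>) t = 0" "killing (fv \<alpha>) t = 0"
    using 1 2 killing_sym[OF H_sub[OF assms(1)] e_sp[OF assms(2)]] killing_sym[OF H_sub[OF assms(1)] fv_sp[OF assms(2)]]
    by auto
qed

lemma killing_tv': "i \<in> {1..n} \<Longrightarrow> z \<in> sp \<Longrightarrow> killing z (tv' i) = killing z (tv i) / of_int cc"
  by (simp add: tv'_def killing_scale_right tv_sp)

lemma killing_expand:
  assumes z: "z \<in> sp"
  shows "z = (\<Sum>a\<in>Phi_pos n. mscale (killing z (fv a)) (e a)) +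
     ((\<Sum>a\<in>Phi_pos n. mscale (killing z (e a)) (fv a)) + (\<Sum>i\<in>{1..n}. mscale (killing z (tv' i)) (tv i)))"
    (is "z = ?X + (?Y + ?Z)")
proof -
  have sp: "?X \<in> sp" "?Y \<in> sp" "?Z \<in> sp"
    by (intro sp.sum_closed sp.scale_closed e_sp fv_sp tv_sp; assumption)+
  define w where "w = z + mscale (-1) (?X + (?Y + ?Z))"
  have wsp: "w \<in> sp" unfolding w_def using z sp by (intro sp.add_closed sp.scale_closed)
  have kw: "killing w x = killing z x - ((\<Sum>a\<in>Phi_pos n. killing z (fv a) * killing (e a) x) +
     ((\<Sum>a\<in>Phi_pos n. killing z (e a) * killing (fv a) x) + (\<Sum>i\<in>{1..n}. killing z (tv' i) * killing (tv i) x)))"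
    if x: "x \<in> sp" for x
  proof -
    have k: "killing ?X x = (\<Sum>a\<in>Phi_pos n. killing z (fv a) * killing (e a) x)"
      "killing ?Y x = (\<Sum>a\<in>Phi_pos n. killing z (e a) * killing (fv a) x)"
      "killing ?Z x = (\<Sum>i\<in>{1..n}. killing z (tv' i) * killing (tv i) x)"
      by (intro killing_sum e_sp fv_sp tv_sp x; assumption)+
    have "killing w x = killing z x + (-1) * (killing ?X x + (killing ?Y x + killing ?Z x))"
      unfolding w_def using z sp x
      by (simp only: killing_add killing_scale sp.add_closed sp.scale_closed)
    then show ?thesis unfolding k by simp
  qed
  have we: "killing w (e \<beta>) = 0" and wf: "killing w (fv \<beta>) = 0" if \<beta>: "\<beta> \<in> Phi_pos n" for \<beta>
  proof -
    have "(\<Sum>a\<in>Phi_pos n. killing z (fv a) * killing (e a) (e \<beta>)) = 0"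
      "(\<Sum>a\<in>Phi_pos n. killing z (e a) * killing (fv a) (fv \<beta>)) = 0"
      "(\<Sum>i\<in>{1..n}. killing z (tv' i) * killing (tv i) (e \<beta>)) = 0"
      "(\<Sum>i\<in>{1..n}. killing z (tv' i) * killing (tv i) (fv \<beta>)) = 0"
      using \<beta> by (auto intro!: sum.neutral simp: killing_e_e killing_f_f killing_H_root tv_H)
    moreover have "(\<Sum>a\<in>Phi_pos n. killing z (e a) * killing (fv a) (e \<beta>)) = killing z (e \<beta>)"
    proof -
      have "(\<Sum>a\<in>Phi_pos n. killing z (e a) * killing (fv a) (e \<beta>)) = (\<Sum>a\<in>Phi_pos n. if a = \<beta> then killing z (e a) else 0)"
        using \<beta> by (intro sum.cong refl) (auto simp: killing_e_f)
      then show ?thesis using \<beta> finite_Phi_pos by simp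
    qed
    moreover have "(\<Sum>a\<in>Phi_pos n. killing z (fv a) * killing (e a) (fv \<beta>)) = killing z (fv \<beta>)"
    proof -
      have "(\<Sum>a\<in>Phi_pos n. killing z (fv a) * killing (e a) (fv \<beta>)) = (\<Sum>a\<in>Phi_pos n. if a = \<beta> then killing z (fv a) else 0)"
        using \<beta> by (intro sum.cong refl) (auto simp: killing_e_f)
      then show ?thesis using \<beta> finite_Phi_pos by simp
    qed
    ultimately show "killing w (e \<beta>) = 0" "killing w (fv \<beta>) = 0"
      using kw[OF e_sp[OF \<beta>]] kw[OF fv_sp[OF \<beta>]] by simp_all
  qed
  have wt: "killing w (tv j) = 0" if j: "j \<in> {1..n}" for j
  proof -
    have "(\<Sum>a\<in>Phi_pos n. killing z (fv a) * killing (e a) (tv j)) = 0"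
      "(\<Sum>a\<in>Phi_pos n. killing z (e a) * killing (fv a) (tv j)) = 0"
      using j by (auto intro!: sum.neutral simp: killing_H_root tv_H)
    moreover have "(\<Sum>i\<in>{1..n}. killing z (tv' i) * killing (tv i) (tv j)) = (\<Sum>i\<in>{1..n}. if i = j then killing z (tv i) else 0)"
      using j z cc_pos by (intro sum.cong refl) (auto simp: killing_tv killing_tv')
    ultimately show ?thesis using kw[OF tv_sp[OF j]] j by simp
  qed
  have "w = 0"
  proof (rule killing_zero_on_basis[OF wsp wt])
    fix \<alpha> assume "\<alpha> \<in> Phi n"
    then consider "\<alpha> \<in> Phi_pos n" | "- \<alpha> \<in> Phi_pos n" using Phi_cases by blast
    then show "killing w (rv \<alpha>) = 0"
    proof cases
      case 1
      then show ?thesis using we rv_pos by simp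
    next
      case 2
      obtain c where c: "rv \<alpha> = mscale c (fv (- \<alpha>))" using rv_neg[OF 2] by simp
      show ?thesis unfolding c killing_scale_right[OF fv_sp[OF 2] wsp] wf[OF 2] by simp
    qed
  qed
  moreover have "a + mscale (-1) b = 0 \<Longrightarrow> a = b" for a b :: "'n cmat" by simp
  ultimately show ?thesis unfolding w_def by blast
qed

lemma rspace_zero_H: assumes x: "x \<in> rspace 0" shows "x \<in> H"
proof -
  have "killing x (fv a) = 0" "killing x (e a) = 0" if a: "a \<in> Phi_pos n" for a
    using pos_sum_nonzero(3)[OF a a]
    by (auto intro!: killing_orth[OF x fv_rspace[OF a] weight_vec_zero weight_vec_minus[OF weight_vec_pos[OF a]]]
        killing_orth[OF x e_rspace[OF a] weight_vec_zero weight_vec_pos[OF a]])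
  then have "x = (\<Sum>i\<in>{1..n}. mscale (killing x (tv' i)) (tv i))"
    using killing_expand[OF rspace_sp[OF x]] by simp
  moreover have "\<dots> \<in> H" by (intro mt.subspace_sum[OF H_subspace] H_scale tv_H)
  ultimately show ?thesis by simp
qed

lemma rspace_pos: assumes \<alpha>: "\<alpha> \<in> Phi_pos n" and x: "x \<in> rspace \<alpha>" shows "x = mscale (killing x (fv \<alpha>)) (e \<alpha>)"
proof -
  have xe: "killing x (e a) = 0" if a: "a \<in> Phi_pos n" for a
    by (rule killing_orth[OF x e_rspace[OF a] weight_vec_pos[OF \<alpha>] weight_vec_pos[OF a] pos_sum_nonzero(1)[OF \<alpha> a]])
  have xt: "killing x (tv' i) = 0" if i: "i \<in> {1..n}" for i
  proof -
    have "tv' i \<in> rspace 0" using tv'_H[OF i] H_rspace_zero by blast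
    then show ?thesis using pos_sum_nonzero(3)[OF \<alpha> \<alpha>]
      by (intro killing_orth[OF x _ weight_vec_pos[OF \<alpha>] weight_vec_zero]) auto
  qed
  have xf: "killing x (fv a) = 0" if a: "a \<in> Phi_pos n" "a \<noteq> \<alpha>" for a
  proof -
    have "\<alpha> + - a \<noteq> 0" using a by (simp add: algebra_simps)
    then show ?thesis
      by (rule killing_orth[OF x fv_rspace[OF a(1)] weight_vec_pos[OF \<alpha>] weight_vec_minus[OF weight_vec_pos[OF a(1)]]])
  qed
  have "x = (\<Sum>a\<in>Phi_pos n. mscale (killing x (fv a)) (e a))"
    using killing_expand[OF rspace_sp[OF x]] xe xt by simp
  also have "\<dots> = (\<Sum>a\<in>Phi_pos n. if a = \<alpha> then mscale (killing x (fv a)) (e a) else 0)"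
    using xf by (intro sum.cong refl) auto
  also have "\<dots> = mscale (killing x (fv \<alpha>)) (e \<alpha>)" using \<alpha> finite_Phi_pos by simp
  finally show ?thesis .
qed

subsection \<open>The Borel subalgebra and its nilradical\<close>

definition nn :: "'n cmat set" where "nn = mt.span (e ` Phi_pos n)"

abbreviation bb :: "'n cmat set" where "bb \<equiv> borel_sub H \<epsilon>"

lemma bb_eq: "bb = mt.span (H \<union> (\<Union>\<alpha>\<in>Phi_pos n. rspace \<alpha>))"
  unfolding borel_sub_def n ..

lemma H_bb: "t \<in> H \<Longrightarrow> t \<in> bb" and rspace_bb: "\<alpha> \<in> Phi_pos n \<Longrightarrow> x \<in> rspace \<alpha> \<Longrightarrow> x \<in> bb"
  unfolding bb_eq by (auto intro: mt.span_base)

lemma nn_subspace: "mt.subspace nn"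
  by (simp add: nn_def)

lemma e_nn: "\<alpha> \<in> Phi_pos n \<Longrightarrow> e \<alpha> \<in> nn"
  unfolding nn_def by (intro mt.span_base) auto

lemma nn_sp: "nn \<subseteq> sp"
  unfolding nn_def by (rule mt.span_minimal[OF _ subspace_sp]) (auto intro: e_sp)

lemma nn_induct:
  assumes "x \<in> nn" "mt.subspace {x. P x}" "\<And>\<alpha>. \<alpha> \<in> Phi_pos n \<Longrightarrow> P (e \<alpha>)" shows "P x"
  using mt.span_induct[of x "e ` Phi_pos n" P] assms unfolding nn_def by blast

lemma rspace_nn: assumes "\<alpha> \<in> Phi_pos n" "x \<in> rspace \<alpha>" shows "x \<in> nn"
  using rspace_pos[OF assms] mt.subspace_scale[OF nn_subspace e_nn[OF assms(1)]] by metis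

lemma br_subspace: assumes "mt.subspace W" shows "mt.subspace {x. br y x \<in> W}" "mt.subspace {x. br x y \<in> W}"
  using assms by (auto intro!: mt.subspaceI simp: br_add_right br_scale_right br_add_left br_scale_left
      mt.subspace_0 mt.subspace_add mt.subspace_scale)

lemma br_H_nn: assumes "t \<in> H" "x \<in> nn" shows "br t x \<in> nn"
  using assms(2)
  by (rule nn_induct[OF _ br_subspace(1)[OF nn_subspace]])
    (simp add: rspace_br[OF e_rspace assms(1)] mt.subspace_scale[OF nn_subspace] e_nn)

lemma br_e_e:
  assumes "\<alpha> \<in> Phi_pos n" "\<beta> \<in> Phi_pos n"
  shows "br (e \<alpha>) (e \<beta>) \<in> rspace (\<alpha> + \<beta>)" "\<alpha> + \<beta> \<notin> Phi_pos n \<Longrightarrow> br (e \<alpha>) (e \<beta>) = 0"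
proof -
  show 1: "br (e \<alpha>) (e \<beta>) \<in> rspace (\<alpha> + \<beta>)" by (rule br_rspace[OF e_rspace[OF assms(1)] e_rspace[OF assms(2)]])
  assume "\<alpha> + \<beta> \<notin> Phi_pos n"
  moreover have "wdot n (rho n) (\<alpha> + \<beta>) > 0"
    using rho_pos[OF assms(1)] rho_pos[OF assms(2)] unfolding wdot_simps by simp
  ultimately have "\<alpha> + \<beta> \<notin> Phi n" unfolding Phi_pos_iff by simp
  then show "br (e \<alpha>) (e \<beta>) = 0"
    by (rule rspace_trivial[OF weight_vec_add[OF weight_vec_pos[OF assms(1)] weight_vec_pos[OF assms(2)]]
          pos_sum_nonzero(1)[OF assms] _ 1])
qed

lemma br_e_e_nn: "\<alpha> \<in> Phi_pos n \<Longrightarrow> \<beta> \<in> Phi_pos n \<Longrightarrow> br (e \<alpha>) (e \<beta>) \<in> nn"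
  using br_e_e rspace_nn mt.subspace_0[OF nn_subspace] by metis

lemma br_nn: assumes "x \<in> nn" "y \<in> nn" shows "br x y \<in> nn"
  using assms(1)
proof (rule nn_induct[OF _ br_subspace(2)[OF nn_subspace]])
  fix \<alpha> assume \<alpha>: "\<alpha> \<in> Phi_pos n"
  show "br (e \<alpha>) y \<in> nn"
    using assms(2) by (rule nn_induct[OF _ br_subspace(1)[OF nn_subspace]]) (rule br_e_e_nn[OF \<alpha>])
qed

lemma nn_perp: assumes "z \<in> nn" shows "\<alpha> \<in> Phi_pos n \<Longrightarrow> killing z (e \<alpha>) = 0" "t \<in> H \<Longrightarrow> killing z t = 0"
proof -
  have sub: "mt.subspace {z. z \<in> sp \<and> killing z y = 0}" if "y \<in> sp" for y
  proof -
    have "killing 0 y = 0" using killing_scale[OF sp.zero_closed that, of 0] by simp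
    then show ?thesis
      using that by (auto intro!: mt.subspaceI simp: sp.zero_closed sp.add_closed sp.scale_closed killing_add killing_scale)
  qed
  show "killing z (e \<alpha>) = 0" if "\<alpha> \<in> Phi_pos n"
    using nn_induct[OF assms sub[OF e_sp[OF that]]] by (simp add: e_sp killing_e_e that)
  show "killing z t = 0" if "t \<in> H"
    using nn_induct[OF assms sub[OF H_sub[OF that]]] by (simp add: e_sp killing_H_root that)
qed

lemma bb_decompose: assumes "z \<in> bb" obtains t u where "t \<in> H" "u \<in> nn" "z = t + u"
proof -
  have "mt.subspace {t + u |t u. t \<in> H \<and> u \<in> nn}" by (rule mt.subspace_sums[OF H_subspace nn_subspace])
  moreover have "H \<union> (\<Union>\<alpha>\<in>Phi_pos n. rspace \<alpha>) \<subseteq> {t + u |t u. t \<in> H \<and> u \<in> nn}"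
  proof
    fix x assume "x \<in> H \<union> (\<Union>\<alpha>\<in>Phi_pos n. rspace \<alpha>)"
    then consider "x \<in> H" | "x \<in> nn" using rspace_nn by blast
    then show "x \<in> {t + u |t u. t \<in> H \<and> u \<in> nn}"
    proof cases
      case 1
      then have "x = x + 0 \<and> x \<in> H \<and> 0 \<in> nn" using mt.subspace_0[OF nn_subspace] by simp
      then show ?thesis by blast
    next
      case 2
      then have "x = 0 + x \<and> 0 \<in> H \<and> x \<in> nn" using mt.subspace_0[OF H_subspace] by simp
      then show ?thesis by blast
    qed
  qed
  ultimately have "bb \<subseteq> {t + u |t u. t \<in> H \<and> u \<in> nn}" unfolding bb_eq by (intro mt.span_minimal)
  then show thesis using assms that by blast
qed

lemma nilrad_eq: "nilrad H \<epsilon> = nn"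
proof
  have "br x y \<in> nn" if x: "x \<in> bb" and y: "y \<in> bb" for x y
  proof -
    obtain t u where t: "t \<in> H" "u \<in> nn" "x = t + u" using x by (rule bb_decompose)
    obtain t' u' where t': "t' \<in> H" "u' \<in> nn" "y = t' + u'" using y by (rule bb_decompose)
    have "br u t' \<in> nn" using br_H_nn[OF t'(1) t(2)] mt.subspace_neg[OF nn_subspace] by (metis br_anti)
    then show ?thesis
      using H_abelian[OF t(1) t'(1)] br_H_nn[OF t(1) t'(2)] br_nn[OF t(2) t'(2)]
      by (simp add: t(3) t'(3) br_add_left br_add_right mt.subspace_add[OF nn_subspace])
  qed
  then show "nilrad H \<epsilon> \<subseteq> nn"
    unfolding nilrad_def br_span_def by (intro mt.span_minimal[OF _ nn_subspace]) auto
  have "e \<alpha> \<in> nilrad H \<epsilon>" if \<alpha>: "\<alpha> \<in> Phi_pos n" for \<alpha>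
  proof -
    obtain k where k: "k \<in> {1..n}" "\<alpha> k \<noteq> 0 k"
      using weight_separate[OF weight_vec_pos[OF \<alpha>] weight_vec_zero pos_sum_nonzero(3)[OF \<alpha> \<alpha>]] by blast
    have eq: "br (mscale (1 / of_int (\<alpha> k)) (tv k)) (e \<alpha>) = e \<alpha>"
      using k rspace_br[OF e_rspace[OF \<alpha>] tv_H[OF k(1)]] by (simp add: br_scale_left wt_tv)
    have "mscale (1 / of_int (\<alpha> k)) (tv k) \<in> bb" by (intro H_bb H_scale tv_H k)
    moreover have "e \<alpha> \<in> bb" by (rule rspace_bb[OF \<alpha> e_rspace[OF \<alpha>]])
    ultimately have "br (mscale (1 / of_int (\<alpha> k)) (tv k)) (e \<alpha>) \<in> nilrad H \<epsilon>"
      unfolding nilrad_def br_span_def by (intro mt.span_base) blast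
    then show ?thesis unfolding eq .
  qed
  then show "nn \<subseteq> nilrad H \<epsilon>"
    unfolding nn_def by (intro mt.span_minimal) (auto simp: nilrad_def br_span_def)
qed

lemma e_inj: "inj_on e (Phi_pos n)"
  by (rule inj_onI) (metis e_rspace e_nonzero rspace_unique weight_vec_pos)

lemma basis_nn: "basis_of nn (e ` Phi_pos n)"
proof -
  have "e ` Phi_pos n \<subseteq> root_basis" using rv_pos Phi_posD by (force simp: root_basis_def)
  then have "mt.independent (e ` Phi_pos n)" using root_basis_independent mt.independent_mono by blast
  then show ?thesis by (simp add: basis_of_def nn_def finite_Phi_pos)
qed

lemma dual_root_basis_nn:
  assumes "\<alpha> \<in> Phi_pos n"
  shows "z \<in> nn \<Longrightarrow> dual_root_basis e \<alpha> z = killing z (fv \<alpha>)" and "z \<notin> nn \<Longrightarrow> dual_root_basis e \<alpha> z = 0"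
proof -
  assume z: "z \<in> nn"
  have "killing z (fv \<alpha>) = (\<Sum>u\<in>e ` Phi_pos n. mt.representation (e ` Phi_pos n) z u * killing u (fv \<alpha>))"
    by (rule linear_basis_expand[OF basis_nn z, where \<phi> = "\<lambda>z. killing z (fv \<alpha>)"])
      (auto simp: killing_add killing_scale fv_sp[OF assms] subsetD[OF nn_sp])
  also have "\<dots> = (\<Sum>\<beta>\<in>Phi_pos n. if \<beta> = \<alpha> then mt.representation (e ` Phi_pos n) z (e \<beta>) else 0)"
    unfolding sum.reindex[OF e_inj] o_def using assms by (intro sum.cong refl) (simp add: killing_e_f)
  also have "\<dots> = dual_root_basis e \<alpha> z"
    using assms finite_Phi_pos by (simp add: dual_root_basis_def n)
  finally show "dual_root_basis e \<alpha> z = killing z (fv \<alpha>)" by simp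
next
  assume "z \<notin> nn"
  then show "dual_root_basis e \<alpha> z = 0" unfolding dual_root_basis_def n[symmetric] mt.representation_def nn_def by auto
qed

subsection \<open>The Laplacian on weight spaces\<close>

text \<open>The usual identity \<open>[x, y] = B(x, y) t\<^sub>\<alpha>\<close>, where \<open>t\<^sub>\<alpha>\<close> represents \<open>\<alpha>\<close> by the Killing form.\<close>
lemma br_opposite:
  assumes \<alpha>: "weight_vec \<alpha>" and x: "x \<in> rspace \<alpha>" and y: "y \<in> rspace (- \<alpha>)"
  shows "br x y \<in> H" "wt \<epsilon> \<mu> (br x y) = killing x y * of_int (wdot n \<mu> \<alpha>) / of_int cc"
proof -
  define t where "t = br x y"
  have "t \<in> rspace (\<alpha> + - \<alpha>)" unfolding t_def by (rule br_rspace[OF x y])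
  then have tH: "t \<in> H" using rspace_zero_H by simp
  then show "br x y \<in> H" by (simp add: t_def)
  have "killing t (tv k) = killing x y * of_int (\<alpha> k)" if k: "k \<in> {1..n}" for k
  proof -
    have "killing t (tv k) = killing x (br y (tv k))"
      unfolding t_def by (rule killing_invariant[OF rspace_sp[OF x] rspace_sp[OF y] tv_sp[OF k]])
    also have "br y (tv k) = mscale (of_int (\<alpha> k)) y"
      using rspace_br[OF y tv_H[OF k]] by (simp add: br_anti[of y "tv k"] wt_tv[OF k])
    also have "killing x (mscale (of_int (\<alpha> k)) y) = of_int (\<alpha> k) * killing x y"
      by (rule killing_scale_right[OF rspace_sp[OF y] rspace_sp[OF x]])
    finally show ?thesis by simp
  qed
  moreover have "t = (\<Sum>i\<in>{1..n}. mscale (killing t (tv' i)) (tv i))"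
    using killing_expand[OF H_sub[OF tH]] by (simp add: killing_H_root[OF tH])
  ultimately have "t = (\<Sum>i\<in>{1..n}. mscale (killing x y * of_int (\<alpha> i) / of_int cc) (tv i))"
    using H_sub[OF tH] by (simp add: killing_tv')
  then have "wt \<epsilon> \<mu> t = (\<Sum>i = 1..n. killing x y * of_int (\<alpha> i) / of_int cc * of_int (\<mu> i))"
    using wt_tv_combination[of \<mu> "\<lambda>i. killing x y * of_int (\<alpha> i) / of_int cc"] by simp
  also have "\<dots> = killing x y * of_int (wdot n \<mu> \<alpha>) / of_int cc"
    by (simp add: wdot_def sum_divide_distrib[symmetric] sum_distrib_left mult_ac)
  finally show "wt \<epsilon> \<mu> (br x y) = killing x y * of_int (wdot n \<mu> \<alpha>) / of_int cc" by (simp add: t_def)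
qed

lemma coroot: assumes a: "a \<in> Phi_pos n"
  shows "br (fv a) (e a) \<in> H" "wt \<epsilon> \<mu> (br (fv a) (e a)) = - of_int (wdot n \<mu> a) / of_int cc"
proof -
  have e: "e a \<in> rspace (- (- a))" using e_rspace[OF a] by simp
  note * = br_opposite[OF weight_vec_minus[OF weight_vec_pos[OF a]] fv_rspace[OF a] e]
  show "br (fv a) (e a) \<in> H" by (rule *(1))
  show "wt \<epsilon> \<mu> (br (fv a) (e a)) = - of_int (wdot n \<mu> a) / of_int cc"
    using *(2)[of \<mu>] killing_e_f(2)[OF a a] by (simp add: wdot_minus_right)
qed

sublocale dual_bases sp nn killing "Phi_pos n" e fv "{1..n}" tv tv'
proof
  show "\<And>a b. a \<in> Phi_pos n \<Longrightarrow> b \<in> Phi_pos n \<Longrightarrow> killing (br (fv a) (e a)) (fv b) = 0"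
    by (intro killing_H_root coroot)
  show "\<And>z. z \<in> sp \<Longrightarrow> z = (\<Sum>a\<in>Phi_pos n. mscale (killing z (fv a)) (e a)) +
        ((\<Sum>a\<in>Phi_pos n. mscale (killing z (e a)) (fv a)) + (\<Sum>i\<in>{1..n}. mscale (killing z (tv' i)) (tv i)))"
    by (rule killing_expand)
qed (use nn_sp in \<open>auto simp: nn_subspace br_nn killing_add killing_scale killing_sym killing_invariant
      e_nn fv_sp tv_sp tv'_sp nn_perp tv'_H killing_f_f killing_H_root tv_H br_H_nn\<close>)

lemma lie_der_H:
  assumes \<omega>: "alt_multilinear sp \<omega>" and t: "t \<in> H" and l: "set l \<subseteq> Phi_pos n"
  shows "lie_der t \<omega> (map e l) = - wt \<epsilon> (sum_list l) t * \<omega> (map e l)"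
proof -
  have el: "set (map e l) \<subseteq> sp" using l e_sp by auto
  have "\<omega> ((map e l)[j := br t (map e l ! j)]) = wt \<epsilon> (l ! j) t * \<omega> (map e l)" if j: "j < length l" for j
  proof -
    have lj: "l ! j \<in> Phi_pos n" using j l nth_mem by blast
    have "(map e l)[j := br t (map e l ! j)] = (map e l)[j := mscale (wt \<epsilon> (l ! j) t) (e (l ! j))]"
      using j rspace_br[OF e_rspace[OF lj] t] by simp
    also have "\<omega> \<dots> = wt \<epsilon> (l ! j) t * \<omega> ((map e l)[j := e (l ! j)])"
      using j by (intro sp.alt_update_scale[OF \<omega> el _ e_sp[OF lj]]) simp
    also have "(map e l)[j := e (l ! j)] = map e l"
      using j list_update_id[of "map e l" j] by simp
    finally show ?thesis .
  qed
  then have "lie_der t \<omega> (map e l) = - (\<Sum>j<length l. wt \<epsilon> (l ! j) t) * \<omega> (map e l)"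
    by (simp add: lie_der_conv_sum sum_distrib_right)
  also have "(\<Sum>j<length l. wt \<epsilon> (l ! j) t) = wt \<epsilon> (sum_list l) t"
  proof -
    have "(\<Sum>x\<leftarrow>l. wt \<epsilon> x t) = wt \<epsilon> (sum_list l) t"
      by (induction l) (simp_all only: list.map sum_list.Nil sum_list.Cons wt_zero wt_add)
    then show ?thesis by (simp add: sum_list_sum_nth atLeast0LessThan)
  qed
  finally show ?thesis .
qed

text \<open>In the homotopy formula the brackets \<open>[f\<^sub>\<alpha>, e\<^sub>\<alpha>]\<close> act by \<open>\<langle>\<mu>, \<alpha>\<rangle>\<close>, which sums to
  \<open>2 \<langle>\<rho>, \<mu>\<rangle>\<close>, and the Casimir element of H acts by \<open>\<langle>\<mu>, \<mu>\<rangle>\<close>.\<close>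
theorem laplacian_weight:
  assumes \<omega>: "alt_multilinear nn \<omega>" and l: "set l \<subseteq> Phi_pos n"
  defines "s \<equiv> sum_list l"
  shows "cartan_d (homotopy \<omega>) (map e l) + homotopy (cartan_d \<omega>) (map e l) =
    of_int (2 * wdot n (rho n) s - wdot n s s) / of_int cc * \<omega> (map e l)"
proof -
  have el: "set (map e l) \<subseteq> nn" using l e_nn by auto
  note E = alt_extend[OF \<omega>]
  have 1: "(\<Sum>a\<in>Phi_pos n. lie_der (br (fv a) (e a)) (extend \<omega>) (map e l)) =
      of_int (2 * wdot n (rho n) s) / of_int cc * \<omega> (map e l)"
  proof -
    have "(\<Sum>a\<in>Phi_pos n. lie_der (br (fv a) (e a)) (extend \<omega>) (map e l)) =
        (\<Sum>a\<in>Phi_pos n. of_int (wdot n s a) / of_int cc * \<omega> (map e l))"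
      by (intro sum.cong refl) (simp add: lie_der_H[OF E coroot(1) l] coroot(2) extend_N[OF el] s_def)
    also have "\<dots> = of_int (\<Sum>a\<in>Phi_pos n. wdot n s a) / of_int cc * \<omega> (map e l)"
      by (simp add: sum_distrib_right sum_divide_distrib)
    finally show ?thesis by (simp add: wdot_sum_Phi_pos)
  qed
  have 2: "(\<Sum>i\<in>{1..n}. lie_der (tv' i) (lie_der (tv i) (extend \<omega>)) (map e l)) =
      of_int (wdot n s s) / of_int cc * \<omega> (map e l)"
  proof -
    have "(\<Sum>i\<in>{1..n}. lie_der (tv' i) (lie_der (tv i) (extend \<omega>)) (map e l)) =
        (\<Sum>i\<in>{1..n}. of_int (s i * s i) / of_int cc * \<omega> (map e l))"
    proof (intro sum.cong refl)
      fix i assume i: "i \<in> {1..n}"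
      have "wt \<epsilon> s (tv' i) = of_int (s i) / of_int cc"
        unfolding tv'_def by (simp add: wt_linear(2)[OF tv_H[OF i]] wt_tv[OF i])
      then show "lie_der (tv' i) (lie_der (tv i) (extend \<omega>)) (map e l) = of_int (s i * s i) / of_int cc * \<omega> (map e l)"
        using lie_der_H[OF sp.alt_lie_der[OF E tv_sp[OF i]] tv'_H[OF i] l] lie_der_H[OF E tv_H[OF i] l]
        by (simp add: extend_N[OF el] wt_tv[OF i] s_def[symmetric])
    qed
    then show ?thesis by (simp add: wdot_def sum_distrib_right sum_divide_distrib)
  qed
  show ?thesis unfolding homotopy_formula[OF \<omega> el] 1 2 by (simp add: diff_divide_distrib left_diff_distrib)
qed

end

section \<open>Abelian ideals of the Borel subalgebra\<close>

context sp_roots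
begin

text \<open>At an obtuse angle \<open>\<beta> - \<alpha>\<close> is too long to be a root. If the bracket vanished too, the coroot
  \<open>[e\<^sub>\<alpha>, e\<^bsub>-\<alpha>\<^esub>]\<close> would kill \<open>e\<^sub>\<beta>\<close>, contradicting that the roots are not orthogonal.\<close>
lemma br_nonzero_obtuse:
  assumes \<alpha>: "\<alpha> \<in> Phi n" and \<beta>: "\<beta> \<in> Phi n" and neg: "wdot n \<alpha> \<beta> < 0"
  shows "br (rv \<alpha>) (rv \<beta>) \<noteq> 0"
proof
  assume zero: "br (rv \<alpha>) (rv \<beta>) = 0"
  define f where "f = rv (- \<alpha>)"
  have f: "f \<in> rspace (- \<alpha>)" unfolding f_def by (rule rv(1)[OF Phi_minus[OF \<alpha>]])
  have norm: "wdot n (- \<alpha> + \<beta>) (- \<alpha> + \<beta>) > 4"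
    using wdot_Phi[OF \<alpha>] wdot_Phi[OF \<beta>] neg wdot_commute[of n \<beta> \<alpha>] unfolding wdot_simps by auto
  then have "- \<alpha> + \<beta> \<noteq> 0" "- \<alpha> + \<beta> \<notin> Phi n" using wdot_Phi[of "- \<alpha> + \<beta>" n] by auto
  then have fb: "br f (rv \<beta>) = 0"
    by (rule rspace_trivial[OF weight_vec_add[OF weight_vec_minus[OF weight_vec_Phi[OF \<alpha>]] weight_vec_Phi[OF \<beta>]]
          _ _ br_rspace[OF f rv(1)[OF \<beta>]]])
  note h = br_opposite[OF weight_vec_Phi[OF \<alpha>] rv(1)[OF \<alpha>] f]
  have "br (br (rv \<alpha>) f) (rv \<beta>) = 0" unfolding br_jacobi[of "rv \<alpha>" f] fb zero by simp
  then have "mscale (wt \<epsilon> \<beta> (br (rv \<alpha>) f)) (rv \<beta>) = 0" using rspace_br[OF rv(1)[OF \<beta>] h(1)] by simp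
  then have "killing (rv \<alpha>) f * of_int (wdot n \<beta> \<alpha>) / of_int cc = 0"
    using rv(2)[OF \<beta>] h(2)[of \<beta>] by simp
  then show False
    using killing_pair[OF \<alpha>] neg cc_pos by (simp add: f_def wdot_commute[of n \<beta> \<alpha>])
qed

text \<open>In a triple of roots with sum zero each bracket of two pairs with the third by the invariant form,
  so the three brackets vanish together; two of the three roots form an obtuse angle.\<close>
lemma br_nonzero:
  assumes \<alpha>: "\<alpha> \<in> Phi n" and \<beta>: "\<beta> \<in> Phi n" and sum: "\<alpha> + \<beta> \<in> Phi n"
  shows "br (rv \<alpha>) (rv \<beta>) \<noteq> 0"
proof (cases "wdot n \<alpha> \<beta> < 0")
  case True
  then show ?thesis by (rule br_nonzero_obtuse[OF \<alpha> \<beta>])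
next
  case False
  define \<gamma> where "\<gamma> = - (\<alpha> + \<beta>)"
  have \<gamma>: "\<gamma> \<in> Phi n" unfolding \<gamma>_def by (rule Phi_minus[OF sum])
  have "wdot n \<gamma> \<alpha> < 0"
    using wdot_Phi[OF \<alpha>] False unfolding \<gamma>_def wdot_simps by (auto simp: wdot_commute[of n \<beta> \<alpha>])
  then have nz: "br (rv \<gamma>) (rv \<alpha>) \<noteq> 0" by (rule br_nonzero_obtuse[OF \<gamma> \<alpha>])
  have "br (rv \<gamma>) (rv \<alpha>) \<in> rspace (\<gamma> + \<alpha>)" by (rule br_rspace[OF rv(1)[OF \<gamma>] rv(1)[OF \<alpha>]])
  also have "\<gamma> + \<alpha> = - \<beta>" by (simp add: \<gamma>_def)
  finally have "killing (br (rv \<gamma>) (rv \<alpha>)) (rv (- (- \<beta>))) \<noteq> 0"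
    using nz by (intro killing_opposite[OF Phi_minus[OF \<beta>]])
  then have "killing (rv \<gamma>) (br (rv \<alpha>) (rv \<beta>)) \<noteq> 0"
    using killing_invariant[OF rspace_sp rspace_sp rspace_sp, OF rv(1)[OF \<gamma>] rv(1)[OF \<alpha>] rv(1)[OF \<beta>]] by simp
  moreover have "killing (rv \<gamma>) 0 = 0"
    using killing_scale_right[OF sp.zero_closed rspace_sp[OF rv(1)[OF \<gamma>]], of 0] by simp
  ultimately show ?thesis by auto
qed

lemma br_e_nonzero:
  assumes "\<alpha> \<in> Phi_pos n" "\<beta> \<in> Phi_pos n" "\<alpha> + \<beta> \<in> Phi_pos n" shows "br (e \<alpha>) (e \<beta>) \<noteq> 0"
  using br_nonzero[OF Phi_posD[OF assms(1)] Phi_posD[OF assms(2)] Phi_posD[OF assms(3)]]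
  by (simp add: rv_pos assms(1,2))

lemma ideal_roots_eq: "ideal_roots H \<epsilon> I = {\<alpha> \<in> Phi_pos n. rspace \<alpha> \<subseteq> I}"
  unfolding ideal_roots_def n ..

lemma rspace_sub_iff:
  assumes "mt.subspace I" "\<alpha> \<in> Phi_pos n" shows "rspace \<alpha> \<subseteq> I \<longleftrightarrow> e \<alpha> \<in> I"
proof
  assume "e \<alpha> \<in> I"
  then show "rspace \<alpha> \<subseteq> I"
    using rspace_pos[OF assms(2)] mt.subspace_scale[OF assms(1)] by (metis subsetI)
qed (use e_rspace[OF assms(2)] in blast)

lemma mscale_cancel_mem: "mt.subspace I \<Longrightarrow> mscale c x \<in> I \<Longrightarrow> c \<noteq> 0 \<Longrightarrow> x \<in> I"
  using mt.subspace_scale[of I "mscale c x" "1 / c"] by simp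

context
  fixes I assumes I: "I \<in> abelian_ideals bb"
begin

lemma I_subspace: "mt.subspace I" and I_bb: "x \<in> I \<Longrightarrow> x \<in> bb"
  and I_br: "x \<in> bb \<Longrightarrow> y \<in> I \<Longrightarrow> br x y \<in> I"
  and I_abelian: "x \<in> I \<Longrightarrow> y \<in> I \<Longrightarrow> br x y = 0"
  using I unfolding abelian_ideals_def by blast+

text \<open>Bracketing t with a root vector gives a multiple of that root vector in I, which must commute with
  t; so all positive roots vanish on t.\<close>
lemma I_H: assumes "t \<in> I" "t \<in> H" shows "t = 0"
proof -
  have root0: "wt \<epsilon> \<alpha> t = 0" if \<alpha>: "\<alpha> \<in> Phi_pos n" for \<alpha>
  proof -
    have tx: "br t (e \<alpha>) = mscale (wt \<epsilon> \<alpha> t) (e \<alpha>)" by (rule rspace_br[OF e_rspace[OF \<alpha>] assms(2)])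
    have "br (e \<alpha>) t \<in> I" by (rule I_br[OF rspace_bb[OF \<alpha> e_rspace[OF \<alpha>]] assms(1)])
    then have "mscale (- wt \<epsilon> \<alpha> t) (e \<alpha>) \<in> I" using tx by (simp add: br_anti[of "e \<alpha>" t])
    then have "br t (mscale (- wt \<epsilon> \<alpha> t) (e \<alpha>)) = 0" by (rule I_abelian[OF assms(1)])
    then show ?thesis using e_nonzero[OF \<alpha>] tx by (simp add: br_scale_right br_minus_right)
  qed
  have "\<epsilon> i t = 0" if i: "i \<in> {1..n}" for i
  proof -
    have "wt \<epsilon> (eps i + eps i) t = 2 * \<epsilon> i t"
      unfolding wt_add using i by (simp add: wt_eq eps_def if_distrib if_distribR cong: if_cong)
    then show ?thesis using root0[OF plus_in_Phi_pos[OF i i]] by simp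
  qed
  then show ?thesis using H_expand[OF assms(2)] by simp
qed

lemma I_root_step:
  assumes \<alpha>: "\<alpha> \<in> Phi_pos n" "e \<alpha> \<in> I" and \<beta>: "\<beta> \<in> Phi_pos n" and sum: "\<beta> + \<alpha> \<in> Phi_pos n"
  shows "e (\<beta> + \<alpha>) \<in> I"
proof -
  define x where "x = br (e \<beta>) (e \<alpha>)"
  have "x \<in> I" unfolding x_def by (rule I_br[OF rspace_bb[OF \<beta> e_rspace[OF \<beta>]] \<alpha>(2)])
  moreover have "x \<in> rspace (\<beta> + \<alpha>)" unfolding x_def by (rule br_e_e(1)[OF \<beta> \<alpha>(1)])
  moreover have "x \<noteq> 0" unfolding x_def by (rule br_e_nonzero[OF \<beta> \<alpha>(1) sum])
  ultimately obtain c where "mscale c (e (\<beta> + \<alpha>)) \<in> I" "c \<noteq> 0" using rspace_pos[OF sum] by (metis mt.scale_zero_left)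
  then show ?thesis by (rule mscale_cancel_mem[OF I_subspace])
qed

text \<open>If \<open>e\<close> with index \<open>eps i - eps j\<close> were in the ideal, so would be its bracket with the vector of
  \<open>2 eps j\<close>, of weight \<open>eps i + eps j\<close>; these two elements do not commute, as \<open>2 eps i\<close> is a root.\<close>
lemma ideal_roots_upper: "upper_set n (ideal_roots H \<epsilon> I)"
  unfolding upper_set_def
proof (intro conjI ballI impI)
  have mem: "\<alpha> \<in> ideal_roots H \<epsilon> I \<longleftrightarrow> \<alpha> \<in> Phi_pos n \<and> e \<alpha> \<in> I" for \<alpha>
    using rspace_sub_iff[OF I_subspace] by (auto simp: ideal_roots_eq)
  show "ideal_roots H \<epsilon> I \<subseteq> {eps i + eps j |i j. i \<in> {1..n} \<and> j \<in> {1..n}}"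
  proof
    fix \<alpha> assume "\<alpha> \<in> ideal_roots H \<epsilon> I"
    then have \<alpha>: "\<alpha> \<in> Phi_pos n" "e \<alpha> \<in> I" using mem by auto
    show "\<alpha> \<in> {eps i + eps j |i j. i \<in> {1..n} \<and> j \<in> {1..n}}"
      using \<alpha>(1)
    proof (cases rule: Phi_posE)
      case (diff i j)
      then have ij: "i \<in> {1..n}" "j \<in> {1..n}" by auto
      define \<beta> where "\<beta> = eps j + eps j"
      have \<beta>: "\<beta> \<in> Phi_pos n" unfolding \<beta>_def by (rule plus_in_Phi_pos[OF ij(2,2)])
      have s: "\<beta> + \<alpha> = eps i + eps j" unfolding \<beta>_def diff(4) by (simp add: fun_eq_iff)
      have s1: "\<beta> + \<alpha> \<in> Phi_pos n" unfolding s by (rule plus_in_Phi_pos[OF ij])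
      have s': "\<alpha> + (\<beta> + \<alpha>) = eps i + eps i" unfolding s unfolding diff(4) by (simp add: fun_eq_iff)
      have s2: "\<alpha> + (\<beta> + \<alpha>) \<in> Phi_pos n" unfolding s' by (rule plus_in_Phi_pos[OF ij(1,1)])
      have "br (e \<alpha>) (e (\<beta> + \<alpha>)) \<noteq> 0" by (rule br_e_nonzero[OF \<alpha>(1) s1 s2])
      moreover have "br (e \<alpha>) (e (\<beta> + \<alpha>)) = 0" by (rule I_abelian[OF \<alpha>(2) I_root_step[OF \<alpha> \<beta> s1]])
      ultimately show ?thesis by simp
    next
      case (plus i j)
      then have "i \<in> {1..n}" "j \<in> {1..n}" by auto
      then show ?thesis using plus(4) by blast
    qed
  qed
  fix i j k assume ij: "i \<in> {1..n}" "j \<in> {1..n}" and k: "k \<in> {1..i}" and "eps i + eps j \<in> ideal_roots H \<epsilon> I"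
  then have \<alpha>: "eps i + eps j \<in> Phi_pos n" "e (eps i + eps j) \<in> I" using mem by auto
  show "eps k + eps j \<in> ideal_roots H \<epsilon> I"
  proof (cases "k = i")
    case True
    then show ?thesis using \<alpha> mem by simp
  next
    case False
    then have \<beta>: "eps k - eps i \<in> Phi_pos n" using k ij by (intro diff_in_Phi_pos) auto
    have s: "(eps k - eps i) + (eps i + eps j) = eps k + eps j" by (simp add: fun_eq_iff)
    have kj: "eps k + eps j \<in> Phi_pos n" using k ij by (intro plus_in_Phi_pos) auto
    then have "e (eps k + eps j) \<in> I" using I_root_step[OF \<alpha> \<beta>] unfolding s by blast
    then show ?thesis using kj mem by blast
  qed
qed

text \<open>The ideal is stable under H, so it contains the weight components of its elements, and its
  component in H is zero.\<close>
lemma ideal_span: "I = mt.span (e ` ideal_roots H \<epsilon> I)"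
proof
  show "mt.span (e ` ideal_roots H \<epsilon> I) \<subseteq> I"
    using e_rspace by (intro mt.span_minimal[OF _ I_subspace]) (auto simp: ideal_roots_eq)
  show "I \<subseteq> mt.span (e ` ideal_roots H \<epsilon> I)"
  proof
    fix z assume z: "z \<in> I"
    obtain t u where t: "t \<in> H" and u: "u \<in> nn" and tu: "z = t + u" using I_bb[OF z] by (rule bb_decompose)
    define x where "x \<alpha> = (if \<alpha> = 0 then t else mscale (killing u (fv \<alpha>)) (e \<alpha>))" for \<alpha>
    have z0: "0 \<notin> Phi_pos n" using zero_notin_Phi Phi_posD by blast
    have x_pos: "x \<alpha> = mscale (killing u (fv \<alpha>)) (e \<alpha>)" if "\<alpha> \<in> Phi_pos n" for \<alpha>
    proof -
      have "\<alpha> \<noteq> 0" using that z0 by blast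
      then show ?thesis by (simp add: x_def)
    qed
    have "u = n_proj u" using n_proj_id[OF u] by simp
    also have "\<dots> = (\<Sum>\<alpha>\<in>Phi_pos n. x \<alpha>)"
      unfolding n_proj_def using z0 by (intro sum.cong refl) (auto simp: x_def)
    finally have ux: "u = (\<Sum>\<alpha>\<in>Phi_pos n. x \<alpha>)" .
    then have zx: "(\<Sum>\<alpha>\<in>insert 0 (Phi_pos n). x \<alpha>) = z"
      using z0 finite_Phi_pos by (simp add: tu x_def)
    have comp: "x \<alpha> \<in> I" if "\<alpha> \<in> insert 0 (Phi_pos n)" for \<alpha>
    proof (rule weight_components[where A = "insert 0 (Phi_pos n)"])
      show "x \<alpha> \<in> rspace \<alpha>" if "\<alpha> \<in> insert 0 (Phi_pos n)" for \<alpha>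
        using that t H_rspace_zero e_rspace by (auto simp: x_def mt.subspace_scale[OF rspace_subspace])
      show "weight_vec \<alpha>" if "\<alpha> \<in> insert 0 (Phi_pos n)" for \<alpha>
        using that weight_vec_zero weight_vec_pos by auto
      show "(\<Sum>\<alpha>\<in>insert 0 (Phi_pos n). x \<alpha>) \<in> I" unfolding zx by (rule z)
    qed (use that finite_Phi_pos I_subspace I_br H_bb in auto)
    have "t = 0" using comp[of 0] t I_H by (simp add: x_def)
    moreover have "x \<alpha> \<in> mt.span (e ` ideal_roots H \<epsilon> I)" if \<alpha>: "\<alpha> \<in> Phi_pos n" for \<alpha>
    proof (cases "killing u (fv \<alpha>) = 0")
      case True
      then have "x \<alpha> = 0" by (simp add: x_pos[OF \<alpha>])
      then show ?thesis by (simp add: mt.span_zero)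
    next
      case False
      have "mscale (killing u (fv \<alpha>)) (e \<alpha>) \<in> I" using comp[of \<alpha>] \<alpha> x_pos[OF \<alpha>] by simp
      then have "e \<alpha> \<in> I" using False by (rule mscale_cancel_mem[OF I_subspace])
      then have "\<alpha> \<in> ideal_roots H \<epsilon> I" using rspace_sub_iff[OF I_subspace \<alpha>] \<alpha> by (simp add: ideal_roots_eq)
      then show ?thesis unfolding x_pos[OF \<alpha>] by (intro mt.span_scale mt.span_base imageI)
    qed
    ultimately show "z \<in> mt.span (e ` ideal_roots H \<epsilon> I)"
      unfolding tu ux by (simp add: mt.span_sum)
  qed
qed

end

lemma upper_set_step:
  assumes \<Psi>: "upper_set n \<Psi>" and \<alpha>: "\<alpha> \<in> \<Psi>" and \<beta>: "\<beta> \<in> Phi_pos n" and sum: "\<beta> + \<alpha> \<in> Phi_pos n"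
  shows "\<beta> + \<alpha> \<in> \<Psi>"
proof -
  obtain i j where ij: "i \<in> {1..n}" "j \<in> {1..n}" "\<alpha> = eps i + eps j"
    using \<Psi> \<alpha> unfolding upper_set_def by blast
  have \<alpha>ij: "eps i + eps j \<in> \<Psi>" using \<alpha> ij(3) by simp
  have h\<alpha>: "wdot n (\<lambda>_. 1) \<alpha> = 2" unfolding ij(3) by (rule wdot_one_plus[OF ij(1,2)])
  have ht: "wdot n (\<lambda>_. 1) \<gamma> \<le> 2" if "\<gamma> \<in> Phi_pos n" for \<gamma>
    using that
  proof (cases rule: Phi_posE)
    case (plus i j)
    then show ?thesis using wdot_one_plus[of i n j] by simp
  next
    case (diff i j)
    then show ?thesis using wdot_one_diff[of i n j] by simp
  qed
  show ?thesis
    using \<beta>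
  proof (cases rule: Phi_posE)
    case (plus a b)
    then have "wdot n (\<lambda>_. 1) \<beta> = 2" using wdot_one_plus[of a n b] by simp
    then show ?thesis using ht[OF sum] h\<alpha> unfolding wdot_simps by simp
  next
    case (diff a b)
    then have ab: "a \<in> {1..n}" "b \<in> {1..n}" "a \<in> {1..b}" by auto
    have h: "wdot n (\<lambda>_. 1) (\<beta> + \<alpha>) = 2"
      unfolding wdot_add_right h\<alpha> unfolding diff(4) using wdot_one_diff[OF ab(1,2)] by simp
    have "(\<beta> + \<alpha>) b \<ge> 0"
      using sum
    proof (cases rule: Phi_posE)
      case (diff c d)
      then have "wdot n (\<lambda>_. 1) (\<beta> + \<alpha>) = 0" using wdot_one_diff[of c n d] by simp
      then show ?thesis using h by simp
    next
      case (plus c d)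
      show ?thesis unfolding plus(4) by (simp add: eps_def)
    qed
    then have "b = i \<or> b = j"
      using diff(2) unfolding diff(4) ij(3) by (auto simp: eps_def split: if_splits)
    then show ?thesis
    proof
      assume b: "b = i"
      have s: "\<beta> + \<alpha> = eps a + eps j" unfolding diff(4) ij(3) b by (simp add: fun_eq_iff)
      show ?thesis unfolding s by (rule upper_left[OF \<Psi> \<alpha>ij ij(1,2)]) (use ab b in auto)
    next
      assume b: "b = j"
      have s: "\<beta> + \<alpha> = eps i + eps a" unfolding diff(4) ij(3) b by (simp add: fun_eq_iff)
      show ?thesis unfolding s by (rule upper_right[OF \<Psi> \<alpha>ij ij(1,2)]) (use ab b in auto)
    qed
  qed
qed

lemma upper_set_abelian:
  assumes \<Psi>: "upper_set n \<Psi>" and "\<alpha> \<in> \<Psi>" "\<beta> \<in> \<Psi>" shows "\<alpha> + \<beta> \<notin> Phi_pos n"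
proof
  assume "\<alpha> + \<beta> \<in> Phi_pos n"
  moreover have h: "wdot n (\<lambda>_. 1) \<gamma> = 2" if "\<gamma> \<in> \<Psi>" for \<gamma>
    using \<Psi> that wdot_one_plus unfolding upper_set_def by blast
  have "wdot n (\<lambda>_. 1) (\<alpha> + \<beta>) = 4" unfolding wdot_add_right h[OF assms(2)] h[OF assms(3)] by simp
  ultimately show False
    by (cases rule: Phi_posE) (use wdot_one_plus wdot_one_diff in force)+
qed

lemma upper_set_pos: "upper_set n \<Psi> \<Longrightarrow> \<Psi> \<subseteq> Phi_pos n"
  unfolding upper_set_def using plus_in_Phi_pos by blast

lemma bb_subspace: "mt.subspace bb"
  by (simp add: bb_eq)

lemma upper_set_ideal:
  assumes \<Psi>: "upper_set n \<Psi>"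
  shows "mt.span (e ` \<Psi>) \<in> abelian_ideals bb" "ideal_roots H \<epsilon> (mt.span (e ` \<Psi>)) = \<Psi>"
proof -
  define I where "I = mt.span (e ` \<Psi>)"
  have sub: "mt.subspace I" by (simp add: I_def)
  note pos = upper_set_pos[OF \<Psi>]
  have eI: "e \<alpha> \<in> I" if "\<alpha> \<in> \<Psi>" for \<alpha> unfolding I_def using that by (intro mt.span_base) auto
  have ind: "P x" if "x \<in> I" "mt.subspace {x. P x}" "\<And>\<alpha>. \<alpha> \<in> \<Psi> \<Longrightarrow> P (e \<alpha>)" for P x
    using mt.span_induct[of x "e ` \<Psi>" P] that unfolding I_def by blast
  have "I \<subseteq> bb"
    unfolding I_def using pos rspace_bb e_rspace by (intro mt.span_minimal[OF _ bb_subspace]) auto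
  moreover have "br x y \<in> I" if x: "x \<in> bb" and y: "y \<in> I" for x y
    using y
  proof (rule ind[OF _ br_subspace(1)[OF sub]])
    fix \<alpha> assume \<alpha>: "\<alpha> \<in> \<Psi>"
    obtain t u where t: "t \<in> H" and u: "u \<in> nn" and tu: "x = t + u" using x by (rule bb_decompose)
    have "\<alpha> \<in> Phi_pos n" using \<alpha> pos by blast
    then have "br t (e \<alpha>) \<in> I" using rspace_br[OF e_rspace t] mt.subspace_scale[OF sub eI[OF \<alpha>]] by simp
    moreover have "br u (e \<alpha>) \<in> I"
      using u
    proof (rule nn_induct[OF _ br_subspace(2)[OF sub]])
      fix \<beta> assume \<beta>: "\<beta> \<in> Phi_pos n"
      show "br (e \<beta>) (e \<alpha>) \<in> I"
      proof (cases "\<beta> + \<alpha> \<in> Phi_pos n")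
        case True
        have "e (\<beta> + \<alpha>) \<in> I" by (rule eI[OF upper_set_step[OF \<Psi> \<alpha> \<beta> True]])
        then have "rspace (\<beta> + \<alpha>) \<subseteq> I" using rspace_sub_iff[OF sub True] by blast
        then show ?thesis using br_e_e(1)[OF \<beta> \<open>\<alpha> \<in> Phi_pos n\<close>] by blast
      next
        case False
        then show ?thesis using br_e_e(2)[OF \<beta> \<open>\<alpha> \<in> Phi_pos n\<close>] mt.subspace_0[OF sub] by simp
      qed
    qed
    ultimately show "br x (e \<alpha>) \<in> I" unfolding tu br_add_left by (rule mt.subspace_add[OF sub])
  qed
  moreover have "br x y = 0" if x: "x \<in> I" and y: "y \<in> I" for x y
  proof -
    have zs: "mt.subspace {0 :: 'n cmat}" by (simp add: mt.subspace_single_0)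
    have "br x y \<in> {0}"
      using x
    proof (rule ind[OF _ br_subspace(2)[OF zs]])
      fix \<alpha> assume \<alpha>: "\<alpha> \<in> \<Psi>"
      show "br (e \<alpha>) y \<in> {0}"
        using y
      proof (rule ind[OF _ br_subspace(1)[OF zs]])
        fix \<beta> assume \<beta>: "\<beta> \<in> \<Psi>"
        show "br (e \<alpha>) (e \<beta>) \<in> {0}"
          using br_e_e(2)[of \<alpha> \<beta>] upper_set_abelian[OF \<Psi> \<alpha> \<beta>] \<alpha> \<beta> pos by blast
      qed
    qed
    then show ?thesis by simp
  qed
  ultimately show "mt.span (e ` \<Psi>) \<in> abelian_ideals bb"
    using sub unfolding abelian_ideals_def I_def by blast
  have "\<alpha> \<in> \<Psi>" if \<alpha>: "\<alpha> \<in> Phi_pos n" "e \<alpha> \<in> I" for \<alpha>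
  proof (rule ccontr)
    assume n\<alpha>: "\<alpha> \<notin> \<Psi>"
    have z: "killing 0 (fv \<alpha>) = 0" using killing_scale[OF sp.zero_closed fv_sp[OF \<alpha>(1)], of 0] by simp
    have "e \<alpha> \<in> sp \<and> killing (e \<alpha>) (fv \<alpha>) = 0"
      using \<alpha>(2)
    proof (rule ind)
      show "mt.subspace {x. x \<in> sp \<and> killing x (fv \<alpha>) = 0}"
        using z by (auto intro!: mt.subspaceI simp: sp.zero_closed sp.add_closed sp.scale_closed killing_add killing_scale fv_sp[OF \<alpha>(1)])
      show "e \<beta> \<in> sp \<and> killing (e \<beta>) (fv \<alpha>) = 0" if "\<beta> \<in> \<Psi>" for \<beta>
        using that n\<alpha> pos killing_e_f(1)[OF _ \<alpha>(1), of \<beta>] e_sp by auto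
    qed
    then show False using killing_e_f(1)[OF \<alpha>(1,1)] by simp
  qed
  then show "ideal_roots H \<epsilon> (mt.span (e ` \<Psi>)) = \<Psi>"
    unfolding I_def[symmetric] ideal_roots_eq using rspace_sub_iff[OF sub] eI pos by blast
qed

end

section \<open>The inner product on forms\<close>

text \<open>The sign is the same for all forms, so it cancels in products of two forms and in quotients of
  their values.\<close>
lemma alt_permute:
  assumes "mset xs = mset ys" "set xs \<subseteq> V"
  shows "\<exists>s\<in>{1, -1 :: complex}. \<forall>\<omega>. alt_multilinear V \<omega> \<longrightarrow> \<omega> xs = s * \<omega> ys"
  using assms
proof (induction xs arbitrary: ys)
  case Nil
  then show ?case by auto
next
  case (Cons x xs)
  have "x \<in> set ys" using Cons.prems(1) by (metis list.set_intros(1) set_mset_mset)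
  then obtain as bs where ys: "ys = as @ x # bs" by (blast dest: split_list)
  have m: "mset xs = mset (as @ bs)" using Cons.prems(1) unfolding ys by simp
  have V: "x \<in> V" "set xs \<subseteq> V" "set as \<subseteq> V" "set bs \<subseteq> V"
    using Cons.prems(2) mset_eq_setD[OF m] by auto
  obtain s where s: "s \<in> {1, -1 :: complex}" and sw: "\<And>\<omega>. alt_multilinear V \<omega> \<Longrightarrow> \<omega> xs = s * \<omega> (as @ bs)"
    using Cons.IH[OF m V(2)] by blast
  define s' where "s' = s * (- 1) ^ length as"
  have "s' \<in> {1, -1}" using s unfolding s'_def by (cases "even (length as)") auto
  moreover have "\<omega> (x # xs) = s' * \<omega> ys" if \<omega>: "alt_multilinear V \<omega>" for \<omega>
  proof -
    have "\<omega> (x # xs) = s * \<omega> (x # as @ bs)" using sw[OF alt_contract[OF \<omega> V(1)]] .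
    also have "\<omega> ys = (- 1) ^ length as * \<omega> (x # as @ bs)"
      unfolding ys by (rule alt_front[OF \<omega> V(3,1,4)])
    then have "\<omega> (x # as @ bs) = (- 1) ^ length as * \<omega> ys" by (simp add: mult.assoc[symmetric] power_mult_distrib[symmetric])
    finally show ?thesis by (simp add: s'_def)
  qed
  ultimately show ?case by blast
qed

lemma alt_same_set:
  assumes "distinct xs" "distinct ys" "set xs = set ys" "set xs \<subseteq> V"
  shows "\<exists>s\<in>{1, -1 :: complex}. \<forall>\<omega>. alt_multilinear V \<omega> \<longrightarrow> \<omega> xs = s * \<omega> ys"
  using alt_permute[of xs ys V] assms set_eq_iff_mset_eq_distinct by blast

text \<open>The inner product of the components of degree k, up to the factor \<open>k!\<close>, as a sum over all lists of
  basis vectors. In this form the change of basis is an induction on k.\<close>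
primrec qform :: "'n::finite cmat set \<Rightarrow> nat \<Rightarrow> 'n form \<Rightarrow> 'n form \<Rightarrow> complex" where
  "qform U 0 \<omega> \<eta> = \<omega> [] * cnj (\<eta> [])"
| "qform U (Suc k) \<omega> \<eta> = (\<Sum>u\<in>U. qform U k (\<lambda>zs. \<omega> (u # zs)) (\<lambda>zs. \<eta> (u # zs)))"

lemma qform_lin_left:
  "qform U k (\<lambda>zs. a * f zs + b * g zs) \<eta> = a * qform U k f \<eta> + b * qform U k g \<eta>"
  by (induction k arbitrary: f g \<eta>) (simp_all add: algebra_simps sum.distrib sum_distrib_left)

lemma qform_cnj: "qform U k \<eta> \<omega> = cnj (qform U k \<omega> \<eta>)"
proof (induction k arbitrary: \<omega> \<eta>)
  case (Suc k)
  show ?case unfolding qform.simps cnj_sum by (rule sum.cong[OF refl Suc.IH])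
qed (simp add: mult.commute)

lemma qform_cong:
  assumes "U \<subseteq> V" "\<And>zs. set zs \<subseteq> V \<Longrightarrow> \<omega> zs = \<omega>' zs"
  shows "qform U k \<omega> \<eta> = qform U k \<omega>' \<eta>"
  using assms(2)
proof (induction k arbitrary: \<omega> \<omega>' \<eta>)
  case 0
  then show ?case by simp
next
  case (Suc k)
  have "qform U k (\<lambda>zs. \<omega> (u # zs)) (\<lambda>zs. \<eta> (u # zs)) = qform U k (\<lambda>zs. \<omega>' (u # zs)) (\<lambda>zs. \<eta> (u # zs))"
    if "u \<in> U" for u
    using that assms(1) Suc.prems by (intro Suc.IH) auto
  then show ?case by simp
qed

lemma qform_explicit:
  assumes "finite U"
  shows "qform U k \<omega> \<eta> = (\<Sum>l | set l \<subseteq> U \<and> length l = k. \<omega> l * cnj (\<eta> l))"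
proof (induction k arbitrary: \<omega> \<eta>)
  case 0
  have "{l. set l \<subseteq> U \<and> length l = 0} = {[]}" by auto
  then show ?case by simp
next
  case (Suc k)
  have inj: "inj_on (\<lambda>(l, u). u # l) ({l. set l \<subseteq> U \<and> length l = k} \<times> U)" by (auto simp: inj_on_def)
  have "(\<Sum>l | set l \<subseteq> U \<and> length l = Suc k. \<omega> l * cnj (\<eta> l)) =
      (\<Sum>(l, u)\<in>{l. set l \<subseteq> U \<and> length l = k} \<times> U. \<omega> (u # l) * cnj (\<eta> (u # l)))"
    unfolding lists_length_Suc_eq by (subst sum.reindex[OF inj]) (simp add: case_prod_unfold)
  also have "\<dots> = (\<Sum>u\<in>U. \<Sum>l | set l \<subseteq> U \<and> length l = k. \<omega> (u # l) * cnj (\<eta> (u # l)))"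
    unfolding sum.cartesian_product[symmetric] by (rule sum.swap)
  finally show ?case by (simp add: Suc.IH)
qed

lemma set_nths_filter: assumes "A \<subseteq> set us" shows "set (nths us {i. i < length us \<and> us ! i \<in> A}) = A"
proof
  show "A \<subseteq> set (nths us {i. i < length us \<and> us ! i \<in> A})"
  proof
    fix x assume x: "x \<in> A"
    then obtain i where "i < length us" "us ! i = x" using assms by (metis in_set_conv_nth subsetD)
    then show "x \<in> set (nths us {i. i < length us \<and> us ! i \<in> A})" using x by (auto simp: set_nths)
  qed
qed (auto simp: set_nths)

text \<open>Each subset of a basis is enumerated by as many lists as it has permutations, and the
  product of two alternating forms does not depend on the enumeration.\<close>
lemma qform_subsets:
  assumes us: "distinct us" "set us \<subseteq> V" and \<omega>: "alt_multilinear V \<omega>" and \<eta>: "alt_multilinear V \<eta>"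
  defines "F \<equiv> \<lambda>A. \<omega> (nths us {i. i < length us \<and> us ! i \<in> A}) * cnj (\<eta> (nths us {i. i < length us \<and> us ! i \<in> A}))"
  shows "qform (set us) k \<omega> \<eta> = fact k * (\<Sum>A | A \<subseteq> set us \<and> card A = k. F A)"
proof -
  define \<phi> where "\<phi> l = \<omega> l * cnj (\<eta> l)" for l
  have \<phi>_F: "\<phi> l = F (set l)" if l: "distinct l" "set l \<subseteq> set us" for l
  proof -
    let ?m = "nths us {i. i < length us \<and> us ! i \<in> set l}"
    have "set l \<subseteq> V" using l(2) us(2) by blast
    with alt_same_set[OF l(1) distinct_nthsI[OF us(1)] set_nths_filter[OF l(2), symmetric]]
    obtain s where s: "s \<in> {1, -1 :: complex}" and sw: "\<forall>\<omega>. alt_multilinear V \<omega> \<longrightarrow> \<omega> l = s * \<omega> ?m"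
      by blast
    have "\<omega> l = s * \<omega> ?m" "\<eta> l = s * \<eta> ?m" using sw \<omega> \<eta> by blast+
    then show ?thesis using s by (auto simp: \<phi>_def F_def)
  qed
  let ?D = "{l. distinct l \<and> set l \<subseteq> set us \<and> length l = k}"
  have fin: "finite {l. set l \<subseteq> set us \<and> length l = k}" by (rule finite_lists_length_eq) simp
  have "qform (set us) k \<omega> \<eta> = (\<Sum>l | set l \<subseteq> set us \<and> length l = k. \<phi> l)"
    by (simp add: qform_explicit \<phi>_def)
  also have "\<dots> = (\<Sum>l\<in>?D. \<phi> l)"
    by (rule sum.mono_neutral_right[OF fin])
      (use alt_not_distinct[OF \<omega>] us(2) in \<open>auto simp: \<phi>_def\<close>)
  also have "?D = (\<Union>A\<in>{A. A \<subseteq> set us \<and> card A = k}. permutations_of_set A)"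
    by (auto simp: permutations_of_set_def distinct_card)
  also have "(\<Sum>l\<in>\<dots>. \<phi> l) = (\<Sum>A | A \<subseteq> set us \<and> card A = k. \<Sum>l\<in>permutations_of_set A. \<phi> l)"
  proof (rule sum.UNION_disjoint)
    show "finite {A. A \<subseteq> set us \<and> card A = k}" by (rule finite_subset[of _ "Pow (set us)"]) auto
    show "\<forall>A\<in>{A. A \<subseteq> set us \<and> card A = k}. finite (permutations_of_set A)" by simp
  qed (auto simp: permutations_of_set_def)
  also have "\<dots> = (\<Sum>A | A \<subseteq> set us \<and> card A = k. fact k * F A)"
  proof (intro sum.cong refl)
    fix A assume A: "A \<in> {A. A \<subseteq> set us \<and> card A = k}"
    then have fA: "finite A" using finite_subset by auto
    have "(\<Sum>l\<in>permutations_of_set A. \<phi> l) = (\<Sum>l\<in>permutations_of_set A. F A)"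
      using A by (intro sum.cong refl) (auto simp: permutations_of_set_def \<phi>_F)
    also have "\<dots> = fact k * F A" using A fA by simp
    finally show "(\<Sum>l\<in>permutations_of_set A. \<phi> l) = fact k * F A" .
  qed
  finally show ?thesis by (simp add: sum_distrib_left)
qed

context compact_form
begin

definition onb :: "'n cmat set \<Rightarrow> 'n cmat set \<Rightarrow> bool" where
  "onb V U \<longleftrightarrow> basis_of V U \<and> (\<forall>u\<in>U. \<forall>v\<in>U. herm K u v = (if u = v then 1 else 0))"

lemma onb_expand:
  assumes U: "onb V U" and V: "V \<subseteq> sp" and x: "x \<in> V"
    and add: "\<And>x y. x \<in> V \<Longrightarrow> y \<in> V \<Longrightarrow> \<phi> (x + y) = \<phi> x + \<phi> y"
    and sc: "\<And>c x. x \<in> V \<Longrightarrow> \<phi> (mscale c x) = (c :: complex) * \<phi> x"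
  shows "\<phi> x = (\<Sum>u\<in>U. herm K x u * \<phi> u)"
proof -
  have B: "basis_of V U" using U by (simp add: onb_def)
  have fin: "finite U" using B by (simp add: basis_of_def)
  have rep: "mt.representation U x u = herm K x u" if u: "u \<in> U" for u
  proof -
    have usp: "u \<in> sp" using basis_in[OF B u] V by blast
    have "herm K x u = (\<Sum>w\<in>U. mt.representation U x w * herm K w u)"
      by (rule linear_basis_expand[OF B x, where \<phi> = "\<lambda>x. herm K x u"])
        (auto simp: herm_add herm_scale usp subsetD[OF V])
    also have "\<dots> = (\<Sum>w\<in>U. if w = u then mt.representation U x w else 0)"
      using U u by (intro sum.cong refl) (auto simp: onb_def)
    finally show ?thesis using fin u by simp
  qed
  have "\<phi> x = (\<Sum>u\<in>U. mt.representation U x u * \<phi> u)"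
    by (rule linear_basis_expand[OF B x add sc])
  then show ?thesis by (simp add: rep)
qed

text \<open>The step of the induction is Parseval's identity in the first vector, for two orthonormal bases.\<close>
lemma qform_basis_independent:
  assumes U: "onb V U" and W: "onb V W" and V: "V \<subseteq> sp"
    and \<omega>: "alt_multilinear V \<omega>" and \<eta>: "alt_multilinear V \<eta>"
  shows "qform U k \<omega> \<eta> = qform W k \<omega> \<eta>"
  using \<omega> \<eta>
proof (induction k arbitrary: \<omega> \<eta>)
  case 0
  show ?case by simp
next
  case (Suc k)
  note \<omega> = Suc.prems(1) and \<eta> = Suc.prems(2)
  have BU: "basis_of V U" and BW: "basis_of V W" using U W by (auto simp: onb_def)
  have UV: "u \<in> V" if "u \<in> U" for u using basis_in[OF BU that] .
  have WV: "W \<subseteq> V" using basis_in[OF BW] by blast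
  have lin: "qform W k (\<lambda>zs. f ((x + y) # zs)) g = qform W k (\<lambda>zs. f (x # zs)) g + qform W k (\<lambda>zs. f (y # zs)) g"
    "qform W k (\<lambda>zs. f (mscale c x # zs)) g = c * qform W k (\<lambda>zs. f (x # zs)) g"
    if f: "alt_multilinear V f" and xy: "x \<in> V" "y \<in> V" for f g x y c
  proof -
    have "qform W k (\<lambda>zs. f ((x + y) # zs)) g = qform W k (\<lambda>zs. 1 * f (x # zs) + 1 * f (y # zs)) g"
      using alt_add0[OF f xy(1) _ xy(2)] by (intro qform_cong[OF WV]) simp
    then show "qform W k (\<lambda>zs. f ((x + y) # zs)) g = qform W k (\<lambda>zs. f (x # zs)) g + qform W k (\<lambda>zs. f (y # zs)) g"
      unfolding qform_lin_left by simp
    have "qform W k (\<lambda>zs. f (mscale c x # zs)) g = qform W k (\<lambda>zs. c * f (x # zs) + 0 * f zs) g"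
      using alt_scale0[OF f xy(1)] by (intro qform_cong[OF WV]) simp
    then show "qform W k (\<lambda>zs. f (mscale c x # zs)) g = c * qform W k (\<lambda>zs. f (x # zs)) g"
      unfolding qform_lin_left by simp
  qed
  define B where "B x y = qform W k (\<lambda>zs. \<omega> (x # zs)) (\<lambda>zs. \<eta> (y # zs))" for x y
  have B1: "B x y = (\<Sum>v\<in>W. herm K x v * B v y)" if "x \<in> V" for x y
    unfolding B_def by (rule onb_expand[OF W V that, where \<phi> = "\<lambda>x. qform W k (\<lambda>zs. \<omega> (x # zs)) (\<lambda>zs. \<eta> (y # zs))"])
      (use lin[OF \<omega>] in auto)
  have B2: "B x y = (\<Sum>v\<in>W. cnj (herm K y v) * B x v)" if "y \<in> V" for x y
  proof -
    have "cnj (B x y) = (\<Sum>v\<in>W. herm K y v * cnj (B x v))"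
      unfolding B_def qform_cnj[symmetric]
      by (rule onb_expand[OF W V that, where \<phi> = "\<lambda>y. qform W k (\<lambda>zs. \<eta> (y # zs)) (\<lambda>zs. \<omega> (x # zs))"])
        (use lin[OF \<eta>] in auto)
    then have "cnj (cnj (B x y)) = cnj (\<Sum>v\<in>W. herm K y v * cnj (B x v))" by (rule arg_cong)
    then show ?thesis by simp
  qed
  have "qform U (Suc k) \<omega> \<eta> = (\<Sum>u\<in>U. B u u)"
    unfolding B_def qform.simps using UV by (intro sum.cong refl Suc.IH alt_contract[OF \<omega>] alt_contract[OF \<eta>])
  also have "\<dots> = (\<Sum>u\<in>U. \<Sum>v\<in>W. \<Sum>v'\<in>W. herm K u v * cnj (herm K u v') * B v v')"
  proof (intro sum.cong refl)
    fix u assume u: "u \<in> U"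
    have "B u u = (\<Sum>v\<in>W. herm K u v * B v u)" by (rule B1[OF UV[OF u]])
    also have "\<dots> = (\<Sum>v\<in>W. herm K u v * (\<Sum>v'\<in>W. cnj (herm K u v') * B v v'))"
      by (subst B2[OF UV[OF u]]) (rule refl)
    finally show "B u u = (\<Sum>v\<in>W. \<Sum>v'\<in>W. herm K u v * cnj (herm K u v') * B v v')"
      by (simp add: sum_distrib_left mult.assoc)
  qed
  also have "\<dots> = (\<Sum>v\<in>W. \<Sum>v'\<in>W. (\<Sum>u\<in>U. herm K u v * cnj (herm K u v')) * B v v')"
    unfolding sum_distrib_right by (rule trans[OF sum.swap], rule sum.cong[OF refl], rule sum.swap)
  also have "\<dots> = (\<Sum>v\<in>W. \<Sum>v'\<in>W. if v' = v then B v v' else 0)"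
  proof (intro sum.cong refl)
    fix v v' assume v: "v \<in> W" and v': "v' \<in> W"
    have vV: "v \<in> V" "v' \<in> V" "v \<in> sp" "v' \<in> sp" using v v' WV V by auto
    have "herm K v' v = (\<Sum>u\<in>U. herm K v' u * herm K u v)"
      by (rule onb_expand[OF U V vV(2), where \<phi> = "\<lambda>x. herm K x v"])
        (auto simp: herm_add herm_scale vV subsetD[OF V])
    also have "\<dots> = (\<Sum>u\<in>U. herm K u v * cnj (herm K u v'))"
    proof (intro sum.cong refl)
      fix u assume "u \<in> U"
      then have "u \<in> sp" using UV V by blast
      then show "herm K v' u * herm K u v = herm K u v * cnj (herm K u v')"
        using herm_cnj[of u v'] vV by simp
    qed
    finally have "(\<Sum>u\<in>U. herm K u v * cnj (herm K u v')) = (if v' = v then 1 else 0)"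
      using W v v' by (auto simp: onb_def)
    then show "(\<Sum>u\<in>U. herm K u v * cnj (herm K u v')) * B v v' = (if v' = v then B v v' else 0)" by simp
  qed
  also have "\<dots> = (\<Sum>v\<in>W. B v v)" using BW by (intro sum.cong refl) (simp add: basis_of_def)
  finally show ?case by (simp add: B_def)
qed

lemma form_inner_zero:
  assumes us: "distinct us" "set us \<subseteq> V" and \<omega>: "alt_multilinear V \<omega>" and \<eta>: "alt_multilinear V \<eta>"
    and q: "\<And>k. qform (set us) k \<omega> \<eta> = 0"
  shows "(\<Sum>S\<in>Pow {..<length us}. \<omega> (nths us S) * cnj (\<eta> (nths us S))) = 0"
proof -
  define F where "F A = \<omega> (nths us {i. i < length us \<and> us ! i \<in> A}) * cnj (\<eta> (nths us {i. i < length us \<and> us ! i \<in> A}))" for A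
  have enum: "{i. i < length us \<and> us ! i \<in> set (nths us S)} = S" if "S \<in> Pow {..<length us}" for S
    using that us(1) by (auto simp: set_nths nth_eq_iff_index_eq)
  have "(\<Sum>S\<in>Pow {..<length us}. \<omega> (nths us S) * cnj (\<eta> (nths us S))) = (\<Sum>A\<in>Pow (set us). F A)"
  proof (rule sum.reindex_bij_witness[where i = "\<lambda>A. {i. i < length us \<and> us ! i \<in> A}" and j = "\<lambda>S. set (nths us S)"])
    fix S assume S: "S \<in> Pow {..<length us}"
    show "{i. i < length us \<and> us ! i \<in> set (nths us S)} = S" by (rule enum[OF S])
    show "set (nths us S) \<in> Pow (set us)" using set_nths_subset by fast
    show "F (set (nths us S)) = \<omega> (nths us S) * cnj (\<eta> (nths us S))" unfolding F_def enum[OF S] ..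
  next
    fix A assume A: "A \<in> Pow (set us)"
    show "set (nths us {i. i < length us \<and> us ! i \<in> A}) = A"
      using A by (intro set_nths_filter) simp
  qed auto
  also have "\<dots> = (\<Sum>k\<in>card ` Pow (set us). \<Sum>A | A \<in> Pow (set us) \<and> card A = k. F A)"
    by (rule sum.image_gen) simp
  also have "\<dots> = 0"
  proof (rule sum.neutral, rule ballI)
    fix k
    have "fact k * (\<Sum>A | A \<subseteq> set us \<and> card A = k. F A) = 0"
      using qform_subsets[OF us \<omega> \<eta>, of k] q[of k] by (simp add: F_def)
    then show "(\<Sum>A | A \<in> Pow (set us) \<and> card A = k. F A) = 0" by simp
  qed
  finally show ?thesis .
qed

end

lemma alt_zero_on_basis:
  assumes U: "basis_of V U" and \<omega>: "alt_multilinear V \<omega>" and zero: "\<And>l. set l \<subseteq> U \<Longrightarrow> \<omega> l = 0"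
    and xs: "set xs \<subseteq> V"
  shows "\<omega> xs = 0"
  using \<omega> zero xs
proof (induction xs arbitrary: \<omega>)
  case Nil
  then show ?case by simp
next
  case (Cons x xs)
  have x: "x \<in> V" "set xs \<subseteq> V" using Cons.prems(3) by auto
  have "\<omega> (u # xs) = 0" if u: "u \<in> U" for u
    using Cons.prems(2) u by (intro Cons.IH[OF alt_contract[OF Cons.prems(1) basis_in[OF U u]] _ x(2)]) simp
  moreover have "\<omega> (x # xs) = (\<Sum>u\<in>U. mt.representation U x u * \<omega> (u # xs))"
    by (rule linear_basis_expand[OF U x(1), where \<phi> = "\<lambda>x. \<omega> (x # xs)"])
      (simp_all add: alt_add0[OF Cons.prems(1)] alt_scale0[OF Cons.prems(1)] x(2))
  ultimately show ?case by simp
qed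

lemma form_inner_definite:
  assumes us: "distinct us" "basis_of V (set us)" and \<omega>: "alt_multilinear V \<omega>"
    and zero: "(\<Sum>S\<in>Pow {..<length us}. \<omega> (nths us S) * cnj (\<omega> (nths us S))) = 0"
    and xs: "set xs \<subseteq> V"
  shows "\<omega> xs = 0"
proof (rule alt_zero_on_basis[OF us(2) \<omega> _ xs])
  have usV: "set us \<subseteq> V" using basis_in[OF us(2)] by blast
  have "(\<Sum>S\<in>Pow {..<length us}. (cmod (\<omega> (nths us S)))\<^sup>2) = 0"
  proof -
    have "of_real (\<Sum>S\<in>Pow {..<length us}. (cmod (\<omega> (nths us S)))\<^sup>2) = (0 :: complex)"
      using zero by (simp add: complex_norm_square[symmetric])
    then show ?thesis by (simp only: of_real_eq_0_iff)
  qed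
  then have z: "\<omega> (nths us S) = 0" if "S \<in> Pow {..<length us}" for S
    using that by (simp add: sum_nonneg_eq_0_iff)
  fix l assume l: "set l \<subseteq> set us"
  show "\<omega> l = 0"
  proof (cases "distinct l")
    case False
    then show ?thesis using alt_not_distinct[OF \<omega>, of l] l usV by auto
  next
    case True
    define S where "S = {i. i < length us \<and> us ! i \<in> set l}"
    have "set l = set (nths us S)" unfolding S_def by (rule set_nths_filter[OF l, symmetric])
    then obtain s where "\<omega> l = s * \<omega> (nths us S)"
      using alt_same_set[OF True distinct_nthsI[OF us(1)], of S V] l usV \<omega> by blast
    moreover have "S \<in> Pow {..<length us}" by (auto simp: S_def)
    ultimately show ?thesis using z by simp
  qed
qed

section \<open>Weights of cochains\<close>

context sp_roots
begin

lemma cochains_nn: "\<omega> \<in> cochains nn \<longleftrightarrow> alt_multilinear nn \<omega> \<and> (\<forall>xs. \<not> set xs \<subseteq> nn \<longrightarrow> \<omega> xs = 0)"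
  by (rule cochains_iff[OF nn_subspace])

lemma map_e_nn: "set l \<subseteq> Phi_pos n \<Longrightarrow> set (map e l) \<subseteq> nn"
  using e_nn by auto

lemma cochain_eqI:
  assumes \<omega>: "\<omega> \<in> cochains nn" and \<eta>: "\<eta> \<in> cochains nn"
    and eq: "\<And>l. set l \<subseteq> Phi_pos n \<Longrightarrow> \<omega> (map e l) = \<eta> (map e l)"
  shows "\<omega> = \<eta>"
proof
  fix xs
  show "\<omega> xs = \<eta> xs"
  proof (cases "set xs \<subseteq> nn")
    case True
    have "\<omega> xs - \<eta> xs = 0"
    proof (rule alt_zero_on_basis[OF basis_nn _ _ True, where \<omega> = "\<lambda>xs. \<omega> xs - \<eta> xs"])
      show "alt_multilinear nn (\<lambda>xs. \<omega> xs - \<eta> xs)" using \<omega> \<eta> cochains_nn by (blast intro: alt_diff)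
      fix l assume "set l \<subseteq> e ` Phi_pos n"
      then have "map e (map (inv_into (Phi_pos n) e) l) = l" "set (map (inv_into (Phi_pos n) e) l) \<subseteq> Phi_pos n"
        using f_inv_into_f[of _ e "Phi_pos n"] inv_into_into[of _ e "Phi_pos n"]
        by (auto simp: o_def subset_eq intro!: map_idI)
      then obtain l' where "l = map e l'" "set l' \<subseteq> Phi_pos n" by metis
      then show "\<omega> l - \<eta> l = 0" using eq by simp
    qed
    then show ?thesis by simp
  next
    case False
    then show ?thesis using \<omega> \<eta> cochains_nn by metis
  qed
qed

lemma distinct_map_e: "set l \<subseteq> Phi_pos n \<Longrightarrow> distinct (map e l) \<longleftrightarrow> distinct l"
  unfolding distinct_map using inj_on_subset[OF e_inj] by blast

lemma alt_map_e_not_distinct: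
  "alt_multilinear nn \<omega> \<Longrightarrow> set l \<subseteq> Phi_pos n \<Longrightarrow> \<not> distinct l \<Longrightarrow> \<omega> (map e l) = 0"
  using alt_not_distinct[of nn \<omega> "map e l"] map_e_nn distinct_map_e by blast

lemma lie_der_weight:
  assumes "alt_multilinear nn \<omega>" "alt_multilinear nn \<eta>"
    and "\<And>l. set l \<subseteq> Phi_pos n \<Longrightarrow> \<eta> (map e l) = g (length l) (sum_list l) * \<omega> (map e l)"
    and \<alpha>: "\<alpha> \<in> Phi_pos n" and "set l \<subseteq> Phi_pos n"
  shows "lie_der (e \<alpha>) \<eta> (map e l) = g (length l) (\<alpha> + sum_list l) * lie_der (e \<alpha>) \<omega> (map e l)"
  using assms(1-3,5)
proof (induction l arbitrary: \<omega> \<eta> g)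
  case Nil
  show ?case by simp
next
  case (Cons \<beta> l)
  have \<beta>: "\<beta> \<in> Phi_pos n" and l: "set l \<subseteq> Phi_pos n" using Cons.prems(4) by auto
  note \<omega> = Cons.prems(1) and \<eta> = Cons.prems(2) and eq = Cons.prems(3)
  have 1: "lie_der (e \<alpha>) (\<lambda>zs. \<eta> (e \<beta> # zs)) (map e l) =
      g (Suc (length l)) (\<beta> + (\<alpha> + sum_list l)) * lie_der (e \<alpha>) (\<lambda>zs. \<omega> (e \<beta> # zs)) (map e l)"
  proof (rule Cons.IH[where g = "\<lambda>k \<mu>. g (Suc k) (\<beta> + \<mu>)"])
    fix l' assume "set l' \<subseteq> Phi_pos n"
    then have "set (\<beta> # l') \<subseteq> Phi_pos n" using \<beta> by simp
    from eq[OF this] show "\<eta> (e \<beta> # map e l') = g (Suc (length l')) (\<beta> + sum_list l') * \<omega> (e \<beta> # map e l')"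
      by (simp only: list.map length_Cons sum_list.Cons)
  qed (use alt_contract[OF \<omega> e_nn[OF \<beta>]] alt_contract[OF \<eta> e_nn[OF \<beta>]] l in auto)
  have 2: "\<eta> (br (e \<alpha>) (e \<beta>) # map e l) = g (Suc (length l)) (\<alpha> + \<beta> + sum_list l) * \<omega> (br (e \<alpha>) (e \<beta>) # map e l)"
  proof (cases "\<alpha> + \<beta> \<in> Phi_pos n")
    case True
    obtain c where c: "br (e \<alpha>) (e \<beta>) = mscale c (e (\<alpha> + \<beta>))"
      using rspace_pos[OF True br_e_e(1)[OF \<alpha> \<beta>]] by blast
    have "set ((\<alpha> + \<beta>) # l) \<subseteq> Phi_pos n" using True l by simp
    from eq[OF this] have "\<eta> (e (\<alpha> + \<beta>) # map e l) = g (Suc (length l)) (\<alpha> + \<beta> + sum_list l) * \<omega> (e (\<alpha> + \<beta>) # map e l)"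
      by (simp only: list.map length_Cons sum_list.Cons)
    then show ?thesis
      unfolding c by (simp add: alt_scale0[OF \<omega> e_nn[OF True] map_e_nn[OF l]] alt_scale0[OF \<eta> e_nn[OF True] map_e_nn[OF l]])
  next
    case False
    then have "br (e \<alpha>) (e \<beta>) = 0" by (rule br_e_e(2)[OF \<alpha> \<beta>])
    then show ?thesis
      using N.alt_zero[OF \<omega>, of "[]" "map e l"] N.alt_zero[OF \<eta>, of "[]" "map e l"] map_e_nn[OF l] by simp
  qed
  have "\<beta> + (\<alpha> + sum_list l) = \<alpha> + sum_list (\<beta> # l)" "\<alpha> + \<beta> + sum_list l = \<alpha> + sum_list (\<beta> # l)"
    unfolding sum_list.Cons by (rule add.left_commute, rule add.assoc)
  then show ?case using 1 2 by (simp only: list.map lie_der.simps right_diff_distrib list.size add_0_right add_Suc_right)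
qed

text \<open>The differential preserves weights: if the components of \<open>\<eta>\<close> are multiples of those of
  \<open>\<omega>\<close>, by factors that depend on the degree and the weight only, then the same holds for the
  differentials.\<close>
lemma cartan_d_weight:
  assumes "alt_multilinear nn \<omega>" "alt_multilinear nn \<eta>"
    and "\<And>l. set l \<subseteq> Phi_pos n \<Longrightarrow> \<eta> (map e l) = g (length l) (sum_list l) * \<omega> (map e l)"
    and "set l \<subseteq> Phi_pos n"
  shows "cartan_d \<eta> (map e l) = g (length l - 1) (sum_list l) * cartan_d \<omega> (map e l)"
  using assms
proof (induction l arbitrary: \<omega> \<eta> g)
  case Nil
  show ?case by simp
next
  case (Cons \<alpha> l)
  have \<alpha>: "\<alpha> \<in> Phi_pos n" and l: "set l \<subseteq> Phi_pos n" using Cons.prems(4) by auto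
  note \<omega> = Cons.prems(1) and \<eta> = Cons.prems(2) and eq = Cons.prems(3)
  have 1: "lie_der (e \<alpha>) \<eta> (map e l) = g (length l) (\<alpha> + sum_list l) * lie_der (e \<alpha>) \<omega> (map e l)"
    by (rule lie_der_weight[OF \<omega> \<eta> eq \<alpha> l])
  have 2: "cartan_d (\<lambda>zs. \<eta> (e \<alpha> # zs)) (map e l) =
      g (Suc (length l - 1)) (\<alpha> + sum_list l) * cartan_d (\<lambda>zs. \<omega> (e \<alpha> # zs)) (map e l)"
  proof (rule Cons.IH[where g = "\<lambda>k \<mu>. g (Suc k) (\<alpha> + \<mu>)"])
    fix l' assume "set l' \<subseteq> Phi_pos n"
    then have "set (\<alpha> # l') \<subseteq> Phi_pos n" using \<alpha> by simp
    from eq[OF this] show "\<eta> (e \<alpha> # map e l') = g (Suc (length l')) (\<alpha> + sum_list l') * \<omega> (e \<alpha> # map e l')"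
      by (simp only: list.map length_Cons sum_list.Cons)
  qed (use alt_contract[OF \<omega> e_nn[OF \<alpha>]] alt_contract[OF \<eta> e_nn[OF \<alpha>]] l in auto)
  have 3: "cartan_d (\<lambda>zs. \<eta> (e \<alpha> # zs)) (map e l) =
      g (length l) (\<alpha> + sum_list l) * cartan_d (\<lambda>zs. \<omega> (e \<alpha> # zs)) (map e l)"
    using 2 by (cases l) simp_all
  show ?case using 1 3 by (simp only: list.map cartan_d.simps right_diff_distrib list.size
    add_0_right add_Suc_right diff_Suc_1 sum_list.Cons)
qed

lemma sum_list_set: "distinct l \<Longrightarrow> sum_list l = \<Sum>(set l)" for l :: "weight list"
  using sum_list_distinct_conv_sum_set[of l id] by simp

text \<open>A separated set is the only set of positive roots with its sum, so a cochain of the same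
  weight as the product over such a set lives in a single degree.\<close>
lemma cartan_d_separated:
  assumes \<eta>: "alt_multilinear nn \<eta>" and S: "separated n (set l)" and l: "distinct l"
  shows "cartan_d \<eta> (map e l) = 0"
proof (cases "l = []")
  case False
  have lP: "set l \<subseteq> Phi_pos n" using S by (simp add: separated_def)
  define g where "g k \<mu> = (if k = length l - 1 \<and> \<mu> = sum_list l then 1 else 0 :: complex)" for k \<mu>
  have "cartan_d (\<lambda>_. 0) (map e l) = g (length l - 1) (sum_list l) * cartan_d \<eta> (map e l)"
  proof (rule cartan_d_weight[OF \<eta> _ _ lP])
    show "alt_multilinear nn (\<lambda>_. 0)" by (rule alt_multilinearI) simp_all
    fix l' assume l': "set l' \<subseteq> Phi_pos n"
    show "0 = g (length l') (sum_list l') * \<eta> (map e l')"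
    proof (cases "distinct l' \<and> g (length l') (sum_list l') \<noteq> 0")
      case True
      then have len: "length l' = length l - 1" and "sum_list l' = sum_list l" by (auto simp: g_def split: if_splits)
      then have "\<Sum>(set l') = \<Sum>(set l)" using sum_list_set l True by metis
      then have "set l' = set l" by (rule separated_unique_sum[OF S l'])
      then have "length l' = length l" using l True by (metis distinct_card)
      then show ?thesis using len False by (cases l) simp_all
    next
      case nd: False
      then show ?thesis using alt_map_e_not_distinct[OF \<eta> l'] by auto
    qed
  qed
  then show ?thesis by (simp add: g_def cartan_d_zero)
qed simp

text \<open>The cochain that multiplies the component of weight \<open>- \<mu>\<close> by the factor \<open>g \<mu>\<close>. Splitting off
  the root vectors from the first argument avoids a choice of an enumeration of the sets of roots.\<close>
primrec weight_mult :: "(weight \<Rightarrow> complex) \<Rightarrow> 'n form \<Rightarrow> 'n cmat list \<Rightarrow> complex" where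
  "weight_mult g \<omega> [] = g 0 * \<omega> []"
| "weight_mult g \<omega> (x # xs) = (\<Sum>\<alpha>\<in>Phi_pos n. dual_root_basis e \<alpha> x *
     weight_mult (\<lambda>\<mu>. g (\<alpha> + \<mu>)) (\<lambda>zs. \<omega> (e \<alpha> # zs)) xs)"

lemma dual_root_basis_e:
  assumes "\<alpha> \<in> Phi_pos n" "\<beta> \<in> Phi_pos n"
  shows "dual_root_basis e \<alpha> (e \<beta>) = (if \<beta> = \<alpha> then 1 else 0)"
  using dual_root_basis_nn(1)[OF assms(1) e_nn[OF assms(2)]] killing_e_f(1)[OF assms(2,1)] by simp

lemma dual_root_basis_dual: assumes "\<alpha> \<in> Phi_pos n" shows "dual_root_basis e \<alpha> \<in> dual nn"
  using assms fv_sp[OF assms] nn_sp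
  by (auto simp: dual_def dual_root_basis_nn N.add_closed N.scale_closed killing_add killing_scale subset_eq)

lemma dual_root_basis_linear:
  assumes "\<alpha> \<in> Phi_pos n"
  shows "x \<in> nn \<Longrightarrow> y \<in> nn \<Longrightarrow> dual_root_basis e \<alpha> (x + y) = dual_root_basis e \<alpha> x + dual_root_basis e \<alpha> y"
    and "x \<in> nn \<Longrightarrow> dual_root_basis e \<alpha> (mscale c x) = c * dual_root_basis e \<alpha> x"
  using dual_root_basis_dual[OF assms] unfolding dual_def by blast+

lemma weight_mult_e:
  "set l \<subseteq> Phi_pos n \<Longrightarrow> weight_mult g \<omega> (map e l) = g (sum_list l) * \<omega> (map e l)"
proof (induction l arbitrary: g \<omega>)
  case (Cons \<beta> l)
  then have \<beta>: "\<beta> \<in> Phi_pos n" and l: "set l \<subseteq> Phi_pos n" by auto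
  have "weight_mult g \<omega> (map e (\<beta> # l)) =
      (\<Sum>\<alpha>\<in>Phi_pos n. if \<alpha> = \<beta> then weight_mult (\<lambda>\<mu>. g (\<alpha> + \<mu>)) (\<lambda>zs. \<omega> (e \<alpha> # zs)) (map e l) else 0)"
    unfolding list.map weight_mult.simps using \<beta> by (intro sum.cong refl) (auto simp: dual_root_basis_e)
  also have "\<dots> = weight_mult (\<lambda>\<mu>. g (\<beta> + \<mu>)) (\<lambda>zs. \<omega> (e \<beta> # zs)) (map e l)"
    using \<beta> finite_Phi_pos by simp
  finally show ?case using Cons.IH[OF l, of "\<lambda>\<mu>. g (\<beta> + \<mu>)" "\<lambda>zs. \<omega> (e \<beta> # zs)"] by (simp only: sum_list.Cons list.map)
next
  case Nil
  show ?case by (simp only: list.map weight_mult.simps sum_list.Nil)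
qed

lemma weight_mult_neg:
  assumes "\<And>l. set l \<subseteq> Phi_pos n \<Longrightarrow> \<eta> (map e l) = - \<omega> (map e l)"
  shows "weight_mult g \<eta> xs = - weight_mult g \<omega> xs"
  using assms
proof (induction xs arbitrary: g \<omega> \<eta>)
  case Nil
  then show ?case using Nil[of "[]"] by simp
next
  case (Cons x xs)
  have "weight_mult (\<lambda>\<mu>. g (\<alpha> + \<mu>)) (\<lambda>zs. \<eta> (e \<alpha> # zs)) xs = - weight_mult (\<lambda>\<mu>. g (\<alpha> + \<mu>)) (\<lambda>zs. \<omega> (e \<alpha> # zs)) xs"
    if "\<alpha> \<in> Phi_pos n" for \<alpha>
  proof (rule Cons.IH)
    fix l assume "set l \<subseteq> Phi_pos n"
    then show "\<eta> (e \<alpha> # map e l) = - \<omega> (e \<alpha> # map e l)" using Cons.prems[of "\<alpha> # l"] that by simp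
  qed
  then show ?case by (simp add: sum_negf)
qed

lemma weight_mult_outside: "\<not> set xs \<subseteq> nn \<Longrightarrow> weight_mult g \<omega> xs = 0"
proof (induction xs arbitrary: g \<omega>)
  case (Cons x xs)
  then show ?case by (cases "x \<in> nn") (auto intro!: sum.neutral simp: dual_root_basis_nn(2))
qed simp

lemma alt_weight_mult:
  assumes "alt_multilinear nn \<omega>" shows "alt_multilinear nn (weight_mult g \<omega>)"
proof (rule alt_multilinearI)
  fix us x y vs assume "set us \<subseteq> nn" and v: "x \<in> nn" "y \<in> nn" "set vs \<subseteq> nn"
  from this(1) show "weight_mult g \<omega> (us @ (x + y) # vs) = weight_mult g \<omega> (us @ x # vs) + weight_mult g \<omega> (us @ y # vs)"
    by (induction us arbitrary: g \<omega>)
      (simp_all add: dual_root_basis_linear v sum.distrib[symmetric] distrib_left distrib_right cong: sum.cong)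
  from \<open>set us \<subseteq> nn\<close> show "weight_mult g \<omega> (us @ x # y # vs) = - weight_mult g \<omega> (us @ y # x # vs)"
    using assms
  proof (induction us arbitrary: g \<omega>)
    case Nil
    define W where "W \<alpha> \<beta> = weight_mult (\<lambda>\<mu>. g (\<alpha> + (\<beta> + \<mu>))) (\<lambda>zs. \<omega> (e \<alpha> # e \<beta> # zs)) vs" for \<alpha> \<beta>
    have W: "W \<beta> \<alpha> = - W \<alpha> \<beta>" if "\<alpha> \<in> Phi_pos n" "\<beta> \<in> Phi_pos n" for \<alpha> \<beta>
    proof -
      have "(\<lambda>\<mu>. g (\<alpha> + (\<beta> + \<mu>))) = (\<lambda>\<mu>. g (\<beta> + (\<alpha> + \<mu>)))" by (simp only: add.left_commute)
      then show ?thesis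
        unfolding W_def using that alt_swap0[OF Nil.prems(2) e_nn _ e_nn] map_e_nn
        by (simp only:) (rule weight_mult_neg, blast)
    qed
    have exp: "weight_mult g \<omega> ([] @ a # b # vs) =
        (\<Sum>\<alpha>\<in>Phi_pos n. \<Sum>\<beta>\<in>Phi_pos n. dual_root_basis e \<alpha> a * dual_root_basis e \<beta> b * W \<alpha> \<beta>)" for a b
      by (simp only: append_Nil weight_mult.simps sum_distrib_left W_def mult.assoc)
    have "weight_mult g \<omega> ([] @ y # x # vs) =
        (\<Sum>\<beta>\<in>Phi_pos n. \<Sum>\<alpha>\<in>Phi_pos n. dual_root_basis e \<alpha> y * dual_root_basis e \<beta> x * W \<alpha> \<beta>)"
      unfolding exp by (rule sum.swap)
    also have "\<dots> = (\<Sum>\<beta>\<in>Phi_pos n. \<Sum>\<alpha>\<in>Phi_pos n. - (dual_root_basis e \<beta> x * dual_root_basis e \<alpha> y * W \<beta> \<alpha>))"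
      by (intro sum.cong refl) (subst W, simp_all)
    also have "\<dots> = - weight_mult g \<omega> ([] @ x # y # vs)" unfolding exp by (simp add: sum_negf)
    finally show ?case by simp
  next
    case (Cons u us)
    have "weight_mult (\<lambda>\<mu>. g (\<alpha> + \<mu>)) (\<lambda>zs. \<omega> (e \<alpha> # zs)) (us @ x # y # vs) =
        - weight_mult (\<lambda>\<mu>. g (\<alpha> + \<mu>)) (\<lambda>zs. \<omega> (e \<alpha> # zs)) (us @ y # x # vs)" if "\<alpha> \<in> Phi_pos n" for \<alpha>
      using Cons.prems e_nn[OF that] by (intro Cons.IH alt_contract) auto
    then show ?case by (simp add: sum_negf)
  qed
next
  fix us c x vs assume "set us \<subseteq> nn" and v: "x \<in> nn" "set vs \<subseteq> nn"
  from this(1) show "weight_mult g \<omega> (us @ mscale c x # vs) = c * weight_mult g \<omega> (us @ x # vs)"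
    by (induction us arbitrary: g \<omega>)
      (simp_all add: dual_root_basis_linear v sum_distrib_left mult_ac cong: sum.cong)
qed

lemma weight_mult_cochains: "alt_multilinear nn \<omega> \<Longrightarrow> weight_mult g \<omega> \<in> cochains nn"
  unfolding cochains_nn using alt_weight_mult weight_mult_outside by blast

subsection \<open>An orthonormal basis of the nilradical\<close>

text \<open>Elements of \<open>K \<inter> H\<close> act on root vectors by imaginary scalars, since they are skew for the
  Hermitian form, and they separate the roots, since they span H.\<close>
lemma herm_e_orth:
  assumes \<alpha>: "\<alpha> \<in> Phi_pos n" and \<beta>: "\<beta> \<in> Phi_pos n" and "\<alpha> \<noteq> \<beta>"
  shows "herm K (e \<alpha>) (e \<beta>) = 0"
proof -
  obtain k where k: "k \<in> {1..n}" "\<alpha> k \<noteq> \<beta> k"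
    using weight_separate[OF weight_vec_pos[OF \<alpha>] weight_vec_pos[OF \<beta>] assms(3)] by blast
  have "\<exists>p. p \<in> (K \<inter> H) \<times> (K \<inter> H) \<and> tv k = fst p + mscale \<i> (snd p)"
    using compact_cartan tv_H[OF k(1)] unfolding real_form_def by blast
  then obtain x y where xy: "x \<in> K" "x \<in> H" "y \<in> K" "y \<in> H" "tv k = x + mscale \<i> y" by auto
  have w: "wt \<epsilon> \<gamma> (tv k) = wt \<epsilon> \<gamma> x + \<i> * wt \<epsilon> \<gamma> y" for \<gamma>
    unfolding xy(5) using xy by (simp add: wt_linear H_scale)
  have "wt \<epsilon> \<alpha> (tv k) \<noteq> wt \<epsilon> \<beta> (tv k)" using k by (simp add: wt_tv)
  then obtain t where t: "t \<in> K" "t \<in> H" "wt \<epsilon> \<alpha> t \<noteq> wt \<epsilon> \<beta> t" using w xy by metis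
  have skew: "wt \<epsilon> \<gamma> t * herm K (e \<gamma>) (e \<delta>) = - (cnj (wt \<epsilon> \<delta> t) * herm K (e \<gamma>) (e \<delta>))"
    if "\<gamma> \<in> Phi_pos n" "\<delta> \<in> Phi_pos n" for \<gamma> \<delta>
    using herm_skew[OF t(1) e_sp[OF that(1)] e_sp[OF that(2)]] that
    by (simp add: rspace_br[OF e_rspace t(2)] herm_scale herm_scale_right e_sp)
  obtain r where r: "r > 0" "herm K (e \<beta>) (e \<beta>) = of_real r"
    using herm_positive[OF e_sp[OF \<beta>] e_nonzero[OF \<beta>]] by blast
  have "(wt \<epsilon> \<beta> t + cnj (wt \<epsilon> \<beta> t)) * herm K (e \<beta>) (e \<beta>) = 0"
    unfolding distrib_right skew[OF \<beta> \<beta>] by simp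
  then have "wt \<epsilon> \<beta> t + cnj (wt \<epsilon> \<beta> t) = 0" unfolding r(2) using r(1) by simp
  then have "cnj (wt \<epsilon> \<beta> t) = - wt \<epsilon> \<beta> t" by (simp only: eq_neg_iff_add_eq_0 add.commute)
  then show ?thesis using skew[OF \<alpha> \<beta>] t(3) by simp
qed

lemma onb_exists:
  obtains c where "\<And>\<alpha>. \<alpha> \<in> Phi_pos n \<Longrightarrow> c \<alpha> \<noteq> 0" "onb nn ((\<lambda>\<alpha>. mscale (c \<alpha>) (e \<alpha>)) ` Phi_pos n)"
proof -
  have "\<forall>\<alpha>\<in>Phi_pos n. \<exists>r>0. herm K (e \<alpha>) (e \<alpha>) = of_real r"
    using herm_positive[OF e_sp e_nonzero] by blast
  then obtain r where r: "\<And>\<alpha>. \<alpha> \<in> Phi_pos n \<Longrightarrow> r \<alpha> > 0" "\<And>\<alpha>. \<alpha> \<in> Phi_pos n \<Longrightarrow> herm K (e \<alpha>) (e \<alpha>) = of_real (r \<alpha>)"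
    by metis
  define c where "c \<alpha> = complex_of_real (1 / sqrt (r \<alpha>))" for \<alpha>
  have c: "c \<alpha> \<noteq> 0" if "\<alpha> \<in> Phi_pos n" for \<alpha> using r(1)[OF that] by (simp add: c_def)
  define w where "w \<alpha> = mscale (c \<alpha>) (e \<alpha>)" for \<alpha>
  have wnn: "w \<alpha> \<in> nn" if "\<alpha> \<in> Phi_pos n" for \<alpha> unfolding w_def by (intro N.scale_closed e_nn that)
  have hw: "herm K (w \<alpha>) (w \<beta>) = (if \<alpha> = \<beta> then 1 else 0)" if "\<alpha> \<in> Phi_pos n" "\<beta> \<in> Phi_pos n" for \<alpha> \<beta>
  proof (cases "\<alpha> = \<beta>")
    case True
    have "herm K (w \<alpha>) (w \<alpha>) = c \<alpha> * cnj (c \<alpha>) * of_real (r \<alpha>)"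
      unfolding w_def using that by (simp add: herm_scale herm_scale_right e_sp sp.scale_closed r(2))
    also have "\<dots> = of_real (1 / sqrt (r \<alpha>) * (1 / sqrt (r \<alpha>)) * r \<alpha>)" by (simp only: c_def complex_cnj_complex_of_real of_real_mult)
    also have "1 / sqrt (r \<alpha>) * (1 / sqrt (r \<alpha>)) * r \<alpha> = 1" using r(1)[OF that(1)] by simp
    finally show ?thesis using True by simp
  next
    case False
    then show ?thesis
      unfolding w_def using that by (simp add: herm_scale herm_scale_right e_sp sp.scale_closed herm_e_orth)
  qed
  have inj: "inj_on w (Phi_pos n)" by (rule inj_onI) (metis hw zero_neq_one)
  have fin: "finite (w ` Phi_pos n)" using finite_Phi_pos by simp
  have "u v = 0" if u: "(\<Sum>v\<in>w ` Phi_pos n. mscale (u v) v) = 0" and v: "v \<in> w ` Phi_pos n" for u v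
  proof -
    obtain \<beta> where \<beta>: "\<beta> \<in> Phi_pos n" "v = w \<beta>" using v by blast
    have wsp: "w \<alpha> \<in> sp" if "\<alpha> \<in> Phi_pos n" for \<alpha> using wnn[OF that] nn_sp by blast
    have "(\<Sum>v\<in>w ` Phi_pos n. mscale (u v) v) = (\<Sum>\<alpha>\<in>Phi_pos n. mscale (u (w \<alpha>)) (w \<alpha>))"
      unfolding sum.reindex[OF inj] o_def ..
    then have "herm K (\<Sum>\<alpha>\<in>Phi_pos n. mscale (u (w \<alpha>)) (w \<alpha>)) (w \<beta>) = herm K 0 (w \<beta>)" using u by simp
    also have "herm K 0 (w \<beta>) = 0" using herm_scale[OF sp.zero_closed wsp[OF \<beta>(1)], of 0] by simp
    also have "herm K (\<Sum>\<alpha>\<in>Phi_pos n. mscale (u (w \<alpha>)) (w \<alpha>)) (w \<beta>) = (\<Sum>\<alpha>\<in>Phi_pos n. u (w \<alpha>) * herm K (w \<alpha>) (w \<beta>))"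
      by (rule herm_sum[OF wsp wsp[OF \<beta>(1)]])
    also have "\<dots> = (\<Sum>\<alpha>\<in>Phi_pos n. if \<alpha> = \<beta> then u (w \<alpha>) else 0)"
      using \<beta>(1) by (intro sum.cong refl) (simp add: hw)
    finally show ?thesis using \<beta> finite_Phi_pos by simp
  qed
  then have ind: "mt.independent (w ` Phi_pos n)" unfolding mt.dependent_finite[OF fin] by blast
  have "mt.span (w ` Phi_pos n) = nn"
  proof
    show "mt.span (w ` Phi_pos n) \<subseteq> nn" using wnn by (intro mt.span_minimal[OF _ nn_subspace]) auto
    have "e \<alpha> \<in> mt.span (w ` Phi_pos n)" if "\<alpha> \<in> Phi_pos n" for \<alpha>
    proof (rule mscale_cancel_mem[of _ "c \<alpha>"])
      show "mscale (c \<alpha>) (e \<alpha>) \<in> mt.span (w ` Phi_pos n)"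
        unfolding w_def[symmetric] using that by (intro mt.span_base) auto
    qed (use c[OF that] in auto)
    then show "nn \<subseteq> mt.span (w ` Phi_pos n)" unfolding nn_def by (intro mt.span_minimal) auto
  qed
  then have "onb nn (w ` Phi_pos n)"
    unfolding onb_def basis_of_def using fin ind hw inj_on_eq_iff[OF inj] by auto
  then show thesis using that[of c] c unfolding w_def by blast
qed

lemma qform_e_zero:
  assumes "alt_multilinear nn \<phi>" "alt_multilinear nn \<psi>"
    and "\<And>l. set l \<subseteq> Phi_pos n \<Longrightarrow> \<phi> (map e l) = 0 \<or> \<psi> (map e l) = 0"
  shows "qform ((\<lambda>\<alpha>. mscale (c \<alpha>) (e \<alpha>)) ` Phi_pos n) k \<phi> \<psi> = 0"
proof -
  define W where "W = (\<lambda>\<alpha>. mscale (c \<alpha>) (e \<alpha>)) ` Phi_pos n"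
  have fin: "finite W" by (simp add: W_def finite_Phi_pos)
  have ex: "\<exists>l d. set l \<subseteq> Phi_pos n \<and> (\<forall>\<omega>. alt_multilinear nn \<omega> \<longrightarrow> \<omega> ws = d * \<omega> (map e l))"
    if "set ws \<subseteq> W" for ws
    using that
  proof (induction ws)
    case Nil
    show ?case by (rule exI[of _ "[]"], rule exI[of _ 1]) simp
  next
    case (Cons w ws)
    obtain l d where l: "set l \<subseteq> Phi_pos n" and d: "\<And>\<omega>. alt_multilinear nn \<omega> \<Longrightarrow> \<omega> ws = d * \<omega> (map e l)"
      using Cons by auto
    obtain \<alpha> where \<alpha>: "\<alpha> \<in> Phi_pos n" "w = mscale (c \<alpha>) (e \<alpha>)" using Cons.prems by (auto simp: W_def)
    have wnn: "w \<in> nn" unfolding \<alpha>(2) by (intro N.scale_closed e_nn \<alpha>)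
    have "\<omega> (w # ws) = (d * c \<alpha>) * \<omega> (map e (\<alpha> # l))" if \<omega>: "alt_multilinear nn \<omega>" for \<omega>
      using d[OF alt_contract[OF \<omega> wnn]] alt_scale0[OF \<omega> e_nn[OF \<alpha>(1)] map_e_nn[OF l], of "c \<alpha>"]
      by (simp add: \<alpha>(2))
    then show ?case using l \<alpha>(1) by (intro exI[of _ "\<alpha> # l"] exI[of _ "d * c \<alpha>"]) auto
  qed
  have "\<phi> ws * cnj (\<psi> ws) = 0" if ws: "set ws \<subseteq> W" for ws
  proof -
    obtain l d where "set l \<subseteq> Phi_pos n" "\<phi> ws = d * \<phi> (map e l)" "\<psi> ws = d * \<psi> (map e l)"
      using ex[OF ws] assms(1,2) by blast
    then show ?thesis using assms(3)[of l] by auto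
  qed
  then show ?thesis unfolding W_def[symmetric] qform_explicit[OF fin] by (intro sum.neutral) auto
qed

lemma form_inner_facts:
  obtains us where "distinct us" "onb nn (set us)"
    "\<And>\<omega> \<eta>. form_inner (herm K) nn \<omega> \<eta> = (\<Sum>S\<in>Pow {..<length us}. \<omega> (nths us S) * cnj (\<eta> (nths us S)))"
proof -
  obtain c where c: "onb nn ((\<lambda>\<alpha>. mscale (c \<alpha>) (e \<alpha>)) ` Phi_pos n)" (is "onb nn ?W") using onb_exists by blast
  have "finite ?W" by (simp add: finite_Phi_pos)
  then obtain ws where "set ws = ?W" "distinct ws" using finite_distinct_list by blast
  then have "orthonormal_basis (herm K) nn ws"
    using c unfolding onb_def basis_of_def orthonormal_basis_def by simp
  then have ex: "\<exists>us. orthonormal_basis (herm K) nn us" by blast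
  define us where "us = (SOME us. orthonormal_basis (herm K) nn us)"
  have us: "orthonormal_basis (herm K) nn us" unfolding us_def by (rule someI_ex[OF ex])
  show thesis
  proof (rule that)
    show "distinct us" using us by (simp add: orthonormal_basis_def)
    show "onb nn (set us)" using us by (simp add: orthonormal_basis_def onb_def basis_of_def)
    show "form_inner (herm K) nn \<omega> \<eta> = (\<Sum>S\<in>Pow {..<length us}. \<omega> (nths us S) * cnj (\<eta> (nths us S)))" for \<omega> \<eta>
      unfolding form_inner_def us_def[symmetric] Let_def ..
  qed
qed

lemma zero_cochain: "(0 :: 'n form) \<in> cochains nn"
  unfolding cochains_nn by (auto intro!: alt_multilinearI)

text \<open>The adjoint is defined as a unique object; here uniqueness is definiteness of the inner product.\<close>
lemma ce_codiff_zero: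
  assumes "\<And>\<omega>. \<omega> \<in> cochains nn \<Longrightarrow> form_inner (herm K) nn (ce_diff nn \<omega>) \<eta> = 0"
  shows "ce_codiff (herm K) nn \<eta> = 0"
  unfolding ce_codiff_def
proof (rule the_equality)
  obtain us where us: "distinct us" "onb nn (set us)"
    "\<And>\<omega> \<eta>. form_inner (herm K) nn \<omega> \<eta> = (\<Sum>S\<in>Pow {..<length us}. \<omega> (nths us S) * cnj (\<eta> (nths us S)))"
    using form_inner_facts by blast
  show "0 \<in> cochains nn \<and> (\<forall>\<omega>\<in>cochains nn. form_inner (herm K) nn (ce_diff nn \<omega>) \<eta> = form_inner (herm K) nn \<omega> 0)"
    using assms zero_cochain by (simp add: us(3))
  fix \<zeta> assume \<zeta>: "\<zeta> \<in> cochains nn \<and> (\<forall>\<omega>\<in>cochains nn. form_inner (herm K) nn (ce_diff nn \<omega>) \<eta> = form_inner (herm K) nn \<omega> \<zeta>)"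
  then have z: "form_inner (herm K) nn \<zeta> \<zeta> = 0" using assms by simp
  have "\<zeta> xs = 0" for xs
  proof (cases "set xs \<subseteq> nn")
    case True
    then show ?thesis
      using form_inner_definite[OF us(1) _ _ _ True] us(2) z \<zeta> cochains_nn unfolding us(3) onb_def by blast
  qed (use \<zeta> cochains_nn in blast)
  then show "\<zeta> = 0" by (simp add: fun_eq_iff)
qed

end

section \<open>Cohomology\<close>

lemma ce_diff_add: "ce_diff V (\<omega> + \<eta>) = ce_diff V \<omega> + ce_diff V \<eta>"
  by (auto simp: ce_diff_def fun_eq_iff distrib_left sum.distrib[symmetric] intro!: sum.cong)

lemma ce_diff_fscale: "ce_diff V (fscale c \<omega>) = fscale c (ce_diff V \<omega>)"
  by (auto simp: ce_diff_def fscale_def fun_eq_iff sum_distrib_left mult_ac intro!: sum.cong)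

lemma fscale_minus_one: "fscale (-1) \<omega> = - \<omega>"
  by (simp add: fscale_def fun_eq_iff)

context matrix_lie_algebra
begin

lemma cochains_add: assumes "\<omega> \<in> cochains V" "\<eta> \<in> cochains V" shows "\<omega> + \<eta> \<in> cochains V"
proof -
  have a: "alt_multilinear V \<omega>" "alt_multilinear V \<eta>" using assms cochains_iff[OF subspace] by auto
  have "alt_multilinear V (\<omega> + \<eta>)"
  proof (rule alt_multilinearI)
    fix us x y vs assume "set us \<subseteq> V" "x \<in> V" "y \<in> V" "set vs \<subseteq> V"
    then show "(\<omega> + \<eta>) (us @ (x + y) # vs) = (\<omega> + \<eta>) (us @ x # vs) + (\<omega> + \<eta>) (us @ y # vs)"
      and "(\<omega> + \<eta>) (us @ x # y # vs) = - (\<omega> + \<eta>) (us @ y # x # vs)"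
      using alt_add[OF a(1), of us x vs y] alt_add[OF a(2), of us x vs y]
        alt_swap[OF a(1), of us x vs y] alt_swap[OF a(2), of us x vs y] by simp_all
  next
    fix us c x vs assume "set us \<subseteq> V" "x \<in> V" "set vs \<subseteq> V"
    then show "(\<omega> + \<eta>) (us @ mscale c x # vs) = c * (\<omega> + \<eta>) (us @ x # vs)"
      using alt_scale[OF a(1), of us x vs c] alt_scale[OF a(2), of us x vs c] by (simp add: distrib_left)
  qed
  then show ?thesis using assms unfolding cochains_iff[OF subspace] by simp
qed

lemma cochains_fscale: assumes "\<omega> \<in> cochains V" shows "fscale c \<omega> \<in> cochains V"
proof -
  have a: "alt_multilinear V \<omega>" using assms cochains_iff[OF subspace] by auto
  have "alt_multilinear V (fscale c \<omega>)"
  proof (rule alt_multilinearI)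
    fix us x y vs assume "set us \<subseteq> V" "x \<in> V" "y \<in> V" "set vs \<subseteq> V"
    then show "fscale c \<omega> (us @ (x + y) # vs) = fscale c \<omega> (us @ x # vs) + fscale c \<omega> (us @ y # vs)"
      and "fscale c \<omega> (us @ x # y # vs) = - fscale c \<omega> (us @ y # x # vs)"
      using alt_add[OF a, of us x vs y] alt_swap[OF a, of us x vs y] by (simp_all add: fscale_def distrib_left)
  next
    fix us d x vs assume "set us \<subseteq> V" "x \<in> V" "set vs \<subseteq> V"
    then show "fscale c \<omega> (us @ mscale d x # vs) = d * fscale c \<omega> (us @ x # vs)"
      using alt_scale[OF a, of us x vs d] by (simp add: fscale_def)
  qed
  then show ?thesis using assms unfolding cochains_iff[OF subspace] by (simp add: fscale_def)
qed

lemma cochains_zero: "0 \<in> cochains V"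
  unfolding cochains_iff[OF subspace] by (auto intro!: alt_multilinearI)

lemma cochains_sum: "(\<And>p. p \<in> F \<Longrightarrow> f p \<in> cochains V) \<Longrightarrow> (\<Sum>p\<in>F. f p) \<in> cochains V"
  by (induction F rule: infinite_finite_induct) (simp_all add: cochains_zero cochains_add)

lemma cocycles_add: "\<omega> \<in> cocycles V \<Longrightarrow> \<eta> \<in> cocycles V \<Longrightarrow> \<omega> + \<eta> \<in> cocycles V"
  by (simp add: cocycles_def cochains_add ce_diff_add)

lemma cocycles_fscale: "\<omega> \<in> cocycles V \<Longrightarrow> fscale c \<omega> \<in> cocycles V"
  by (simp add: cocycles_def cochains_fscale ce_diff_fscale)

lemma ce_diff_zero: "ce_diff V 0 = 0"
  by (auto simp: ce_diff_def fun_eq_iff intro!: sum.neutral)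

lemma cocycles_zero: "0 \<in> cocycles V"
  by (simp add: cocycles_def cochains_zero ce_diff_zero)

lemma coboundaries_add:
  assumes "\<omega> \<in> coboundaries V" "\<eta> \<in> coboundaries V" shows "\<omega> + \<eta> \<in> coboundaries V"
proof -
  obtain a b where "a \<in> cochains V" "b \<in> cochains V" "\<omega> = ce_diff V a" "\<eta> = ce_diff V b"
    using assms unfolding coboundaries_def by blast
  then show ?thesis
    unfolding coboundaries_def using imageI[OF cochains_add, of a b "ce_diff V"] by (simp only: ce_diff_add)
qed

lemma coboundaries_fscale: assumes "\<omega> \<in> coboundaries V" shows "fscale c \<omega> \<in> coboundaries V"
proof -
  obtain a where "a \<in> cochains V" "\<omega> = ce_diff V a" using assms unfolding coboundaries_def by blast
  then show ?thesis
    unfolding coboundaries_def using imageI[OF cochains_fscale, of a "ce_diff V" c] by (simp only: ce_diff_fscale)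
qed

lemma coboundaries_zero: "0 \<in> coboundaries V"
  unfolding coboundaries_def using imageI[OF cochains_zero, of "ce_diff V"] by (simp only: ce_diff_zero)

lemma coboundaries_minus: "\<omega> \<in> coboundaries V \<Longrightarrow> - \<omega> \<in> coboundaries V"
  using coboundaries_fscale[of \<omega> "-1"] by (simp only: fscale_minus_one)

lemma coh_class_eq_iff: "coh_class V \<omega> = coh_class V \<eta> \<longleftrightarrow> \<omega> - \<eta> \<in> coboundaries V"
proof
  assume "coh_class V \<omega> = coh_class V \<eta>"
  moreover have "\<omega> \<in> coh_class V \<omega>" using coboundaries_zero unfolding coh_class_def by force
  ultimately obtain \<beta> where "\<beta> \<in> coboundaries V" "\<omega> = \<eta> + \<beta>" unfolding coh_class_def by blast
  then show "\<omega> - \<eta> \<in> coboundaries V" by simp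
next
  have sub: "coh_class V \<omega> \<subseteq> coh_class V \<eta>" if d: "\<omega> - \<eta> \<in> coboundaries V" for \<omega> \<eta>
  proof
    fix \<zeta> assume "\<zeta> \<in> coh_class V \<omega>"
    then obtain \<beta> where "\<beta> \<in> coboundaries V" "\<zeta> = \<omega> + \<beta>" unfolding coh_class_def by blast
    then have "\<zeta> = \<eta> + ((\<omega> - \<eta>) + \<beta>)" "(\<omega> - \<eta>) + \<beta> \<in> coboundaries V" using coboundaries_add[OF d] by simp_all
    then show "\<zeta> \<in> coh_class V \<eta>" unfolding coh_class_def by blast
  qed
  assume d: "\<omega> - \<eta> \<in> coboundaries V"
  have "\<eta> - \<omega> \<in> coboundaries V" using coboundaries_minus[OF d] by simp
  then show "coh_class V \<omega> = coh_class V \<eta>" using sub d by blast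
qed

lemma coh_add: "coh_class V \<omega> \<oplus>\<^bsub>cohomology V\<^esub> coh_class V \<eta> = coh_class V (\<omega> + \<eta>)"
proof -
  have "{a + b |a b. a \<in> coh_class V \<omega> \<and> b \<in> coh_class V \<eta>} = coh_class V (\<omega> + \<eta>)" (is "?L = ?R")
  proof
    show "?L \<subseteq> ?R"
    proof
      fix \<zeta> assume "\<zeta> \<in> ?L"
      then obtain \<beta> \<beta>' where "\<beta> \<in> coboundaries V" "\<beta>' \<in> coboundaries V" "\<zeta> = (\<omega> + \<beta>) + (\<eta> + \<beta>')"
        unfolding coh_class_def by blast
      then have "\<zeta> = (\<omega> + \<eta>) + (\<beta> + \<beta>')" "\<beta> + \<beta>' \<in> coboundaries V"
        using coboundaries_add by (simp_all add: add_ac)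
      then show "\<zeta> \<in> ?R" unfolding coh_class_def by blast
    qed
    show "?R \<subseteq> ?L"
    proof
      fix \<zeta> assume "\<zeta> \<in> ?R"
      then obtain \<beta> where "\<beta> \<in> coboundaries V" "\<zeta> = (\<omega> + \<eta>) + \<beta>" unfolding coh_class_def by blast
      then have "\<zeta> = (\<omega> + \<beta>) + (\<eta> + 0)" "\<omega> + \<beta> \<in> coh_class V \<omega>" "\<eta> + 0 \<in> coh_class V \<eta>"
        using coboundaries_zero unfolding coh_class_def by (simp add: add_ac, blast+)
      then show "\<zeta> \<in> ?L" by blast
    qed
  qed
  then show ?thesis by (simp add: cohomology_def)
qed

lemma coh_smult: "c \<odot>\<^bsub>cohomology V\<^esub> coh_class V \<omega> = coh_class V (fscale c \<omega>)"
proof -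
  have "{fscale c a + \<beta> |a \<beta>. a \<in> coh_class V \<omega> \<and> \<beta> \<in> coboundaries V} = coh_class V (fscale c \<omega>)" (is "?L = ?R")
  proof
    show "?L \<subseteq> ?R"
    proof
      fix \<zeta> assume "\<zeta> \<in> ?L"
      then obtain \<beta> \<beta>' where "\<beta> \<in> coboundaries V" "\<beta>' \<in> coboundaries V" "\<zeta> = fscale c (\<omega> + \<beta>) + \<beta>'"
        unfolding coh_class_def by blast
      then have "\<zeta> = fscale c \<omega> + (fscale c \<beta> + \<beta>')" "fscale c \<beta> + \<beta>' \<in> coboundaries V"
        using coboundaries_add coboundaries_fscale by (simp_all add: fn.scale_right_distrib add_ac)
      then show "\<zeta> \<in> ?R" unfolding coh_class_def by blast
    qed
    show "?R \<subseteq> ?L"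
    proof
      fix \<zeta> assume "\<zeta> \<in> ?R"
      then obtain \<beta> where "\<beta> \<in> coboundaries V" "\<zeta> = fscale c \<omega> + \<beta>" unfolding coh_class_def by blast
      moreover have "\<omega> + 0 \<in> coh_class V \<omega>" using coboundaries_zero unfolding coh_class_def by blast
      ultimately show "\<zeta> \<in> ?L" by force
    qed
  qed
  then show ?thesis by (simp add: cohomology_def)
qed

lemma carrier_cohomology: "carrier (cohomology V) = coh_class V ` cocycles V"
  by (simp add: cohomology_def)

lemma zero_cohomology: "\<zero>\<^bsub>cohomology V\<^esub> = coh_class V 0"
  by (simp add: cohomology_def coh_class_def)

lemma abelian_monoid_cohomology: "abelian_monoid (cohomology V)"
  by (rule abelian_monoidI)
    (auto simp: carrier_cohomology zero_cohomology coh_add cocycles_zero add_ac intro: cocycles_add)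

lemma finsum_coh_class:
  assumes "finite F" "\<And>p. p \<in> F \<Longrightarrow> L p \<in> cocycles V"
  shows "(\<Oplus>\<^bsub>cohomology V\<^esub>p\<in>F. c p \<odot>\<^bsub>cohomology V\<^esub> coh_class V (L p)) = coh_class V (\<Sum>p\<in>F. fscale (c p) (L p))"
  using assms
proof (induction F rule: finite_induct)
  case empty
  show ?case by (simp only: abelian_monoid.finsum_empty[OF abelian_monoid_cohomology] zero_cohomology sum.empty)
next
  case (insert p F)
  have in_carrier: "c q \<odot>\<^bsub>cohomology V\<^esub> coh_class V (L q) \<in> carrier (cohomology V)" if "q \<in> insert p F" for q
    unfolding coh_smult carrier_cohomology using insert.prems[OF that] by (intro imageI cocycles_fscale)
  have "(\<Oplus>\<^bsub>cohomology V\<^esub>q\<in>insert p F. c q \<odot>\<^bsub>cohomology V\<^esub> coh_class V (L q)) =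
      c p \<odot>\<^bsub>cohomology V\<^esub> coh_class V (L p) \<oplus>\<^bsub>cohomology V\<^esub>
      (\<Oplus>\<^bsub>cohomology V\<^esub>q\<in>F. c q \<odot>\<^bsub>cohomology V\<^esub> coh_class V (L q))"
    by (rule abelian_monoid.finsum_insert[OF abelian_monoid_cohomology insert.hyps]) (use in_carrier in auto)
  also have "\<dots> = coh_class V (fscale (c p) (L p) + (\<Sum>q\<in>F. fscale (c q) (L q)))"
    using insert.IH insert.prems by (simp only: insertI2 coh_smult coh_add)
  also have "fscale (c p) (L p) + (\<Sum>q\<in>F. fscale (c q) (L q)) = (\<Sum>q\<in>insert p F. fscale (c q) (L q))"
    by (rule sum.insert[OF insert.hyps, symmetric])
  finally show ?case .
qed

end

section \<open>The cochains attached to permutations and abelian ideals\<close>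

context sp_roots
begin

definition class_roots :: "(nat \<Rightarrow> nat) \<times> 'n cmat set \<Rightarrow> weight set" where
  "class_roots p = L_roots n (fst p) (ideal_roots H \<epsilon> (snd p))"

definition pairs :: "((nat \<Rightarrow> nat) \<times> 'n cmat set) set" where
  "pairs = {\<sigma>. \<sigma> permutes {1..n}} \<times> abelian_ideals bb"

lemma pairsD: "p \<in> pairs \<Longrightarrow> fst p permutes {1..n}" "p \<in> pairs \<Longrightarrow> snd p \<in> abelian_ideals bb"
  "p \<in> pairs \<Longrightarrow> upper_set n (ideal_roots H \<epsilon> (snd p))"
  using ideal_roots_upper by (auto simp: pairs_def)

lemma class_roots_separated: "p \<in> pairs \<Longrightarrow> separated n (class_roots p)"
  unfolding class_roots_def by (intro separated_L_roots pairsD)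

lemma class_roots_pos: "p \<in> pairs \<Longrightarrow> class_roots p \<subseteq> Phi_pos n"
  using class_roots_separated by (simp add: separated_def)

lemma class_roots_inj: "inj_on class_roots pairs"
proof (rule inj_onI)
  fix p q assume p: "p \<in> pairs" and q: "q \<in> pairs" and eq: "class_roots p = class_roots q"
  note * = L_roots_inj[OF pairsD(1)[OF p] pairsD(3)[OF p] pairsD(1)[OF q] pairsD(3)[OF q] eq[unfolded class_roots_def]]
  have "snd p = snd q" using ideal_span[OF pairsD(2)[OF p]] ideal_span[OF pairsD(2)[OF q]] *(2) by simp
  then show "p = q" using *(1) by (simp add: prod_eq_iff)
qed

lemma finite_pairs: "finite pairs"
proof (rule finite_imageD[OF _ class_roots_inj])
  show "finite (class_roots ` pairs)"
    by (rule finite_subset[of _ "Pow (Phi_pos n)"]) (use class_roots_pos finite_Phi_pos in auto)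
qed

text \<open>Every weight on which the Laplacian vanishes belongs to one of the classes; this is where the
  parametrisations by upper sets and by abelian ideals are joined.\<close>
lemma extremal_is_class:
  assumes S: "S \<subseteq> Phi_pos n" and ext: "wdot n (\<Sum>S) (\<Sum>S) = 2 * wdot n (rho n) (\<Sum>S)"
  shows "\<exists>p\<in>pairs. S = class_roots p"
proof -
  obtain \<sigma> \<Psi> where \<sigma>: "\<sigma> permutes {1..n}" and \<Psi>: "upper_set n \<Psi>" and S: "S = L_roots n \<sigma> \<Psi>"
    using extremal_is_L_roots[OF S ext] by blast
  have "(\<sigma>, mt.span (e ` \<Psi>)) \<in> pairs" using \<sigma> upper_set_ideal(1)[OF \<Psi>] by (simp add: pairs_def)
  moreover have "S = class_roots (\<sigma>, mt.span (e ` \<Psi>))"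
    using S upper_set_ideal(2)[OF \<Psi>] by (simp add: class_roots_def)
  ultimately show ?thesis by blast
qed

lemma one_form_supported:
  assumes "\<alpha> \<in> Phi_pos n" shows "supported_at e (Phi_pos n) {\<alpha>} (one_form (dual_root_basis e \<alpha>))"
  unfolding supported_at_def
proof (intro allI impI)
  fix l assume l: "set l \<subseteq> Phi_pos n"
  show "one_form (dual_root_basis e \<alpha>) (map e l) \<noteq> 0 \<longleftrightarrow> distinct l \<and> set l = {\<alpha>}"
  proof (cases "length l = 1")
    case True
    then obtain \<beta> where "l = [\<beta>]" by (metis One_nat_def length_0_conv length_Suc_conv)
    then show ?thesis using l assms by (auto simp: one_form_def dual_root_basis_e)
  next
    case False
    moreover have "length l = 1" if "distinct l" "set l = {\<alpha>}" using distinct_card[OF that(1)] that(2) by simp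
    ultimately show ?thesis by (auto simp: one_form_def)
  qed
qed

lemma is_L_facts:
  assumes p: "p \<in> pairs" and L: "is_L H \<epsilon> e (fst p) (snd p) \<omega>"
  shows "\<omega> \<in> cochains nn" "supported_at e (Phi_pos n) (class_roots p) \<omega>"
proof -
  define \<tau> where "\<tau> = fst p \<circ> perm_rev n"
  define \<Psi> where "\<Psi> = ideal_roots H \<epsilon> (snd p)"
  note \<sigma> = pairsD(1)[OF p] and \<Psi> = pairsD(3)[OF p, folded \<Psi>_def]
  obtain c as bs where c: "c \<noteq> 0" and as: "distinct as" "set as = Phi_perm n (fst p)"
    and bs: "distinct bs" "set bs = \<Psi>"
    and \<omega>: "\<omega> = fscale c (wedge (wedge_list (map (dual_root_basis e) as))
       (wedge_list (map (\<lambda>\<alpha>. dual_root_basis e (perm_act \<tau> \<alpha>)) bs)))"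
    using L unfolding is_L_def n[symmetric] \<tau>_def \<Psi>_def by blast
  define cs where "cs = map (perm_act \<tau>) bs"
  have inj: "inj (perm_act \<tau>)"
  proof (rule injI)
    fix a b assume eq: "perm_act \<tau> a = perm_act \<tau> b"
    have "a k = b k" for k
      using fun_cong[OF eq, of "\<tau> k"] permutes_inverses(2)[OF tau_permutes[OF \<sigma>]] by (simp add: perm_act_def \<tau>_def)
    then show "a = b" by (rule ext)
  qed
  have cs: "distinct cs" "set cs = perm_act \<tau> ` \<Psi>"
    using bs inj_on_subset[OF inj, of \<Psi>] by (simp_all add: cs_def distinct_map)
  have roots: "class_roots p = set as \<union> set cs"
    by (simp add: class_roots_def L_roots_def as cs \<tau>_def \<Psi>_def)
  have pos: "set as \<subseteq> Phi_pos n" "set cs \<subseteq> Phi_pos n" using class_roots_pos[OF p] roots by auto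
  have disj: "set as \<inter> set cs = {}"
    unfolding as cs \<tau>_def by (rule L_parts_disjoint[OF \<sigma> \<Psi>])
  have \<omega>': "\<omega> = fscale c (wedge (wedge_list (map (dual_root_basis e) as)) (wedge_list (map (dual_root_basis e) cs)))"
    unfolding \<omega> cs_def by (simp add: o_def)
  have wl: "wedge_list (map (dual_root_basis e) l) \<in> cochains nn" if "set l \<subseteq> Phi_pos n" for l
    using that dual_root_basis_dual by (intro wedge_list_cochains nn_subspace) auto
  show "\<omega> \<in> cochains nn"
    unfolding \<omega>' by (intro N.cochains_fscale wedge_cochains nn_subspace wl pos)
  have "supported_at e (Phi_pos n) (set as \<union> set cs)
      (wedge (wedge_list (map (dual_root_basis e) as)) (wedge_list (map (dual_root_basis e) cs)))"
    using pos by (intro supported_wedge supported_wedge_list one_form_supported as cs disj) auto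
  then show "supported_at e (Phi_pos n) (class_roots p) \<omega>"
    unfolding roots \<omega>' using c by (simp add: supported_at_def fscale_def)
qed

context
  fixes L :: "(nat \<Rightarrow> nat) \<times> 'n cmat set \<Rightarrow> 'n form"
  assumes L: "\<And>p. p \<in> pairs \<Longrightarrow> is_L H \<epsilon> e (fst p) (snd p) (L p)"
begin

lemma L_cochain: "p \<in> pairs \<Longrightarrow> L p \<in> cochains nn" and L_alt: "p \<in> pairs \<Longrightarrow> alt_multilinear nn (L p)"
  using is_L_facts(1) L cochains_nn by blast+

lemma L_nonzero_iff:
  "p \<in> pairs \<Longrightarrow> set l \<subseteq> Phi_pos n \<Longrightarrow> L p (map e l) \<noteq> 0 \<longleftrightarrow> distinct l \<and> set l = class_roots p"
  using is_L_facts(2) L unfolding supported_at_def by blast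

text \<open>The differential of L p has the weight of L p, which occurs in a single degree only.\<close>
lemma L_closed: assumes p: "p \<in> pairs" shows "ce_diff nn (L p) = 0"
proof (rule cochain_eqI[OF N.ce_diff_cochains[OF L_cochain[OF p]] zero_cochain])
  fix l assume l: "set l \<subseteq> Phi_pos n"
  have d: "ce_diff nn (L p) (map e l) = cartan_d (L p) (map e l)"
    by (rule N.ce_diff_eq_cartan_d[OF L_alt[OF p] map_e_nn[OF l]])
  define s where "s = \<Sum>(class_roots p)"
  define g where "g k \<mu> = (if \<mu> = s then 1 else 0 :: complex)" for k :: nat and \<mu>
  have "cartan_d (L p) (map e l) = g (length l - 1) (sum_list l) * cartan_d (L p) (map e l)"
  proof (rule cartan_d_weight[OF L_alt[OF p] L_alt[OF p] _ l])
    fix l' assume "set l' \<subseteq> Phi_pos n"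
    then show "L p (map e l') = g (length l') (sum_list l') * L p (map e l')"
      using L_nonzero_iff[OF p] sum_list_set by (cases "L p (map e l') = 0") (auto simp: g_def s_def)
  qed
  moreover have "cartan_d (L p) (map e l) = 0" if "sum_list l = s"
  proof (cases "distinct l")
    case True
    then have "set l = class_roots p"
      using that sum_list_set[OF True] separated_unique_sum[OF class_roots_separated[OF p] l] by (simp add: s_def)
    then show ?thesis using cartan_d_separated[OF L_alt[OF p] _ True] class_roots_separated[OF p] by simp
  next
    case False
    then show ?thesis by (rule alt_map_e_not_distinct[OF N.alt_cartan_d[OF L_alt[OF p]] l])
  qed
  ultimately have "cartan_d (L p) (map e l) = 0" by (cases "sum_list l = s") (simp_all add: g_def)
  then show "ce_diff nn (L p) (map e l) = 0 (map e l)" using d by simp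
qed

lemma L_cocycle: "p \<in> pairs \<Longrightarrow> L p \<in> cocycles nn"
  by (simp add: cocycles_def L_cochain L_closed)

text \<open>A coboundary has no component at the set of roots of L p, since no other cochain has the same
  weight; hence L p is orthogonal to all coboundaries.\<close>
lemma ce_diff_at_class:
  assumes p: "p \<in> pairs" and \<eta>: "\<eta> \<in> cochains nn" and l: "distinct l" "set l = class_roots p"
  shows "ce_diff nn \<eta> (map e l) = 0"
proof -
  have "set l \<subseteq> Phi_pos n" using class_roots_pos[OF p] l by simp
  moreover have a: "alt_multilinear nn \<eta>" using \<eta> cochains_nn by blast
  ultimately have "ce_diff nn \<eta> (map e l) = cartan_d \<eta> (map e l)"
    by (intro N.ce_diff_eq_cartan_d map_e_nn)
  also have "\<dots> = 0" using cartan_d_separated[OF a _ l(1)] class_roots_separated[OF p] l(2) by simp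
  finally show ?thesis .
qed

text \<open>In an orthonormal basis of root vectors the inner product pairs components at equal sets of roots,
  so orthogonality of L p to the coboundaries is \<open>ce_diff_at_class\<close>.\<close>
lemma L_harmonic: assumes p: "p \<in> pairs" shows "harmonic (herm K) nn (L p)"
proof -
  obtain us where us: "distinct us" "onb nn (set us)"
    "\<And>\<omega> \<eta>. form_inner (herm K) nn \<omega> \<eta> = (\<Sum>S\<in>Pow {..<length us}. \<omega> (nths us S) * cnj (\<eta> (nths us S)))"
    using form_inner_facts by blast
  have usV: "set us \<subseteq> nn" using us(2) basis_in unfolding onb_def by blast
  obtain c where W: "onb nn ((\<lambda>\<alpha>. mscale (c \<alpha>) (e \<alpha>)) ` Phi_pos n)" using onb_exists by blast
  have "ce_codiff (herm K) nn (L p) = 0"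
  proof (rule ce_codiff_zero)
    fix \<omega> assume \<omega>: "\<omega> \<in> cochains nn"
    have a: "alt_multilinear nn (ce_diff nn \<omega>)" using N.ce_diff_cochains[OF \<omega>] cochains_nn by blast
    show "form_inner (herm K) nn (ce_diff nn \<omega>) (L p) = 0"
      unfolding us(3)
    proof (rule form_inner_zero[OF us(1) usV a L_alt[OF p]])
      fix k
      have "qform (set us) k (ce_diff nn \<omega>) (L p) = qform ((\<lambda>\<alpha>. mscale (c \<alpha>) (e \<alpha>)) ` Phi_pos n) k (ce_diff nn \<omega>) (L p)"
        by (rule qform_basis_independent[OF us(2) W nn_sp a L_alt[OF p]])
      also have "\<dots> = 0"
        using L_nonzero_iff[OF p] ce_diff_at_class[OF p \<omega>] by (intro qform_e_zero[OF a L_alt[OF p]]) blast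
      finally show "qform (set us) k (ce_diff nn \<omega>) (L p) = 0" .
    qed
  qed
  moreover have "ce_codiff (herm K) nn 0 = 0"
    by (rule ce_codiff_zero) (simp add: us(3))
  ultimately show ?thesis
    using L_cochain[OF p] by (simp add: harmonic_def L_closed[OF p] N.ce_diff_zero)
qed

lemma root_list: obtains r where "\<And>p. p \<in> pairs \<Longrightarrow> distinct (r p) \<and> set (r p) = class_roots p"
proof -
  have "\<forall>p\<in>pairs. \<exists>l. distinct l \<and> set l = class_roots p"
    using finite_distinct_list finite_subset[OF class_roots_pos finite_Phi_pos] by metis
  then show thesis using that by metis
qed

lemma L_at_other:
  assumes "p \<in> pairs" "q \<in> pairs" "q \<noteq> p" "set l = class_roots p" shows "L q (map e l) = 0"
  using L_nonzero_iff[OF assms(2), of l] assms class_roots_pos class_roots_inj by (metis inj_onD)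

lemma L_sum_at:
  assumes p: "p \<in> pairs" and l: "set l = class_roots p"
  shows "(\<Sum>q\<in>pairs. fscale (c q) (L q)) (map e l) = c p * L p (map e l)"
proof -
  have "(\<Sum>q\<in>pairs. fscale (c q) (L q)) (map e l) = (\<Sum>q\<in>pairs. if q = p then c q * L q (map e l) else 0)"
    unfolding sum_fun_apply by (intro sum.cong refl) (simp add: fscale_def L_at_other[OF p _ _ l])
  then show ?thesis using p finite_pairs by simp
qed

text \<open>On a weight space of weight \<open>- \<mu>\<close> the operator \<open>d s + s d\<close>, with s the homotopy, is the scalar
  \<open>2 \<langle>\<rho>, \<mu>\<rangle> - \<langle>\<mu>, \<mu>\<rangle>\<close> up to a constant. Where it does not vanish, dividing by it writes a cocycle as a
  coboundary; where it vanishes, the weight space is spanned by one of the L p.\<close>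
lemma cocycle_decompose:
  assumes \<omega>: "\<omega> \<in> cocycles nn"
  shows "\<exists>c. \<omega> - (\<Sum>p\<in>pairs. fscale (c p) (L p)) \<in> coboundaries nn"
proof -
  have \<omega>c: "\<omega> \<in> cochains nn" and \<omega>0: "ce_diff nn \<omega> = 0" using \<omega> by (auto simp: cocycles_def)
  have \<omega>a: "alt_multilinear nn \<omega>" using \<omega>c cochains_nn by blast
  obtain r where r: "\<And>p. p \<in> pairs \<Longrightarrow> distinct (r p) \<and> set (r p) = class_roots p" using root_list by blast
  define c where "c p = \<omega> (map e (r p)) / L p (map e (r p))" for p
  define W where "W = (\<lambda>p. \<Sum>(class_roots p)) ` pairs"
  define m where "m \<mu> = of_int (2 * wdot n (rho n) \<mu> - wdot n \<mu> \<mu>) / (of_int cc :: complex)" for \<mu>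
  define g where "g \<mu> = (if \<mu> \<in> W then 0 else 1 / m \<mu>)" for \<mu>
  define \<zeta> where "\<zeta> = weight_mult g (homotopy \<omega>)"
  have ha: "alt_multilinear nn (homotopy \<omega>)" by (rule alt_homotopy[OF \<omega>a])
  have \<zeta>: "\<zeta> \<in> cochains nn" unfolding \<zeta>_def by (rule weight_mult_cochains[OF ha])
  have \<zeta>a: "alt_multilinear nn \<zeta>" using \<zeta> cochains_nn by blast
  have dw: "cartan_d \<omega> xs = 0" if "set xs \<subseteq> nn" for xs
    using N.ce_diff_eq_cartan_d[OF \<omega>a that] \<omega>0 by simp
  have "extend (cartan_d \<omega>) = (\<lambda>_. 0)"
    unfolding extend_def using dw n_proj_in by (auto simp: fun_eq_iff image_subset_iff)
  then have hd0: "homotopy (cartan_d \<omega>) xs = 0" for xs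
    unfolding homotopy_def by (simp only: lie_der_zero sum.neutral_const)
  have d\<zeta>: "ce_diff nn \<zeta> (map e l) = g (sum_list l) * m (sum_list l) * \<omega> (map e l)" if l: "set l \<subseteq> Phi_pos n" for l
  proof -
    have "ce_diff nn \<zeta> (map e l) = cartan_d \<zeta> (map e l)" by (rule N.ce_diff_eq_cartan_d[OF \<zeta>a map_e_nn[OF l]])
    also have "\<dots> = g (sum_list l) * cartan_d (homotopy \<omega>) (map e l)"
      by (rule cartan_d_weight[OF ha \<zeta>a _ l, where g = "\<lambda>_. g"]) (simp add: \<zeta>_def weight_mult_e)
    also have "cartan_d (homotopy \<omega>) (map e l) = m (sum_list l) * \<omega> (map e l)"
      using laplacian_weight[OF \<omega>a l] by (simp only: hd0 m_def add_0_right)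
    finally show ?thesis by simp
  qed
  have "\<omega> = (\<Sum>p\<in>pairs. fscale (c p) (L p)) + ce_diff nn \<zeta>"
  proof (rule cochain_eqI[OF \<omega>c])
    show "(\<Sum>p\<in>pairs. fscale (c p) (L p)) + ce_diff nn \<zeta> \<in> cochains nn"
      by (intro N.cochains_add N.cochains_sum N.cochains_fscale L_cochain N.ce_diff_cochains \<zeta>)
    fix l assume l: "set l \<subseteq> Phi_pos n"
    show "\<omega> (map e l) = ((\<Sum>p\<in>pairs. fscale (c p) (L p)) + ce_diff nn \<zeta>) (map e l)"
    proof (cases "distinct l")
      case False
      have "(\<Sum>p\<in>pairs. fscale (c p) (L p)) (map e l) = 0"
        unfolding sum_fun_apply fscale_def using L_nonzero_iff l False by (intro sum.neutral) auto
      then show ?thesis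
        using alt_map_e_not_distinct[OF \<omega>a l False] d\<zeta>[OF l] by simp
    next
      case dist: True
      note sl = sum_list_set[OF dist]
      show ?thesis
      proof (cases "\<exists>p\<in>pairs. set l = class_roots p")
        case True
        then obtain p where p: "p \<in> pairs" "set l = class_roots p" by blast
        have "\<Sum>(set l) \<in> W" using p by (auto simp: W_def)
        then have "g (sum_list l) = 0" by (simp only: g_def sl if_True)
        moreover have "\<exists>s. s \<noteq> 0 \<and> (\<forall>\<phi>. alt_multilinear nn \<phi> \<longrightarrow> \<phi> (map e l) = s * \<phi> (map e (r p)))"
        proof -
          have rp: "set (r p) \<subseteq> Phi_pos n" using r[OF p(1)] class_roots_pos[OF p(1)] by simp
          have "distinct (map e l)" "distinct (map e (r p))" "set (map e l) = set (map e (r p))"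
            using distinct_map_e l rp dist r[OF p(1)] p(2) by auto
          from alt_same_set[OF this map_e_nn[OF l]]
          obtain s where "s \<in> {1, - 1}" "\<forall>\<omega>. alt_multilinear nn \<omega> \<longrightarrow> \<omega> (map e l) = s * \<omega> (map e (r p))" ..
          then show ?thesis by (intro exI[of _ s] conjI) auto
        qed
        then obtain s where s: "s \<noteq> 0" "\<And>\<phi>. alt_multilinear nn \<phi> \<Longrightarrow> \<phi> (map e l) = s * \<phi> (map e (r p))"
          by blast
        moreover have "L p (map e (r p)) \<noteq> 0"
          using L_nonzero_iff[OF p(1), of "r p"] r[OF p(1)] class_roots_pos[OF p(1)] by simp
        then have "c p * L p (map e l) = \<omega> (map e l)"
          using s(2)[OF \<omega>a] s(2)[OF L_alt[OF p(1)]] by (simp add: c_def)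
        ultimately show ?thesis using L_sum_at[OF p, of c] d\<zeta>[OF l] by simp
      next
        case False
        then have nW: "\<Sum>(set l) \<notin> W"
          using separated_unique_sum[OF class_roots_separated l] by (auto simp: W_def)
        have "m (\<Sum>(set l)) \<noteq> 0"
        proof
          assume "m (\<Sum>(set l)) = 0"
          then have "2 * wdot n (rho n) (\<Sum>(set l)) - wdot n (\<Sum>(set l)) (\<Sum>(set l)) = 0"
            using cc_pos unfolding m_def divide_eq_0_iff of_int_eq_0_iff by linarith
          then have "wdot n (\<Sum>(set l)) (\<Sum>(set l)) = 2 * wdot n (rho n) (\<Sum>(set l))" by simp
          then show False using extremal_is_class[OF l] False by blast
        qed
        then have "ce_diff nn \<zeta> (map e l) = \<omega> (map e l)"
          using d\<zeta>[OF l] nW by (simp add: g_def sl)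
        moreover have "(\<Sum>p\<in>pairs. fscale (c p) (L p)) (map e l) = 0"
          unfolding sum_fun_apply fscale_def using L_nonzero_iff l False by (intro sum.neutral) auto
        ultimately show ?thesis by simp
      qed
    qed
  qed
  then have "\<omega> - (\<Sum>p\<in>pairs. fscale (c p) (L p)) = ce_diff nn \<zeta>" by (simp add: algebra_simps)
  then show ?thesis using \<zeta> unfolding coboundaries_def by blast
qed

text \<open>Evaluation at the root vectors of \<open>class_roots p\<close> isolates the coefficient of L p, and vanishes on
  coboundaries.\<close>
lemma L_independent:
  assumes eq: "(\<Sum>q\<in>pairs. fscale (c q) (L q)) - (\<Sum>q\<in>pairs. fscale (d q) (L q)) \<in> coboundaries nn"
    and p: "p \<in> pairs"
  shows "c p = d p"
proof -
  obtain \<eta> where \<eta>: "\<eta> \<in> cochains nn" "(\<Sum>q\<in>pairs. fscale (c q) (L q)) - (\<Sum>q\<in>pairs. fscale (d q) (L q)) = ce_diff nn \<eta>"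
    using eq unfolding coboundaries_def by blast
  obtain r where r: "\<And>p. p \<in> pairs \<Longrightarrow> distinct (r p) \<and> set (r p) = class_roots p" using root_list by blast
  have rp: "distinct (r p)" "set (r p) = class_roots p" using r[OF p] by auto
  have "(\<Sum>q\<in>pairs. fscale (c q) (L q)) (map e (r p)) - (\<Sum>q\<in>pairs. fscale (d q) (L q)) (map e (r p)) = 0"
    using fun_cong[OF \<eta>(2), of "map e (r p)"] ce_diff_at_class[OF p \<eta>(1) rp] by simp
  then have "c p * L p (map e (r p)) = d p * L p (map e (r p))" by (simp add: L_sum_at[OF p rp(2)])
  moreover have "L p (map e (r p)) \<noteq> 0"
    using L_nonzero_iff[OF p, of "r p"] rp class_roots_pos[OF p] by simp
  ultimately show ?thesis by simp
qed

lemma L_basis: "basis_family (cohomology nn) pairs (\<lambda>p. coh_class nn (L p))"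
  unfolding basis_family_def
proof (intro conjI ballI)
  show "finite pairs" by (rule finite_pairs)
  show "(\<lambda>p. coh_class nn (L p)) ` pairs \<subseteq> carrier (cohomology nn)"
    using L_cocycle by (auto simp: N.carrier_cohomology)
  have fs: "(\<Oplus>\<^bsub>cohomology nn\<^esub>p\<in>pairs. c p \<odot>\<^bsub>cohomology nn\<^esub> coh_class nn (L p)) =
      coh_class nn (\<Sum>p\<in>pairs. fscale (c p) (L p))" for c
    by (rule N.finsum_coh_class[OF finite_pairs L_cocycle])
  fix x assume "x \<in> carrier (cohomology nn)"
  then obtain \<omega> where \<omega>: "\<omega> \<in> cocycles nn" "x = coh_class nn \<omega>" by (auto simp: N.carrier_cohomology)
  obtain c where c: "\<omega> - (\<Sum>p\<in>pairs. fscale (c p) (L p)) \<in> coboundaries nn" using cocycle_decompose[OF \<omega>(1)] by blast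
  show "\<exists>!c. c \<in> pairs \<rightarrow>\<^sub>E UNIV \<and> x = (\<Oplus>\<^bsub>cohomology nn\<^esub>p\<in>pairs. c p \<odot>\<^bsub>cohomology nn\<^esub> coh_class nn (L p))"
  proof (rule ex1I[of _ "restrict c pairs"])
    have "(\<Sum>p\<in>pairs. fscale (restrict c pairs p) (L p)) = (\<Sum>p\<in>pairs. fscale (c p) (L p))"
      by (intro sum.cong refl) simp
    then have "x = coh_class nn (\<Sum>p\<in>pairs. fscale (restrict c pairs p) (L p))"
      unfolding \<omega>(2) using c by (simp only: N.coh_class_eq_iff)
    then show "restrict c pairs \<in> pairs \<rightarrow>\<^sub>E UNIV \<and>
        x = (\<Oplus>\<^bsub>cohomology nn\<^esub>p\<in>pairs. restrict c pairs p \<odot>\<^bsub>cohomology nn\<^esub> coh_class nn (L p))"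
      unfolding fs by (intro conjI restrict_PiE_iff[THEN iffD2]) auto
    fix d assume d: "d \<in> pairs \<rightarrow>\<^sub>E UNIV \<and> x = (\<Oplus>\<^bsub>cohomology nn\<^esub>p\<in>pairs. d p \<odot>\<^bsub>cohomology nn\<^esub> coh_class nn (L p))"
    then have "coh_class nn (\<Sum>p\<in>pairs. fscale (d p) (L p)) = coh_class nn (\<Sum>p\<in>pairs. fscale (restrict c pairs p) (L p))"
      using \<open>x = coh_class nn (\<Sum>p\<in>pairs. fscale (restrict c pairs p) (L p))\<close> unfolding fs by simp
    then have "d p = restrict c pairs p" if "p \<in> pairs" for p
      unfolding N.coh_class_eq_iff using L_independent that by blast
    then show "d = restrict c pairs"
      using d by (intro PiE_ext[of d pairs "\<lambda>_. UNIV"]) auto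
  qed
qed

end

end

theorem mainTheorem1:
  fixes H K :: "'n::finite cmat set"
    and \<epsilon> :: "nat \<Rightarrow> 'n cmat \<Rightarrow> complex"
    and e :: "weight \<Rightarrow> 'n cmat"
    and L :: "(nat \<Rightarrow> nat) \<times> 'n cmat set \<Rightarrow> 'n form"
    and P :: "((nat \<Rightarrow> nat) \<times> 'n cmat set) set"
  assumes cartan: "cartan_subalgebra H"
    and weights: "is_weight_basis H \<epsilon>"
    and root_system: "roots H = wt \<epsilon> ` Phi CARD('n)"
    and root_vectors: "\<forall>\<alpha>\<in>Phi_pos CARD('n). e \<alpha> \<in> root_space H (wt \<epsilon> \<alpha>) \<and> e \<alpha> \<noteq> 0"
    and compact: "compact_real_form K"
    and compact_cartan: "real_form (K \<inter> H) H"
    and P_def: "P = {\<sigma>. \<sigma> permutes {1..CARD('n)}} \<times> abelian_ideals (borel_sub H \<epsilon>)"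
    and L: "\<forall>(\<sigma>, I)\<in>P. is_L H \<epsilon> e \<sigma> I (L (\<sigma>, I))"
  shows "(\<forall>p\<in>P. harmonic (herm K) (nilrad H \<epsilon>) (L p) \<and> L p \<in> cocycles (nilrad H \<epsilon>)) \<and>
    basis_family (cohomology (nilrad H \<epsilon>)) P (\<lambda>p. coh_class (nilrad H \<epsilon>) (L p))"
proof -
  interpret sp_roots K H \<epsilon> e "CARD('n)"
    by unfold_locales (rule compact refl cartan weights root_system root_vectors compact_cartan)+
  have P: "P = pairs" by (simp add: P_def pairs_def)
  have L': "is_L H \<epsilon> e (fst p) (snd p) (L p)" if "p \<in> pairs" for p
    using L that unfolding P by (cases p) auto
  show ?thesis
    unfolding nilrad_eq P using L_harmonic[of L] L_cocycle[of L] L_basis[of L] L' by blast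
qed

end
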